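(* Let $V_h$ be the $EQ_1^{\mathrm{rot}}$ finite element space and assume that the potential satisfies $V\in H^1(\mathcal{D})$. Let $u$ be a ground state and $u_h$ a discrete ground state. Then, for all sufficiently small mesh sizes $h$, $$E(u_h)\le E(u).$$
   Context: Continuous problem. Let $d\in\{2,3\}$, let $\mathcal{D}\subset\mathbb{R}^d$ be a square ($d=2$) or cube ($d=3$) with axis-parallel sides, $V\in L^\infty(\mathcal{D};\mathbb{R}_{\ge0})$ and $\beta>0$ a constant. All functions are real valued. Put $\mathcal{M}=\{v\in H_0^1(\mathcal{D}):\|v\|_{L^2(\mathcal{D})}=1\}$ and $E(v)=\frac12\int_{\mathcal{D}}\big(|\nabla v|^2+V|v|^2+\frac{\beta}{2}|v|^4\big)\,dr$. A ground state is a minimizer $u\in\mathcal{M}$ of $E$ over $\mathcal{M}$ (it exists and is unique up to sign). Finite element space. $\{\mathcal{T}_h\}$ is a family of regular (conforming and shape-regular) axis-parallel rectangular ($d=2$) or cubic ($d=3$) meshes of $\mathcal{D}$, indexed by mesh sizes $h>0$ accumulating at $0$; $\mathcal{F}_h$ is the set of all faces of $\mathcal{T}_h$. On $\hat K=[-1,1]^d$ let $EQ_1^{\mathrm{rot}}(\hat K)=P_1(\hat K)+\mathrm{span}\{x_i^2:1\le i\le d\}$. The $EQ_1^{\mathrm{rot}}$ space $V_h$ consists of all $v_h\in L^2(\mathcal{D})$ such that, for each $K\in\mathcal{T}_h$, $v_h|_K$ is (via the coordinatewise affine map $\hat K\to K$) in $EQ_1^{\mathrm{rot}}(\hat K)$;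 $\int_ev_h\,dS=0$ for every $e\in\mathcal{F}_h$ with $e\subseteq\partial\mathcal{D}$; and $\int_e(v_h|_{K_1}-v_h|_{K_2})\,dS=0$ for every interior face $e=K_1\cap K_2\in\mathcal{F}_h$. Discrete problem. $\nabla_h$ is the piecewise gradient, and $E$ is extended to $V_h+H_0^1(\mathcal{D})$ by replacing $\nabla$ with $\nabla_h$. A discrete ground state is a minimizer $u_h$ of $E$ over $\mathcal{M}_h=\{v_h\in V_h:\|v_h\|_{L^2(\mathcal{D})}=1\}$. *)

theory Defs
  imports "HOL-Analysis.Analysis"
begin

section \<open>Sobolev spaces\<close>

text \<open>
  Elements of Lebesgue and Sobolev spaces are represented by functions on the whole space;
  only their values almost everywhere on the open set \<open>U\<close> matter.
\<close>

definition partial_deriv :: "'n \<Rightarrow> (real^'n \<Rightarrow> real) \<Rightarrow> real^'n \<Rightarrow> real"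
  where "partial_deriv i f x = frechet_derivative f (at x) (axis i 1)"

primrec C_k :: "nat \<Rightarrow> (real^'n \<Rightarrow> real) \<Rightarrow> bool"
  where
    "C_k 0 f \<longleftrightarrow> continuous_on UNIV f"
  | "C_k (Suc k) f \<longleftrightarrow> (\<forall>x. f differentiable (at x)) \<and> (\<forall>i. C_k k (partial_deriv i f))"

definition test_function :: "(real^'n) set \<Rightarrow> (real^'n \<Rightarrow> real) \<Rightarrow> bool"
  where "test_function U \<phi> \<longleftrightarrow>
    (\<forall>k. C_k k \<phi>) \<and> compact (closure {x. \<phi> x \<noteq> 0}) \<and> closure {x. \<phi> x \<noteq> 0} \<subseteq> U"

definition L2 :: "(real^'n) set \<Rightarrow> (real^'n \<Rightarrow> 'b::euclidean_space) set"
  where "L2 U = {f. f \<in> borel_measurable (lebesgue_on U) \<and>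
                    integrable (lebesgue_on U) (\<lambda>x. (norm (f x))\<^sup>2)}"

definition L2_norm :: "(real^'n) set \<Rightarrow> (real^'n \<Rightarrow> 'b::euclidean_space) \<Rightarrow> real"
  where "L2_norm U f = sqrt (LINT x|lebesgue_on U. (norm (f x))\<^sup>2)"

definition Linfty :: "(real^'n) set \<Rightarrow> (real^'n \<Rightarrow> real) set"
  where "Linfty U = {f. f \<in> borel_measurable (lebesgue_on U) \<and>
                        (\<exists>C. AE x in lebesgue_on U. \<bar>f x\<bar> \<le> C)}"

definition has_weak_grad :: "(real^'n) set \<Rightarrow> (real^'n \<Rightarrow> real) \<Rightarrow> (real^'n \<Rightarrow> real^'n) \<Rightarrow> bool"
  where "has_weak_grad U v g \<longleftrightarrow> g \<in> L2 U \<and>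
    (\<forall>\<phi> i. test_function U \<phi> \<longrightarrow>
      (LINT x|lebesgue_on U. v x * partial_deriv i \<phi> x) = - (LINT x|lebesgue_on U. g x $ i * \<phi> x))"

definition H1 :: "(real^'n) set \<Rightarrow> (real^'n \<Rightarrow> real) set"
  where "H1 U = {v \<in> L2 U. \<exists>g. has_weak_grad U v g}"

text \<open>The weak gradient is unique up to null sets, so the choice made by \<open>SOME\<close> is immaterial.\<close>

definition weak_grad :: "(real^'n) set \<Rightarrow> (real^'n \<Rightarrow> real) \<Rightarrow> real^'n \<Rightarrow> real^'n"
  where "weak_grad U v = (SOME g. has_weak_grad U v g)"

definition H1_norm :: "(real^'n) set \<Rightarrow> (real^'n \<Rightarrow> real) \<Rightarrow> real"
  where "H1_norm U v = sqrt ((L2_norm U v)\<^sup>2 + (L2_norm U (weak_grad U v))\<^sup>2)"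

definition H10 :: "(real^'n) set \<Rightarrow> (real^'n \<Rightarrow> real) set"
  where "H10 U = {v \<in> H1 U. \<forall>\<epsilon>>0. \<exists>\<phi>. test_function U \<phi> \<and> H1_norm U (\<lambda>x. v x - \<phi> x) < \<epsilon>}"


section \<open>The continuous problem\<close>

text \<open>The energy with the field \<open>g\<close> in the place of the gradient of \<open>v\<close>.\<close>

definition energy_with ::
    "(real^'n) set \<Rightarrow> (real^'n \<Rightarrow> real) \<Rightarrow> real \<Rightarrow> (real^'n \<Rightarrow> real^'n) \<Rightarrow> (real^'n \<Rightarrow> real) \<Rightarrow> real"
  where "energy_with D V \<beta> g v =
    1/2 * (LINT x|lebesgue_on D. (norm (g x))\<^sup>2 + V x * \<bar>v x\<bar>\<^sup>2 + \<beta>/2 * \<bar>v x\<bar>^4)"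

definition energy :: "(real^'n) set \<Rightarrow> (real^'n \<Rightarrow> real) \<Rightarrow> real \<Rightarrow> (real^'n \<Rightarrow> real) \<Rightarrow> real"
  where "energy D V \<beta> v = energy_with D V \<beta> (weak_grad D v) v"

definition ground_state :: "(real^'n) set \<Rightarrow> (real^'n \<Rightarrow> real) \<Rightarrow> real \<Rightarrow> (real^'n \<Rightarrow> real) \<Rightarrow> bool"
  where "ground_state D V \<beta> u \<longleftrightarrow>
    is_arg_min (energy D V \<beta>) (\<lambda>v. v \<in> H10 D \<and> L2_norm D v = 1) u"


section \<open>Meshes\<close>

text \<open>
  \<open>division_of\<close> provides a finite cover of the closed box by closed axis-parallel boxes with
  disjoint interiors, but it admits degenerate boxes and hanging nodes. As the cells have
  nonempty interior, the common face of two different cells is always a proper one.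
\<close>

definition conforming_box_mesh :: "(real^'n) set \<Rightarrow> (real^'n) set set \<Rightarrow> bool"
  where "conforming_box_mesh D T \<longleftrightarrow> T division_of closure D \<and>
    (\<forall>K\<in>T. interior K \<noteq> {}) \<and>
    (\<forall>K\<in>T. \<forall>L\<in>T. K \<inter> L face_of K \<and> K \<inter> L face_of L)"

definition mesh_size :: "(real^'n) set set \<Rightarrow> real"
  where "mesh_size T = Max (diameter ` T)"

definition shape_regular :: "real set \<Rightarrow> (real \<Rightarrow> (real^'n) set set) \<Rightarrow> bool"
  where "shape_regular H T \<longleftrightarrow>
    (\<exists>\<sigma>>0. \<forall>h\<in>H. \<forall>K\<in>T h. \<exists>x. cball x (\<sigma> * diameter K) \<subseteq> K)"

definition mesh_faces :: "(real^'n) set set \<Rightarrow> (real^'n) set set"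
  where "mesh_faces T = {e. \<exists>K\<in>T. e facet_of K}"

text \<open>
  Surface measure on the hyperplane \<open>{x. x $ i = c}\<close>: the image of the Lebesgue measure in the
  remaining coordinates.
\<close>

definition plane_measure :: "'n \<Rightarrow> real \<Rightarrow> (real^'n) measure"
  where "plane_measure i c =
    distr (Pi\<^sub>M (UNIV - {i}) (\<lambda>_. lborel)) borel (\<lambda>y. \<chi> j. if j = i then c else y j)"


lemma plane_embedding_measurable:
  "(\<lambda>y. (\<chi> j. if j = i then c else y j) :: real^'n) \<in> Pi\<^sub>M (UNIV - {i}) (\<lambda>_. lborel) \<rightarrow>\<^sub>M borel"
proof (subst borel_measurable_euclidean_space, rule ballI)
  fix k :: "real^'n" assume "k \<in> Basis"
  then obtain j where k: "k = axis j 1" by (auto simp: Basis_vec_def)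
  show "(\<lambda>y. (\<chi> j. if j = i then c else y j) \<bullet> k) \<in> borel_measurable (Pi\<^sub>M (UNIV - {i}) (\<lambda>_. lborel))"
  proof (cases "j = i")
    case True
    then show ?thesis by (simp add: k inner_axis)
  next
    case False
    then have "(\<lambda>y. y j) \<in> Pi\<^sub>M (UNIV - {i}) (\<lambda>_. lborel) \<rightarrow>\<^sub>M (lborel :: real measure)"
      by (intro measurable_component_singleton) auto
    with False show ?thesis by (simp add: k inner_axis)
  qed
qed


section \<open>The finite element space and the discrete problem\<close>

definition EQ1rot_ref :: "(real^'n \<Rightarrow> real) set"
  where "EQ1rot_ref = {p. \<exists>\<alpha> b q. \<forall>x. p x = \<alpha> + (\<Sum>i\<in>UNIV. b i * x $ i) + (\<Sum>i\<in>UNIV. q i * (x $ i)\<^sup>2)}"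

text \<open>The coordinatewise affine map from the cube with side \<open>[-1,1]\<close> onto the closed box \<open>K\<close>.\<close>

definition cell_map :: "(real^'n) set \<Rightarrow> real^'n \<Rightarrow> real^'n"
  where "cell_map K x = (\<chi> i.
    (interval_lowerbound K $ i + interval_upperbound K $ i) / 2 +
    (interval_upperbound K $ i - interval_lowerbound K $ i) / 2 * x $ i)"

definition EQ1rot :: "(real^'n) set \<Rightarrow> (real^'n \<Rightarrow> real) set"
  where "EQ1rot K = {p. p \<circ> cell_map K \<in> EQ1rot_ref}"

text \<open>
  The polynomial \<open>p K\<close> is the restriction of \<open>v\<close> to the cell \<open>K\<close>. As \<open>v\<close> is determined only almost
  everywhere, its values on the faces are those of the polynomials. For a face \<open>e\<close> the
  coordinate \<open>i\<close> and the value \<open>c\<close> with \<open>e \<subseteq> {x. x $ i = c}\<close> are unique.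
\<close>

definition EQ1rot_space :: "(real^'n) set \<Rightarrow> (real^'n) set set \<Rightarrow> (real^'n \<Rightarrow> real) set"
  where "EQ1rot_space D T = {v \<in> L2 D. \<exists>p.
    (\<forall>K\<in>T. p K \<in> EQ1rot K \<and> (AE x in lebesgue_on K. v x = p K x)) \<and>
    (\<forall>e\<in>mesh_faces T. \<forall>i c. e \<subseteq> {x. x $ i = c} \<longrightarrow>
      (\<forall>K\<in>T. e facet_of K \<and> e \<subseteq> frontier D \<longrightarrow> (LINT x:e|plane_measure i c. p K x) = 0) \<and>
      (\<forall>K1\<in>T. \<forall>K2\<in>T. K1 \<noteq> K2 \<and> e = K1 \<inter> K2 \<longrightarrow>
        (LINT x:e|plane_measure i c. p K1 x - p K2 x) = 0))}"

definition piecewise_grad :: "(real^'n) set set \<Rightarrow> (real^'n \<Rightarrow> real) \<Rightarrow> real^'n \<Rightarrow> real^'n"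
  where "piecewise_grad T v = (SOME g. \<forall>K\<in>T. has_weak_grad (interior K) v g)"

definition discrete_energy ::
    "(real^'n) set \<Rightarrow> (real^'n) set set \<Rightarrow> (real^'n \<Rightarrow> real) \<Rightarrow> real \<Rightarrow> (real^'n \<Rightarrow> real) \<Rightarrow> real"
  where "discrete_energy D T V \<beta> v = energy_with D V \<beta> (piecewise_grad T v) v"

definition discrete_ground_state ::
    "(real^'n) set \<Rightarrow> (real^'n) set set \<Rightarrow> (real^'n \<Rightarrow> real) \<Rightarrow> real \<Rightarrow> (real^'n \<Rightarrow> real) \<Rightarrow> bool"
  where "discrete_ground_state D T V \<beta> uh \<longleftrightarrow>
    is_arg_min (discrete_energy D T V \<beta>) (\<lambda>v. v \<in> EQ1rot_space D T \<and> L2_norm D v = 1) uh"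

end

theory Submission
  imports Defs
begin

text \<open>
  The \<open>EQ1rot\<close> interpolant \<open>w\<close> of the ground state \<open>u\<close> preserves the means of \<open>u\<close> over all cells and
  faces. Hence the piecewise gradient of \<open>e = u - w\<close> is orthogonal to that of \<open>w\<close>, and interpolation
  lowers the Dirichlet integral by exactly \<open>\<eta>2\<close>, the squared \<open>L\<^sup>2\<close> norm of the piecewise gradient of \<open>e\<close>.
  All other changes of the energy, including the one caused by normalising \<open>w\<close>, are \<open>o(\<eta>2)\<close>: the terms
  linear in \<open>e\<close> are integrals of \<open>e\<close> against \<open>u\<close>, \<open>V u\<close> and \<open>u\<^sup>3\<close>, which lie in \<open>L\<^sup>2\<close> because
  \<open>u\<close> lies in \<open>L\<^sup>6\<close>; since \<open>e\<close> has mean zero on every cell, these integrals are \<open>o(h)\<close> times the square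
  root of \<open>\<eta>2\<close>, and \<open>\<eta>2 \<ge> c h\<^sup>2\<close> because piecewise functions without mixed second derivatives cannot
  approximate the gradient of \<open>u\<close> to higher order in \<open>h\<close>. That \<open>u\<close> lies in \<open>L\<^sup>6\<close> is obtained, without the Sobolev embedding, by
  comparing \<open>u\<close> with \<open>u / (1 + \<epsilon> u\<^sup>2)\<close>.
\<close>

section \<open>Square integrable functions\<close>

text \<open>The terms linear in \<open>e\<close> have no sign, while the gain \<open>\<eta>2\<close>
  is quadratic, so they can only be beaten if the gradient error is not too small. This is why an
  upper bound for the discrete energy rests on a lower bound for the error. No regularity of
  \<open>u\<close> beyond H^1 and L^6 is used, hence no convergence rate: the small factor in front
  of h comes from approximating L^2 functions by continuous ones. The lower bound exists because
  \<open>u\<close> is nonzero with zero boundary values: some box has a nonzero integral of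
  \<open>u\<close>, and this number can be tested by fields that are orthogonal to the piecewise
  gradient of \<open>w\<close>. Making these fields orthogonal costs one derivative of a cellwise
  bubble, of size 1/h, which fixes the order in h. Traces are never formed. A face integral is
  rewritten as an integral over an adjacent cell of the function and its gradient, and this passes
  to the limit along the test functions that define \<open>H10\<close>. A conforming mesh of boxes
  is a tensor grid; this provides functions of one coordinate that are adapted to all cells at
  once.\<close>

definition sq_integrable :: "'a measure \<Rightarrow> ('a \<Rightarrow> real) \<Rightarrow> bool" where
  "sq_integrable M f \<longleftrightarrow> f \<in> borel_measurable M \<and> integrable M (\<lambda>x. (f x)\<^sup>2)"

lemma sq_integrableD [dest]:
  assumes "sq_integrable M f"
  shows sq_integrable_measurable: "f \<in> borel_measurable M"
    and sq_integrable_square: "integrable M (\<lambda>x. (f x)\<^sup>2)"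
  using assms by (auto simp: sq_integrable_def)

lemma sq_integrable_mult:
  assumes "sq_integrable M f" "sq_integrable M g"
  shows "integrable M (\<lambda>x. f x * g x)"
proof (rule Bochner_Integration.integrable_bound)
  show "integrable M (\<lambda>x. (f x)\<^sup>2 + (g x)\<^sup>2)"
    using assms by (auto simp: sq_integrable_def)
  show "(\<lambda>x. f x * g x) \<in> borel_measurable M"
    using assms by (auto simp: sq_integrable_def)
  have "\<bar>a * b\<bar> \<le> a\<^sup>2 + b\<^sup>2" for a b :: real
  proof -
    have "0 \<le> (\<bar>a\<bar> - \<bar>b\<bar>)\<^sup>2" "0 \<le> \<bar>a * b\<bar>" by simp_all
    then show ?thesis unfolding power2_diff power2_abs abs_mult by linarith
  qed
  then show "AE x in M. norm (f x * g x) \<le> norm ((f x)\<^sup>2 + (g x)\<^sup>2)"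
    by (auto intro!: AE_I2)
qed

lemma sq_integrable_cmult: "sq_integrable M f \<Longrightarrow> sq_integrable M (\<lambda>x. c * f x)"
  by (auto simp: sq_integrable_def power_mult_distrib)

lemma sq_integrable_add:
  assumes "sq_integrable M f" "sq_integrable M g"
  shows "sq_integrable M (\<lambda>x. f x + g x)"
  using sq_integrable_mult[OF assms] assms
  by (auto simp: sq_integrable_def power2_sum mult.assoc)

lemma sq_integrable_diff:
  assumes "sq_integrable M f" "sq_integrable M g"
  shows "sq_integrable M (\<lambda>x. f x - g x)"
  using sq_integrable_add[OF assms(1) sq_integrable_cmult[OF assms(2), of "-1"]] by simp

lemma sq_integrable_sum:
  assumes "\<And>i. i \<in> I \<Longrightarrow> sq_integrable M (f i)"
  shows "sq_integrable M (\<lambda>x. \<Sum>i\<in>I. f i x)"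
  using assms
proof (induction I rule: infinite_finite_induct)
  case (insert i I)
  then show ?case by (auto intro: sq_integrable_add)
qed (auto simp: sq_integrable_def)

lemma sq_integrable_bound:
  assumes "sq_integrable M f" "g \<in> borel_measurable M" "AE x in M. \<bar>g x\<bar> \<le> \<bar>f x\<bar>"
  shows "sq_integrable M g"
  unfolding sq_integrable_def
proof
  show "integrable M (\<lambda>x. (g x)\<^sup>2)"
  proof (rule Bochner_Integration.integrable_bound)
    show "integrable M (\<lambda>x. (f x)\<^sup>2)" using assms by auto
    show "AE x in M. norm ((g x)\<^sup>2) \<le> norm ((f x)\<^sup>2)"
      using assms(3) by eventually_elim (simp add: abs_le_square_iff)
  qed (use assms in auto)
qed (use assms in auto)

lemma sq_integrable_bounded_mult:
  assumes "sq_integrable M f" "h \<in> borel_measurable M" "AE x in M. \<bar>h x\<bar> \<le> C"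
  shows "sq_integrable M (\<lambda>x. h x * f x)"
proof (rule sq_integrable_bound[OF sq_integrable_cmult[OF assms(1), of C]])
  show "(\<lambda>x. h x * f x) \<in> borel_measurable M" using assms by auto
  show "AE x in M. \<bar>h x * f x\<bar> \<le> \<bar>C * f x\<bar>"
    using assms(3) by eventually_elim (simp add: abs_mult mult_right_mono)
qed

lemma sq_integrable_bounded:
  assumes "finite_measure M" "h \<in> borel_measurable M" "AE x in M. \<bar>h x\<bar> \<le> C"
  shows "sq_integrable M h"
proof -
  interpret finite_measure M by fact
  have "sq_integrable M (\<lambda>_. 1)" by (simp add: sq_integrable_def)
  from sq_integrable_bounded_mult[OF this assms(2,3)] show ?thesis by simp
qed

lemma sq_integrable_integrable:
  assumes "finite_measure M" "sq_integrable M f"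
  shows "integrable M f"
proof -
  interpret finite_measure M by fact
  have "sq_integrable M (\<lambda>_. 1)" by (simp add: sq_integrable_def)
  from sq_integrable_mult[OF assms(2) this] show ?thesis by simp
qed

lemma cauchy_schwarz_integral:
  assumes f: "sq_integrable M f" and g: "sq_integrable M g"
  shows "(\<integral>x. f x * g x \<partial>M)\<^sup>2 \<le> (\<integral>x. (f x)\<^sup>2 \<partial>M) * (\<integral>x. (g x)\<^sup>2 \<partial>M)"
proof -
  define a b c where "a = (\<integral>x. (f x)\<^sup>2 \<partial>M)" "b = (\<integral>x. f x * g x \<partial>M)" "c = (\<integral>x. (g x)\<^sup>2 \<partial>M)"
  have pos: "0 \<le> a + 2 * t * b + t\<^sup>2 * c" for t
  proof -
    have "0 \<le> (\<integral>x. (f x + t * g x)\<^sup>2 \<partial>M)" by simp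
    also have "\<dots> = (\<integral>x. (f x)\<^sup>2 + 2 * t * (f x * g x) + t\<^sup>2 * (g x)\<^sup>2 \<partial>M)"
      by (intro Bochner_Integration.integral_cong) (auto simp: power2_eq_square algebra_simps)
    also have "\<dots> = a + 2 * t * b + t\<^sup>2 * c"
      using sq_integrable_mult[OF f g] f g by (simp add: a_b_c_def sq_integrable_def)
    finally show ?thesis .
  qed
  have c0: "0 \<le> c" by (simp add: a_b_c_def)
  have "b\<^sup>2 \<le> a * c"
  proof (cases "c = 0")
    case True
    have "b = 0"
    proof (rule ccontr)
      assume "b \<noteq> 0"
      \<comment> \<open>For c = 0 the form is affine in t, and at this t it takes the value
        -1.\<close>
      with pos[of "- (a + 1) / (2 * b)"] True show False by (simp add: field_simps)
    qed
    then show ?thesis using True by simp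
  next
    case False
    then have "c > 0" using c0 by simp
    from pos[of "- b / c"] False have "0 \<le> a - b\<^sup>2 / c"
      by (simp add: power2_eq_square field_simps)
    with \<open>c > 0\<close> show ?thesis by (simp add: field_simps)
  qed
  then show ?thesis by (simp add: a_b_c_def)
qed

lemma cauchy_schwarz_integral_abs:
  assumes f: "sq_integrable M f" and g: "sq_integrable M g"
  shows "\<bar>\<integral>x. f x * g x \<partial>M\<bar> \<le> sqrt (\<integral>x. (f x)\<^sup>2 \<partial>M) * sqrt (\<integral>x. (g x)\<^sup>2 \<partial>M)"
  using real_sqrt_le_mono[OF cauchy_schwarz_integral[OF assms]] by (simp add: real_sqrt_mult)

lemma minkowski_integral:
  assumes f: "sq_integrable M f" and g: "sq_integrable M g"
  shows "sqrt (\<integral>x. (f x + g x)\<^sup>2 \<partial>M) \<le> sqrt (\<integral>x. (f x)\<^sup>2 \<partial>M) + sqrt (\<integral>x. (g x)\<^sup>2 \<partial>M)"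
proof (rule real_le_lsqrt)
  have "(\<integral>x. (f x + g x)\<^sup>2 \<partial>M) = (\<integral>x. (f x)\<^sup>2 + (g x)\<^sup>2 + 2 * (f x * g x) \<partial>M)"
    by (intro Bochner_Integration.integral_cong) (auto simp: power2_eq_square algebra_simps)
  also have "\<dots> = (\<integral>x. (f x)\<^sup>2 \<partial>M) + (\<integral>x. (g x)\<^sup>2 \<partial>M) + 2 * (\<integral>x. f x * g x \<partial>M)"
    using sq_integrable_mult[OF f g] f g by (simp add: sq_integrable_def)
  finally show "(\<integral>x. (f x + g x)\<^sup>2 \<partial>M) \<le> (sqrt (\<integral>x. (f x)\<^sup>2 \<partial>M) + sqrt (\<integral>x. (g x)\<^sup>2 \<partial>M))\<^sup>2"
    using cauchy_schwarz_integral_abs[OF f g] by (simp add: power2_sum)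
qed auto

section \<open>Strong convergence in L^2\<close>

definition sq_tendsto :: "'a measure \<Rightarrow> (nat \<Rightarrow> 'a \<Rightarrow> real) \<Rightarrow> ('a \<Rightarrow> real) \<Rightarrow> bool" where
  "sq_tendsto M F f \<longleftrightarrow> (\<forall>k. sq_integrable M (F k)) \<and> sq_integrable M f \<and>
     (\<lambda>k. \<integral>x. (F k x - f x)\<^sup>2 \<partial>M) \<longlonglongrightarrow> 0"

lemma sq_tendsto_const: "sq_integrable M f \<Longrightarrow> sq_tendsto M (\<lambda>_. f) f"
  by (simp add: sq_tendsto_def)

lemma sq_tendsto_sqrt: 
  assumes "sq_tendsto M F f"
  shows "(\<lambda>k. sqrt (\<integral>x. (F k x - f x)\<^sup>2 \<partial>M)) \<longlonglongrightarrow> 0"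
  using tendsto_real_sqrt[of _ 0] assms by (auto simp: sq_tendsto_def)

lemma sq_tendstoI:
  assumes "\<And>k. sq_integrable M (F k)" "sq_integrable M f"
    "\<And>k. (\<integral>x. (F k x - f x)\<^sup>2 \<partial>M) \<le> e k" "e \<longlonglongrightarrow> 0"
  shows "sq_tendsto M F f"
  unfolding sq_tendsto_def
proof (intro conjI allI)
  show "(\<lambda>k. \<integral>x. (F k x - f x)\<^sup>2 \<partial>M) \<longlonglongrightarrow> 0"
    by (rule tendsto_sandwich[OF _ _ tendsto_const assms(4)]) (auto simp: assms(3))
qed (use assms in auto)

lemma sq_tendsto_cmult:
  assumes "sq_tendsto M F f"
  shows "sq_tendsto M (\<lambda>k x. c * F k x) (\<lambda>x. c * f x)"
  unfolding sq_tendsto_def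
proof (intro conjI allI)
  have "(\<lambda>k. c\<^sup>2 * (\<integral>x. (F k x - f x)\<^sup>2 \<partial>M)) \<longlonglongrightarrow> c\<^sup>2 * 0"
    using assms by (intro tendsto_intros) (auto simp: sq_tendsto_def)
  then show "(\<lambda>k. \<integral>x. (c * F k x - c * f x)\<^sup>2 \<partial>M) \<longlonglongrightarrow> 0"
    by (simp flip: right_diff_distrib add: power_mult_distrib)
qed (use assms in \<open>auto simp: sq_tendsto_def intro: sq_integrable_cmult\<close>)

lemma sq_tendsto_add:
  assumes F: "sq_tendsto M F f" and G: "sq_tendsto M G g"
  shows "sq_tendsto M (\<lambda>k x. F k x + G k x) (\<lambda>x. f x + g x)"
  unfolding sq_tendsto_def
proof (intro conjI allI)
  have i: "sq_integrable M (\<lambda>x. F k x - f x)" "sq_integrable M (\<lambda>x. G k x - g x)" for k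
    using assms by (auto simp: sq_tendsto_def intro: sq_integrable_diff)
  have lim: "(\<lambda>k. sqrt (\<integral>x. (F k x - f x)\<^sup>2 \<partial>M) + sqrt (\<integral>x. (G k x - g x)\<^sup>2 \<partial>M)) \<longlonglongrightarrow> 0"
    using tendsto_add[OF sq_tendsto_sqrt[OF F] sq_tendsto_sqrt[OF G]] by simp
  have "(\<lambda>k. sqrt (\<integral>x. ((F k x - f x) + (G k x - g x))\<^sup>2 \<partial>M)) \<longlonglongrightarrow> 0"
    by (rule Lim_null_comparison[OF always_eventually lim]) (simp add: minkowski_integral i)
  from tendsto_power[OF this, of 2]
  show "(\<lambda>k. \<integral>x. ((F k x + G k x) - (f x + g x))\<^sup>2 \<partial>M) \<longlonglongrightarrow> 0"
    by (simp add: algebra_simps)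
qed (use assms in \<open>auto simp: sq_tendsto_def intro: sq_integrable_add\<close>)

lemma sq_tendsto_diff:
  assumes F: "sq_tendsto M F f" and G: "sq_tendsto M G g"
  shows "sq_tendsto M (\<lambda>k x. F k x - G k x) (\<lambda>x. f x - g x)"
  using sq_tendsto_add[OF F sq_tendsto_cmult[OF G, of "-1"]] by simp

lemma sq_tendsto_inner:
  assumes F: "sq_tendsto M F f" and G: "sq_tendsto M G g"
  shows "(\<lambda>k. \<integral>x. F k x * G k x \<partial>M) \<longlonglongrightarrow> (\<integral>x. f x * g x \<partial>M)"
proof -
  define a where "a k = sqrt (\<integral>x. (F k x - f x)\<^sup>2 \<partial>M)" for k
  define b where "b k = sqrt (\<integral>x. (G k x - g x)\<^sup>2 \<partial>M)" for k
  have f: "sq_integrable M f" and g: "sq_integrable M g"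
    and i: "\<And>k. sq_integrable M (\<lambda>x. F k x - f x)" "\<And>k. sq_integrable M (\<lambda>x. G k x - g x)"
    and j: "\<And>k. sq_integrable M (F k)" "\<And>k. sq_integrable M (G k)"
    using assms by (auto simp: sq_tendsto_def intro: sq_integrable_diff)
  have le: "\<bar>(\<integral>x. F k x * G k x \<partial>M) - (\<integral>x. f x * g x \<partial>M)\<bar> \<le>
      a k * b k + a k * sqrt (\<integral>x. (g x)\<^sup>2 \<partial>M) + sqrt (\<integral>x. (f x)\<^sup>2 \<partial>M) * b k" for k
  proof -
    have "(\<integral>x. F k x * G k x \<partial>M) - (\<integral>x. f x * g x \<partial>M) =
      (\<integral>x. (F k x - f x) * (G k x - g x) + (F k x - f x) * g x + f x * (G k x - g x) \<partial>M)"
      by (subst Bochner_Integration.integral_diff[symmetric])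
         (auto intro!: sq_integrable_mult j f g Bochner_Integration.integral_cong simp: algebra_simps)
    also have "\<dots> = (\<integral>x. (F k x - f x) * (G k x - g x) \<partial>M) + (\<integral>x. (F k x - f x) * g x \<partial>M)
        + (\<integral>x. f x * (G k x - g x) \<partial>M)"
      by (subst Bochner_Integration.integral_add;
          (intro Bochner_Integration.integrable_add sq_integrable_mult i f g)?)+ simp
    finally show ?thesis
      using cauchy_schwarz_integral_abs[OF i(1) i(2), of k k] cauchy_schwarz_integral_abs[OF i(1) g, of k]
        cauchy_schwarz_integral_abs[OF f i(2), of k]
      unfolding a_def b_def by linarith
  qed
  have "a \<longlonglongrightarrow> 0" "b \<longlonglongrightarrow> 0"
    using sq_tendsto_sqrt[OF F] sq_tendsto_sqrt[OF G] by (simp_all add: a_def[abs_def] b_def[abs_def])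
  then have "(\<lambda>k. a k * b k + a k * sqrt (\<integral>x. (g x)\<^sup>2 \<partial>M) + sqrt (\<integral>x. (f x)\<^sup>2 \<partial>M) * b k) \<longlonglongrightarrow>
     0 * 0 + 0 * sqrt (\<integral>x. (g x)\<^sup>2 \<partial>M) + sqrt (\<integral>x. (f x)\<^sup>2 \<partial>M) * 0"
    by (intro tendsto_intros)
  then have lim: "(\<lambda>k. a k * b k + a k * sqrt (\<integral>x. (g x)\<^sup>2 \<partial>M) + sqrt (\<integral>x. (f x)\<^sup>2 \<partial>M) * b k) \<longlonglongrightarrow> 0"
    by simp
  have "(\<lambda>k. (\<integral>x. F k x * G k x \<partial>M) - (\<integral>x. f x * g x \<partial>M)) \<longlonglongrightarrow> 0"
    by (rule Lim_null_comparison[OF always_eventually lim]) (simp add: le)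
  then show ?thesis by (rule LIM_zero_cancel)
qed

lemma sq_tendsto_square:
  assumes "sq_tendsto M F f"
  shows "(\<lambda>k. \<integral>x. (F k x)\<^sup>2 \<partial>M) \<longlonglongrightarrow> (\<integral>x. (f x)\<^sup>2 \<partial>M)"
  using sq_tendsto_inner[OF assms assms] by (simp add: power2_eq_square)

lemma sq_tendsto_inner_const:
  assumes "sq_tendsto M F f" "sq_integrable M g"
  shows "(\<lambda>k. \<integral>x. F k x * g x \<partial>M) \<longlonglongrightarrow> (\<integral>x. f x * g x \<partial>M)"
  using sq_tendsto_inner[OF assms(1) sq_tendsto_const[OF assms(2)]] .

lemma sq_tendsto_integral:
  assumes "finite_measure M" "sq_tendsto M F f"
  shows "(\<lambda>k. \<integral>x. F k x \<partial>M) \<longlonglongrightarrow> (\<integral>x. f x \<partial>M)"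
proof -
  interpret finite_measure M by fact
  have "sq_integrable M (\<lambda>_. 1)" by (simp add: sq_integrable_def)
  from sq_tendsto_inner_const[OF assms(2) this] show ?thesis by simp
qed

lemma sq_tendsto_bounded_mult:
  assumes F: "sq_tendsto M F f" and h: "h \<in> borel_measurable M" "AE x in M. \<bar>h x\<bar> \<le> C"
  shows "sq_tendsto M (\<lambda>k x. h x * F k x) (\<lambda>x. h x * f x)"
proof (rule sq_tendstoI[where e="\<lambda>k. C\<^sup>2 * (\<integral>x. (F k x - f x)\<^sup>2 \<partial>M)"])
  have i: "sq_integrable M (F k)" "sq_integrable M f" for k using F by (auto simp: sq_tendsto_def)
  show "sq_integrable M (\<lambda>x. h x * F k x)" "sq_integrable M (\<lambda>x. h x * f x)" for k
    using sq_integrable_bounded_mult[OF i(1) h] sq_integrable_bounded_mult[OF i(2) h] by auto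
  show "(\<lambda>k. C\<^sup>2 * (\<integral>x. (F k x - f x)\<^sup>2 \<partial>M)) \<longlonglongrightarrow> 0"
    using F by (intro tendsto_mult_right_zero) (auto simp: sq_tendsto_def)
  fix k
  have d: "sq_integrable M (\<lambda>x. F k x - f x)" by (intro sq_integrable_diff i)
  have "(\<integral>x. (h x * F k x - h x * f x)\<^sup>2 \<partial>M) \<le> (\<integral>x. C\<^sup>2 * (F k x - f x)\<^sup>2 \<partial>M)"
  proof (rule integral_mono_AE)
    show "integrable M (\<lambda>x. (h x * F k x - h x * f x)\<^sup>2)"
      using sq_integrable_bounded_mult[OF d h] by (simp add: sq_integrable_def right_diff_distrib)
    show "integrable M (\<lambda>x. C\<^sup>2 * (F k x - f x)\<^sup>2)" using d by auto
    show "AE x in M. (h x * F k x - h x * f x)\<^sup>2 \<le> C\<^sup>2 * (F k x - f x)\<^sup>2"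
      using h(2)
    proof eventually_elim
      case (elim x)
      then have "(h x)\<^sup>2 \<le> C\<^sup>2" by (meson abs_ge_zero abs_le_square_iff abs_ge_self order_trans)
      then show ?case
        by (simp flip: right_diff_distrib add: power_mult_distrib mult_right_mono)
    qed
  qed
  then show "(\<integral>x. (h x * F k x - h x * f x)\<^sup>2 \<partial>M) \<le> C\<^sup>2 * (\<integral>x. (F k x - f x)\<^sup>2 \<partial>M)" by simp
qed

lemma sq_tendsto_lipschitz:
  fixes \<theta> :: "real \<Rightarrow> real"
  assumes F: "sq_tendsto M F f" and lip: "\<And>s t. \<bar>\<theta> s - \<theta> t\<bar> \<le> L * \<bar>s - t\<bar>" and "\<theta> 0 = 0"
    and meas: "\<theta> \<in> borel_measurable borel"
  shows "sq_tendsto M (\<lambda>k x. \<theta> (F k x)) (\<lambda>x. \<theta> (f x))"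
proof (rule sq_tendstoI[where e="\<lambda>k. L\<^sup>2 * (\<integral>x. (F k x - f x)\<^sup>2 \<partial>M)"])
  have i: "sq_integrable M (F k)" "sq_integrable M f" for k using F by (auto simp: sq_tendsto_def)
  have L0: "0 \<le> L" using order_trans[OF abs_ge_zero lip[of 1 0]] by simp
  have comp: "sq_integrable M (\<lambda>x. \<theta> (g x))" if "sq_integrable M g" for g
  proof (rule sq_integrable_bound[OF sq_integrable_cmult[OF that, of L]])
    show "AE x in M. \<bar>\<theta> (g x)\<bar> \<le> \<bar>L * g x\<bar>"
      using lip[of _ 0] L0 by (auto simp: \<open>\<theta> 0 = 0\<close> abs_mult)
    show "(\<lambda>x. \<theta> (g x)) \<in> borel_measurable M"
      using that meas by (auto intro: measurable_compose simp: sq_integrable_def)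
  qed
  show "sq_integrable M (\<lambda>x. \<theta> (F k x))" "sq_integrable M (\<lambda>x. \<theta> (f x))" for k
    using i comp by auto
  show "(\<lambda>k. L\<^sup>2 * (\<integral>x. (F k x - f x)\<^sup>2 \<partial>M)) \<longlonglongrightarrow> 0"
    using F by (intro tendsto_mult_right_zero) (auto simp: sq_tendsto_def)
  fix k
  have "(\<integral>x. (\<theta> (F k x) - \<theta> (f x))\<^sup>2 \<partial>M) \<le> (\<integral>x. L\<^sup>2 * (F k x - f x)\<^sup>2 \<partial>M)"
  proof (rule integral_mono)
    show "integrable M (\<lambda>x. (\<theta> (F k x) - \<theta> (f x))\<^sup>2)"
      using sq_integrable_diff[OF comp[OF i(1)] comp[OF i(2)]] by auto
    show "integrable M (\<lambda>x. L\<^sup>2 * (F k x - f x)\<^sup>2)" using sq_integrable_diff[OF i] by auto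
    show "(\<theta> (F k x) - \<theta> (f x))\<^sup>2 \<le> L\<^sup>2 * (F k x - f x)\<^sup>2" for x
      using power_mono[OF lip[of "F k x" "f x"], of 2] by (simp add: power_mult_distrib)
  qed
  then show "(\<integral>x. (\<theta> (F k x) - \<theta> (f x))\<^sup>2 \<partial>M) \<le> L\<^sup>2 * (\<integral>x. (F k x - f x)\<^sup>2 \<partial>M)" by simp
qed

text \<open>Convergence in L^2 alone says nothing about fourth powers. Along a subsequence that
  converges almost everywhere, Fatou's lemma carries the bounds \<open>c k\<close> to the limit and
  yields integrability as well.\<close>

lemma sq_tendsto_power4:
  assumes F: "sq_tendsto M F f" and int: "\<And>k. integrable M (\<lambda>x. (F k x)^4)"
    and le: "\<And>k. (\<integral>x. (F k x)^4 \<partial>M) \<le> c k" and c: "c \<longlonglongrightarrow> C"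
  shows "integrable M (\<lambda>x. (f x)^4)" and "(\<integral>x. (f x)^4 \<partial>M) \<le> C"
proof -
  have i: "sq_integrable M (F k)" "sq_integrable M f" for k using F by (auto simp: sq_tendsto_def)
  have [measurable]: "F k \<in> borel_measurable M" "f \<in> borel_measurable M" for k using i by auto
  have "\<exists>r. strict_mono r \<and> (AE x in M. (\<lambda>k. (F (r k) x - f x)\<^sup>2) \<longlonglongrightarrow> 0)"
  proof -
    have "(\<lambda>k. \<integral>x. norm ((F k x - f x)\<^sup>2) \<partial>M) \<longlonglongrightarrow> 0" using F by (simp add: sq_tendsto_def)
    with sq_integrable_diff[OF i] obtain r where "strict_mono r" "AE x in M. (\<lambda>k. (F (r k) x - f x)\<^sup>2) \<longlonglongrightarrow> 0"
      using tendsto_L1_AE_subseq[where M=M and u="\<lambda>k x. (F k x - f x)\<^sup>2"] by auto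
    then show ?thesis by blast
  qed
  then obtain r where r: "strict_mono r" and ae: "AE x in M. (\<lambda>k. (F (r k) x - f x)\<^sup>2) \<longlonglongrightarrow> 0" by blast
  have C0: "0 \<le> C"
  proof (rule LIMSEQ_le_const[OF c], intro exI allI impI)
    fix k show "0 \<le> c k"
      using order_trans[OF Bochner_Integration.integral_nonneg le[of k]] by simp
  qed
  have "(\<integral>\<^sup>+x. ennreal ((f x)^4) \<partial>M) = (\<integral>\<^sup>+x. liminf (\<lambda>k. ennreal ((F (r k) x)^4)) \<partial>M)"
  proof (rule nn_integral_cong_AE)
    show "AE x in M. ennreal ((f x)^4) = liminf (\<lambda>k. ennreal ((F (r k) x)^4))"
      using ae
    proof eventually_elim
      case (elim x)
      then have "(\<lambda>k. F (r k) x - f x) \<longlonglongrightarrow> 0"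
        using tendsto_real_sqrt[OF elim] by (simp add: tendsto_rabs_zero_iff)
      then have "(\<lambda>k. F (r k) x) \<longlonglongrightarrow> f x" by (simp add: LIM_zero_iff)
      then have "(\<lambda>k. ennreal ((F (r k) x)^4)) \<longlonglongrightarrow> ennreal ((f x)^4)"
        by (intro tendsto_ennrealI tendsto_power)
      then show ?case by (intro lim_imp_Liminf[symmetric]) simp_all
    qed
  qed
  also have "\<dots> \<le> liminf (\<lambda>k. \<integral>\<^sup>+x. ennreal ((F (r k) x)^4) \<partial>M)"
    by (intro nn_integral_liminf) auto
  also have "\<dots> \<le> liminf (\<lambda>k. ennreal (c (r k)))"
    using le int by (intro Liminf_mono always_eventually allI)
      (auto simp: nn_integral_eq_integral intro!: ennreal_leI)
  also have "\<dots> = ennreal C"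
    using LIMSEQ_subseq_LIMSEQ[OF c r] by (intro lim_imp_Liminf) (auto simp: o_def)
  finally have fin: "(\<integral>\<^sup>+x. ennreal ((f x)^4) \<partial>M) \<le> ennreal C" .
  show int4: "integrable M (\<lambda>x. (f x)^4)"
    using fin by (intro integrableI_bounded) (auto simp: order.strict_trans1)
  then show "(\<integral>x. (f x)^4 \<partial>M) \<le> C"
    using fin C0 by (simp add: nn_integral_eq_integral)
qed

section \<open>Smooth functions and test functions\<close>

definition smooth :: "(real^'n \<Rightarrow> real) \<Rightarrow> bool" where
  "smooth f \<longleftrightarrow> (\<forall>k. C_k k f)"

lemma partial_deriv_eq:
  assumes "(f has_derivative f') (at x)"
  shows "partial_deriv i f x = f' (axis i 1)"
  using frechet_derivative_at[OF assms] by (simp add: partial_deriv_def)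

lemma C_k_SucI:
  assumes "\<And>x. (f has_derivative f' x) (at x)" "\<And>i. C_k k (\<lambda>x. f' x (axis i 1))"
  shows "C_k (Suc k) f"
proof -
  have "partial_deriv i f = (\<lambda>x. f' x (axis i 1))" for i
    using partial_deriv_eq[OF assms(1)] by auto
  then show ?thesis using assms by (auto simp: differentiable_def)
qed

lemma C_k_has_derivative:
  assumes "C_k (Suc k) f"
  shows "(f has_derivative frechet_derivative f (at x)) (at x)"
  using assms by (simp add: frechet_derivative_works)

lemma C_k_partial: "C_k (Suc k) f \<Longrightarrow> C_k k (partial_deriv i f)"
  by simp

lemma C_k_Suc_D: "C_k (Suc k) f \<Longrightarrow> C_k k f"
proof (induction k arbitrary: f)
  case 0
  then show ?case
    by (auto simp: continuous_on_eq_continuous_at differentiable_imp_continuous_within)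
next
  case (Suc k)
  then show ?case by (metis C_k.simps(2))
qed

lemma C_k_const: "C_k k (\<lambda>_. c)"
proof (induction k arbitrary: c)
  case (Suc k)
  show ?case by (rule C_k_SucI[where f'="\<lambda>_ _. 0"]) (auto intro: Suc)
qed simp

lemma C_k_coord: "C_k k (\<lambda>x. x $ j)"
proof (cases k)
  case (Suc m)
  show ?thesis unfolding Suc
    by (rule C_k_SucI[where f'="\<lambda>_ h. h $ j"])
      (auto intro!: bounded_linear_imp_has_derivative bounded_linear_vec_nth C_k_const)
qed (auto intro!: continuous_intros)

lemma C_k_add: "C_k k f \<Longrightarrow> C_k k g \<Longrightarrow> C_k k (\<lambda>x. f x + g x)"
proof (induction k arbitrary: f g)
  case 0
  then show ?case by (auto intro: continuous_intros)
next
  case (Suc k)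
  have "C_k k (\<lambda>x. partial_deriv i f x + partial_deriv i g x)" for i
    by (intro Suc.IH C_k_partial Suc.prems)
  then show ?case
    by (intro C_k_SucI[OF has_derivative_add[OF C_k_has_derivative[OF Suc.prems(1)] C_k_has_derivative[OF Suc.prems(2)]]])
      (simp add: partial_deriv_def)
qed

lemma C_k_mult: "C_k k f \<Longrightarrow> C_k k g \<Longrightarrow> C_k k (\<lambda>x. f x * g x)"
proof (induction k arbitrary: f g)
  case 0
  then show ?case by (auto intro: continuous_intros)
next
  case (Suc k)
  have "C_k k (\<lambda>x. f x * partial_deriv i g x + partial_deriv i f x * g x)" for i
    by (intro C_k_add Suc.IH C_k_partial C_k_Suc_D[OF Suc.prems(1)] C_k_Suc_D[OF Suc.prems(2)] Suc.prems)
  then show ?case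
    by (intro C_k_SucI[OF has_derivative_mult[OF C_k_has_derivative[OF Suc.prems(1)] C_k_has_derivative[OF Suc.prems(2)]]])
      (simp add: partial_deriv_def)
qed

lemma C_k_inverse: "C_k k f \<Longrightarrow> (\<And>x. f x \<noteq> 0) \<Longrightarrow> C_k k (\<lambda>x. inverse (f x))"
proof (induction k arbitrary: f)
  case 0
  then show ?case by (auto intro: continuous_intros)
next
  case (Suc k)
  have "C_k k (\<lambda>x. (-1) * (inverse (f x) * partial_deriv i f x * inverse (f x)))" for i
    by (intro C_k_mult C_k_const Suc.IH C_k_partial C_k_Suc_D[OF Suc.prems(1)] Suc.prems)
  then show ?case
    by (intro C_k_SucI[OF Deriv.has_derivative_inverse[OF Suc.prems(2) C_k_has_derivative[OF Suc.prems(1)]]])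
      (simp add: partial_deriv_def)
qed

text \<open>\<open>G\<close> lists all derivatives of a function of one variable. Quantifying over
  the whole list keeps the chain rule inside the family, so that the induction on \<open>k\<close>
  closes with \<open>m\<close> arbitrary.\<close>

lemma C_k_compose:
  assumes G: "\<And>m t. (G m has_real_derivative G (Suc m) t) (at t)"
  shows "C_k k f \<Longrightarrow> C_k k (\<lambda>x. G m (f x))"
proof (induction k arbitrary: m)
  case 0
  have "continuous_on UNIV (G m)"
    using G by (auto intro!: DERIV_continuous_on)
  with 0 show ?case by (auto intro: continuous_on_compose2)
next
  case (Suc k)
  have *: "((\<lambda>x. G m (f x)) has_derivative (\<lambda>h. G (Suc m) (f x) * frechet_derivative f (at x) h)) (at x)" for x
    using has_derivative_compose[OF C_k_has_derivative[OF Suc.prems] G[of m, THEN has_field_derivative_imp_has_derivative]]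
    by simp
  have "C_k k (\<lambda>x. G (Suc m) (f x) * partial_deriv i f x)" for i
    by (intro C_k_mult Suc.IH C_k_partial C_k_Suc_D[OF Suc.prems(1)] Suc.prems)
  then show ?case
    by (intro C_k_SucI[OF *]) (simp add: partial_deriv_def)
qed

lemma smooth_const: "smooth (\<lambda>_. c)" and smooth_coord: "smooth (\<lambda>x. x $ j)"
  and smooth_add: "smooth f \<Longrightarrow> smooth g \<Longrightarrow> smooth (\<lambda>x. f x + g x)"
  and smooth_mult: "smooth f \<Longrightarrow> smooth g \<Longrightarrow> smooth (\<lambda>x. f x * g x)"
  and smooth_inverse: "smooth f \<Longrightarrow> (\<And>x. f x \<noteq> 0) \<Longrightarrow> smooth (\<lambda>x. inverse (f x))"
  by (auto simp: smooth_def intro: C_k_const C_k_coord C_k_add C_k_mult C_k_inverse)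

lemma smooth_diff: "smooth f \<Longrightarrow> smooth g \<Longrightarrow> smooth (\<lambda>x. f x - g x)"
  using smooth_add[of f, OF _ smooth_mult[OF smooth_const[of "-1"]]] by simp

lemma smooth_sum: "(\<And>i. i \<in> I \<Longrightarrow> smooth (f i)) \<Longrightarrow> smooth (\<lambda>x. \<Sum>i\<in>I. f i x)"
  by (induction I rule: infinite_finite_induct) (auto intro: smooth_const smooth_add)

lemma smooth_prod: "(\<And>i. i \<in> I \<Longrightarrow> smooth (f i)) \<Longrightarrow> smooth (\<lambda>x. \<Prod>i\<in>I. f i x)"
  by (induction I rule: infinite_finite_induct) (auto intro: smooth_const smooth_mult)

lemma smooth_power: "smooth f \<Longrightarrow> smooth (\<lambda>x. f x ^ k)"
  by (induction k) (auto intro: smooth_const smooth_mult)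

lemma smooth_compose:
  assumes "\<And>m t. (G m has_real_derivative G (Suc m) t) (at t)" "smooth f"
  shows "smooth (\<lambda>x. G m (f x))"
  using assms by (auto simp: smooth_def intro: C_k_compose)

lemma smooth_has_derivative:
  assumes "smooth f"
  shows "(f has_derivative frechet_derivative f (at x)) (at x)"
  using assms C_k_has_derivative by (metis smooth_def)

lemma smooth_continuous: "smooth f \<Longrightarrow> continuous_on A f"
  unfolding smooth_def by (metis C_k.simps(1) continuous_on_subset subset_UNIV)

lemma smooth_partial: "smooth f \<Longrightarrow> smooth (partial_deriv i f)"
  unfolding smooth_def by (metis C_k_partial)

declare C_k.simps [simp del]

lemma smooth_has_derivative_partial:
  assumes "smooth f"
  shows "(f has_derivative (\<lambda>h. \<Sum>i\<in>UNIV. partial_deriv i f x * h $ i)) (at x)"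
proof -
  let ?D = "frechet_derivative f (at x)"
  have d: "(f has_derivative ?D) (at x)" by (rule smooth_has_derivative[OF assms])
  then have lin: "linear ?D" by (rule has_derivative_linear)
  have "?D h = (\<Sum>i\<in>UNIV. partial_deriv i f x * h $ i)" for h
  proof -
    have "?D h = ?D (\<Sum>i\<in>UNIV. h $ i *s axis i 1)" by (simp add: basis_expansion)
    also have "\<dots> = (\<Sum>i\<in>UNIV. ?D (h $ i *\<^sub>R axis i 1))"
      by (simp add: linear_sum[OF lin] scalar_mult_eq_scaleR)
    finally show ?thesis by (simp add: linear_scale[OF lin] partial_deriv_def mult.commute)
  qed
  with d show ?thesis by (metis (no_types, lifting) ext)
qed

lemma smooth_line_derivative:
  assumes "smooth f"
  shows "((\<lambda>t. f (\<chi> j. if j = i then t else x $ j)) has_real_derivative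
    partial_deriv i f (\<chi> j. if j = i then t else x $ j)) (at t within S)"
proof -
  have eq: "(\<lambda>t. \<chi> j. if j = i then t else x $ j) = (\<lambda>t. (\<chi> j. if j = i then 0 else x $ j) + t *\<^sub>R axis i 1)"
    by (auto simp: vec_eq_iff axis_def)
  have "((\<lambda>t. \<chi> j. if j = i then t else x $ j) has_derivative (\<lambda>t. t *\<^sub>R axis i 1)) (at t within S)"
    unfolding eq by (auto intro!: derivative_eq_intros)
  from has_derivative_compose[OF this smooth_has_derivative[OF assms]]
  have "((\<lambda>t. f (\<chi> j. if j = i then t else x $ j)) has_derivative
    (\<lambda>h. frechet_derivative f (at (\<chi> j. if j = i then t else x $ j)) (h *\<^sub>R axis i 1))) (at t within S)" .
  moreover have "linear (frechet_derivative f (at (\<chi> j. if j = i then t else x $ j)))"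
    by (rule has_derivative_linear[OF smooth_has_derivative[OF assms]])
  ultimately show ?thesis
    by (simp add: has_field_derivative_def linear_scale partial_deriv_def mult.commute[of _ "frechet_derivative _ _ _"])
qed

lemma partial_deriv_mult:
  assumes "smooth f" "smooth g"
  shows "partial_deriv i (\<lambda>x. f x * g x) x = f x * partial_deriv i g x + partial_deriv i f x * g x"
  using partial_deriv_eq[OF has_derivative_mult[OF smooth_has_derivative smooth_has_derivative], OF assms]
  by (simp add: partial_deriv_def)

lemma partial_deriv_diff:
  assumes "smooth f" "smooth g"
  shows "partial_deriv i (\<lambda>x. f x - g x) x = partial_deriv i f x - partial_deriv i g x"
  using partial_deriv_eq[OF has_derivative_diff[OF smooth_has_derivative smooth_has_derivative], OF assms]
  by (simp add: partial_deriv_def)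

lemma partial_deriv_cmult:
  assumes "smooth f"
  shows "partial_deriv i (\<lambda>x. c * f x) x = c * partial_deriv i f x"
  using partial_deriv_eq[OF has_derivative_mult_right[OF smooth_has_derivative], OF assms]
  by (simp add: partial_deriv_def)

lemma test_function_smooth: "test_function U \<phi> \<Longrightarrow> smooth \<phi>"
  unfolding test_function_def smooth_def by blast

lemma test_function_support: "test_function U \<phi> \<Longrightarrow> closure {x. \<phi> x \<noteq> 0} \<subseteq> U"
  unfolding test_function_def by blast

lemma test_function_zero: "test_function U \<phi> \<Longrightarrow> x \<notin> U \<Longrightarrow> \<phi> x = 0"
  using test_function_support[of U \<phi>] closure_subset[of "{x. \<phi> x \<noteq> 0}"] by blast

lemma test_function_intro:
  assumes "smooth \<psi>" "closure {x. \<psi> x \<noteq> 0} \<subseteq> S" "compact S" "S \<subseteq> U"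
  shows "test_function U \<psi>"
proof -
  have "compact (S \<inter> closure {x. \<psi> x \<noteq> 0})"
    by (rule compact_Int_closed[OF assms(3) closed_closure])
  then have "compact (closure {x. \<psi> x \<noteq> 0})" using assms(2) by (simp add: inf.absorb2)
  with assms show ?thesis unfolding test_function_def smooth_def by blast
qed

lemma test_function_compact: "test_function U \<phi> \<Longrightarrow> compact (closure {x. \<phi> x \<noteq> 0})"
  unfolding test_function_def by blast

lemma test_functionI:
  assumes "test_function U \<phi>" "smooth \<psi>" "\<And>x. \<phi> x = 0 \<Longrightarrow> \<psi> x = 0"
  shows "test_function U \<psi>"
proof (rule test_function_intro[OF assms(2) _ test_function_compact test_function_support, OF _ assms(1) assms(1)])
  show "closure {x. \<psi> x \<noteq> 0} \<subseteq> closure {x. \<phi> x \<noteq> 0}"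
    using assms(3) by (intro closure_mono) auto
qed

section \<open>A smooth bump and cutoff functions of boxes\<close>

fun bump_poly :: "nat \<Rightarrow> real poly" where
  "bump_poly 0 = 1"
| "bump_poly (Suc m) = [:0, 0, 1:] * (bump_poly m - pderiv (bump_poly m))"

text \<open>The m-th derivative of exp(-1/t), extended by 0 to t \<le> 0. Differentiating p(1/t)
  exp(-1/t) gives (p - p')(1/t) exp(-1/t) / t^2, which is the recursion of
  \<open>bump_poly\<close>.\<close>

definition bump_deriv :: "nat \<Rightarrow> real \<Rightarrow> real" where
  "bump_deriv m t = (if t > 0 then poly (bump_poly m) (1 / t) * exp (- (1 / t)) else 0)"

lemma poly_mult_exp_tendsto_0: "((\<lambda>x::real. poly p x * exp (- x)) \<longlongrightarrow> 0) at_top"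
proof -
  have "((\<lambda>x::real. \<Sum>i\<le>degree p. coeff p i * (x ^ i / exp x)) \<longlongrightarrow> (\<Sum>i\<le>degree p. coeff p i * 0)) at_top"
    by (intro tendsto_sum tendsto_mult tendsto_const tendsto_power_div_exp_0)
  moreover have "(\<lambda>x. poly p x * exp (- x)) = (\<lambda>x. \<Sum>i\<le>degree p. coeff p i * (x ^ i / exp x))"
    by (simp add: poly_altdef sum_distrib_right exp_minus divide_inverse mult.assoc)
  ultimately show ?thesis by simp
qed

lemma bump_deriv: "(bump_deriv m has_real_derivative bump_deriv (Suc m) t) (at t)"
proof -
  consider "t > 0" | "t < 0" | "t = 0" by linarith
  then show ?thesis
  proof cases
    case 1
    have "((\<lambda>t. poly (bump_poly m) (1 / t) * exp (- (1 / t))) has_real_derivative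
        poly (bump_poly (Suc m)) (1 / t) * exp (- (1 / t))) (at t)"
    proof -
      have "((\<lambda>t. poly (bump_poly m) (1 / t)) has_real_derivative
         poly (pderiv (bump_poly m)) (1 / t) * (- 1 / t\<^sup>2)) (at t)"
        by (rule DERIV_chain2[OF poly_DERIV]) (use 1 in \<open>auto intro!: derivative_eq_intros simp: power2_eq_square\<close>)
      moreover have "((\<lambda>t. exp (- (1 / t))) has_real_derivative exp (- (1/t)) * (1 / t\<^sup>2)) (at t)"
        using 1 by (auto intro!: derivative_eq_intros simp: power2_eq_square)
      ultimately show ?thesis
        by (rule DERIV_cong[OF DERIV_mult]) (simp add: power2_eq_square algebra_simps)
    qed
    then have "(bump_deriv m has_real_derivative poly (bump_poly (Suc m)) (1 / t) * exp (- (1 / t))) (at t)"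
      by (rule has_field_derivative_transform_within_open[where S="{0<..}"]) (use 1 in \<open>auto simp: bump_deriv_def\<close>)
    then show ?thesis using 1 by (simp add: bump_deriv_def)
  next
    case 2
    have "((\<lambda>_. 0) has_real_derivative 0) (at t)" by simp
    then have "(bump_deriv m has_real_derivative 0) (at t)"
      by (rule has_field_derivative_transform_within_open[where S="{..<0}"]) (use 2 in \<open>auto simp: bump_deriv_def\<close>)
    then show ?thesis using 2 by (simp add: bump_deriv_def)
  next
    case 3
    have r: "((\<lambda>h. bump_deriv m h / h) \<longlongrightarrow> 0) (at_right 0)"
    proof -
      \<comment> \<open>Dividing by h multiplies the polynomial in 1/h by its variable, hence
        \<open>pCons 0\<close>; the exponential still wins.\<close>
      have "((\<lambda>h::real. poly (pCons 0 (bump_poly m)) (inverse h) * exp (- inverse h)) \<longlongrightarrow> 0) (at_right 0)"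
        using filterlim_compose[OF poly_mult_exp_tendsto_0 filterlim_inverse_at_top_right] .
      then show ?thesis
        by (rule tendsto_cong[THEN iffD1, rotated])
          (auto simp: bump_deriv_def eventually_at_right_field divide_inverse intro!: exI[of _ 1])
    qed
    have l: "((\<lambda>h. bump_deriv m h / h) \<longlongrightarrow> 0) (at_left 0)"
      by (rule tendsto_eventually) (auto simp: bump_deriv_def eventually_at_left_field intro!: exI[of _ "-1"])
    have "((\<lambda>h. bump_deriv m h / h) \<longlongrightarrow> 0) (at 0)" by (rule filterlim_split_at[OF l r])
    then show ?thesis unfolding 3 DERIV_def by (simp add: bump_deriv_def)
  qed
qed

lemma bump_deriv_0: "bump_deriv 0 t = (if t > 0 then exp (- (1 / t)) else 0)"
  by (simp add: bump_deriv_def)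

definition box_bump :: "real^'n \<Rightarrow> real^'n \<Rightarrow> real^'n \<Rightarrow> real" where
  "box_bump c d x = (\<Prod>i\<in>UNIV. bump_deriv 0 (x $ i - c $ i) * bump_deriv 0 (d $ i - x $ i))"

lemma smooth_box_bump: "smooth (box_bump c d)"
  unfolding box_bump_def[abs_def]
  by (intro smooth_prod smooth_mult smooth_compose[where G=bump_deriv, OF bump_deriv] smooth_diff smooth_coord smooth_const)

lemma box_bump_nonneg: "0 \<le> box_bump c d x"
  by (auto simp: box_bump_def bump_deriv_0 intro!: prod_nonneg)

lemma box_bump_pos_iff: "0 < box_bump c d x \<longleftrightarrow> x \<in> box c d"
proof
  assume "0 < box_bump c d x"
  show "x \<in> box c d"
  proof (rule ccontr)
    assume "x \<notin> box c d"
    then obtain i where "\<not> (c $ i < x $ i \<and> x $ i < d $ i)" by (auto simp: mem_box_cart)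
    then have "bump_deriv 0 (x $ i - c $ i) * bump_deriv 0 (d $ i - x $ i) = 0" by (auto simp: bump_deriv_0)
    then have "box_bump c d x = 0" unfolding box_bump_def by (intro prod_zero) auto
    with \<open>0 < box_bump c d x\<close> show False by simp
  qed
qed (auto simp: box_bump_def mem_box_cart bump_deriv_0 intro!: prod_pos)

text \<open>The quotient b / (b + \<epsilon>) tends to 1 where b > 0 and is 0 where b = 0. This
  yields smooth cutoffs that converge pointwise to the indicator of the open box, without any
  convolution.\<close>

definition box_cutoff :: "real^'n \<Rightarrow> real^'n \<Rightarrow> nat \<Rightarrow> real^'n \<Rightarrow> real" where
  "box_cutoff c d k x = box_bump c d x * inverse (box_bump c d x + 1 / real (Suc k))"

lemma box_cutoff_bounds: "0 \<le> box_cutoff c d k x" "box_cutoff c d k x \<le> 1"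
proof -
  have "0 \<le> b * inverse (b + e) \<and> b * inverse (b + e) \<le> 1" if "0 \<le> b" "0 < e" for b e :: real
    using that by (auto simp: field_simps)
  from this[OF box_bump_nonneg[of c d x], of "1 / real (Suc k)"]
  show "0 \<le> box_cutoff c d k x" "box_cutoff c d k x \<le> 1" by (simp_all add: box_cutoff_def)
qed

lemma box_cutoff_test_function:
  assumes "cbox c d \<subseteq> U"
  shows "test_function U (box_cutoff c d k)"
proof -
  have ne: "box_bump c d x + 1 / real (Suc k) \<noteq> 0" for x
    using box_bump_nonneg[of c d x] by (smt (verit) divide_pos_pos of_nat_0_less_iff zero_less_Suc)
  show ?thesis
  proof (rule test_function_intro[OF _ _ compact_cbox assms])
    show "smooth (box_cutoff c d k)"
      unfolding box_cutoff_def[abs_def]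
      by (intro smooth_mult smooth_inverse smooth_add smooth_const smooth_box_bump ne)
    have "{x. box_cutoff c d k x \<noteq> 0} \<subseteq> cbox c d"
      using box_bump_pos_iff[of c d] box_bump_nonneg[of c d] box_subset_cbox[of c d]
      by (auto simp: box_cutoff_def less_le)
    then show "closure {x. box_cutoff c d k x \<noteq> 0} \<subseteq> cbox c d"
      by (rule closure_minimal) (rule closed_cbox)
  qed
qed

lemma box_cutoff_tendsto: "(\<lambda>k. box_cutoff c d k x) \<longlonglongrightarrow> indicator (box c d) x"
proof (cases "x \<in> box c d")
  case True
  then have pos: "box_bump c d x > 0" by (simp add: box_bump_pos_iff)
  have "(\<lambda>k. box_bump c d x * inverse (box_bump c d x + inverse (real (Suc k)))) \<longlonglongrightarrow>
      box_bump c d x * inverse (box_bump c d x + 0)"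
    using pos by (intro tendsto_intros LIMSEQ_inverse_real_of_nat) auto
  with True pos show ?thesis by (simp add: box_cutoff_def[abs_def] inverse_eq_divide)
next
  case False
  then have "box_bump c d x = 0" using box_bump_pos_iff[of c d x] box_bump_nonneg[of c d x] by linarith
  with False show ?thesis by (simp add: box_cutoff_def)
qed

section \<open>Integration over boxes\<close>

text \<open>Identifies Lebesgue measure with a product over the coordinates.
  \<open>plane_measure\<close> is defined through such a product, so one coordinate can be split off
  and the others form the surface measure.\<close>

lemma lborel_vec_eq:
  "(lborel :: (real^'n) measure) = distr (Pi\<^sub>M UNIV (\<lambda>_. lborel)) borel (\<lambda>y. \<chi> j. y j)"
proof (rule lborel_eqI)
  interpret product_sigma_finite "\<lambda>_::'n. lborel :: real measure" ..
  have meas: "(\<lambda>y. \<chi> j. y j) \<in> Pi\<^sub>M UNIV (\<lambda>_. lborel) \<rightarrow>\<^sub>M (borel :: (real^'n) measure)"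
  proof (subst borel_measurable_euclidean_space, rule ballI)
    fix k :: "real^'n" assume "k \<in> Basis"
    then obtain j where k: "k = axis j 1" by (auto simp: Basis_vec_def)
    have "(\<lambda>y. y j) \<in> Pi\<^sub>M UNIV (\<lambda>_. lborel) \<rightarrow>\<^sub>M (lborel :: real measure)"
      by (intro measurable_component_singleton) auto
    then show "(\<lambda>y. (\<chi> j. y j) \<bullet> k) \<in> borel_measurable (Pi\<^sub>M UNIV (\<lambda>_. lborel))"
      by (simp add: k inner_axis)
  qed
  fix l u :: "real^'n" assume le: "\<And>b. b \<in> Basis \<Longrightarrow> l \<bullet> b \<le> u \<bullet> b"
  have le': "l $ j \<le> u $ j" for j
    using le[of "axis j 1"] by (auto simp: inner_axis Basis_vec_def)
  have "emeasure (distr (Pi\<^sub>M UNIV (\<lambda>_. lborel)) borel (\<lambda>y. \<chi> j. y j)) (box l u) =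
    emeasure (Pi\<^sub>M UNIV (\<lambda>_. lborel)) (Pi\<^sub>E UNIV (\<lambda>j. {l $ j<..<u $ j}))"
    by (subst emeasure_distr[OF meas])
      (auto simp: space_PiM PiE_def Pi_def mem_box_cart intro!: arg_cong2[where f=emeasure])
  also have "\<dots> = (\<Prod>j\<in>UNIV. emeasure lborel {l $ j<..<u $ j})"
    by (intro emeasure_PiM) auto
  also have "\<dots> = (\<Prod>j\<in>UNIV. ennreal ((u - l) $ j))" using le' by simp
  also have "\<dots> = ennreal (\<Prod>j\<in>UNIV. (u - l) $ j)" using le' by (intro prod_ennreal) auto
  also have "(\<Prod>j\<in>UNIV. (u - l) $ j) = (\<Prod>b\<in>Basis. (u - l) \<bullet> b)"
  proof -
    have "(Basis :: (real^'n) set) = range (\<lambda>j. axis j 1)" by (auto simp: Basis_vec_def)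
    then have "(\<Prod>b\<in>Basis. (u - l) \<bullet> b) = (\<Prod>b\<in>range (\<lambda>j. axis j 1). (u - l) \<bullet> b)" by (simp only:)
    also have "\<dots> = (\<Prod>j\<in>UNIV. (u - l) \<bullet> axis j 1)"
      by (subst prod.reindex) (auto simp: inj_on_def axis_eq_axis)
    finally show ?thesis by (simp add: inner_axis)
  qed
  finally show "emeasure (distr (Pi\<^sub>M UNIV (\<lambda>_. lborel)) borel (\<lambda>y. \<chi> j. y j)) (box l u) =
    ennreal (\<Prod>b\<in>Basis. (u - l) \<bullet> b)" .
qed simp

definition upd :: "real^'n \<Rightarrow> 'n \<Rightarrow> real \<Rightarrow> real^'n" where
  "upd x i t = (\<chi> j. if j = i then t else x $ j)"

lemma upd_nth [simp]: "upd x i t $ j = (if j = i then t else x $ j)"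
  by (simp add: upd_def)

lemma upd_same [simp]: "upd x i (x $ i) = x" "upd (upd x i s) i t = upd x i t"
  by (auto simp: vec_eq_iff)

lemma lebesgue_on_integral_lborel:
  fixes f :: "real^'n \<Rightarrow> real"
  assumes "f \<in> borel_measurable borel" "S \<in> sets borel"
  shows "(LINT x|lebesgue_on S. f x) = (\<integral>x. indicator S x * f x \<partial>lborel)"
proof -
  have "(LINT x|lebesgue_on S. f x) = (\<integral>x. indicator S x *\<^sub>R f x \<partial>lebesgue)"
    using assms by (subst integral_restrict_space) auto
  also have "\<dots> = (\<integral>x. indicator S x *\<^sub>R f x \<partial>lborel)"
    using assms by (intro integral_completion) auto
  finally show ?thesis by simp
qed

lemma borel_measurable_lebesgue_on:
  "f \<in> borel_measurable borel \<Longrightarrow> f \<in> borel_measurable (lebesgue_on S)"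
  by (intro measurable_restrict_space1 measurable_completion) simp

lemma integrable_lebesgue_on_bounded:
  fixes f :: "real^'n \<Rightarrow> real"
  assumes "f \<in> borel_measurable (lebesgue_on S)" "S \<in> lmeasurable" "\<And>x. x \<in> S \<Longrightarrow> \<bar>f x\<bar> \<le> B"
  shows "integrable (lebesgue_on S) f"
proof -
  interpret finite_measure "lebesgue_on S"
    using assms(2) by (auto intro: finite_measure_lebesgue_on)
  show ?thesis
    using assms by (intro integrable_const_bound[where B=B] AE_I2) (auto simp: space_restrict_space)
qed

text \<open>Fubini in direction \<open>i\<close>. The outer integral is written over the slice at
  height \<open>c\<close> with \<open>plane_measure\<close>, so that for \<open>c\<close> at an end
  of the interval it is an integral over a face; \<open>J\<close> matters only on that
  slice.\<close>

lemma integral_cbox_lines: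
  fixes f :: "real^'n \<Rightarrow> real"
  assumes f: "f \<in> borel_measurable borel" and bd: "\<And>x. x \<in> cbox l r \<Longrightarrow> \<bar>f x\<bar> \<le> B"
    and c: "c \<in> {l $ i..r $ i}" and J: "J \<in> borel_measurable borel"
    and lines: "\<And>x. x \<in> cbox l r \<Longrightarrow> x $ i = c \<Longrightarrow> ((\<lambda>t. f (upd x i t)) has_integral J x) {l $ i..r $ i}"
  shows "(LINT x|lebesgue_on (cbox l r). f x) = (LINT x:(cbox l r \<inter> {x. x $ i = c})|plane_measure i c. J x)"
proof -
  interpret product_sigma_finite "\<lambda>_::'n. lborel :: real measure" ..
  let ?E = "\<lambda>y. (\<chi> j. y j) :: real^'n"
  let ?c = "\<lambda>y. (\<chi> j. if j = i then c else y j) :: real^'n"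
  let ?F = "\<lambda>x. indicator (cbox l r) x * f x"
  have meas: "?E \<in> Pi\<^sub>M UNIV (\<lambda>_. lborel) \<rightarrow>\<^sub>M borel"
  proof (subst borel_measurable_euclidean_space, rule ballI)
    fix k :: "real^'n" assume "k \<in> Basis"
    then obtain j where k: "k = axis j 1" by (auto simp: Basis_vec_def)
    have "(\<lambda>y. y j) \<in> Pi\<^sub>M UNIV (\<lambda>_. lborel) \<rightarrow>\<^sub>M (lborel :: real measure)"
      by (intro measurable_component_singleton) auto
    then show "(\<lambda>y. ?E y \<bullet> k) \<in> borel_measurable (Pi\<^sub>M UNIV (\<lambda>_. lborel))"
      by (simp add: k inner_axis)
  qed
  have F: "?F \<in> borel_measurable borel" using f by measurable
  have "integrable (lebesgue_on (cbox l r)) f"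
    by (rule integrable_lebesgue_on_bounded[OF borel_measurable_lebesgue_on[OF f] _ bd]) auto
  then have "integrable lebesgue (\<lambda>x. indicator (cbox l r) x *\<^sub>R f x)"
    by (subst (asm) integrable_restrict_space) auto
  then have int: "integrable lborel ?F"
    using F by (subst (asm) integrable_completion) auto
  have U: "insert i (UNIV - {i}) = UNIV" by auto
  have "(LINT x|lebesgue_on (cbox l r). f x) = (\<integral>x. ?F x \<partial>lborel)"
    by (rule lebesgue_on_integral_lborel[OF f]) simp
  also have "\<dots> = (\<integral>y. ?F (?E y) \<partial>Pi\<^sub>M UNIV (\<lambda>_. lborel))"
    by (subst lborel_vec_eq, subst integral_distr[OF meas]) (use F in auto)
  also have "\<dots> = (\<integral>y. (\<integral>t. ?F (?E (y(i:=t))) \<partial>lborel) \<partial>Pi\<^sub>M (UNIV - {i}) (\<lambda>_. lborel))"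
  proof -
    have "integrable (Pi\<^sub>M UNIV (\<lambda>_. lborel)) (\<lambda>y. ?F (?E y))"
      using int by (subst (asm) lborel_vec_eq, subst (asm) integrable_distr_eq[OF meas]) (use F in auto)
    then show ?thesis
      using product_integral_insert[of "UNIV - {i}" i "\<lambda>y. ?F (?E y)"] unfolding U by simp
  qed
  also have "\<dots> = (\<integral>y. indicator (cbox l r \<inter> {x. x $ i = c}) (?c y) *\<^sub>R J (?c y) \<partial>Pi\<^sub>M (UNIV - {i}) (\<lambda>_. lborel))"
  proof (rule Bochner_Integration.integral_cong[OF refl])
    fix y :: "'n \<Rightarrow> real"
    have eq: "?E (y(i:=t)) = upd (?c y) i t" for t by (auto simp: vec_eq_iff)
    have mem: "upd (?c y) i t \<in> cbox l r \<longleftrightarrow> ?c y \<in> cbox l r \<and> t \<in> {l $ i..r $ i}" for t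
      using c by (auto simp: mem_box_cart split: if_splits)
    show "(\<integral>t. ?F (?E (y(i:=t))) \<partial>lborel) = indicator (cbox l r \<inter> {x. x $ i = c}) (?c y) *\<^sub>R J (?c y)"
    proof (cases "?c y \<in> cbox l r")
      case True
      have um: "(\<lambda>t. upd (?c y) i t) \<in> borel_measurable borel"
      proof -
        have "continuous_on UNIV (\<lambda>t. if j = i then t else ?c y $ j)" for j by (cases "j = i") auto
        then show ?thesis unfolding upd_def by (intro borel_measurable_continuous_onI continuous_on_vec_lambda)
      qed
      have "(\<integral>t. ?F (?E (y(i:=t))) \<partial>lborel) = (LINT t:{l $ i..r $ i}|lborel. f (upd (?c y) i t))"
        unfolding set_lebesgue_integral_def eq using True mem
        by (intro Bochner_Integration.integral_cong) (auto simp: indicator_def)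
      also have "\<dots> = integral {l $ i..r $ i} (\<lambda>t. f (upd (?c y) i t))"
      proof (rule set_borel_integral_eq_integral)
        show "set_integrable lborel {l $ i..r $ i} (\<lambda>t. f (upd (?c y) i t))"
          unfolding set_integrable_def
        proof (rule integrableI_bounded_set_indicator[where B="B"])
          show "(\<lambda>t. f (upd (?c y) i t)) \<in> borel_measurable lborel"
            using measurable_compose[OF um f] by simp
          show "AE t\<in>{l $ i..r $ i} in lborel. norm (f (upd (?c y) i t)) \<le> B"
            using bd mem True by auto
        qed (auto simp: emeasure_lborel_Icc_eq)
      qed
      also have "\<dots> = J (?c y)" using lines[of "?c y"] True by (auto intro: integral_unique)
      finally show ?thesis using True by simp
    next
      case False
      then show ?thesis unfolding eq using mem by (simp add: indicator_def)
    qed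
  qed
  also have "\<dots> = (LINT x:(cbox l r \<inter> {x. x $ i = c})|plane_measure i c. J x)"
    unfolding set_lebesgue_integral_def plane_measure_def
  proof (rule integral_distr[OF plane_embedding_measurable, symmetric])
    have "closed {x::real^'n. x $ i = c}" by (simp add: closed_Collect_eq continuous_on_component)
    then have "cbox l r \<inter> {x. x $ i = c} \<in> sets borel" by auto
    then show "(\<lambda>x. indicator (cbox l r \<inter> {x. x $ i = c}) x *\<^sub>R J x) \<in> borel_measurable borel"
      using J by auto
  qed
  finally show ?thesis .
qed

lemma integral_cbox_lines_0:
  fixes f :: "real^'n \<Rightarrow> real"
  assumes f: "f \<in> borel_measurable borel" and bd: "\<And>x. x \<in> cbox l r \<Longrightarrow> \<bar>f x\<bar> \<le> B"
    and lines: "\<And>x. x \<in> cbox l r \<Longrightarrow> ((\<lambda>t. f (upd x i t)) has_integral 0) {l $ i..r $ i}"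
  shows "(LINT x|lebesgue_on (cbox l r). f x) = 0"
proof (cases "cbox l r = {}")
  case False
  then have "l $ i \<in> {l $ i..r $ i}" by (metis atLeastAtMost_iff interval_ne_empty_cart(1) order_refl)
  from integral_cbox_lines[OF f bd this, of "\<lambda>_. 0"] lines show ?thesis
    by (simp add: set_lebesgue_integral_def)
qed (simp add: integral_restrict_space)

lemma negligible_cbox_minus_box: "negligible (cbox l r - box l r)"
  by (rule negligible_frontier_interval)

lemma AE_lebesgue_on_cbox_box:
  "(AE x in lebesgue_on (cbox l r). P x) \<longleftrightarrow> (AE x in lebesgue_on (box l r). P x)"
proof -
  have "AE x in lebesgue. x \<notin> cbox l r - box l r"
    using negligible_cbox_minus_box[of l r] by (intro AE_not_in) (simp add: negligible_iff_null_sets)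
  moreover have "box l r \<subseteq> cbox l r" by (rule box_subset_cbox)
  ultimately show ?thesis
    by (auto simp: AE_restrict_space_iff elim!: eventually_elim2)
qed

lemma integral_lebesgue_on_cbox_box:
  fixes f :: "real^'n \<Rightarrow> real"
  assumes "f \<in> borel_measurable (lebesgue_on (cbox l r))"
  shows "(LINT x|lebesgue_on (cbox l r). f x) = (LINT x|lebesgue_on (box l r). f x)"
proof -
  have N: "AE x in lebesgue. x \<notin> cbox l r - box l r"
    using negligible_cbox_minus_box[of l r] by (intro AE_not_in) (simp add: negligible_iff_null_sets)
  have sub: "box l r \<subseteq> cbox l r" by (rule box_subset_cbox)
  have "f \<in> borel_measurable (lebesgue_on (box l r))"
    using assms sub by (rule measurable_restrict_mono)
  then have "(\<integral>x. (if x \<in> cbox l r then f x else 0) \<partial>lebesgue) = (\<integral>x. (if x \<in> box l r then f x else 0) \<partial>lebesgue)"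
    using assms N sub by (intro integral_cong_AE borel_measurable_if_I) (auto elim!: eventually_mono)
  then show ?thesis by (simp add: Lebesgue_Measure.integral_restrict_UNIV)
qed

lemma smooth_borel: "smooth f \<Longrightarrow> f \<in> borel_measurable borel"
  by (intro borel_measurable_continuous_onI smooth_continuous)

lemma smooth_bounded_cbox:
  assumes "smooth f"
  obtains B where "\<And>x. x \<in> cbox l r \<Longrightarrow> \<bar>f x\<bar> \<le> B"
proof -
  have "compact (f ` cbox l r)" by (intro compact_continuous_image smooth_continuous[OF assms] compact_cbox)
  then obtain B where "\<forall>y\<in>f ` cbox l r. norm y \<le> B" using compact_imp_bounded bounded_iff by blast
  then show ?thesis using that[of B] by auto
qed

lemma smooth_line:
  assumes "smooth f"
  shows "((\<lambda>t. f (upd x i t)) has_real_derivative partial_deriv i f (upd x i t)) (at t within S)"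
  using smooth_line_derivative[OF assms] by (simp add: upd_def)

text \<open>The left integrand is the derivative of (x $ i - d) q in direction \<open>i\<close>, and
  \<open>d\<close> is the end opposite to \<open>c\<close>, so only the face at \<open>c\<close>
  contributes. The face integral thus becomes an expression that is continuous in H^1, which
  replaces the trace.\<close>

lemma face_mean:
  assumes q: "smooth q" and le: "l $ i \<le> r $ i" and c: "c \<in> {l $ i, r $ i}" and d: "d = l $ i + r $ i - c"
  shows "(LINT x|lebesgue_on (cbox l r). q x + (x $ i - d) * partial_deriv i q x) =
     (r $ i - l $ i) * (LINT x:(cbox l r \<inter> {x. x $ i = c})|plane_measure i c. q x)"
proof -
  have sm: "smooth (\<lambda>x. q x + (x $ i - d) * partial_deriv i q x)"
    by (intro smooth_add smooth_mult smooth_diff smooth_coord smooth_const smooth_partial q)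
  obtain B where B: "\<And>x. x \<in> cbox l r \<Longrightarrow> \<bar>q x + (x $ i - d) * partial_deriv i q x\<bar> \<le> B"
    using smooth_bounded_cbox[OF sm] by blast
  have "(LINT x|lebesgue_on (cbox l r). q x + (x $ i - d) * partial_deriv i q x) =
    (LINT x:(cbox l r \<inter> {x. x $ i = c})|plane_measure i c. (r $ i - l $ i) * q x)"
  proof (rule integral_cbox_lines[OF smooth_borel[OF sm] B])
    show "c \<in> {l $ i..r $ i}" using c le by auto
    show "(\<lambda>x. (r $ i - l $ i) * q x) \<in> borel_measurable borel" using smooth_borel[OF q] by simp
    fix x assume x: "x $ i = c"
    have "((\<lambda>t. q (upd x i t) + (t - d) * partial_deriv i q (upd x i t)) has_integral
       (r $ i - d) * q (upd x i (r $ i)) - (l $ i - d) * q (upd x i (l $ i))) {l $ i..r $ i}"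
      by (rule fundamental_theorem_of_calculus[OF le])
        (auto simp flip: has_real_derivative_iff_has_vector_derivative intro!: derivative_eq_intros smooth_line[OF q])
    moreover have "(r $ i - d) * q (upd x i (r $ i)) - (l $ i - d) * q (upd x i (l $ i)) = (r $ i - l $ i) * q x"
      using c x d upd_same(1)[of x i] by (auto simp: algebra_simps)
    ultimately show "((\<lambda>t. q (upd x i t) + (upd x i t $ i - d) * partial_deriv i q (upd x i t)) has_integral
       (r $ i - l $ i) * q x) {l $ i..r $ i}" by simp
  qed
  also have "\<dots> = (r $ i - l $ i) * (LINT x:(cbox l r \<inter> {x. x $ i = c})|plane_measure i c. q x)"
    by simp
  finally show ?thesis .
qed

text \<open>The weight is far from a test function: \<open>F\<close> may have corners in the finite
  set \<open>P\<close>, and \<open>q\<close> is only bounded and Borel. Since \<open>q\<close> is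
  constant in direction \<open>i\<close>, one-dimensional integration along lines is enough, and the
  zeros of \<open>\<psi>\<close> remove the boundary terms.\<close>

lemma integral_partial_by_parts:
  fixes F F' :: "real \<Rightarrow> real" and q :: "real^'n \<Rightarrow> real"
  assumes \<psi>: "smooth \<psi>" and le: "l $ i \<le> r $ i"
    and zero: "\<And>x. x $ i \<in> {l $ i, r $ i} \<Longrightarrow> \<psi> x = 0"
    and F: "continuous_on {l $ i..r $ i} F" "F \<in> borel_measurable borel" "F' \<in> borel_measurable borel"
      "finite P" "\<And>t. t \<in> {l $ i<..<r $ i} - P \<Longrightarrow> (F has_real_derivative F' t) (at t)"
    and bF: "\<And>t. t \<in> {l $ i..r $ i} \<Longrightarrow> \<bar>F t\<bar> \<le> C" "\<And>t. t \<in> {l $ i..r $ i} \<Longrightarrow> \<bar>F' t\<bar> \<le> C"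
    and q: "q \<in> borel_measurable borel" "\<And>x. x \<in> cbox l r \<Longrightarrow> \<bar>q x\<bar> \<le> C" "\<And>x t. q (upd x i t) = q x"
  shows "(LINT x|lebesgue_on (cbox l r). partial_deriv i \<psi> x * (F (x $ i) * q x)) =
    - (LINT x|lebesgue_on (cbox l r). \<psi> x * (F' (x $ i) * q x))"
proof -
  let ?f = "\<lambda>x. partial_deriv i \<psi> x * (F (x $ i) * q x)"
  let ?g = "\<lambda>x. \<psi> x * (F' (x $ i) * q x)"
  obtain B1 where B1: "\<And>x. x \<in> cbox l r \<Longrightarrow> \<bar>\<psi> x\<bar> \<le> B1" using smooth_bounded_cbox[OF \<psi>] by blast
  obtain B2 where B2: "\<And>x. x \<in> cbox l r \<Longrightarrow> \<bar>partial_deriv i \<psi> x\<bar> \<le> B2"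
    using smooth_bounded_cbox[OF smooth_partial[OF \<psi>]] by blast
  have [measurable]: "\<psi> \<in> borel_measurable borel" "partial_deriv i \<psi> \<in> borel_measurable borel"
    by (auto intro!: smooth_borel smooth_partial \<psi>)
  note [measurable] = F(2,3) q(1)
  have coord [measurable]: "(\<lambda>x::real^'n. x $ i) \<in> borel_measurable borel"
    by (intro borel_measurable_continuous_onI continuous_on_component continuous_on_id)
  have mf: "?f \<in> borel_measurable borel" and mg: "?g \<in> borel_measurable borel" by measurable
  have bf: "\<bar>?f x\<bar> \<le> B2 * (C * C)" and bg: "\<bar>?g x\<bar> \<le> B1 * (C * C)" if x: "x \<in> cbox l r" for x
  proof -
    have xi: "x $ i \<in> {l $ i..r $ i}" using x by (auto simp: mem_box_cart)
    have C: "0 \<le> C" using bF(1)[OF xi] by linarith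
    have B: "0 \<le> B1" "0 \<le> B2" using B1[OF x] B2[OF x] by linarith+
    show "\<bar>?f x\<bar> \<le> B2 * (C * C)" "\<bar>?g x\<bar> \<le> B1 * (C * C)"
      unfolding abs_mult using B1[OF x] B2[OF x] bF[OF xi] q(2)[OF x] C B
      by (auto intro!: mult_mono)
  qed
  have int: "integrable (lebesgue_on (cbox l r)) ?f" "integrable (lebesgue_on (cbox l r)) ?g"
    using integrable_lebesgue_on_bounded[OF borel_measurable_lebesgue_on[OF mf] _ bf]
      integrable_lebesgue_on_bounded[OF borel_measurable_lebesgue_on[OF mg] _ bg] by auto
  have "(LINT x|lebesgue_on (cbox l r). ?f x + ?g x) = 0"
  proof (rule integral_cbox_lines_0[where B="B2 * (C * C) + B1 * (C * C)" and i=i])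
    show "(\<lambda>x. ?f x + ?g x) \<in> borel_measurable borel" by measurable
    show "\<bar>?f x + ?g x\<bar> \<le> B2 * (C * C) + B1 * (C * C)" if "x \<in> cbox l r" for x
      using bf[OF that] bg[OF that] by linarith
    fix x :: "real^'n" assume x: "x \<in> cbox l r"
    let ?h = "\<lambda>t. \<psi> (upd x i t) * F t * q x"
    have cont: "continuous_on {l $ i..r $ i} ?h"
      by (intro continuous_intros F DERIV_continuous_on[OF smooth_line[OF \<psi>]])
    have der: "(?h has_real_derivative (partial_deriv i \<psi> (upd x i t) * F t + F' t * \<psi> (upd x i t)) * q x) (at t)"
      if "t \<in> {l $ i<..<r $ i} - P" for t
      by (intro DERIV_cmult_right DERIV_mult smooth_line[OF \<psi>] F(5)[OF that])
    have "((\<lambda>t. (partial_deriv i \<psi> (upd x i t) * F t + F' t * \<psi> (upd x i t)) * q x) has_integral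
      ?h (r $ i) - ?h (l $ i)) {l $ i..r $ i}"
      using fundamental_theorem_of_calculus_interior_strong[OF F(4) le _ cont] der
      by (simp add: has_real_derivative_iff_has_vector_derivative)
    moreover have "?h (r $ i) - ?h (l $ i) = 0" using zero[of "upd x i (r $ i)"] zero[of "upd x i (l $ i)"] by simp
    ultimately have "((\<lambda>t. (partial_deriv i \<psi> (upd x i t) * F t + F' t * \<psi> (upd x i t)) * q x) has_integral 0) {l $ i..r $ i}"
      by (simp only:)
    then show "((\<lambda>t. ?f (upd x i t) + ?g (upd x i t)) has_integral 0) {l $ i..r $ i}"
      by (simp add: q(3) algebra_simps)
  qed
  with int show ?thesis by simp
qed

lemma integral_separated_0:
  fixes h :: "real \<Rightarrow> real" and q :: "real^'n \<Rightarrow> real"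
  assumes h: "h \<in> borel_measurable borel" "\<And>t. t \<in> {l $ i..r $ i} \<Longrightarrow> \<bar>h t\<bar> \<le> C" "(h has_integral 0) {l $ i..r $ i}"
    and q: "q \<in> borel_measurable borel" "\<And>x. x \<in> cbox l r \<Longrightarrow> \<bar>q x\<bar> \<le> C" "\<And>x t. q (upd x i t) = q x"
  shows "(LINT x|lebesgue_on (cbox l r). h (x $ i) * q x) = 0"
proof (rule integral_cbox_lines_0[where B="C * C" and i=i])
  have coord: "(\<lambda>x::real^'n. x $ i) \<in> borel_measurable borel"
    by (intro borel_measurable_continuous_onI continuous_on_component continuous_on_id)
  show "(\<lambda>x. h (x $ i) * q x) \<in> borel_measurable borel"
    using measurable_compose[OF coord h(1)] q(1) by simp
  show "\<bar>h (x $ i) * q x\<bar> \<le> C * C" if x: "x \<in> cbox l r" for x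
  proof -
    have "x $ i \<in> {l $ i..r $ i}" using x by (auto simp: mem_box_cart)
    then show ?thesis using h(2)[of "x $ i"] q(2)[OF x] unfolding abs_mult by (intro mult_mono) auto
  qed
  show "((\<lambda>t. h (upd x i t $ i) * q (upd x i t)) has_integral 0) {l $ i..r $ i}" for x
    using has_integral_mult_left[OF h(3), of "q x"] by (simp add: q(3))
qed

lemma integral_partial_0:
  assumes \<psi>: "smooth \<psi>" and le: "l $ i \<le> r $ i"
    and zero: "\<And>x. x $ i \<in> {l $ i, r $ i} \<Longrightarrow> \<psi> x = 0"
  shows "(LINT x|lebesgue_on (cbox l r). partial_deriv i \<psi> x) = 0"
  using integral_partial_by_parts[OF \<psi> le zero, of "\<lambda>_. 1" "\<lambda>_. 0" "{}" 1 "\<lambda>_. 1"] by simp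

section \<open>Weak gradients\<close>

lemma lmeasurable_box_finite: "finite_measure (lebesgue_on (box a b))" "finite_measure (lebesgue_on (cbox a b))"
  by (auto intro!: finite_measure_lebesgue_on)

text \<open>Open boxes are stable under intersection and generate the Borel sets, so the integral of
  \<open>F\<close> vanishes over every Borel set, in particular where \<open>F\<close> is positive
  and where it is negative. The whole space is not a box; its integral is what the complement step
  starts from.\<close>

lemma AE_0_of_box_integrals:
  fixes F :: "real^'n \<Rightarrow> real"
  assumes F: "integrable lborel F" and boxes: "\<And>c d. (LINT x:box c d|lborel. F x) = 0"
    and total: "(LINT x|lborel. F x) = 0"
  shows "AE x in lborel. F x = 0"
proof -
  have si: "set_integrable lborel A F" if "A \<in> sets borel" for A
    using that F unfolding set_integrable_def by (intro integrable_mult_indicator) auto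
  have zero: "(LINT x:A|lborel. F x) = 0" if "A \<in> sets borel" for A
  proof -
    have isp: "Int_stable (range (\<lambda>(a, b). box a b :: (real^'n) set))"
      "range (\<lambda>(a, b). box a b :: (real^'n) set) \<subseteq> Pow UNIV"
      by (auto simp: Int_stable_def box_Int_box)
    have "A \<in> sigma_sets UNIV (range (\<lambda>(a, b). box a b :: (real^'n) set))"
      using that unfolding borel_eq_box by (simp add: sets_measure_of)
    from isp this show ?thesis
    proof (induction rule: sigma_sets_induct_disjoint)
      case (basic A)
      then show ?case using boxes by auto
    next
      case empty
      then show ?case by (simp add: set_lebesgue_integral_def)
    next
      case (compl A)
      then have A: "A \<in> sets borel" by (subst borel_eq_box) (simp add: sets_measure_of)
      have "(LINT x:UNIV|lborel. F x) = (LINT x:(UNIV - A)|lborel. F x) + (LINT x:A|lborel. F x)"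
        using A by (subst set_integral_Un[symmetric]) (auto intro!: si)
      moreover have "(LINT x:UNIV|lborel. F x) = 0" using total by (simp add: set_lebesgue_integral_def)
      ultimately show ?case using compl by simp
    next
      case (union A)
      then have A: "A i \<in> sets borel" for i by (subst borel_eq_box) (auto simp: sets_measure_of)
      have "(LINT x:(\<Union>i. A i)|lborel. F x) = (\<Sum>i. LINT x:A i|lborel. F x)"
        using A union(1) by (intro lebesgue_integral_countable_add si) (auto simp: disjoint_family_on_def)
      with union show ?case by simp
    qed
  qed
  have [measurable]: "F \<in> borel_measurable borel" using F by auto
  have "AE x in lborel. F x \<le> 0"
  proof -
    have A: "{x. F x > 0} \<in> sets borel" by measurable
    have "(LINT x|lborel. indicator {x. F x > 0} x *\<^sub>R F x) = 0"
      using zero[OF A] by (simp add: set_lebesgue_integral_def)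
    then have "AE x in lborel. indicator {x. F x > 0} x *\<^sub>R F x = 0"
      using si[OF A] by (subst (asm) integral_nonneg_eq_0_iff_AE) (auto simp: set_integrable_def indicator_def)
    then show ?thesis by eventually_elim (auto simp: indicator_def split: if_splits)
  qed
  moreover have "AE x in lborel. F x \<ge> 0"
  proof -
    have A: "{x. F x < 0} \<in> sets borel" by measurable
    have "(LINT x|lborel. - (indicator {x. F x < 0} x *\<^sub>R F x)) = 0"
      using zero[OF A] by (simp add: set_lebesgue_integral_def)
    then have "AE x in lborel. - (indicator {x. F x < 0} x *\<^sub>R F x) = 0"
      using si[OF A] by (subst (asm) integral_nonneg_eq_0_iff_AE) (auto simp: set_integrable_def indicator_def)
    then show ?thesis by eventually_elim (auto simp: indicator_def split: if_splits)
  qed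
  ultimately show ?thesis by eventually_elim simp
qed

text \<open>Box integrals are limits of integrals against \<open>box_cutoff\<close>, which reduces
  the claim to \<open>AE_0_of_box_integrals\<close>. The Borel representative \<open>F\<close> is
  taken because that argument runs over Borel sets.\<close>

lemma fundamental_lemma:
  fixes f :: "real^'n \<Rightarrow> real"
  assumes f: "integrable (lebesgue_on (box a b)) f"
    and zero: "\<And>\<phi>. test_function (box a b) \<phi> \<Longrightarrow> (LINT x|lebesgue_on (box a b). f x * \<phi> x) = 0"
  shows "AE x in lebesgue_on (box a b). f x = 0"
proof -
  let ?U = "box a b"
  let ?f = "\<lambda>x. indicator ?U x *\<^sub>R f x"
  have f': "integrable lebesgue ?f"
    using f by (subst (asm) integrable_restrict_space) auto
  then obtain F where F: "F \<in> borel_measurable lborel" and "AE x in lborel. ?f x = F x"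
    using completion_ex_borel_measurable_real borel_measurable_integrable by blast
  then have ae: "AE x in lebesgue. ?f x = F x" by (intro AE_completion)
  have Fl: "F \<in> borel_measurable lebesgue" using F by (intro measurable_completion)
  have "integrable lebesgue F"
    using integrable_cong_AE_imp[OF f' Fl] ae by (simp add: eq_commute)
  then have Fi: "integrable lborel F" using F by (simp add: integrable_completion)
  have FU: "AE x in lborel. F x = indicator ?U x *\<^sub>R F x"
    using \<open>AE x in lborel. ?f x = F x\<close> by eventually_elim (auto simp: indicator_def)
  have test0: "(LINT x|lborel. F x * \<phi> x) = 0" if t: "test_function ?U \<phi>" for \<phi>
  proof -
    have m: "\<phi> \<in> borel_measurable borel" by (intro smooth_borel test_function_smooth[OF t])
    then have ml: "\<phi> \<in> borel_measurable lebesgue" by (intro measurable_completion) simp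
    have "0 = (LINT x|lebesgue. indicator ?U x *\<^sub>R (f x * \<phi> x))"
      using zero[OF t] by (subst (asm) integral_restrict_space) auto
    also have "\<dots> = (LINT x|lebesgue. ?f x * \<phi> x)" by (simp add: mult.assoc)
    also have "\<dots> = (LINT x|lebesgue. F x * \<phi> x)"
    proof (rule integral_cong_AE)
      show "AE x in lebesgue. ?f x * \<phi> x = F x * \<phi> x" using ae by eventually_elim simp
    qed (use f' Fl ml in \<open>auto intro!: borel_measurable_times\<close>)
    also have "\<dots> = (LINT x|lborel. F x * \<phi> x)"
      using F m by (intro integral_completion) auto
    finally show ?thesis by simp
  qed
  have inner: "(LINT x:box c d|lborel. F x) = 0" if "cbox c d \<subseteq> ?U" for c d
  proof -
    have "(\<lambda>k. LINT x|lborel. F x * box_cutoff c d k x) \<longlonglongrightarrow> (LINT x|lborel. F x * indicator (box c d) x)"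
    proof (rule integral_dominated_convergence[where w="\<lambda>x. norm (F x)"])
      show "(\<lambda>x. F x * box_cutoff c d k x) \<in> borel_measurable lborel" for k
        using F smooth_borel[OF test_function_smooth[OF box_cutoff_test_function[OF order_refl]], of c d k] by simp
      show "AE x in lborel. (\<lambda>k. F x * box_cutoff c d k x) \<longlonglongrightarrow> F x * indicator (box c d) x"
        by (intro AE_I2 tendsto_mult tendsto_const box_cutoff_tendsto)
      show "AE x in lborel. norm (F x * box_cutoff c d k x) \<le> norm (F x)" for k
        using box_cutoff_bounds[of c d k] by (auto simp: abs_mult intro!: mult_left_le)
    qed (use F Fi in auto)
    moreover have "(LINT x|lborel. F x * box_cutoff c d k x) = 0" for k
      by (intro test0 box_cutoff_test_function that)
    ultimately have "(LINT x|lborel. F x * indicator (box c d) x) = 0"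
      by (simp add: LIMSEQ_const_iff)
    then show ?thesis by (simp add: set_lebesgue_integral_def mult.commute)
  qed
  \<comment> \<open>A box that touches the boundary of the domain is exhausted by boxes shrunk by
    the margin \<open>e m\<close>, whose closures lie inside it.\<close>
  have sub: "(LINT x:box c d|lborel. F x) = 0" if cd: "box c d \<subseteq> ?U" for c d
  proof (cases "box c d = {}")
    case False
    define e :: "nat \<Rightarrow> real^'n" where "e m = (\<chi> i. inverse (real (Suc m)))" for m
    have "(\<lambda>m. LINT x|lborel. indicator (box (c + e m) (d - e m)) x *\<^sub>R F x) \<longlonglongrightarrow>
      (LINT x|lborel. indicator (box c d) x *\<^sub>R F x)"
    proof (rule integral_dominated_convergence[where w="\<lambda>x. norm (F x)"])
      show "AE x in lborel. (\<lambda>m. indicator (box (c + e m) (d - e m)) x *\<^sub>R F x) \<longlonglongrightarrow> indicator (box c d) x *\<^sub>R F x"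
      proof (rule AE_I2)
        fix x
        show "(\<lambda>m. indicator (box (c + e m) (d - e m)) x *\<^sub>R F x) \<longlonglongrightarrow> indicator (box c d) x *\<^sub>R F x"
        proof (cases "x \<in> box c d")
          case True
          have "eventually (\<lambda>m. \<forall>i. c $ i + inverse (real (Suc m)) < x $ i \<and> x $ i < d $ i - inverse (real (Suc m))) sequentially"
          proof (rule eventually_all_finite)
            fix i
            have "c $ i < x $ i" "x $ i < d $ i" using True by (auto simp: mem_box_cart)
            then have "eventually (\<lambda>m. inverse (real (Suc m)) < x $ i - c $ i) sequentially"
              "eventually (\<lambda>m. inverse (real (Suc m)) < d $ i - x $ i) sequentially"
              by (auto intro!: order_tendstoD(2)[OF LIMSEQ_inverse_real_of_nat] simp del: of_nat_Suc)
            then show "eventually (\<lambda>m. c $ i + inverse (real (Suc m)) < x $ i \<and> x $ i < d $ i - inverse (real (Suc m))) sequentially"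
              by eventually_elim auto
          qed
          then have "eventually (\<lambda>m. indicator (box (c + e m) (d - e m)) x *\<^sub>R F x = indicator (box c d) x *\<^sub>R F x) sequentially"
            by eventually_elim (use True in \<open>auto simp: indicator_def mem_box_cart e_def\<close>)
          then show ?thesis by (rule tendsto_eventually)
        next
          case False
          have "x \<notin> box (c + e m) (d - e m)" for m
          proof
            have e0: "e m $ i > 0" for i by (simp add: e_def)
            assume "x \<in> box (c + e m) (d - e m)"
            then have "c $ i < x $ i \<and> x $ i < d $ i" for i
              using e0[of i] by (auto simp: mem_box_cart dest!: spec[of _ i])
            with False show False by (auto simp: mem_box_cart)
          qed
          with False show ?thesis by simp
        qed
      qed
    qed (use F Fi in \<open>auto simp: indicator_def\<close>)
    moreover have "(LINT x|lborel. indicator (box (c + e m) (d - e m)) x *\<^sub>R F x) = 0" for m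
    proof -
      have e0: "e m $ i > 0" for i by (simp add: e_def)
      have "cbox (c + e m) (d - e m) \<subseteq> box c d"
        using e0 by (auto simp: mem_box_cart) (smt (verit))+
      with cd inner[of "c + e m" "d - e m"] show ?thesis by (auto simp: set_lebesgue_integral_def)
    qed
    ultimately show ?thesis by (simp add: LIMSEQ_const_iff set_lebesgue_integral_def)
  qed (simp add: set_lebesgue_integral_def)
  have all: "(LINT x:box c d|lborel. F x) = 0" for c d
  proof -
    obtain c' d' where eq: "box c d \<inter> ?U = box c' d'" using box_Int_box[of c d a b] by blast
    have "(LINT x:box c d|lborel. F x) = (LINT x:box c d \<inter> ?U|lborel. F x)"
      unfolding set_lebesgue_integral_def
    proof (rule integral_cong_AE)
      show "AE x in lborel. indicator (box c d) x *\<^sub>R F x = indicator (box c d \<inter> ?U) x *\<^sub>R F x"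
        using FU by eventually_elim (auto simp: indicator_def)
    qed (use F in auto)
    then show ?thesis using sub[of c' d'] eq by (metis inf_le2)
  qed
  have "AE x in lborel. F x = 0"
  proof (rule AE_0_of_box_integrals[OF Fi all])
    have "(LINT x|lborel. F x) = (LINT x|lborel. indicator ?U x *\<^sub>R F x)"
      using F FU by (intro integral_cong_AE) auto
    also have "\<dots> = 0" using all[of a b] by (simp add: set_lebesgue_integral_def)
    finally show "(LINT x|lborel. F x) = 0" .
  qed
  then have "AE x in lebesgue. F x = 0" by (rule AE_completion)
  with ae have "AE x in lebesgue. x \<in> ?U \<longrightarrow> f x = 0" by eventually_elim auto
  then show ?thesis by (subst AE_restrict_space_iff) auto
qed

lemma L2_iff_sq_integrable: "f \<in> L2 U \<longleftrightarrow> sq_integrable (lebesgue_on U) f"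
  for f :: "real^'n \<Rightarrow> real"
  by (simp add: L2_def sq_integrable_def)

lemma norm_vec_sq: "(norm x)\<^sup>2 = (\<Sum>i\<in>UNIV. (x $ i)\<^sup>2)" for x :: "real^'n"
  unfolding norm_vec_def L2_set_def by (simp add: sum_nonneg)

lemma component_sq_le: "(x $ i)\<^sup>2 \<le> (norm x)\<^sup>2" for x :: "real^'n"
  using component_le_norm_cart[of x i] by (simp add: abs_le_square_iff[symmetric])

lemma borel_measurable_vec_iff:
  fixes g :: "'a \<Rightarrow> real^'n"
  shows "g \<in> borel_measurable M \<longleftrightarrow> (\<forall>i. (\<lambda>x. g x $ i) \<in> borel_measurable M)"
  by (subst borel_measurable_euclidean_space) (auto simp: Basis_vec_def inner_axis)

lemma L2_vec_iff_sq_integrable: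
  fixes g :: "real^'n \<Rightarrow> real^'n"
  shows "g \<in> L2 U \<longleftrightarrow> (\<forall>i. sq_integrable (lebesgue_on U) (\<lambda>x. g x $ i))"
proof
  assume g: "g \<in> L2 U"
  show "\<forall>i. sq_integrable (lebesgue_on U) (\<lambda>x. g x $ i)"
  proof
    fix i
    have m: "(\<lambda>x. g x $ i) \<in> borel_measurable (lebesgue_on U)"
      using g by (auto simp: L2_def borel_measurable_vec_iff)
    moreover have "integrable (lebesgue_on U) (\<lambda>x. (g x $ i)\<^sup>2)"
      by (rule Bochner_Integration.integrable_bound[of _ "\<lambda>x. (norm (g x))\<^sup>2"])
        (use g m in \<open>auto simp: L2_def intro!: AE_I2 component_sq_le\<close>)
    ultimately show "sq_integrable (lebesgue_on U) (\<lambda>x. g x $ i)" by (simp add: sq_integrable_def)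
  qed
next
  assume "\<forall>i. sq_integrable (lebesgue_on U) (\<lambda>x. g x $ i)"
  then show "g \<in> L2 U"
    by (auto simp: L2_def sq_integrable_def borel_measurable_vec_iff norm_vec_sq)
qed

lemma smooth_sq_integrable_box:
  assumes "smooth f"
  shows "sq_integrable (lebesgue_on (box l r)) f" "sq_integrable (lebesgue_on (cbox l r)) f"
proof -
  obtain B where B: "\<And>x. x \<in> cbox l r \<Longrightarrow> \<bar>f x\<bar> \<le> B" using smooth_bounded_cbox[OF assms] by blast
  have m: "f \<in> borel_measurable (lebesgue_on S)" for S
    by (intro borel_measurable_lebesgue_on smooth_borel assms)
  show "sq_integrable (lebesgue_on (box l r)) f" "sq_integrable (lebesgue_on (cbox l r)) f"
    using B box_subset_cbox[of l r]
    by (auto intro!: sq_integrable_bounded[OF _ m, where C=B] lmeasurable_box_finite AE_I2 simp: space_restrict_space)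
qed

definition grad :: "(real^'n \<Rightarrow> real) \<Rightarrow> real^'n \<Rightarrow> real^'n" where
  "grad f x = (\<chi> i. partial_deriv i f x)"

lemma grad_nth [simp]: "grad f x $ i = partial_deriv i f x"
  by (simp add: grad_def)

lemma has_weak_grad_smooth:
  assumes p: "smooth p"
  shows "has_weak_grad (box l r) p (grad p)"
  unfolding has_weak_grad_def
proof (intro conjI allI impI)
  show "grad p \<in> L2 (box l r)"
    by (auto simp: L2_vec_iff_sq_integrable intro!: smooth_sq_integrable_box smooth_partial p)
  fix \<phi> i assume t: "test_function (box l r) \<phi>"
  have sm: "smooth \<phi>" by (rule test_function_smooth[OF t])
  have smp: "smooth (\<lambda>x. p x * \<phi> x)" by (intro smooth_mult p sm)
  have eq: "partial_deriv i (\<lambda>x. p x * \<phi> x) = (\<lambda>x. p x * partial_deriv i \<phi> x + partial_deriv i p x * \<phi> x)"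
    by (rule ext) (rule partial_deriv_mult[OF p sm])
  have int: "integrable (lebesgue_on (box l r)) (\<lambda>x. p x * partial_deriv i \<phi> x)"
    "integrable (lebesgue_on (box l r)) (\<lambda>x. partial_deriv i p x * \<phi> x)"
    by (intro sq_integrable_mult smooth_sq_integrable_box smooth_partial p sm)+
  have "(LINT x|lebesgue_on (box l r). p x * partial_deriv i \<phi> x + partial_deriv i p x * \<phi> x) = 0"
  proof (cases "l $ i \<le> r $ i")
    case True
    have "(LINT x|lebesgue_on (cbox l r). partial_deriv i (\<lambda>x. p x * \<phi> x) x) = 0"
    proof (rule integral_partial_0[OF smp True])
      show "p x * \<phi> x = 0" if "x $ i \<in> {l $ i, r $ i}" for x
      proof -
        have "x \<notin> box l r" using that by (auto simp: mem_box_cart) (metis less_irrefl)+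
        then show ?thesis using test_function_zero[OF t] by simp
      qed
    qed
    then show ?thesis
      unfolding eq[symmetric] integral_lebesgue_on_cbox_box[OF borel_measurable_lebesgue_on[OF smooth_borel[OF smooth_partial[OF smp]]]] .
  next
    case False
    have "x \<notin> box l r" for x
      using False by (metis mem_box_cart(1) less_trans less_imp_le)
    then have "box l r = {}" by blast
    then show ?thesis by (simp add: integral_restrict_space)
  qed
  then show "(LINT x|lebesgue_on (box l r). p x * partial_deriv i \<phi> x) = - (LINT x|lebesgue_on (box l r). grad p x $ i * \<phi> x)"
    using int by simp
qed

text \<open>Besides \<open>weak_grad\<close>, this also controls the choice made in
  \<open>piecewise_grad\<close>, cell by cell.\<close>

lemma has_weak_grad_unique:
  assumes g: "has_weak_grad (box a b) v g" and h: "has_weak_grad (box a b) v h"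
  shows "AE x in lebesgue_on (box a b). g x = h x"
proof -
  let ?M = "lebesgue_on (box a b)"
  have "AE x in ?M. g x $ i - h x $ i = 0" for i
  proof (rule fundamental_lemma)
    have gi: "sq_integrable ?M (\<lambda>x. g x $ i)" and hi: "sq_integrable ?M (\<lambda>x. h x $ i)"
      using g h by (auto simp: has_weak_grad_def L2_vec_iff_sq_integrable)
    show "integrable ?M (\<lambda>x. g x $ i - h x $ i)"
      by (intro sq_integrable_integrable[OF lmeasurable_box_finite(1)] sq_integrable_diff gi hi)
    fix \<phi> assume t: "test_function (box a b) \<phi>"
    have \<phi>: "sq_integrable ?M \<phi>" by (intro smooth_sq_integrable_box test_function_smooth[OF t])
    have "(LINT x|?M. v x * partial_deriv i \<phi> x) = - (LINT x|?M. g x $ i * \<phi> x)"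
      "(LINT x|?M. v x * partial_deriv i \<phi> x) = - (LINT x|?M. h x $ i * \<phi> x)"
      using g h t unfolding has_weak_grad_def by blast+
    then have "(LINT x|?M. g x $ i * \<phi> x) = (LINT x|?M. h x $ i * \<phi> x)" by linarith
    then show "(LINT x|?M. (g x $ i - h x $ i) * \<phi> x) = 0"
      using sq_integrable_mult[OF gi \<phi>] sq_integrable_mult[OF hi \<phi>] by (simp add: left_diff_distrib)
  qed
  then have "AE x in ?M. \<forall>i\<in>UNIV. g x $ i - h x $ i = 0" by (intro AE_finite_allI) auto
  then show ?thesis by eventually_elim (simp add: vec_eq_iff)
qed

lemma has_weak_grad_diff:
  assumes g: "has_weak_grad (box a b) v g" and h: "has_weak_grad (box a b) w h"
    and v: "v \<in> L2 (box a b)" and w: "w \<in> L2 (box a b)"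
  shows "has_weak_grad (box a b) (\<lambda>x. v x - w x) (\<lambda>x. g x - h x)"
  unfolding has_weak_grad_def
proof (intro conjI allI impI)
  let ?M = "lebesgue_on (box a b)"
  have gi: "sq_integrable ?M (\<lambda>x. g x $ i)" and hi: "sq_integrable ?M (\<lambda>x. h x $ i)" for i
    using g h by (auto simp: has_weak_grad_def L2_vec_iff_sq_integrable)
  then show "(\<lambda>x. g x - h x) \<in> L2 (box a b)"
    by (auto simp: L2_vec_iff_sq_integrable intro!: sq_integrable_diff)
  fix \<phi> i assume t: "test_function (box a b) \<phi>"
  have \<phi>: "sq_integrable ?M \<phi>" "sq_integrable ?M (partial_deriv i \<phi>)"
    by (intro smooth_sq_integrable_box smooth_partial test_function_smooth[OF t])+
  have vw: "sq_integrable ?M v" "sq_integrable ?M w" using v w by (auto simp: L2_iff_sq_integrable)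
  show "(LINT x|?M. (v x - w x) * partial_deriv i \<phi> x) = - (LINT x|?M. (g x - h x) $ i * \<phi> x)"
    using sq_integrable_mult[OF gi \<phi>(1)] sq_integrable_mult[OF hi \<phi>(1)]
      sq_integrable_mult[OF vw(1) \<phi>(2)] sq_integrable_mult[OF vw(2) \<phi>(2)] g h t
    by (simp add: left_diff_distrib has_weak_grad_def)
qed

lemma L2_norm_sq: "(L2_norm U f)\<^sup>2 = (LINT x|lebesgue_on U. (norm (f x))\<^sup>2)"
  by (simp add: L2_norm_def)

lemma weak_grad_ae:
  assumes "has_weak_grad (box a b) v g"
  shows "has_weak_grad (box a b) v (weak_grad (box a b) v)"
    and "AE x in lebesgue_on (box a b). weak_grad (box a b) v x = g x"
proof -
  show *: "has_weak_grad (box a b) v (weak_grad (box a b) v)"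
    unfolding weak_grad_def using someI[of "has_weak_grad (box a b) v" g] assms by simp
  show "AE x in lebesgue_on (box a b). weak_grad (box a b) v x = g x"
    by (rule has_weak_grad_unique[OF * assms])
qed

lemma weak_grad_norm:
  assumes "has_weak_grad (box a b) v g"
  shows "(L2_norm (box a b) (weak_grad (box a b) v))\<^sup>2 = (LINT x|lebesgue_on (box a b). (norm (g x))\<^sup>2)"
  unfolding L2_norm_sq
proof (rule integral_cong_AE)
  show "AE x in lebesgue_on (box a b). (norm (weak_grad (box a b) v x))\<^sup>2 = (norm (g x))\<^sup>2"
    using weak_grad_ae(2)[OF assms] by eventually_elim simp
qed (use weak_grad_ae(1)[OF assms] assms in \<open>auto simp: has_weak_grad_def L2_def\<close>)

lemma test_function_H10:
  assumes "test_function (box a b) \<phi>"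
  shows "\<phi> \<in> H10 (box a b)"
proof -
  have sm: "smooth \<phi>" by (rule test_function_smooth[OF assms])
  have "\<phi> \<in> H1 (box a b)"
    using has_weak_grad_smooth[OF sm] smooth_sq_integrable_box[OF sm] by (auto simp: H1_def L2_iff_sq_integrable)
  moreover have "H1_norm (box a b) (\<lambda>x. \<phi> x - \<phi> x) = 0"
  proof -
    have "has_weak_grad (box a b) (\<lambda>x. \<phi> x - \<phi> x) (\<lambda>x. grad \<phi> x - grad \<phi> x)"
      by (intro has_weak_grad_diff has_weak_grad_smooth sm) (auto simp: L2_iff_sq_integrable intro!: smooth_sq_integrable_box sm)
    from weak_grad_norm[OF this] show ?thesis by (simp add: H1_norm_def L2_norm_sq)
  qed
  ultimately show ?thesis using assms unfolding H10_def by fastforce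
qed

text \<open>Every later use of the zero boundary values goes through this sequence: functions and
  gradients converge together in L^2, so identities for test functions pass to \<open>v\<close> and
  \<open>g\<close>.\<close>

lemma H10_sequence:
  assumes "v \<in> H10 (box a b)"
  obtains g \<phi> where "has_weak_grad (box a b) v g" "\<And>k. test_function (box a b) (\<phi> k)"
    "sq_tendsto (lebesgue_on (box a b)) \<phi> v"
    "\<And>i. sq_tendsto (lebesgue_on (box a b)) (\<lambda>k. partial_deriv i (\<phi> k)) (\<lambda>x. g x $ i)"
proof -
  let ?M = "lebesgue_on (box a b)"
  obtain g where g: "has_weak_grad (box a b) v g" and v: "v \<in> L2 (box a b)"
    using assms by (auto simp: H10_def H1_def)
  have "\<exists>\<phi>. test_function (box a b) \<phi> \<and> H1_norm (box a b) (\<lambda>x. v x - \<phi> x) < inverse (real (Suc k))" for k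
  proof -
    have "0 < inverse (real (Suc k))" by simp
    then show ?thesis using assms unfolding H10_def by blast
  qed
  then obtain \<phi> where \<phi>: "\<And>k. test_function (box a b) (\<phi> k)"
    and lt: "\<And>k. H1_norm (box a b) (\<lambda>x. v x - \<phi> k x) < inverse (real (Suc k))" by metis
  have sm: "smooth (\<phi> k)" for k by (rule test_function_smooth[OF \<phi>])
  have \<phi>L: "\<phi> k \<in> L2 (box a b)" for k by (auto simp: L2_iff_sq_integrable intro!: smooth_sq_integrable_box sm)
  have wg: "has_weak_grad (box a b) (\<lambda>x. v x - \<phi> k x) (\<lambda>x. g x - grad (\<phi> k) x)" for k
    by (intro has_weak_grad_diff has_weak_grad_smooth sm g v \<phi>L)
  have le: "(LINT x|?M. (v x - \<phi> k x)\<^sup>2) + (LINT x|?M. (norm (g x - grad (\<phi> k) x))\<^sup>2) \<le> inverse (real (Suc k))" for k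
  proof -
    let ?H = "H1_norm (box a b) (\<lambda>x. v x - \<phi> k x)"
    have H: "?H\<^sup>2 = (LINT x|?M. (v x - \<phi> k x)\<^sup>2) + (LINT x|?M. (norm (g x - grad (\<phi> k) x))\<^sup>2)"
      unfolding H1_norm_def weak_grad_norm[OF wg] by (simp add: L2_norm_sq)
    have "0 \<le> ?H" by (simp add: H1_norm_def)
    moreover have "inverse (real (Suc k)) \<le> 1" by (simp add: field_simps)
    ultimately have "?H * ?H \<le> inverse (real (Suc k)) * 1"
      using lt[of k] by (intro mult_mono) linarith+
    with H show ?thesis by (simp add: power2_eq_square)
  qed
  have lim: "(\<lambda>k. inverse (real (Suc k))) \<longlonglongrightarrow> 0" by (rule LIMSEQ_inverse_real_of_nat)
  have sv: "sq_integrable ?M v" "sq_integrable ?M (\<phi> k)" for k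
    using v \<phi>L by (auto simp: L2_iff_sq_integrable)
  have sg: "sq_integrable ?M (\<lambda>x. g x $ i)" "sq_integrable ?M (partial_deriv i (\<phi> k))" for i k
    using g by (auto simp: has_weak_grad_def L2_vec_iff_sq_integrable intro!: smooth_sq_integrable_box smooth_partial sm)
  have t1: "sq_tendsto ?M \<phi> v"
  proof (rule sq_tendstoI[OF sv(2) sv(1) _ lim])
    show "(LINT x|?M. (\<phi> k x - v x)\<^sup>2) \<le> inverse (real (Suc k))" for k
    proof -
      have "0 \<le> (LINT x|?M. (norm (g x - grad (\<phi> k) x))\<^sup>2)" by simp
      moreover have "(LINT x|?M. (\<phi> k x - v x)\<^sup>2) = (LINT x|?M. (v x - \<phi> k x)\<^sup>2)"
        by (intro Bochner_Integration.integral_cong refl power2_commute)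
      ultimately show ?thesis using le[of k] by linarith
    qed
  qed
  have t2: "sq_tendsto ?M (\<lambda>k. partial_deriv i (\<phi> k)) (\<lambda>x. g x $ i)" for i
  proof (rule sq_tendstoI[OF sg(2) sg(1) _ lim])
    fix k
    have "(LINT x|?M. (partial_deriv i (\<phi> k) x - g x $ i)\<^sup>2) \<le> (LINT x|?M. (norm (g x - grad (\<phi> k) x))\<^sup>2)"
    proof (rule integral_mono)
      show "integrable ?M (\<lambda>x. (partial_deriv i (\<phi> k) x - g x $ i)\<^sup>2)"
        using sq_integrable_diff[OF sg(2) sg(1)] by auto
      show "integrable ?M (\<lambda>x. (norm (g x - grad (\<phi> k) x))\<^sup>2)"
        using wg[of k] by (auto simp: has_weak_grad_def L2_def)
      show "(partial_deriv i (\<phi> k) x - g x $ i)\<^sup>2 \<le> (norm (g x - grad (\<phi> k) x))\<^sup>2" for x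
        using component_sq_le[of "g x - grad (\<phi> k) x" i] by (subst power2_commute) simp
    qed
    also have "\<dots> \<le> inverse (real (Suc k))"
    proof -
      have "0 \<le> (LINT x|?M. (v x - \<phi> k x)\<^sup>2)" by simp
      with le[of k] show ?thesis by linarith
    qed
    finally show "(LINT x|?M. (partial_deriv i (\<phi> k) x - g x $ i)\<^sup>2) \<le> inverse (real (Suc k))" .
  qed
  show ?thesis by (rule that[OF g \<phi> t1 t2])
qed

section \<open>The Sobolev--Poincare inequality\<close>

lemma nn_integral_affine:
  fixes e :: "real^'n \<Rightarrow> ennreal"
  assumes [measurable]: "e \<in> borel_measurable borel" and c: "c > 0"
  shows "ennreal (c ^ CARD('n)) * (\<integral>\<^sup>+y. e (w + c *\<^sub>R y) \<partial>lborel) = (\<integral>\<^sup>+y. e y \<partial>lborel)"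
proof -
  have "(\<integral>\<^sup>+y. e y \<partial>lborel) = (\<integral>\<^sup>+y. e y \<partial>density (distr lborel borel (\<lambda>x. w + c *\<^sub>R x)) (\<lambda>_. ennreal (\<bar>c\<bar> ^ DIM(real^'n))))"
    using lborel_affine[of c w] c by simp
  also have "\<dots> = (\<integral>\<^sup>+y. ennreal (c ^ CARD('n)) * e (w + c *\<^sub>R y) \<partial>lborel)"
    using c by (subst nn_integral_density) (auto simp: nn_integral_distr)
  also have "\<dots> = ennreal (c ^ CARD('n)) * (\<integral>\<^sup>+y. e (w + c *\<^sub>R y) \<partial>lborel)"
    by (rule nn_integral_cmult) simp
  finally show ?thesis by simp
qed

text \<open>The fundamental theorem along the path from \<open>x\<close> to \<open>y\<close>,
  followed by the Cauchy-Schwarz inequality; \<open>16 * \<tau> ^ 6\<close> is the square of the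
  speed \<open>4 * \<tau> ^ 3\<close> of the parametrisation. The bound is a nonnegative integral so
  that later exchanges of integrals need no integrability.\<close>

lemma nn_integral_segment:
  fixes \<phi> :: "real^'n \<Rightarrow> real"
  assumes \<phi>: "smooth \<phi>" and d: "norm (y - x) \<le> d"
  shows "ennreal ((\<phi> x - \<phi> y)\<^sup>2) \<le>
    (\<integral>\<^sup>+\<tau>. ennreal (16 * d\<^sup>2 * \<tau> ^ 6) * ennreal ((norm (grad \<phi> (x + \<tau> ^ 4 *\<^sub>R (y - x))))\<^sup>2) * indicator {0..1} \<tau> \<partial>lborel)"
proof -
  let ?z = "\<lambda>\<tau>. x + \<tau> ^ 4 *\<^sub>R (y - x)"
  let ?h = "\<lambda>\<tau>. 4 * \<tau> ^ 3 * (\<Sum>i\<in>UNIV. partial_deriv i \<phi> (?z \<tau>) * (y - x) $ i)"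
  let ?b = "\<lambda>\<tau>. 16 * d\<^sup>2 * \<tau> ^ 6 * (norm (grad \<phi> (?z \<tau>)))\<^sup>2"
  let ?M = "lebesgue_on {0..1::real}"
  have d0: "0 \<le> d" using d norm_ge_zero order_trans by blast
  have cz: "continuous_on S ?z" for S by (intro continuous_intros)
  have cp: "continuous_on S (\<lambda>\<tau>. partial_deriv i \<phi> (?z \<tau>))" for S i
    by (rule continuous_on_compose2[OF smooth_continuous[OF smooth_partial[OF \<phi>], of UNIV] cz]) auto
  have cg: "continuous_on S (\<lambda>\<tau>. grad \<phi> (?z \<tau>))" for S
    unfolding grad_def by (intro continuous_on_vec_lambda cp)
  have ch: "continuous_on S ?h" and cb: "continuous_on S ?b" for S
    by (intro continuous_intros cp cg)+
  have der: "((\<lambda>\<tau>. \<phi> (?z \<tau>)) has_vector_derivative ?h \<tau>) (at \<tau> within S)" for \<tau> S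
  proof -
    have "(?z has_derivative (\<lambda>s. (s * (4 * \<tau> ^ 3)) *\<^sub>R (y - x))) (at \<tau> within S)"
      by (auto intro!: derivative_eq_intros simp: algebra_simps)
    from has_derivative_compose[OF this smooth_has_derivative_partial[OF \<phi>]]
    show ?thesis unfolding has_vector_derivative_def
      by (rule has_derivative_eq_rhs) (auto simp: sum_distrib_left algebra_simps)
  qed
  have "(?h has_integral \<phi> (?z 1) - \<phi> (?z 0)) {0..1}"
    by (rule fundamental_theorem_of_calculus[OF _ der]) simp
  then have hk: "integral {0..1} ?h = \<phi> y - \<phi> x" by (simp add: integral_unique)
  have fin: "finite_measure ?M" by (intro finite_measure_lebesgue_on) simp
  have bl: "(\<lambda>\<tau>. f \<tau>) \<in> borel_measurable ?M" if "continuous_on UNIV f" for f :: "real \<Rightarrow> real"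
    by (intro measurable_restrict_space1 measurable_completion) (use that borel_measurable_continuous_onI in simp)
  have bounded: "\<exists>B. \<forall>\<tau>\<in>{0..1}. \<bar>f \<tau>\<bar> \<le> B" if "continuous_on UNIV f" for f :: "real \<Rightarrow> real"
  proof -
    have "compact (f ` {0..1})" by (intro compact_continuous_image continuous_on_subset[OF that]) auto
    then show ?thesis using compact_imp_bounded[of "f ` {0..1}"] by (auto simp: bounded_iff)
  qed
  have si: "sq_integrable ?M f" if f: "continuous_on UNIV f" for f :: "real \<Rightarrow> real"
  proof -
    obtain B where "\<forall>\<tau>\<in>{0..1}. \<bar>f \<tau>\<bar> \<le> B" using bounded[OF f] by blast
    then show ?thesis
      by (intro sq_integrable_bounded[OF fin bl[OF f], where C=B] AE_I2) (auto simp: space_restrict_space)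
  qed
  have "(LINT \<tau>|?M. ?h \<tau> * 1)\<^sup>2 \<le> (LINT \<tau>|?M. (?h \<tau>)\<^sup>2) * (LINT \<tau>|?M. 1\<^sup>2)"
    by (rule cauchy_schwarz_integral) (rule si[OF ch], rule si, rule continuous_on_const)
  also have "(LINT \<tau>|?M. 1\<^sup>2) = (1::real)" by (simp add: measure_restrict_space)
  also have "(LINT \<tau>|?M. ?h \<tau> * 1) = \<phi> y - \<phi> x"
    using lebesgue_integral_eq_integral[OF sq_integrable_integrable[OF fin si[OF ch]]] hk by simp
  finally have "(\<phi> x - \<phi> y)\<^sup>2 \<le> (LINT \<tau>|?M. (?h \<tau>)\<^sup>2)" by (simp add: power2_commute)
  also have "\<dots> \<le> (LINT \<tau>|?M. ?b \<tau>)"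
  proof (rule integral_mono)
    show "integrable ?M (\<lambda>\<tau>. (?h \<tau>)\<^sup>2)" using si[OF ch] by auto
    show "integrable ?M ?b" by (rule sq_integrable_integrable[OF fin si[OF cb]])
    fix \<tau> :: real
    have "\<bar>\<Sum>i\<in>UNIV. partial_deriv i \<phi> (?z \<tau>) * (y - x) $ i\<bar> = \<bar>grad \<phi> (?z \<tau>) \<bullet> (y - x)\<bar>"
      by (simp add: inner_vec_def)
    also have "\<dots> \<le> norm (grad \<phi> (?z \<tau>)) * norm (y - x)" by (rule Cauchy_Schwarz_ineq2)
    also have "\<dots> \<le> norm (grad \<phi> (?z \<tau>)) * d" using d by (intro mult_left_mono) auto
    finally have "(\<Sum>i\<in>UNIV. partial_deriv i \<phi> (?z \<tau>) * (y - x) $ i)\<^sup>2 \<le> (norm (grad \<phi> (?z \<tau>)) * d)\<^sup>2"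
      using d0 by (subst abs_le_square_iff[symmetric]) simp
    then have "(4 * \<tau> ^ 3)\<^sup>2 * (\<Sum>i\<in>UNIV. partial_deriv i \<phi> (?z \<tau>) * (y - x) $ i)\<^sup>2 \<le>
      (4 * \<tau> ^ 3)\<^sup>2 * (norm (grad \<phi> (?z \<tau>)) * d)\<^sup>2"
      by (rule mult_left_mono) simp
    then show "(?h \<tau>)\<^sup>2 \<le> ?b \<tau>" by (simp add: power_mult_distrib mult_ac flip: power_mult)
  qed
  finally have "ennreal ((\<phi> x - \<phi> y)\<^sup>2) \<le> ennreal (LINT \<tau>|?M. ?b \<tau>)" by (rule ennreal_leI)
  also have "\<dots> = (\<integral>\<^sup>+\<tau>. ennreal (?b \<tau>) \<partial>?M)"
    by (rule nn_integral_eq_integral[symmetric, OF sq_integrable_integrable[OF fin si[OF cb]]]) (auto intro!: AE_I2)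
  also have "\<dots> = (\<integral>\<^sup>+\<tau>. ennreal (?b \<tau>) * indicator {0..1} \<tau> \<partial>lborel)"
    by (simp add: nn_integral_restrict_space nn_integral_completion)
  also have "\<dots> = (\<integral>\<^sup>+\<tau>. ennreal (16 * d\<^sup>2 * \<tau> ^ 6) * ennreal ((norm (grad \<phi> (x + \<tau> ^ 4 *\<^sub>R (y - x))))\<^sup>2) * indicator {0..1} \<tau> \<partial>lborel)"
    by (intro nn_integral_cong) (auto simp: ennreal_mult')
  finally show ?thesis .
qed

lemma ennreal_mult_leD:
  assumes "ennreal (a * b) \<le> ennreal (a * c)" "a > 0" "0 \<le> c"
  shows "b \<le> c"
  using assms by (subst (asm) ennreal_le_iff) auto

text \<open>
  The exponent in the parametrisation \<open>x + \<tau> ^ 4 *\<^sub>R (y - x)\<close> is chosen so that the weight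
  \<open>\<tau> ^ 12\<close>, which appears after two applications of the Cauchy-Schwarz inequality, absorbs the
  Jacobian \<open>\<tau> ^ (4 * n)\<close> of \<open>y \<mapsto> x + \<tau> ^ 4 *\<^sub>R (y - x)\<close> for all \<open>n \<le> 3\<close>.
\<close>

lemma sobolev_poincare_smooth:
  fixes \<phi> :: "real^'n \<Rightarrow> real" and l r :: "real^'n"
  defines "K \<equiv> cbox l r"
  assumes n: "CARD('n) \<le> 3" and \<phi>: "smooth \<phi>" and v: "measure lebesgue K > 0"
    and m: "m = (LINT x|lebesgue_on K. \<phi> x) / measure lebesgue K"
  shows "(LINT x|lebesgue_on K. (\<phi> x - m) ^ 4) \<le>
    2048 * (diameter K) ^ 4 / measure lebesgue K * (LINT x|lebesgue_on K. (norm (grad \<phi> x))\<^sup>2)\<^sup>2"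
proof -
  let ?n = "CARD('n)"
  let ?M = "lebesgue_on K"
  define d where "d = diameter K"
  define v where "v = measure lebesgue K"
  define e where "e x = ennreal ((norm (grad \<phi> x))\<^sup>2) * indicator K x" for x
  define G where "G = (LINT x|?M. (norm (grad \<phi> x))\<^sup>2)"
  \<comment> \<open>For fixed \<open>x\<close>, this samples the squared gradient on the contraction
    of \<open>K\<close> towards \<open>x\<close> with ratio \<open>t\<close>. The indicator inside
    \<open>e\<close> loses nothing for ratios in [0, 1], because \<open>K\<close> is convex.\<close>
  define A where "A t x = (\<integral>\<^sup>+y. e (x + t *\<^sub>R (y - x)) * indicator K y \<partial>lborel)" for t x
  have v0: "v > 0" using v by (simp add: v_def)
  have d0: "0 \<le> d" by (simp add: d_def diameter_ge_0 K_def)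
  have fin: "finite_measure ?M" unfolding K_def by (rule lmeasurable_box_finite)
  have emK: "emeasure lborel K = ennreal v"
    by (simp add: v_def K_def emeasure_eq_measure2 measure_completion)
  have cg: "continuous_on UNIV (grad \<phi>)"
    unfolding grad_def[abs_def] by (intro continuous_on_vec_lambda smooth_continuous smooth_partial \<phi>)
  have gm [measurable]: "grad \<phi> \<in> borel_measurable borel" by (rule borel_measurable_continuous_onI[OF cg])
  have [measurable]: "\<phi> \<in> borel_measurable borel" by (rule smooth_borel[OF \<phi>])
  have [measurable]: "K \<in> sets borel" by (simp add: K_def)
  have em [measurable]: "e \<in> borel_measurable borel" unfolding e_def by measurable
  have Gi: "integrable ?M (\<lambda>x. (norm (grad \<phi> x))\<^sup>2)"
    unfolding norm_vec_sq K_def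
    by (auto intro!: Bochner_Integration.integrable_sum sq_integrable_square smooth_sq_integrable_box smooth_partial \<phi>)
  have G0: "0 \<le> G" by (simp add: G_def)
  have I: "(\<integral>\<^sup>+x. e x \<partial>lborel) = ennreal G"
  proof -
    have "ennreal G = (\<integral>\<^sup>+x. ennreal ((norm (grad \<phi> x))\<^sup>2) \<partial>?M)"
      unfolding G_def using Gi by (subst nn_integral_eq_integral) auto
    also have "\<dots> = (\<integral>\<^sup>+x. e x \<partial>lborel)"
      by (simp add: nn_integral_restrict_space nn_integral_completion e_def)
    finally show ?thesis by simp
  qed
  have [measurable]: "(\<lambda>(t, x). A t x) \<in> borel_measurable (borel \<Otimes>\<^sub>M borel)"
    unfolding A_def by measurable
  have A1: "ennreal (t ^ ?n) * A t x \<le> ennreal G" if t: "t > 0" for t x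
  proof -
    have eq: "x + t *\<^sub>R (y - x) = (x - t *\<^sub>R x) + t *\<^sub>R y" for y by (simp add: algebra_simps)
    have "A t x \<le> (\<integral>\<^sup>+y. e ((x - t *\<^sub>R x) + t *\<^sub>R y) \<partial>lborel)"
      unfolding A_def eq by (intro nn_integral_mono) (auto simp: indicator_def)
    then have "ennreal (t ^ ?n) * A t x \<le> ennreal (t ^ ?n) * (\<integral>\<^sup>+y. e ((x - t *\<^sub>R x) + t *\<^sub>R y) \<partial>lborel)"
      by (rule mult_left_mono) simp
    also have "\<dots> = ennreal G" by (subst nn_integral_affine[OF em t]) (rule I)
    finally show ?thesis .
  qed
  have KG: "(\<integral>\<^sup>+x. ennreal (8 * G) * indicator K x \<partial>lborel) = ennreal (8 * v * G)"
  proof -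
    have "(\<integral>\<^sup>+x. ennreal (8 * G) * indicator K x \<partial>lborel) = ennreal (8 * G) * ennreal v"
      by (simp add: nn_integral_cmult_indicator emK)
    also have "\<dots> = ennreal (8 * v * G)" using G0 v0 by (subst ennreal_mult[symmetric]) (auto simp: mult_ac)
    finally show ?thesis .
  qed
  \<comment> \<open>For t \<ge> 1/2 substitute in \<open>y\<close>, with Jacobian t^n; for smaller t
    exchange the integrals and substitute in \<open>x\<close>, with Jacobian (1 - t)^n. The base is
    at least 1/2 in both cases, and n \<le> 3 gives the factor 8.\<close>
  have A2: "(\<integral>\<^sup>+x. A t x * indicator K x \<partial>lborel) \<le> ennreal (8 * v * G)" if t: "0 \<le> t" "t \<le> 1" for t
  proof -
    have scale: "X \<le> ennreal (8 * C)" if "ennreal (s ^ ?n) * X \<le> ennreal C" "s \<ge> 1/2" "0 \<le> C" for s C and X :: ennreal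
    proof -
      have "(1/2) ^ 3 \<le> (1/2 :: real) ^ ?n" using n by (intro power_decreasing) auto
      also have "\<dots> \<le> s ^ ?n" using that by (intro power_mono) auto
      finally have "1 \<le> 8 * s ^ ?n" by (simp add: power3_eq_cube)
      then have "1 * X \<le> ennreal (8 * s ^ ?n) * X" by (intro mult_right_mono) auto
      also have "\<dots> = ennreal 8 * (ennreal (s ^ ?n) * X)"
        using that by (simp add: ennreal_mult mult.assoc)
      also have "\<dots> \<le> ennreal 8 * ennreal C" by (intro mult_left_mono that) simp
      also have "\<dots> = ennreal (8 * C)" using that by (simp add: ennreal_mult)
      finally show ?thesis by simp
    qed
    show ?thesis
    proof (cases "t \<ge> 1/2")
      case True
      then have "A t x \<le> ennreal (8 * G)" for x using scale[OF A1 True G0] by simp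
      then have "(\<integral>\<^sup>+x. A t x * indicator K x \<partial>lborel) \<le> (\<integral>\<^sup>+x. ennreal (8 * G) * indicator K x \<partial>lborel)"
        by (intro nn_integral_mono mult_right_mono) auto
      also have "\<dots> = ennreal (8 * v * G)"
        by (rule KG)
      finally show ?thesis .
    next
      case False
      have "(\<integral>\<^sup>+x. A t x * indicator K x \<partial>lborel) =
        (\<integral>\<^sup>+x. \<integral>\<^sup>+y. e (x + t *\<^sub>R (y - x)) * indicator K y * indicator K x \<partial>lborel \<partial>lborel)"
        unfolding A_def by (subst nn_integral_multc[symmetric]) auto
      also have "\<dots> = (\<integral>\<^sup>+y. \<integral>\<^sup>+x. e (x + t *\<^sub>R (y - x)) * indicator K y * indicator K x \<partial>lborel \<partial>lborel)"
        by (rule lborel_pair.Fubini') measurable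
      also have "\<dots> \<le> (\<integral>\<^sup>+y. ennreal (8 * G) * indicator K y \<partial>lborel)"
      proof (rule nn_integral_mono)
        fix y :: "real^'n"
        have eq: "x + t *\<^sub>R (y - x) = t *\<^sub>R y + (1 - t) *\<^sub>R x" for x by (simp add: algebra_simps)
        have "ennreal ((1 - t) ^ ?n) * (\<integral>\<^sup>+x. e (t *\<^sub>R y + (1 - t) *\<^sub>R x) \<partial>lborel) \<le> ennreal G"
          using False by (subst nn_integral_affine[OF em]) (auto simp: I)
        from scale[OF this _ G0] False
        have "(\<integral>\<^sup>+x. e (t *\<^sub>R y + (1 - t) *\<^sub>R x) \<partial>lborel) \<le> ennreal (8 * G)" by simp
        then have "(\<integral>\<^sup>+x. e (x + t *\<^sub>R (y - x)) \<partial>lborel) * indicator K y \<le> ennreal (8 * G) * indicator K y"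
          unfolding eq by (rule mult_right_mono) simp
        moreover have "(\<integral>\<^sup>+x. e (x + t *\<^sub>R (y - x)) * indicator K y * indicator K x \<partial>lborel) \<le>
          (\<integral>\<^sup>+x. e (x + t *\<^sub>R (y - x)) \<partial>lborel) * indicator K y"
          by (subst nn_integral_multc[symmetric]) (auto intro!: nn_integral_mono simp: indicator_def)
        ultimately show "(\<integral>\<^sup>+x. e (x + t *\<^sub>R (y - x)) * indicator K y * indicator K x \<partial>lborel) \<le> ennreal (8 * G) * indicator K y"
          by (rule order_trans[rotated])
      qed
      also have "\<dots> = ennreal (8 * v * G)"
        by (rule KG)
      finally show ?thesis .
    qed
  qed
  have sm: "sq_integrable ?M f" if "smooth f" for f
    unfolding K_def by (rule smooth_sq_integrable_box[OF that])
  have S3: "ennreal (v * (\<phi> x - m)\<^sup>2) \<le> ennreal (16 * d\<^sup>2) * (\<integral>\<^sup>+\<tau>. ennreal (\<tau> ^ 6) * A (\<tau> ^ 4) x * indicator {0..1} \<tau> \<partial>lborel)"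
    if x: "x \<in> K" for x
  proof -
    have s1: "smooth (\<lambda>y. \<phi> x - \<phi> y)" by (intro smooth_diff smooth_const \<phi>)
    have "(LINT y|?M. (\<phi> x - \<phi> y) * 1)\<^sup>2 \<le> (LINT y|?M. (\<phi> x - \<phi> y)\<^sup>2) * (LINT y|?M. 1\<^sup>2)"
      by (rule cauchy_schwarz_integral) (auto intro!: sm s1 smooth_const)
    also have "(LINT y|?M. 1\<^sup>2) = v" by (simp add: v_def measure_restrict_space K_def)
    also have "(LINT y|?M. (\<phi> x - \<phi> y) * 1) = v * (\<phi> x - m)"
    proof -
      have vM: "measure ?M (space ?M) = v" by (simp add: v_def measure_restrict_space K_def)
      have "integrable ?M (\<lambda>_. \<phi> x)" "integrable ?M \<phi>"
        by (intro sq_integrable_integrable[OF fin] sm smooth_const \<phi>)+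
      then show ?thesis using v0 vM by (simp add: m v_def[symmetric] field_simps)
    qed
    finally have "v * (v * (\<phi> x - m)\<^sup>2) \<le> v * (LINT y|?M. (\<phi> x - \<phi> y)\<^sup>2)"
      by (simp add: power2_eq_square mult_ac)
    then have "v * (\<phi> x - m)\<^sup>2 \<le> (LINT y|?M. (\<phi> x - \<phi> y)\<^sup>2)" using v0 by simp
    then have "ennreal (v * (\<phi> x - m)\<^sup>2) \<le> ennreal (LINT y|?M. (\<phi> x - \<phi> y)\<^sup>2)" by (rule ennreal_leI)
    also have "\<dots> = (\<integral>\<^sup>+y. ennreal ((\<phi> x - \<phi> y)\<^sup>2) \<partial>?M)"
      using sm[OF s1] by (subst nn_integral_eq_integral) auto
    also have "\<dots> = (\<integral>\<^sup>+y. ennreal ((\<phi> x - \<phi> y)\<^sup>2) * indicator K y \<partial>lborel)"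
      by (simp add: nn_integral_restrict_space nn_integral_completion)
    also have "\<dots> \<le> (\<integral>\<^sup>+y. \<integral>\<^sup>+\<tau>. ennreal (16 * d\<^sup>2 * \<tau> ^ 6) * e (x + \<tau> ^ 4 *\<^sub>R (y - x)) * indicator {0..1} \<tau> * indicator K y \<partial>lborel \<partial>lborel)"
    proof (rule nn_integral_mono)
      fix y
      show "ennreal ((\<phi> x - \<phi> y)\<^sup>2) * indicator K y \<le>
        (\<integral>\<^sup>+\<tau>. ennreal (16 * d\<^sup>2 * \<tau> ^ 6) * e (x + \<tau> ^ 4 *\<^sub>R (y - x)) * indicator {0..1} \<tau> * indicator K y \<partial>lborel)"
      proof (cases "y \<in> K")
        case True
        have nd: "norm (y - x) \<le> d"
          using diameter_bounded_bound[of K y x] True x by (auto simp: d_def K_def dist_norm)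
        have in_K: "x + \<tau> ^ 4 *\<^sub>R (y - x) \<in> K" if "\<tau> \<in> {0..1}" for \<tau>
        proof -
          have "(1 - \<tau> ^ 4) *\<^sub>R x + \<tau> ^ 4 *\<^sub>R y \<in> K"
            using that True x by (intro convexD[of K]) (auto simp: K_def power_le_one)
          then show ?thesis by (simp add: algebra_simps)
        qed
        have "ennreal ((\<phi> x - \<phi> y)\<^sup>2) \<le> (\<integral>\<^sup>+\<tau>. ennreal (16 * d\<^sup>2 * \<tau> ^ 6) * ennreal ((norm (grad \<phi> (x + \<tau> ^ 4 *\<^sub>R (y - x))))\<^sup>2) * indicator {0..1} \<tau> \<partial>lborel)"
          by (rule nn_integral_segment[OF \<phi> nd])
        also have "\<dots> = (\<integral>\<^sup>+\<tau>. ennreal (16 * d\<^sup>2 * \<tau> ^ 6) * e (x + \<tau> ^ 4 *\<^sub>R (y - x)) * indicator {0..1} \<tau> * indicator K y \<partial>lborel)"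
          using True in_K by (intro nn_integral_cong) (auto simp: e_def indicator_def)
        finally show ?thesis using True by simp
      qed simp
    qed
    also have "\<dots> = (\<integral>\<^sup>+\<tau>. \<integral>\<^sup>+y. ennreal (16 * d\<^sup>2 * \<tau> ^ 6) * e (x + \<tau> ^ 4 *\<^sub>R (y - x)) * indicator {0..1} \<tau> * indicator K y \<partial>lborel \<partial>lborel)"
      by (rule lborel_pair.Fubini') measurable
    also have "\<dots> = (\<integral>\<^sup>+\<tau>. ennreal (16 * d\<^sup>2) * (ennreal (\<tau> ^ 6) * A (\<tau> ^ 4) x * indicator {0..1} \<tau>) \<partial>lborel)"
    proof (rule nn_integral_cong)
      fix \<tau> :: real
      have "(\<integral>\<^sup>+y. ennreal (16 * d\<^sup>2 * \<tau> ^ 6) * e (x + \<tau> ^ 4 *\<^sub>R (y - x)) * indicator {0..1} \<tau> * indicator K y \<partial>lborel) =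
        (\<integral>\<^sup>+y. (ennreal (16 * d\<^sup>2) * ennreal (\<tau> ^ 6) * indicator {0..1} \<tau>) * (e (x + \<tau> ^ 4 *\<^sub>R (y - x)) * indicator K y) \<partial>lborel)"
        by (intro nn_integral_cong) (simp add: ennreal_mult mult_ac)
      also have "\<dots> = (ennreal (16 * d\<^sup>2) * ennreal (\<tau> ^ 6) * indicator {0..1} \<tau>) * A (\<tau> ^ 4) x"
        unfolding A_def by (rule nn_integral_cmult) measurable
      finally show "(\<integral>\<^sup>+y. ennreal (16 * d\<^sup>2 * \<tau> ^ 6) * e (x + \<tau> ^ 4 *\<^sub>R (y - x)) * indicator {0..1} \<tau> * indicator K y \<partial>lborel) =
        ennreal (16 * d\<^sup>2) * (ennreal (\<tau> ^ 6) * A (\<tau> ^ 4) x * indicator {0..1} \<tau>)" by (simp add: mult_ac)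
    qed
    also have "\<dots> = ennreal (16 * d\<^sup>2) * (\<integral>\<^sup>+\<tau>. ennreal (\<tau> ^ 6) * A (\<tau> ^ 4) x * indicator {0..1} \<tau> \<partial>lborel)"
      by (rule nn_integral_cmult) measurable
    finally show ?thesis .
  qed
  \<comment> \<open>Squaring S3 produces 256 = 16^2 and two factors \<open>A\<close> under the
    integral. One of them is absorbed by A1 at the cost of \<open>G\<close>; the other stays linear
    and is integrated over \<open>x\<close> by A2.\<close>
  have S5: "ennreal (v\<^sup>2 * (\<phi> x - m) ^ 4) \<le> ennreal (256 * d ^ 4 * G) * (\<integral>\<^sup>+\<tau>. A (\<tau> ^ 4) x * indicator {0..1} \<tau> \<partial>lborel)"
    if x: "x \<in> K" for x
  proof -
    let ?f = "\<lambda>\<tau>. ennreal (\<tau> ^ 6) * A (\<tau> ^ 4) x * indicator {0..1::real} \<tau>"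
    have "(\<integral>\<^sup>+\<tau>. ?f \<tau> \<partial>lborel)\<^sup>2 = (\<integral>\<^sup>+\<tau>. ?f \<tau> * indicator {0..1} \<tau> \<partial>lborel)\<^sup>2"
      by (intro arg_cong2[where f=power] nn_integral_cong) (auto simp: indicator_def)
    also have "\<dots> \<le> (\<integral>\<^sup>+\<tau>. (?f \<tau>)\<^sup>2 \<partial>lborel) * (\<integral>\<^sup>+\<tau>. (indicator {0..1::real} \<tau>)\<^sup>2 \<partial>lborel)"
      by (rule Cauchy_Schwarz_nn_integral) measurable
    also have "(\<integral>\<^sup>+\<tau>. (indicator {0..1::real} \<tau>)\<^sup>2 \<partial>lborel) = 1"
    proof -
      have "(\<integral>\<^sup>+\<tau>. (indicator {0..1::real} \<tau>)\<^sup>2 \<partial>lborel) = (\<integral>\<^sup>+\<tau>. indicator {0..1::real} \<tau> \<partial>lborel)"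
        by (intro nn_integral_cong) (auto simp: indicator_def)
      then show ?thesis by simp
    qed
    also have "(\<integral>\<^sup>+\<tau>. (?f \<tau>)\<^sup>2 \<partial>lborel) * 1 \<le> (\<integral>\<^sup>+\<tau>. ennreal G * (A (\<tau> ^ 4) x * indicator {0..1} \<tau>) \<partial>lborel)"
      unfolding mult_1_right
    proof (rule nn_integral_mono)
      fix \<tau> :: real
      show "(?f \<tau>)\<^sup>2 \<le> ennreal G * (A (\<tau> ^ 4) x * indicator {0..1} \<tau>)"
      proof (cases "\<tau> \<in> {0<..1}")
        case True
        have "ennreal (\<tau> ^ 12) * A (\<tau> ^ 4) x \<le> ennreal ((\<tau> ^ 4) ^ ?n) * A (\<tau> ^ 4) x"
        proof (intro mult_right_mono ennreal_leI)
          have "(\<tau> ^ 4) ^ 3 \<le> (\<tau> ^ 4) ^ ?n" using True n by (intro power_decreasing) (auto simp: power_le_one)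
          then show "\<tau> ^ 12 \<le> (\<tau> ^ 4) ^ ?n" by (simp flip: power_mult)
        qed simp
        also have "\<dots> \<le> ennreal G" using True by (intro A1) auto
        finally have "ennreal (\<tau> ^ 12) * A (\<tau> ^ 4) x * A (\<tau> ^ 4) x \<le> ennreal G * A (\<tau> ^ 4) x"
          by (rule mult_right_mono) simp
        moreover have "(ennreal (\<tau> ^ 6))\<^sup>2 = ennreal (\<tau> ^ 12)"
          using True by (simp add: ennreal_power flip: power_mult)
        moreover have "(?f \<tau>)\<^sup>2 = (ennreal (\<tau> ^ 6))\<^sup>2 * (A (\<tau> ^ 4) x * A (\<tau> ^ 4) x)"
          using True by (simp add: power_mult_distrib power2_eq_square[of "A (\<tau> ^ 4) x"])
        ultimately have "(?f \<tau>)\<^sup>2 \<le> ennreal G * A (\<tau> ^ 4) x" by (simp only: mult.assoc)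
        then show ?thesis using True by simp
      next
        case False
        then have "?f \<tau> = 0" by (cases "\<tau> = 0") (auto simp: indicator_def)
        then have "(?f \<tau>)\<^sup>2 = 0" by (simp only: zero_power2)
        then show ?thesis by (simp only: zero_le)
      qed
    qed
    also have "\<dots> = ennreal G * (\<integral>\<^sup>+\<tau>. A (\<tau> ^ 4) x * indicator {0..1} \<tau> \<partial>lborel)"
      by (rule nn_integral_cmult) measurable
    finally have sq: "(\<integral>\<^sup>+\<tau>. ?f \<tau> \<partial>lborel)\<^sup>2 \<le> ennreal G * (\<integral>\<^sup>+\<tau>. A (\<tau> ^ 4) x * indicator {0..1} \<tau> \<partial>lborel)" .
    have "ennreal (v\<^sup>2 * (\<phi> x - m) ^ 4) = (ennreal (v * (\<phi> x - m)\<^sup>2))\<^sup>2"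
      using v0 by (simp add: ennreal_power power_mult_distrib flip: power_mult)
    also have "\<dots> \<le> (ennreal (16 * d\<^sup>2) * (\<integral>\<^sup>+\<tau>. ?f \<tau> \<partial>lborel))\<^sup>2"
      by (intro power_mono S3[OF x]) simp
    also have "\<dots> = ennreal (256 * d ^ 4) * (\<integral>\<^sup>+\<tau>. ?f \<tau> \<partial>lborel)\<^sup>2"
      by (simp add: power_mult_distrib ennreal_power flip: power_mult)
    also have "\<dots> \<le> ennreal (256 * d ^ 4) * (ennreal G * (\<integral>\<^sup>+\<tau>. A (\<tau> ^ 4) x * indicator {0..1} \<tau> \<partial>lborel))"
      by (intro mult_left_mono sq) simp
    finally show ?thesis using G0 by (simp add: ennreal_mult mult.assoc)
  qed
  have s4: "smooth (\<lambda>x. (\<phi> x - m)\<^sup>2)" by (intro smooth_power smooth_diff smooth_const \<phi>)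
  have i4: "integrable ?M (\<lambda>x. (\<phi> x - m) ^ 4)"
    using sm[OF s4] by (auto simp: sq_integrable_def simp flip: power_mult)
  define Q where "Q = (LINT x|?M. (\<phi> x - m) ^ 4)"
  have "ennreal (v\<^sup>2 * Q) = (\<integral>\<^sup>+x. ennreal (v\<^sup>2 * (\<phi> x - m) ^ 4) \<partial>?M)"
    unfolding Q_def using i4 by (subst nn_integral_eq_integral) auto
  also have "\<dots> = (\<integral>\<^sup>+x. ennreal (v\<^sup>2 * (\<phi> x - m) ^ 4) * indicator K x \<partial>lborel)"
    by (simp add: nn_integral_restrict_space nn_integral_completion)
  also have "\<dots> \<le> (\<integral>\<^sup>+x. ennreal (256 * d ^ 4 * G) * (\<integral>\<^sup>+\<tau>. A (\<tau> ^ 4) x * indicator K x * indicator {0..1} \<tau> \<partial>lborel) \<partial>lborel)"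
    using S5 by (intro nn_integral_mono) (auto simp: indicator_def)
  also have "\<dots> = ennreal (256 * d ^ 4 * G) * (\<integral>\<^sup>+x. \<integral>\<^sup>+\<tau>. A (\<tau> ^ 4) x * indicator K x * indicator {0..1} \<tau> \<partial>lborel \<partial>lborel)"
    by (rule nn_integral_cmult) measurable
  also have "(\<integral>\<^sup>+x. \<integral>\<^sup>+\<tau>. A (\<tau> ^ 4) x * indicator K x * indicator {0..1} \<tau> \<partial>lborel \<partial>lborel) =
    (\<integral>\<^sup>+\<tau>. \<integral>\<^sup>+x. A (\<tau> ^ 4) x * indicator K x * indicator {0..1} \<tau> \<partial>lborel \<partial>lborel)"
    by (rule lborel_pair.Fubini') measurable
  also have "\<dots> \<le> (\<integral>\<^sup>+\<tau>. ennreal (8 * v * G) * indicator {0..1::real} \<tau> \<partial>lborel)"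
  proof (rule nn_integral_mono)
    fix \<tau> :: real
    show "(\<integral>\<^sup>+x. A (\<tau> ^ 4) x * indicator K x * indicator {0..1} \<tau> \<partial>lborel) \<le> ennreal (8 * v * G) * indicator {0..1} \<tau>"
      using A2[of "\<tau> ^ 4"] by (auto simp: indicator_def power_le_one)
  qed
  also have "(\<integral>\<^sup>+\<tau>. ennreal (8 * v * G) * indicator {0..1::real} \<tau> \<partial>lborel) = ennreal (8 * v * G)"
    by (simp add: nn_integral_cmult_indicator)
  finally have "ennreal (v\<^sup>2 * Q) \<le> ennreal (256 * d ^ 4 * G) * ennreal (8 * v * G)"
    by (simp add: mult_left_mono)
  \<comment> \<open>2048 = 256 * 8, from S5 and A2.\<close>
  also have "\<dots> = ennreal (v\<^sup>2 * (2048 * d ^ 4 / v * G\<^sup>2))"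
    using v0 G0 by (simp add: power2_eq_square mult_ac flip: ennreal_mult)
  finally have "Q \<le> 2048 * d ^ 4 / v * G\<^sup>2"
    by (rule ennreal_mult_leD) (use v0 in auto)
  then show ?thesis by (simp add: Q_def G_def d_def v_def)
qed

lemma integral_norm_sq_sum:
  fixes g :: "'a \<Rightarrow> real^'n"
  assumes "\<And>i. sq_integrable M (\<lambda>x. g x $ i)"
  shows "(LINT x|M. (norm (g x))\<^sup>2) = (\<Sum>i\<in>UNIV. LINT x|M. (g x $ i)\<^sup>2)"
    and "integrable M (\<lambda>x. (norm (g x))\<^sup>2)"
  unfolding norm_vec_sq
  using assms by (auto intro!: Bochner_Integration.integral_sum Bochner_Integration.integrable_sum sq_integrable_square)

lemma integral_norm_sq_tendsto:
  fixes G :: "nat \<Rightarrow> 'a \<Rightarrow> real^'n"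
  assumes "\<And>i. sq_tendsto M (\<lambda>k x. G k x $ i) (\<lambda>x. g x $ i)"
  shows "(\<lambda>k. LINT x|M. (norm (G k x))\<^sup>2) \<longlonglongrightarrow> (LINT x|M. (norm (g x))\<^sup>2)"
proof -
  have "sq_integrable M (\<lambda>x. g x $ i)" "sq_integrable M (\<lambda>x. G k x $ i)" for i k
    using assms[of i] by (auto simp: sq_tendsto_def)
  then show ?thesis
    by (simp add: integral_norm_sq_sum) (intro tendsto_sum sq_tendsto_square assms)
qed

text \<open>The smooth inequality passes to the limit through \<open>sq_tendsto_power4\<close>. The
  functions \<open>\<psi> k\<close> need not vanish on the boundary of the box, so the lemma applies
  on a single cell. In the L^2 bound the volume of \<open>K\<close> cancels after one more
  Cauchy-Schwarz inequality.\<close>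

lemma sobolev_poincare:
  fixes l r :: "real^'n" and e :: "real^'n \<Rightarrow> real" and g :: "real^'n \<Rightarrow> real^'n"
  defines "K \<equiv> cbox l r"
  defines "M \<equiv> lebesgue_on K"
  assumes n: "CARD('n) \<le> 3" and v: "measure lebesgue K > 0" and \<psi>: "\<And>k. smooth (\<psi> k)"
    and e: "sq_tendsto M \<psi> e" and g: "\<And>i. sq_tendsto M (\<lambda>k. partial_deriv i (\<psi> k)) (\<lambda>x. g x $ i)"
    and m: "m = (LINT x|M. e x) / measure lebesgue K"
  shows "integrable M (\<lambda>x. (e x - m) ^ 4)"
    and "(LINT x|M. (e x - m) ^ 4) \<le> 2048 * (diameter K) ^ 4 / measure lebesgue K * (LINT x|M. (norm (g x))\<^sup>2)\<^sup>2"
    and "(LINT x|M. (e x - m)\<^sup>2) \<le> 46 * (diameter K)\<^sup>2 * (LINT x|M. (norm (g x))\<^sup>2)"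
proof -
  have fin: "finite_measure M" unfolding M_def K_def by (rule lmeasurable_box_finite)
  define mk where "mk k = (LINT x|M. \<psi> k x) / measure lebesgue K" for k
  define G where "G = (LINT x|M. (norm (g x))\<^sup>2)"
  let ?v = "measure lebesgue K"
  have vM: "measure M (space M) = ?v" by (simp add: M_def measure_restrict_space K_def)
  have mk: "mk \<longlonglongrightarrow> m"
    unfolding mk_def[abs_def] m using v by (intro tendsto_divide sq_tendsto_integral[OF fin e] tendsto_const) auto
  have const: "sq_integrable M (\<lambda>_. c)" for c :: real
    unfolding M_def K_def by (rule smooth_sq_integrable_box[OF smooth_const])
  have cm: "sq_tendsto M (\<lambda>k _. mk k) (\<lambda>_. m)"
    unfolding sq_tendsto_def
  proof (intro conjI allI const)
    have "(\<lambda>k. ?v * (mk k - m)\<^sup>2) \<longlonglongrightarrow> ?v * (m - m)\<^sup>2" by (intro tendsto_intros mk)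
    then show "(\<lambda>k. LINT x|M. (mk k - m)\<^sup>2) \<longlonglongrightarrow> 0" by (simp add: vM)
  qed
  have t: "sq_tendsto M (\<lambda>k x. \<psi> k x - mk k) (\<lambda>x. e x - m)" by (rule sq_tendsto_diff[OF e cm])
  have i: "integrable M (\<lambda>x. (\<psi> k x - mk k) ^ 4)" for k
  proof -
    have "smooth (\<lambda>x. (\<psi> k x - mk k)\<^sup>2)" by (intro smooth_power smooth_diff smooth_const \<psi>)
    then have "sq_integrable M (\<lambda>x. (\<psi> k x - mk k)\<^sup>2)" unfolding M_def K_def by (rule smooth_sq_integrable_box)
    then show ?thesis by (auto simp: sq_integrable_def simp flip: power_mult)
  qed
  have le: "(LINT x|M. (\<psi> k x - mk k) ^ 4) \<le> 2048 * (diameter K) ^ 4 / ?v * (LINT x|M. (norm (grad (\<psi> k) x))\<^sup>2)\<^sup>2" for k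
    unfolding M_def K_def
    by (rule sobolev_poincare_smooth[OF n \<psi>]) (use v in \<open>auto simp: mk_def M_def K_def\<close>)
  have lim: "(\<lambda>k. 2048 * (diameter K) ^ 4 / ?v * (LINT x|M. (norm (grad (\<psi> k) x))\<^sup>2)\<^sup>2) \<longlonglongrightarrow>
    2048 * (diameter K) ^ 4 / ?v * G\<^sup>2"
    unfolding G_def by (intro tendsto_intros integral_norm_sq_tendsto) (simp add: g)
  show i4: "integrable M (\<lambda>x. (e x - m) ^ 4)" by (rule sq_tendsto_power4(1)[OF t i le lim])
  have le4: "(LINT x|M. (e x - m) ^ 4) \<le> 2048 * (diameter K) ^ 4 / ?v * G\<^sup>2"
    by (rule sq_tendsto_power4(2)[OF t i le lim])
  then show "(LINT x|M. (e x - m) ^ 4) \<le> 2048 * (diameter K) ^ 4 / ?v * (LINT x|M. (norm (g x))\<^sup>2)\<^sup>2"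
    by (simp add: G_def)
  have em: "sq_integrable M (\<lambda>x. e x - m)" using t by (simp add: sq_tendsto_def)
  have sq: "sq_integrable M (\<lambda>x. (e x - m)\<^sup>2)"
    using i4 em by (auto simp: sq_integrable_def simp flip: power_mult)
  have "(LINT x|M. (e x - m)\<^sup>2 * 1)\<^sup>2 \<le> (LINT x|M. ((e x - m)\<^sup>2)\<^sup>2) * (LINT x|M. 1\<^sup>2)"
    by (rule cauchy_schwarz_integral[OF sq const])
  also have "\<dots> = (LINT x|M. (e x - m) ^ 4) * ?v" by (simp add: vM flip: power_mult)
  also have "\<dots> \<le> (2048 * (diameter K) ^ 4 / ?v * G\<^sup>2) * ?v" by (intro mult_right_mono le4) simp
  \<comment> \<open>46^2 = 2116 exceeds 2048.\<close>
  also have "\<dots> \<le> (46 * (diameter K)\<^sup>2 * G)\<^sup>2"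
    using v by (simp add: power_mult_distrib mult_right_mono flip: power_mult)
  finally have "(LINT x|M. (e x - m)\<^sup>2)\<^sup>2 \<le> (46 * (diameter K)\<^sup>2 * G)\<^sup>2" by simp
  then show "(LINT x|M. (e x - m)\<^sup>2) \<le> 46 * (diameter K)\<^sup>2 * (LINT x|M. (norm (g x))\<^sup>2)"
    unfolding G_def by (rule power2_le_imp_le) simp
qed

section \<open>Integrability of the ground state\<close>

text \<open>The problem is posed on the open box, whereas mesh cells are closed. They differ by a
  null set, and as Lebesgue measure is complete even measurability carries over; the following
  lemmas do the same for integrals and convergence.\<close>

lemma borel_measurable_cbox_box:
  fixes f :: "real^'n \<Rightarrow> real"
  shows "f \<in> borel_measurable (lebesgue_on (cbox l r)) \<longleftrightarrow> f \<in> borel_measurable (lebesgue_on (box l r))"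
proof
  assume "f \<in> borel_measurable (lebesgue_on (cbox l r))"
  then show "f \<in> borel_measurable (lebesgue_on (box l r))"
    using box_subset_cbox by (rule measurable_restrict_mono)
next
  assume "f \<in> borel_measurable (lebesgue_on (box l r))"
  then have m: "(\<lambda>x. if x \<in> box l r then f x else 0) \<in> borel_measurable lebesgue"
    by (rule borel_measurable_if_I) simp
  have "AE x in lebesgue. x \<notin> cbox l r - box l r"
    using negligible_cbox_minus_box[of l r] by (intro AE_not_in) (simp add: negligible_iff_null_sets)
  then have "AE x in lebesgue. (if x \<in> box l r then f x else 0) = (if x \<in> cbox l r then f x else 0)"
    by eventually_elim (use box_subset_cbox[of l r] in auto)
  with m have "(\<lambda>x. if x \<in> cbox l r then f x else 0) \<in> borel_measurable lebesgue"
    by (rule borel_measurable_AE)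
  then show "f \<in> borel_measurable (lebesgue_on (cbox l r))" by (rule borel_measurable_if_D)
qed

lemma integral_cbox_box:
  fixes f :: "real^'n \<Rightarrow> real"
  shows "(LINT x|lebesgue_on (cbox l r). f x) = (LINT x|lebesgue_on (box l r). f x)"
proof (cases "f \<in> borel_measurable (lebesgue_on (cbox l r))")
  case False
  then show ?thesis
    by (metis borel_measurable_cbox_box borel_measurable_integrable not_integrable_integral_eq)
qed (rule integral_lebesgue_on_cbox_box)

lemma integrable_cbox_box:
  fixes f :: "real^'n \<Rightarrow> real"
  shows "integrable (lebesgue_on (cbox l r)) f \<longleftrightarrow> integrable (lebesgue_on (box l r)) f"
proof (cases "f \<in> borel_measurable (lebesgue_on (cbox l r))")
  case True
  then have m: "f \<in> borel_measurable (lebesgue_on (box l r))" by (simp add: borel_measurable_cbox_box)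
  have N: "AE x in lebesgue. x \<notin> cbox l r - box l r"
    using negligible_cbox_minus_box[of l r] by (intro AE_not_in) (simp add: negligible_iff_null_sets)
  have "integrable lebesgue (\<lambda>x. if x \<in> cbox l r then f x else 0) \<longleftrightarrow> integrable lebesgue (\<lambda>x. if x \<in> box l r then f x else 0)"
    using N box_subset_cbox[of l r]
    by (intro integrable_cong_AE borel_measurable_if_I True m) (auto elim!: eventually_mono)
  then show ?thesis by (simp add: Lebesgue_Measure.integrable_restrict_UNIV)
next
  case False
  then show ?thesis by (metis borel_measurable_cbox_box borel_measurable_integrable)
qed

lemma sq_integrable_cbox_box:
  fixes f :: "real^'n \<Rightarrow> real"
  shows "sq_integrable (lebesgue_on (cbox l r)) f \<longleftrightarrow> sq_integrable (lebesgue_on (box l r)) f"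
  by (simp add: sq_integrable_def integrable_cbox_box borel_measurable_cbox_box)

lemma sq_tendsto_cbox_box:
  fixes f :: "real^'n \<Rightarrow> real"
  shows "sq_tendsto (lebesgue_on (cbox l r)) F f \<longleftrightarrow> sq_tendsto (lebesgue_on (box l r)) F f"
  by (simp add: sq_tendsto_def sq_integrable_cbox_box integral_cbox_box)

lemma integral_energy_split:
  fixes g :: "'a \<Rightarrow> real^'n"
  assumes v: "sq_integrable M v" and g: "\<And>i. sq_integrable M (\<lambda>x. g x $ i)"
    and V: "V \<in> borel_measurable M" "AE x in M. \<bar>V x\<bar> \<le> C" and v4: "integrable M (\<lambda>x. v x ^ 4)"
  shows "1/2 * (LINT x|M. (norm (g x))\<^sup>2 + V x * \<bar>v x\<bar>\<^sup>2 + \<beta>/2 * \<bar>v x\<bar>^4) =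
    1/2 * ((LINT x|M. (norm (g x))\<^sup>2) + (LINT x|M. V x * (v x)\<^sup>2)) + \<beta>/4 * (LINT x|M. v x ^ 4)"
proof -
  have 1: "integrable M (\<lambda>x. V x * (v x)\<^sup>2)"
    using sq_integrable_mult[OF sq_integrable_bounded_mult[OF v V] v] by (simp add: power2_eq_square mult.assoc)
  have eq: "(norm (g x))\<^sup>2 + V x * \<bar>v x\<bar>\<^sup>2 + \<beta>/2 * \<bar>v x\<bar>^4 = (norm (g x))\<^sup>2 + V x * (v x)\<^sup>2 + \<beta>/2 * v x ^ 4" for x
    by simp
  show ?thesis
    unfolding eq using integral_norm_sq_sum(2)[OF g] 1 v4 by (simp add: algebra_simps)
qed

section \<open>The damping function s / (1 + \<epsilon> s^2)\<close>

definition damp :: "real \<Rightarrow> real \<Rightarrow> real" where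
  "damp \<epsilon> s = s / (1 + \<epsilon> * s\<^sup>2)"

lemma damp_denom: "0 \<le> \<epsilon> \<Longrightarrow> 1 \<le> 1 + \<epsilon> * s\<^sup>2" for \<epsilon> s :: real by simp

lemma damp_0 [simp]: "damp \<epsilon> 0 = 0" by (simp add: damp_def)

lemma damp_lipschitz:
  assumes "0 \<le> \<epsilon>"
  shows "\<bar>damp \<epsilon> s - damp \<epsilon> t\<bar> \<le> 1 * \<bar>s - t\<bar>"
proof -
  let ?a = "1 + \<epsilon> * s\<^sup>2" and ?b = "1 + \<epsilon> * t\<^sup>2"
  have ab: "1 \<le> ?a" "1 \<le> ?b" using damp_denom[OF assms] by blast+
  have eq: "damp \<epsilon> s - damp \<epsilon> t = (s - t) * ((1 - \<epsilon> * (s * t)) / (?a * ?b))"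
    using ab by (simp add: damp_def field_simps power2_eq_square)
  have "0 \<le> \<epsilon> * (\<bar>s\<bar> - \<bar>t\<bar>)\<^sup>2" using assms by simp
  then have "2 * \<epsilon> * \<bar>s * t\<bar> \<le> \<epsilon> * s\<^sup>2 + \<epsilon> * t\<^sup>2" by (simp add: power2_diff algebra_simps abs_mult)
  moreover have "\<bar>1 - \<epsilon> * (s * t)\<bar> \<le> 1 + \<epsilon> * \<bar>s * t\<bar>"
    using assms by (metis abs_mult abs_of_nonneg abs_one abs_triangle_ineq4)
  moreover have "0 \<le> \<epsilon> * \<bar>s * t\<bar>" "0 \<le> (\<epsilon> * s\<^sup>2) * (\<epsilon> * t\<^sup>2)" using assms by simp_all
  moreover have "?a * ?b = 1 + \<epsilon> * s\<^sup>2 + \<epsilon> * t\<^sup>2 + (\<epsilon> * s\<^sup>2) * (\<epsilon> * t\<^sup>2)" by (simp add: algebra_simps)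
  ultimately have le: "\<bar>1 - \<epsilon> * (s * t)\<bar> \<le> ?a * ?b" by linarith
  have pos: "0 < ?a * ?b" using ab by (intro mult_pos_pos) linarith+
  have "\<bar>(1 - \<epsilon> * (s * t)) / (?a * ?b)\<bar> \<le> 1"
    unfolding abs_divide using le pos by (simp add: divide_le_eq)
  then show ?thesis unfolding eq abs_mult by (metis abs_ge_zero mult.commute mult_right_mono)
qed

lemma damp_le: "0 \<le> \<epsilon> \<Longrightarrow> \<bar>damp \<epsilon> s\<bar> \<le> \<bar>s\<bar>"
  using damp_lipschitz[of \<epsilon> s 0] by simp

lemma damp_bounded:
  assumes "0 < \<epsilon>" "\<epsilon> \<le> 1"
  shows "\<bar>damp \<epsilon> s\<bar> \<le> 1 / \<epsilon>"
proof -
  have "0 \<le> (1 - \<epsilon> * \<bar>s\<bar>)\<^sup>2" by simp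
  then have "2 * (\<epsilon> * \<bar>s\<bar>) \<le> 1 + \<epsilon> * (\<epsilon> * s\<^sup>2)" by (simp add: power2_eq_square algebra_simps)
  moreover have "\<epsilon> * (\<epsilon> * s\<^sup>2) \<le> 1 * (\<epsilon> * s\<^sup>2)" using assms by (intro mult_right_mono) auto
  moreover have "0 \<le> \<epsilon> * s\<^sup>2" using assms by simp
  ultimately have "\<epsilon> * \<bar>s\<bar> \<le> 1 + \<epsilon> * s\<^sup>2" by linarith
  moreover have pos: "0 < 1 + \<epsilon> * s\<^sup>2" using damp_denom[of \<epsilon> s] assms by linarith
  ultimately have "\<bar>s\<bar> / (1 + \<epsilon> * s\<^sup>2) * \<epsilon> \<le> 1" by (simp add: divide_le_eq mult.commute)
  then have "\<bar>s\<bar> / (1 + \<epsilon> * s\<^sup>2) \<le> 1 / \<epsilon>" using assms by (simp only: pos_le_divide_eq)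
  then show ?thesis using pos by (simp add: damp_def abs_divide)
qed

lemma damp_deriv:
  assumes "0 \<le> \<epsilon>"
  shows "(damp \<epsilon> has_real_derivative (1 - \<epsilon> * s\<^sup>2) / (1 + \<epsilon> * s\<^sup>2)\<^sup>2) (at s)"
    and "\<bar>(1 - \<epsilon> * s\<^sup>2) / (1 + \<epsilon> * s\<^sup>2)\<^sup>2\<bar> \<le> 1"
proof -
  have ne: "1 + \<epsilon> * s\<^sup>2 \<noteq> 0" using damp_denom[OF assms, of s] by linarith
  show "(damp \<epsilon> has_real_derivative (1 - \<epsilon> * s\<^sup>2) / (1 + \<epsilon> * s\<^sup>2)\<^sup>2) (at s)"
    unfolding damp_def[abs_def]
    by (rule derivative_eq_intros refl ne)+ (simp add: power2_eq_square algebra_simps)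
  have x: "0 \<le> \<epsilon> * s\<^sup>2" using assms by simp
  then have "\<bar>1 - \<epsilon> * s\<^sup>2\<bar> \<le> (1 + \<epsilon> * s\<^sup>2)\<^sup>2" by (simp add: power2_sum) (smt (verit) zero_le_power2)
  then show "\<bar>(1 - \<epsilon> * s\<^sup>2) / (1 + \<epsilon> * s\<^sup>2)\<^sup>2\<bar> \<le> 1"
    using ne by (simp add: abs_divide divide_le_eq)
qed

text \<open>With x = \<epsilon> s^2, both defects come from 1 - 1/(1 + x)^2. The loss of mass and
  the gain in the fourth power are of the same order in \<epsilon>, but the gain carries the sixth
  power of s. Dividing by \<epsilon> therefore turns minimality into a bound for the sixth
  power.\<close>

lemma damp_square_defect:
  assumes "0 \<le> \<epsilon>"
  shows "s\<^sup>2 - (damp \<epsilon> s)\<^sup>2 \<le> 2 * \<epsilon> * s ^ 4"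
    and "\<epsilon> * (s ^ 6 / (1 + \<epsilon> * s\<^sup>2)) \<le> s ^ 4 - (damp \<epsilon> s) ^ 4"
proof -
  define x where "x = \<epsilon> * s\<^sup>2"
  have x0: "0 \<le> x" using assms by (simp add: x_def)
  have eq: "s\<^sup>2 - (damp \<epsilon> s)\<^sup>2 = s\<^sup>2 * ((2 * x + x\<^sup>2) / (1 + x)\<^sup>2)"
  proof -
    have deq: "damp \<epsilon> s = s / (1 + x)" by (simp add: damp_def x_def)
    have "1 + x \<noteq> 0" using x0 by linarith
    then have "s\<^sup>2 - s\<^sup>2 / (1 + x)\<^sup>2 = s\<^sup>2 * (((1 + x)\<^sup>2 - 1) / (1 + x)\<^sup>2)"
      by (simp add: diff_divide_distrib right_diff_distrib)
    then show ?thesis unfolding deq by (simp add: power_divide power2_sum)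
  qed
  have "(2 * x + x\<^sup>2) / (1 + x)\<^sup>2 \<le> 2 * x"
  proof -
    have "2 * x * (1 + x)\<^sup>2 - (2 * x + x\<^sup>2) = 3 * x\<^sup>2 + 2 * x * x\<^sup>2" by (simp add: power2_eq_square algebra_simps)
    moreover have "0 \<le> 3 * x\<^sup>2 + 2 * x * x\<^sup>2" using x0 by simp
    ultimately have "2 * x + x\<^sup>2 \<le> 2 * x * (1 + x)\<^sup>2" by linarith
    then show ?thesis using x0 by (simp add: divide_le_eq)
  qed
  then have "s\<^sup>2 - (damp \<epsilon> s)\<^sup>2 \<le> s\<^sup>2 * (2 * x)" unfolding eq by (rule mult_left_mono) simp
  also have "\<dots> = 2 * \<epsilon> * s ^ 4" by (simp add: x_def power2_eq_square power4_eq_xxxx)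
  finally show "s\<^sup>2 - (damp \<epsilon> s)\<^sup>2 \<le> 2 * \<epsilon> * s ^ 4" .
  have "x / (1 + x) \<le> (2 * x + x\<^sup>2) / (1 + x)\<^sup>2"
  proof -
    have "x / (1 + x) = (x * (1 + x)) / (1 + x)\<^sup>2" using x0 by (simp add: power2_eq_square)
    also have "\<dots> \<le> (2 * x + x\<^sup>2) / (1 + x)\<^sup>2"
      using x0 by (intro divide_right_mono) (auto simp: power2_eq_square algebra_simps)
    finally show ?thesis .
  qed
  then have ge: "s\<^sup>2 * (x / (1 + x)) \<le> s\<^sup>2 - (damp \<epsilon> s)\<^sup>2" unfolding eq by (rule mult_left_mono) simp
  have "0 \<le> s\<^sup>2 - (damp \<epsilon> s)\<^sup>2" using damp_le[OF assms, of s] by (simp add: abs_le_square_iff)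
  then have "(s\<^sup>2 - (damp \<epsilon> s)\<^sup>2) * s\<^sup>2 \<le> (s\<^sup>2 - (damp \<epsilon> s)\<^sup>2) * (s\<^sup>2 + (damp \<epsilon> s)\<^sup>2)"
    by (intro mult_left_mono) auto
  also have "\<dots> = s ^ 4 - (damp \<epsilon> s) ^ 4" by (simp add: algebra_simps flip: power_add)
  finally have "(s\<^sup>2 - (damp \<epsilon> s)\<^sup>2) * s\<^sup>2 \<le> s ^ 4 - (damp \<epsilon> s) ^ 4" .
  moreover have "s\<^sup>2 * (x / (1 + x)) * s\<^sup>2 \<le> (s\<^sup>2 - (damp \<epsilon> s)\<^sup>2) * s\<^sup>2" using ge by (intro mult_right_mono) auto
  moreover have "s\<^sup>2 * (x / (1 + x)) * s\<^sup>2 = \<epsilon> * (s ^ 6 / (1 + \<epsilon> * s\<^sup>2))"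
  proof -
    have "s\<^sup>2 * x * s\<^sup>2 = \<epsilon> * s ^ 6" by (simp add: x_def mult_ac flip: power_add)
    then show ?thesis by (simp add: x_def)
  qed
  ultimately show "\<epsilon> * (s ^ 6 / (1 + \<epsilon> * s\<^sup>2)) \<le> s ^ 4 - (damp \<epsilon> s) ^ 4" by linarith
qed

text \<open>Damping is a smooth function whose derivative is at most 1 in modulus, so it acts on the
  approximating test functions directly and does not increase their Dirichlet integrals.\<close>

lemma damp_test_function:
  assumes \<epsilon>: "0 \<le> \<epsilon>" and \<phi>: "test_function U \<phi>"
  shows "test_function U (\<lambda>x. damp \<epsilon> (\<phi> x))"
    and "\<bar>partial_deriv i (\<lambda>x. damp \<epsilon> (\<phi> x)) x\<bar> \<le> \<bar>partial_deriv i \<phi> x\<bar>"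
proof -
  have sm: "smooth \<phi>" by (rule test_function_smooth[OF \<phi>])
  have ne: "1 + \<epsilon> * (\<phi> x)\<^sup>2 \<noteq> 0" for x using damp_denom[OF \<epsilon>, of "\<phi> x"] by linarith
  have "smooth (\<lambda>x. \<phi> x * inverse (1 + \<epsilon> * (\<phi> x)\<^sup>2))"
    by (intro smooth_mult smooth_inverse smooth_add smooth_power smooth_const sm ne)
  then show "test_function U (\<lambda>x. damp \<epsilon> (\<phi> x))"
    by (intro test_functionI[OF \<phi>]) (auto simp: damp_def divide_inverse)
  have "((\<lambda>x. damp \<epsilon> (\<phi> x)) has_derivative
    (\<lambda>h. (1 - \<epsilon> * (\<phi> x)\<^sup>2) / (1 + \<epsilon> * (\<phi> x)\<^sup>2)\<^sup>2 * frechet_derivative \<phi> (at x) h)) (at x)"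
    using has_derivative_compose[OF smooth_has_derivative[OF sm] damp_deriv(1)[OF \<epsilon>, THEN has_field_derivative_imp_has_derivative]]
    by simp
  from partial_deriv_eq[OF this]
  have "partial_deriv i (\<lambda>x. damp \<epsilon> (\<phi> x)) x = (1 - \<epsilon> * (\<phi> x)\<^sup>2) / (1 + \<epsilon> * (\<phi> x)\<^sup>2)\<^sup>2 * partial_deriv i \<phi> x"
    by (simp add: partial_deriv_def)
  then show "\<bar>partial_deriv i (\<lambda>x. damp \<epsilon> (\<phi> x)) x\<bar> \<le> \<bar>partial_deriv i \<phi> x\<bar>"
    using mult_right_mono[OF damp_deriv(2)[OF \<epsilon>, of "\<phi> x"], of "\<bar>partial_deriv i \<phi> x\<bar>"] by (simp add: abs_mult)
qed

text \<open>The weak gradient \<open>g\<close> and the approximating test functions are fixed once,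
  so that statements about \<open>u\<close> can be derived as limits of statements about
  \<open>\<phi> k\<close>. Convergence is stated on the closed box to match the mesh cells.\<close>

locale ground_state_problem =
  fixes a b :: "real^'n" and V :: "real^'n \<Rightarrow> real" and \<beta> C\<^sub>V :: real and u :: "real^'n \<Rightarrow> real"
    and g :: "real^'n \<Rightarrow> real^'n" and \<phi> :: "nat \<Rightarrow> real^'n \<Rightarrow> real"
  assumes dim: "CARD('n) \<le> 3" and ab: "\<And>i. a $ i < b $ i"
    and V_meas: "V \<in> borel_measurable (lebesgue_on (cbox a b))"
    and V_nonneg: "AE x in lebesgue_on (cbox a b). 0 \<le> V x"
    and V_bound: "AE x in lebesgue_on (cbox a b). \<bar>V x\<bar> \<le> C\<^sub>V"
    and beta: "\<beta> > 0"
    and ground: "ground_state (box a b) V \<beta> u"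
    and u_grad: "has_weak_grad (box a b) u g"
    and test: "\<And>k. test_function (box a b) (\<phi> k)"
    and conv: "sq_tendsto (lebesgue_on (cbox a b)) \<phi> u"
    and conv_grad: "\<And>i. sq_tendsto (lebesgue_on (cbox a b)) (\<lambda>k. partial_deriv i (\<phi> k)) (\<lambda>x. g x $ i)"
begin

abbreviation "M \<equiv> lebesgue_on (cbox a b)"

text \<open>The energy is split because the two parts scale by different powers, c^2 and c^4, when a
  function is normalised.\<close>

definition quadratic_energy :: "(real^'n \<Rightarrow> real^'n) \<Rightarrow> (real^'n \<Rightarrow> real) \<Rightarrow> real" where
  "quadratic_energy h v = 1/2 * ((LINT x|M. (norm (h x))\<^sup>2) + (LINT x|M. V x * (v x)\<^sup>2))"

definition quartic_energy :: "(real^'n \<Rightarrow> real) \<Rightarrow> real" where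
  "quartic_energy v = \<beta>/4 * (LINT x|M. v x ^ 4)"

lemma finite_M: "finite_measure M" by (rule lmeasurable_box_finite)

lemma u_sq: "sq_integrable M u" and g_sq: "sq_integrable M (\<lambda>x. g x $ i)"
  using conv conv_grad[of i] by (auto simp: sq_tendsto_def)

lemma smooth_\<phi>: "smooth (\<phi> k)" by (rule test_function_smooth[OF test])

lemma smooth_sq: "smooth f \<Longrightarrow> sq_integrable M f" by (rule smooth_sq_integrable_box)

lemma V_mult_integrable:
  assumes "sq_integrable M v" "sq_integrable M w"
  shows "integrable M (\<lambda>x. V x * (v x * w x))"
  using sq_integrable_mult[OF sq_integrable_bounded_mult[OF assms(1) V_meas V_bound] assms(2)]
  by (simp add: mult.assoc)

lemma V_sq_integrable: "sq_integrable M v \<Longrightarrow> integrable M (\<lambda>x. V x * (v x)\<^sup>2)"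
  using V_mult_integrable[of v v] by (simp add: power2_eq_square)

lemma quadratic_energy_nonneg: "0 \<le> quadratic_energy h v"
proof -
  have "0 \<le> (LINT x|M. V x * (v x)\<^sup>2)"
    using V_nonneg by (intro integral_nonneg_AE) (auto elim!: eventually_mono)
  then show ?thesis by (simp add: quadratic_energy_def)
qed

lemma energy_eq:
  assumes v: "sq_integrable M v" and h: "\<And>i. sq_integrable M (\<lambda>x. h x $ i)" and v4: "integrable M (\<lambda>x. v x ^ 4)"
  shows "energy_with (box a b) V \<beta> h v = quadratic_energy h v + quartic_energy v"
  using integral_energy_split[OF v h V_meas V_bound v4, of \<beta>]
  by (simp add: energy_with_def quadratic_energy_def quartic_energy_def integral_cbox_box)

lemma energy_with_cong:
  assumes h: "AE x in M. h x = h' x" and m: "h \<in> borel_measurable M" "h' \<in> borel_measurable M"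
    and v: "v \<in> borel_measurable M"
  shows "energy_with (box a b) V \<beta> h v = energy_with (box a b) V \<beta> h' v"
proof -
  have "(LINT x|M. (norm (h x))\<^sup>2 + V x * \<bar>v x\<bar>\<^sup>2 + \<beta>/2 * \<bar>v x\<bar>^4) =
    (LINT x|M. (norm (h' x))\<^sup>2 + V x * \<bar>v x\<bar>\<^sup>2 + \<beta>/2 * \<bar>v x\<bar>^4)"
  proof (rule integral_cong_AE)
    show "AE x in M. (norm (h x))\<^sup>2 + V x * \<bar>v x\<bar>\<^sup>2 + \<beta>/2 * \<bar>v x\<bar>^4 =
      (norm (h' x))\<^sup>2 + V x * \<bar>v x\<bar>\<^sup>2 + \<beta>/2 * \<bar>v x\<bar>^4"
      using h by eventually_elim simp
  qed (use m v V_meas in measurable)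
  then show ?thesis by (simp add: energy_with_def integral_cbox_box)
qed

lemma has_weak_grad_measurable:
  assumes "has_weak_grad (box a b) v h"
  shows "h \<in> borel_measurable M"
  using assms by (simp add: has_weak_grad_def L2_vec_iff_sq_integrable borel_measurable_vec_iff
    borel_measurable_cbox_box sq_integrable_def)

lemma energy_eq_weak_grad:
  assumes h: "has_weak_grad (box a b) v h" and v: "sq_integrable M v" and v4: "integrable M (\<lambda>x. v x ^ 4)"
  shows "energy (box a b) V \<beta> v = quadratic_energy h v + quartic_energy v"
proof -
  have "energy (box a b) V \<beta> v = energy_with (box a b) V \<beta> h v"
    unfolding energy_def
    by (rule energy_with_cong)
      (use weak_grad_ae[OF h] h v in \<open>auto simp: AE_lebesgue_on_cbox_box has_weak_grad_measurable\<close>)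
  also have "\<dots> = quadratic_energy h v + quartic_energy v"
    by (rule energy_eq[OF v _ v4])
      (use h in \<open>auto simp: has_weak_grad_def L2_vec_iff_sq_integrable sq_integrable_cbox_box\<close>)
  finally show ?thesis .
qed

lemma measure_cbox_pos: "measure lebesgue (cbox a b) > 0"
  using ab by (simp add: content_cbox_if_cart interval_eq_empty_cart not_less_iff_gr_or_eq less_imp_le prod_pos)

lemma smooth_power4: "smooth f \<Longrightarrow> integrable M (\<lambda>x. f x ^ 4)"
  using smooth_sq[OF smooth_power[of f 2]] by (auto simp: sq_integrable_def simp flip: power_mult)

lemma u_norm: "(LINT x|M. (u x)\<^sup>2) = 1"
  using ground by (auto simp: ground_state_def is_arg_min_def L2_norm_def integral_cbox_box)

lemma energy_le_test:
  assumes \<psi>: "test_function (box a b) \<psi>" and N: "(LINT x|M. (\<psi> x)\<^sup>2) = N" "N > 0"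
  shows "energy (box a b) V \<beta> u \<le> quadratic_energy (grad \<psi>) \<psi> / N + quartic_energy \<psi> / N\<^sup>2"
proof -
  define c where "c = 1 / sqrt N"
  have c: "c\<^sup>2 = 1 / N" using N by (simp add: c_def power_divide)
  then have c4: "c ^ 4 = 1 / N\<^sup>2" using power_mult[of c 2 2] by (simp add: power_divide)
  have s\<psi>: "smooth \<psi>" by (rule test_function_smooth[OF \<psi>])
  let ?w = "\<lambda>x. c * \<psi> x"
  have tw: "test_function (box a b) ?w"
    by (rule test_functionI[OF \<psi>]) (auto intro: smooth_mult smooth_const s\<psi>)
  have sw: "smooth ?w" by (rule test_function_smooth[OF tw])
  have gw: "grad ?w = (\<lambda>x. c *\<^sub>R grad \<psi> x)"
    by (auto simp: vec_eq_iff partial_deriv_cmult[OF s\<psi>])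
  have "L2_norm (box a b) ?w = 1"
    using N c by (simp add: L2_norm_def power_mult_distrib flip: integral_cbox_box)
  then have "energy (box a b) V \<beta> u \<le> energy (box a b) V \<beta> ?w"
    using ground test_function_H10[OF tw] unfolding ground_state_def is_arg_min_def by (meson not_less)
  also have "\<dots> = quadratic_energy (grad ?w) ?w + quartic_energy ?w"
    by (rule energy_eq_weak_grad[OF has_weak_grad_smooth[OF sw] smooth_sq[OF sw] smooth_power4[OF sw]])
  also have "quadratic_energy (grad ?w) ?w = quadratic_energy (grad \<psi>) \<psi> / N"
  proof -
    have "(LINT x|M. (norm (grad ?w x))\<^sup>2) = (LINT x|M. 1 / N * (norm (grad \<psi> x))\<^sup>2)"
      "(LINT x|M. V x * (c * \<psi> x)\<^sup>2) = (LINT x|M. 1 / N * (V x * (\<psi> x)\<^sup>2))"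
      unfolding gw by (simp_all only: norm_scaleR power_mult_distrib power2_abs c mult.left_commute)
    then show ?thesis unfolding quadratic_energy_def integral_mult_right_zero
      by (simp add: add_divide_distrib)
  qed
  also have "quartic_energy ?w = quartic_energy \<psi> / N\<^sup>2"
    by (simp add: quartic_energy_def power_mult_distrib c4)
  finally show ?thesis .
qed

text \<open>The Sobolev-Poincare inequality on the whole box, with the mean of \<open>u\<close>
  restored afterwards.\<close>

lemma u_power4: "integrable M (\<lambda>x. u x ^ 4)"
proof -
  define m where "m = (LINT x|M. u x) / measure lebesgue (cbox a b)"
  have i: "integrable M (\<lambda>x. (u x - m) ^ 4)"
    by (rule sobolev_poincare(1)[OF dim measure_cbox_pos smooth_\<phi> conv conv_grad m_def])
  interpret finite_measure M by (rule finite_M)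
  show ?thesis
  proof (rule Bochner_Integration.integrable_bound)
    show "integrable M (\<lambda>x. 8 * ((u x - m) ^ 4 + m ^ 4))" using i by simp
    have "s ^ 4 \<le> 8 * ((s - m) ^ 4 + m ^ 4)" for s
    proof -
      have two: "(p + q)\<^sup>2 \<le> 2 * (p\<^sup>2 + q\<^sup>2)" for p q :: real
        using sum_squares_bound[of p q] by (simp add: power2_sum)
      have "s\<^sup>2 \<le> 2 * ((s - m)\<^sup>2 + m\<^sup>2)" using two[of "s - m" m] by simp
      then have "(s\<^sup>2)\<^sup>2 \<le> (2 * ((s - m)\<^sup>2 + m\<^sup>2))\<^sup>2" by (rule power_mono) simp
      also have "\<dots> = 4 * ((s - m)\<^sup>2 + m\<^sup>2)\<^sup>2" unfolding power_mult_distrib by simp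
      also have "\<dots> \<le> 4 * (2 * (((s - m)\<^sup>2)\<^sup>2 + (m\<^sup>2)\<^sup>2))" by (intro mult_left_mono two) auto
      finally show ?thesis by (simp flip: power_mult)
    qed
    then show "AE x in M. norm (u x ^ 4) \<le> norm (8 * ((u x - m) ^ 4 + m ^ 4))"
      by (auto intro!: AE_I2)
  qed (use u_sq in auto)
qed

lemma energy_u: "energy (box a b) V \<beta> u = quadratic_energy g u + quartic_energy u"
  by (rule energy_eq_weak_grad[OF u_grad u_sq u_power4])

lemma quadratic_energy_tendsto:
  "(\<lambda>k. quadratic_energy (grad (\<phi> k)) (\<phi> k)) \<longlonglongrightarrow> quadratic_energy g u"
proof -
  have "(\<lambda>k. LINT x|M. (V x * \<phi> k x) * \<phi> k x) \<longlonglongrightarrow> (LINT x|M. (V x * u x) * u x)"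
    by (rule sq_tendsto_inner[OF sq_tendsto_bounded_mult[OF conv V_meas V_bound] conv])
  then have "(\<lambda>k. LINT x|M. V x * (\<phi> k x)\<^sup>2) \<longlonglongrightarrow> (LINT x|M. V x * (u x)\<^sup>2)"
    by (simp add: power2_eq_square mult.assoc)
  moreover have "(\<lambda>k. LINT x|M. (norm (grad (\<phi> k) x))\<^sup>2) \<longlonglongrightarrow> (LINT x|M. (norm (g x))\<^sup>2)"
    by (rule integral_norm_sq_tendsto) (simp add: conv_grad)
  ultimately show ?thesis unfolding quadratic_energy_def by (intro tendsto_intros)
qed

text \<open>Damping \<open>u\<close> lowers the quadratic energy; minimality therefore bounds the gain in the
  quartic energy by the loss of mass.\<close>

lemma damp_estimate:
  assumes \<epsilon>: "0 < \<epsilon>" "\<epsilon> \<le> 1"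
  shows "(LINT x|M. u x ^ 6 / (1 + \<epsilon> * (u x)\<^sup>2)) \<le> 16 * energy (box a b) V \<beta> u / \<beta> * (LINT x|M. u x ^ 4)"
    and "integrable M (\<lambda>x. u x ^ 6 / (1 + \<epsilon> * (u x)\<^sup>2))"
proof -
  let ?\<theta> = "damp \<epsilon>"
  define E where "E = energy (box a b) V \<beta> u"
  define N where "N = (LINT x|M. (?\<theta> (u x))\<^sup>2)"
  define Nk where "Nk k = (LINT x|M. (?\<theta> (\<phi> k x))\<^sup>2)" for k
  have \<epsilon>0: "0 \<le> \<epsilon>" using \<epsilon> by simp
  have m\<theta> [measurable]: "?\<theta> \<in> borel_measurable borel" unfolding damp_def[abs_def] by measurable
  have [measurable]: "u \<in> borel_measurable M" using u_sq by auto
  have t: "sq_tendsto M (\<lambda>k x. ?\<theta> (\<phi> k x)) (\<lambda>x. ?\<theta> (u x))"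
    by (rule sq_tendsto_lipschitz[OF conv damp_lipschitz[OF \<epsilon>0]]) (auto simp: m\<theta>)
  have \<theta>u: "sq_integrable M (\<lambda>x. ?\<theta> (u x))" using t by (simp add: sq_tendsto_def)
  have N: "Nk \<longlonglongrightarrow> N" unfolding Nk_def[abs_def] N_def by (rule sq_tendsto_square[OF t])
  \<comment> \<open>L^2 convergence of the damped functions does not control their fourth powers. As
    \<open>damp\<close> is bounded for fixed \<epsilon>, its square is Lipschitz too, and L^2
    convergence of the squares gives convergence of the quartic energy.\<close>
  have t2: "sq_tendsto M (\<lambda>k x. (?\<theta> (\<phi> k x))\<^sup>2) (\<lambda>x. (?\<theta> (u x))\<^sup>2)"
  proof (rule sq_tendsto_lipschitz[OF conv, where \<theta>="\<lambda>s. (?\<theta> s)\<^sup>2" and L="2 / \<epsilon>"])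
    fix s t
    have "\<bar>(?\<theta> s)\<^sup>2 - (?\<theta> t)\<^sup>2\<bar> = \<bar>?\<theta> s + ?\<theta> t\<bar> * \<bar>?\<theta> s - ?\<theta> t\<bar>"
      by (simp add: power2_eq_square square_diff_square_factored abs_mult)
    also have "\<dots> \<le> 2 / \<epsilon> * \<bar>s - t\<bar>"
    proof (rule mult_mono)
      show "\<bar>?\<theta> s + ?\<theta> t\<bar> \<le> 2 / \<epsilon>"
        using damp_bounded[OF \<epsilon>, of s] damp_bounded[OF \<epsilon>, of t] by (simp add: abs_le_iff)
      show "\<bar>?\<theta> s - ?\<theta> t\<bar> \<le> \<bar>s - t\<bar>" using damp_lipschitz[OF \<epsilon>0, of s t] by simp
    qed (use \<epsilon> in auto)
    finally show "\<bar>(?\<theta> s)\<^sup>2 - (?\<theta> t)\<^sup>2\<bar> \<le> 2 / \<epsilon> * \<bar>s - t\<bar>" .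
  qed (auto simp: m\<theta>)
  have q4: "(\<lambda>k. quartic_energy (\<lambda>x. ?\<theta> (\<phi> k x))) \<longlonglongrightarrow> quartic_energy (\<lambda>x. ?\<theta> (u x))"
    unfolding quartic_energy_def using sq_tendsto_square[OF t2]
    by (intro tendsto_mult tendsto_const) (simp flip: power_mult)
  have \<theta>4: "integrable M (\<lambda>x. ?\<theta> (u x) ^ 4)"
    using t2 by (auto simp: sq_tendsto_def sq_integrable_def simp flip: power_mult)
  have "N \<noteq> 0"
  proof
    assume "N = 0"
    then have "AE x in M. (?\<theta> (u x))\<^sup>2 = 0"
      unfolding N_def using \<theta>u by (subst (asm) integral_nonneg_eq_0_iff_AE) auto
    then have "AE x in M. (u x)\<^sup>2 = 0"
    proof eventually_elim
      case (elim x)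
      then have "u x / (1 + \<epsilon> * (u x)\<^sup>2) = 0" by (simp add: damp_def)
      moreover have "1 + \<epsilon> * (u x)\<^sup>2 \<noteq> 0" using damp_denom[OF \<epsilon>0, of "u x"] by linarith
      ultimately show ?case by simp
    qed
    then have "(LINT x|M. (u x)\<^sup>2) = 0" using u_sq by (subst integral_nonneg_eq_0_iff_AE) auto
    then show False using u_norm by simp
  qed
  moreover have "N \<ge> 0" by (simp add: N_def)
  ultimately have N0: "N > 0" by simp
  have sq_le: "(?\<theta> s)\<^sup>2 \<le> s\<^sup>2" for s using damp_le[OF \<epsilon>0, of s] by (simp add: abs_le_square_iff)
  have N1: "N \<le> 1"
    unfolding N_def u_norm[symmetric] using \<theta>u u_sq sq_le by (intro integral_mono) auto
  have le_k: "E \<le> quadratic_energy (grad (\<phi> k)) (\<phi> k) / Nk k + quartic_energy (\<lambda>x. ?\<theta> (\<phi> k x)) / (Nk k)\<^sup>2"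
    if "Nk k > 0" for k
  proof -
    let ?\<psi> = "\<lambda>x. ?\<theta> (\<phi> k x)"
    have tt: "test_function (box a b) ?\<psi>" by (rule damp_test_function(1)[OF \<epsilon>0 test])
    have st: "smooth ?\<psi>" by (rule test_function_smooth[OF tt])
    have "E \<le> quadratic_energy (grad ?\<psi>) ?\<psi> / Nk k + quartic_energy ?\<psi> / (Nk k)\<^sup>2"
      unfolding E_def by (rule energy_le_test[OF tt _ that]) (simp add: Nk_def)
    \<comment> \<open>Both the contraction property of \<open>damp\<close> and the sign of
      \<open>V\<close> are used here.\<close>
    moreover have "quadratic_energy (grad ?\<psi>) ?\<psi> \<le> quadratic_energy (grad (\<phi> k)) (\<phi> k)"
    proof -
      have "(LINT x|M. (norm (grad ?\<psi> x))\<^sup>2) \<le> (LINT x|M. (norm (grad (\<phi> k) x))\<^sup>2)"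
      proof (rule integral_mono)
        show "integrable M (\<lambda>x. (norm (grad ?\<psi> x))\<^sup>2)" "integrable M (\<lambda>x. (norm (grad (\<phi> k) x))\<^sup>2)"
          by (auto intro!: integral_norm_sq_sum(2) smooth_sq smooth_partial st smooth_\<phi>)
        show "(norm (grad ?\<psi> x))\<^sup>2 \<le> (norm (grad (\<phi> k) x))\<^sup>2" for x
          unfolding norm_vec_sq using damp_test_function(2)[OF \<epsilon>0 test]
          by (intro sum_mono) (simp add: abs_le_square_iff[symmetric])
      qed
      moreover have "(LINT x|M. V x * (?\<psi> x)\<^sup>2) \<le> (LINT x|M. V x * (\<phi> k x)\<^sup>2)"
      proof (rule integral_mono_AE)
        show "AE x in M. V x * (?\<psi> x)\<^sup>2 \<le> V x * (\<phi> k x)\<^sup>2"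
          using V_nonneg by eventually_elim (intro mult_left_mono sq_le)
      qed (auto intro!: V_sq_integrable smooth_sq st smooth_\<phi>)
      ultimately show ?thesis by (simp add: quadratic_energy_def)
    qed
    ultimately show ?thesis using divide_right_mono[of _ _ "Nk k"] that by fastforce
  qed
  have le: "E \<le> quadratic_energy g u / N + quartic_energy (\<lambda>x. ?\<theta> (u x)) / N\<^sup>2"
  proof (rule tendsto_le[OF _ _ tendsto_const])
    show "(\<lambda>k. quadratic_energy (grad (\<phi> k)) (\<phi> k) / Nk k + quartic_energy (\<lambda>x. ?\<theta> (\<phi> k x)) / (Nk k)\<^sup>2) \<longlonglongrightarrow>
      quadratic_energy g u / N + quartic_energy (\<lambda>x. ?\<theta> (u x)) / N\<^sup>2"
      using N0 by (intro tendsto_intros quadratic_energy_tendsto q4 N) auto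
    show "eventually (\<lambda>k. E \<le> quadratic_energy (grad (\<phi> k)) (\<phi> k) / Nk k + quartic_energy (\<lambda>x. ?\<theta> (\<phi> k x)) / (Nk k)\<^sup>2) sequentially"
      using order_tendstoD(1)[OF N N0] by eventually_elim (rule le_k)
  qed simp
  \<comment> \<open>Multiplying by the square of \<open>N\<close> leaves one factor \<open>N\<close>
    on the quadratic energy and none on the quartic one, so \<open>N\<close> \<le> 1 suffices to
    compare with the energy of \<open>u\<close>.\<close>
  have "E * N\<^sup>2 \<le> (quadratic_energy g u / N + quartic_energy (\<lambda>x. ?\<theta> (u x)) / N\<^sup>2) * N\<^sup>2"
    by (intro mult_right_mono le) simp
  also have "\<dots> = quadratic_energy g u * N + quartic_energy (\<lambda>x. ?\<theta> (u x))"
    using N0 by (simp add: field_simps power2_eq_square)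
  also have "\<dots> \<le> quadratic_energy g u * 1 + quartic_energy (\<lambda>x. ?\<theta> (u x))"
    using N1 by (intro add_right_mono mult_left_mono quadratic_energy_nonneg)
  also have "\<dots> = E - (quartic_energy u - quartic_energy (\<lambda>x. ?\<theta> (u x)))"
    by (simp add: E_def energy_u)
  finally have gain: "quartic_energy u - quartic_energy (\<lambda>x. ?\<theta> (u x)) \<le> E * (1 - N\<^sup>2)"
    by (simp add: algebra_simps)
  have E0: "0 \<le> E"
    unfolding E_def energy_u quartic_energy_def using beta by (intro add_nonneg_nonneg quadratic_energy_nonneg) auto
  have "1 - N\<^sup>2 = (1 - N) * (1 + N)" by (simp add: power2_eq_square algebra_simps)
  also have "\<dots> \<le> (1 - N) * 2" using N1 by (intro mult_left_mono) auto
  also have "1 - N = (LINT x|M. (u x)\<^sup>2 - (?\<theta> (u x))\<^sup>2)"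
    using \<theta>u u_sq by (simp add: N_def u_norm sq_integrable_square)
  also have "\<dots> \<le> (LINT x|M. 2 * \<epsilon> * u x ^ 4)"
    using \<theta>u u_sq u_power4 damp_square_defect(1)[OF \<epsilon>0] by (intro integral_mono) auto
  finally have "1 - N\<^sup>2 \<le> 4 * \<epsilon> * (LINT x|M. u x ^ 4)" by simp
  then have "E * (1 - N\<^sup>2) \<le> E * (4 * \<epsilon> * (LINT x|M. u x ^ 4))" by (rule mult_left_mono[OF _ E0])
  with gain have gain2: "\<beta>/4 * ((LINT x|M. u x ^ 4) - (LINT x|M. ?\<theta> (u x) ^ 4)) \<le> E * (4 * \<epsilon> * (LINT x|M. u x ^ 4))"
    unfolding quartic_energy_def by (simp add: right_diff_distrib)
  have d4: "integrable M (\<lambda>x. u x ^ 4 - ?\<theta> (u x) ^ 4)" using u_power4 \<theta>4 by simp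
  have pt: "u x ^ 6 / (1 + \<epsilon> * (u x)\<^sup>2) \<le> 1 / \<epsilon> * (u x ^ 4 - ?\<theta> (u x) ^ 4)" for x
    using damp_square_defect(2)[OF \<epsilon>0, of "u x"] \<epsilon> by (simp add: field_simps)
  have pos: "0 \<le> u x ^ 6 / (1 + \<epsilon> * (u x)\<^sup>2)" for x
    using damp_denom[OF \<epsilon>0, of "u x"] by (intro divide_nonneg_nonneg) auto
  show i6: "integrable M (\<lambda>x. u x ^ 6 / (1 + \<epsilon> * (u x)\<^sup>2))"
  proof (rule Bochner_Integration.integrable_bound)
    show "integrable M (\<lambda>x. 1 / \<epsilon> * (u x ^ 4 - ?\<theta> (u x) ^ 4))" using d4 by simp
    show "AE x in M. norm (u x ^ 6 / (1 + \<epsilon> * (u x)\<^sup>2)) \<le> norm (1 / \<epsilon> * (u x ^ 4 - ?\<theta> (u x) ^ 4))"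
    proof (rule AE_I2)
      fix x
      show "norm (u x ^ 6 / (1 + \<epsilon> * (u x)\<^sup>2)) \<le> norm (1 / \<epsilon> * (u x ^ 4 - ?\<theta> (u x) ^ 4))"
        unfolding real_norm_def using pos[of x] pt[of x] by linarith
    qed
  qed measurable
  have "(LINT x|M. u x ^ 6 / (1 + \<epsilon> * (u x)\<^sup>2)) \<le> (LINT x|M. 1 / \<epsilon> * (u x ^ 4 - ?\<theta> (u x) ^ 4))"
    by (rule integral_mono[OF i6 _ pt]) (use d4 in simp)
  also have "\<dots> = 1 / \<epsilon> * ((LINT x|M. u x ^ 4) - (LINT x|M. ?\<theta> (u x) ^ 4))"
    using u_power4 \<theta>4 by simp
  \<comment> \<open>Here \<epsilon> cancels. The factor 16 collects 2 from 1 - N^2 \<le> 2 (1 - N),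
    2 from the mass defect and 4 from the coefficient \<beta>/4.\<close>
  also have "\<dots> \<le> 16 * E / \<beta> * (LINT x|M. u x ^ 4)"
    using gain2 beta \<epsilon> by (simp add: field_simps)
  finally show "(LINT x|M. u x ^ 6 / (1 + \<epsilon> * (u x)\<^sup>2)) \<le> 16 * energy (box a b) V \<beta> u / \<beta> * (LINT x|M. u x ^ 4)"
    by (simp add: E_def)
qed

text \<open>The bound of \<open>damp_estimate\<close> does not depend on \<epsilon>, so Fatou's
  lemma applies as \<epsilon> tends to 0.\<close>

lemma u_power6: "integrable M (\<lambda>x. u x ^ 6)"
proof (rule integrableI_bounded)
  define C where "C = 16 * energy (box a b) V \<beta> u / \<beta> * (LINT x|M. u x ^ 4)"
  define \<epsilon> where "\<epsilon> k = inverse (real (Suc k))" for k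
  have \<epsilon>: "0 < \<epsilon> k" "\<epsilon> k \<le> 1" for k by (auto simp: \<epsilon>_def field_simps)
  have [measurable]: "u \<in> borel_measurable M" using u_sq by auto
  show "(\<lambda>x. u x ^ 6) \<in> borel_measurable M" by measurable
  have pos: "0 \<le> u x ^ 6 / (1 + \<epsilon> k * (u x)\<^sup>2)" for x k
    using damp_denom[of "\<epsilon> k" "u x"] \<epsilon>[of k] by (intro divide_nonneg_nonneg) auto
  have "(\<integral>\<^sup>+x. ennreal (norm (u x ^ 6)) \<partial>M) = (\<integral>\<^sup>+x. liminf (\<lambda>k. ennreal (u x ^ 6 / (1 + \<epsilon> k * (u x)\<^sup>2))) \<partial>M)"
  proof (rule nn_integral_cong)
    fix x
    have "(\<lambda>k. u x ^ 6 / (1 + \<epsilon> k * (u x)\<^sup>2)) \<longlonglongrightarrow> u x ^ 6 / (1 + 0 * (u x)\<^sup>2)"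
      unfolding \<epsilon>_def by (intro tendsto_intros LIMSEQ_inverse_real_of_nat) auto
    then have "(\<lambda>k. ennreal (u x ^ 6 / (1 + \<epsilon> k * (u x)\<^sup>2))) \<longlonglongrightarrow> ennreal (norm (u x ^ 6))"
      by (intro tendsto_ennrealI) simp
    then show "ennreal (norm (u x ^ 6)) = liminf (\<lambda>k. ennreal (u x ^ 6 / (1 + \<epsilon> k * (u x)\<^sup>2)))"
      by (intro lim_imp_Liminf[symmetric]) simp_all
  qed
  also have "\<dots> \<le> liminf (\<lambda>k. \<integral>\<^sup>+x. ennreal (u x ^ 6 / (1 + \<epsilon> k * (u x)\<^sup>2)) \<partial>M)"
    by (intro nn_integral_liminf) measurable
  also have "\<dots> \<le> liminf (\<lambda>k. ennreal C)"
  proof (intro Liminf_mono always_eventually allI)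
    fix k
    have "(\<integral>\<^sup>+x. ennreal (u x ^ 6 / (1 + \<epsilon> k * (u x)\<^sup>2)) \<partial>M) = ennreal (LINT x|M. u x ^ 6 / (1 + \<epsilon> k * (u x)\<^sup>2))"
      by (rule nn_integral_eq_integral[OF damp_estimate(2)[OF \<epsilon>]]) (use pos in auto)
    also have "\<dots> \<le> ennreal C" unfolding C_def by (intro ennreal_leI damp_estimate(1)[OF \<epsilon>])
    finally show "(\<integral>\<^sup>+x. ennreal (u x ^ 6 / (1 + \<epsilon> k * (u x)\<^sup>2)) \<partial>M) \<le> ennreal C" .
  qed
  also have "\<dots> = ennreal C" by (simp add: Liminf_const)
  finally show "(\<integral>\<^sup>+x. ennreal (norm (u x ^ 6)) \<partial>M) < \<infinity>" by (simp add: order.strict_trans1)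
qed

end

abbreviation "lo \<equiv> interval_lowerbound"
abbreviation "hi \<equiv> interval_upperbound"

section \<open>Box meshes\<close>

definition same_side :: "'n \<Rightarrow> (real^'n) set \<Rightarrow> (real^'n) set \<Rightarrow> bool" where
  "same_side i K L \<longleftrightarrow> lo K $ i = lo L $ i \<and> hi K $ i = hi L $ i"

lemma same_side_refl [simp]: "same_side i K K"
  and same_side_trans: "same_side i K L \<Longrightarrow> same_side i L M \<Longrightarrow> same_side i K M"
  by (auto simp: same_side_def)

lemma integrable_subset_lebesgue_on:
  fixes f :: "real^'n \<Rightarrow> real"
  assumes f: "integrable (lebesgue_on S) f" and "R \<subseteq> S" "R \<in> sets lebesgue" "S \<in> sets lebesgue"
  shows "integrable (lebesgue_on R) f"
proof -
  have "integrable lebesgue (\<lambda>x. if x \<in> S then f x else 0)"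
    using f assms by (simp add: Lebesgue_Measure.integrable_restrict_UNIV)
  then have "integrable lebesgue (\<lambda>x. indicator R x *\<^sub>R (if x \<in> S then f x else 0))"
    using assms by (intro integrable_mult_indicator) auto
  moreover have "(\<lambda>x. indicator R x *\<^sub>R (if x \<in> S then f x else 0)) = (\<lambda>x. if x \<in> R then f x else 0)"
    using assms(2) by (auto simp: fun_eq_iff)
  ultimately show ?thesis using assms by (simp add: Lebesgue_Measure.integrable_restrict_UNIV)
qed

locale box_mesh =
  fixes a b :: "real^'n" and T :: "(real^'n) set set"
  assumes ab: "\<And>i. a $ i < b $ i" and mesh: "conforming_box_mesh (box a b) T"
begin

lemma closure_domain: "closure (box a b) = cbox a b"
proof (rule closure_box)
  have "(\<chi> i. (a $ i + b $ i) / 2) \<in> box a b" using ab by (auto simp: mem_box_cart field_simps)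
  then show "box a b \<noteq> {}" by blast
qed

lemma division: "T division_of cbox a b"
  using mesh unfolding conforming_box_mesh_def closure_domain by blast

lemma finite_T [simp]: "finite T" and Union_T: "\<Union>T = cbox a b"
  using division_ofD(1,6)[OF division] by simp_all

lemma cell_subset: "K \<in> T \<Longrightarrow> K \<subseteq> cbox a b" using Union_T by blast

lemma cell:
  assumes "K \<in> T"
  shows "K = cbox (lo K) (hi K)" and "lo K $ i < hi K $ i" and "interior K = box (lo K) (hi K)"
proof -
  obtain l r where K: "K = cbox l r" using division_ofD(4)[OF division assms] by blast
  have "interior K \<noteq> {}" using mesh assms by (simp add: conforming_box_mesh_def)
  then have ne: "box l r \<noteq> {}" by (simp add: K interior_cbox)
  then have lr: "l $ j < r $ j" for j by (auto simp: interval_ne_empty_cart)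
  then have "cbox l r \<noteq> {}" using box_subset_cbox ne by blast
  then have "lo K = l" "hi K = r" by (auto simp: K)
  with K lr show "K = cbox (lo K) (hi K)" "lo K $ i < hi K $ i" "interior K = box (lo K) (hi K)"
    by (auto simp: interior_cbox)
qed

lemma mem_cell: "K \<in> T \<Longrightarrow> x \<in> K \<longleftrightarrow> (\<forall>j. lo K $ j \<le> x $ j \<and> x $ j \<le> hi K $ j)"
  using cell(1)[of K] mem_box_cart(2) by metis

lemma mem_interior_cell: "K \<in> T \<Longrightarrow> x \<in> interior K \<longleftrightarrow> (\<forall>j. lo K $ j < x $ j \<and> x $ j < hi K $ j)"
  by (simp add: cell(3) mem_box_cart)

lemma disjoint_cells: "K \<in> T \<Longrightarrow> L \<in> T \<Longrightarrow> x \<in> interior K \<Longrightarrow> x \<in> interior L \<Longrightarrow> K = L"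
  using division_ofD(5)[OF division, of K L] by blast

text \<open>The point \<open>z\<close> is interior to \<open>K\<close> in every direction except
  \<open>i\<close>, so the segment from \<open>x\<close> to \<open>z\<close> can be prolonged inside
  \<open>K\<close>. Since \<open>K \<inter> L\<close> is a face of \<open>K\<close> that meets this
  open segment in \<open>z\<close>, it contains the end \<open>x\<close>.\<close>

lemma cell_face:
  assumes K: "K \<in> T" and L: "L \<in> T" and z: "z \<in> K" "z \<in> L"
    and int: "\<And>j. j \<noteq> i \<Longrightarrow> lo K $ j < z $ j \<and> z $ j < hi K $ j" and x: "x \<in> K" "x $ i = z $ i"
  shows "x \<in> L"
proof (cases "x = z")
  case False
  have ev: "eventually (\<lambda>t. \<forall>j. j \<noteq> i \<longrightarrow> lo K $ j < z $ j + t * (z $ j - x $ j) \<and> z $ j + t * (z $ j - x $ j) < hi K $ j) (at_right 0)"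
  proof (rule eventually_all_finite)
    fix j
    have lim: "((\<lambda>t. z $ j + t * (z $ j - x $ j)) \<longlongrightarrow> z $ j + 0 * (z $ j - x $ j)) (at_right 0)"
      by (intro tendsto_intros)
    show "eventually (\<lambda>t. j \<noteq> i \<longrightarrow> lo K $ j < z $ j + t * (z $ j - x $ j) \<and> z $ j + t * (z $ j - x $ j) < hi K $ j) (at_right 0)"
    proof (cases "j = i")
      case False
      then show ?thesis
        using order_tendstoD(1)[OF lim, of "lo K $ j"] order_tendstoD(2)[OF lim, of "hi K $ j"] int[of j]
        by (simp add: eventually_conj_iff)
    qed simp
  qed
  moreover have "eventually (\<lambda>t::real. t > 0) (at_right 0)" by (simp add: eventually_at_right_less)
  ultimately have ev3: "eventually (\<lambda>t. t > 0 \<and> (\<forall>j. j \<noteq> i \<longrightarrow> lo K $ j < z $ j + t * (z $ j - x $ j) \<and> z $ j + t * (z $ j - x $ j) < hi K $ j)) (at_right 0)"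
    by eventually_elim simp
  then obtain t where t: "t > 0" "\<And>j. j \<noteq> i \<Longrightarrow> lo K $ j < z $ j + t * (z $ j - x $ j) \<and> z $ j + t * (z $ j - x $ j) < hi K $ j"
    using eventually_happens'[OF trivial_limit_at_right_real ev3] by blast
  \<comment> \<open>The prolongation does not change coordinate \<open>i\<close>, because
    \<open>x\<close> and \<open>z\<close> agree there.\<close>
  define y where "y = z + t *\<^sub>R (z - x)"
  have "y \<in> K"
    unfolding mem_cell[OF K]
  proof
    fix j
    show "lo K $ j \<le> y $ j \<and> y $ j \<le> hi K $ j"
    proof (cases "j = i")
      case True
      then show ?thesis using z(1) x(2) unfolding mem_cell[OF K] by (simp add: y_def)
    next
      case False
      then show ?thesis using t(2)[OF False] by (simp add: y_def)
    qed
  qed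
  moreover have "z \<in> open_segment x y"
  proof -
    have t1: "1 + t \<noteq> 0" using t by simp
    have "z = (1 - 1 / (1 + t)) *\<^sub>R x + (1 / (1 + t)) *\<^sub>R y"
    proof -
      define s where "s = 1 / (1 + t)"
      have s: "s * (1 + t) = 1" using t1 by (simp add: s_def)
      have "(1 - s) *\<^sub>R x + s *\<^sub>R y = x + (s * (1 + t)) *\<^sub>R z - (s * (1 + t)) *\<^sub>R x"
        by (simp add: y_def algebra_simps)
      then show ?thesis unfolding s by (simp add: s_def)
    qed
    moreover have "x \<noteq> y"
    proof
      assume "x = y"
      then have "(1 + t) *\<^sub>R (z - x) = 0" by (simp add: y_def algebra_simps)
      with False t1 show False by simp
    qed
    moreover have "0 < 1 / (1 + t)" "1 / (1 + t) < 1" using t by auto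
    ultimately show ?thesis unfolding in_segment by blast
  qed
  moreover have "K \<inter> L face_of K" using mesh K L by (simp add: conforming_box_mesh_def)
  ultimately show ?thesis using x(1) z unfolding face_of_def by blast
qed (use z in simp)

text \<open>By \<open>cell_face\<close>, the common point can be slid to both ends of
  \<open>K\<close> in direction \<open>j\<close> without leaving \<open>L\<close>, so the side of
  \<open>L\<close> contains that of \<open>K\<close>. Then \<open>z\<close> is interior to
  \<open>L\<close> in the same directions, and the roles can be exchanged.\<close>

lemma common_point_same_side:
  assumes K: "K \<in> T" and L: "L \<in> T" and z: "z \<in> K" "z \<in> L"
    and int: "\<And>j. j \<noteq> i \<Longrightarrow> lo K $ j < z $ j \<and> z $ j < hi K $ j" and j: "j \<noteq> i"
  shows "same_side j K L"
proof -
  have sub: "lo L $ j \<le> lo K $ j \<and> hi K $ j \<le> hi L $ j"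
    if K: "K \<in> T" and L: "L \<in> T" and z: "z \<in> K" "z \<in> L"
      and int: "\<And>j. j \<noteq> i \<Longrightarrow> lo K $ j < z $ j \<and> z $ j < hi K $ j" and j: "j \<noteq> i" for K L j
  proof -
    have "upd z j s \<in> L" if "s \<in> {lo K $ j, hi K $ j}" for s
      by (rule cell_face[OF K L z int]) (use that z(1) j cell(2)[OF K, of j] in \<open>auto simp: mem_cell[OF K] less_imp_le\<close>)
    then have "upd z j (lo K $ j) \<in> L" "upd z j (hi K $ j) \<in> L" by auto
    then show ?thesis unfolding mem_cell[OF L] by (metis upd_nth)
  qed
  have "lo L $ j \<le> lo K $ j \<and> hi K $ j \<le> hi L $ j" by (rule sub[OF K L z int j])
  moreover have "lo K $ j \<le> lo L $ j \<and> hi L $ j \<le> hi K $ j"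
  proof (rule sub[OF L K z(2,1) _ j])
    fix m assume "m \<noteq> i"
    then show "lo L $ m < z $ m \<and> z $ m < hi L $ m"
      using sub[OF K L z int, of m] int[of m] by linarith
  qed
  ultimately show ?thesis by (simp add: same_side_def)
qed

text \<open>Along the line through \<open>x\<close> in direction \<open>i\<close>, the cells that
  share the other sides with \<open>K\<close> and the remaining cells cover two closed sets,
  disjoint on the line by \<open>common_point_same_side\<close>. The line segment is connected, so
  the second set is empty on it.\<close>

lemma move_coordinate:
  assumes K: "K \<in> T" and x: "x \<in> K" and int: "\<And>j. j \<noteq> i \<Longrightarrow> lo K $ j < x $ j \<and> x $ j < hi K $ j"
    and t: "t \<in> {a $ i..b $ i}"
  obtains M where "M \<in> T" "upd x i t \<in> M" "\<And>j. j \<noteq> i \<Longrightarrow> same_side j K M"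
proof -
  let ?S = "upd x i ` {a $ i..b $ i}"
  let ?A = "\<Union>{M \<in> T. \<forall>j. j \<noteq> i \<longrightarrow> same_side j K M}" and ?B = "\<Union>{M \<in> T. \<not> (\<forall>j. j \<noteq> i \<longrightarrow> same_side j K M)}"
  have cl: "closed M" if "M \<in> T" for M using cell(1)[OF that] closed_cbox by metis
  have "continuous_on {a $ i..b $ i} (upd x i)"
  proof -
    have "continuous_on {a $ i..b $ i} (\<lambda>t. if j = i then t else x $ j)" for j by (cases "j = i") auto
    then show ?thesis unfolding upd_def[abs_def] by (intro continuous_on_vec_lambda)
  qed
  then have conn: "connected ?S" by (rule connected_continuous_image) simp
  have xab: "x \<in> cbox a b" using cell_subset[OF K] x by blast
  have S: "?S \<subseteq> ?A \<union> ?B"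
  proof -
    have "?S \<subseteq> cbox a b" using xab by (auto simp: mem_box_cart)
    then show ?thesis using Union_T by blast
  qed
  have disj: "?A \<inter> ?B \<inter> ?S = {}"
  proof (rule ccontr)
    assume "?A \<inter> ?B \<inter> ?S \<noteq> {}"
    then obtain s M L where zM: "upd x i s \<in> M" "M \<in> T" "\<And>j. j \<noteq> i \<Longrightarrow> same_side j K M"
      and zL: "upd x i s \<in> L" "L \<in> T" "\<not> (\<forall>j. j \<noteq> i \<longrightarrow> same_side j K L)" by blast
    have "same_side j M L" if "j \<noteq> i" for j
    proof (rule common_point_same_side[OF zM(2) zL(2) zM(1) zL(1) _ that])
      fix m assume "m \<noteq> i"
      then show "lo M $ m < upd x i s $ m \<and> upd x i s $ m < hi M $ m"
        using int[of m] zM(3)[of m] by (simp add: same_side_def)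
    qed
    then show False using zM(3) zL(3) same_side_trans by blast
  qed
  have "K \<in> {M \<in> T. \<forall>j. j \<noteq> i \<longrightarrow> same_side j K M}" using K by simp
  from UnionI[OF this x] have xA: "x \<in> ?A" .
  have "x $ i \<in> {a $ i..b $ i}" using xab by (auto simp: mem_box_cart)
  then have xS: "x \<in> ?S" by (intro image_eqI[of _ _ "x $ i"]) simp_all
  have cAB: "closed ?A" "closed ?B" using cl finite_T by (auto intro!: closed_Union)
  have "?B \<inter> ?S = {}"
  proof (rule ccontr)
    assume "?B \<inter> ?S \<noteq> {}"
    moreover have "?A \<inter> ?S \<noteq> {}" using xA xS by blast
    ultimately have "\<exists>A B. closed A \<and> closed B \<and> ?S \<subseteq> A \<union> B \<and> A \<inter> B \<inter> ?S = {} \<and> A \<inter> ?S \<noteq> {} \<and> B \<inter> ?S \<noteq> {}"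
      using cAB S disj by (intro exI[of _ ?A] exI[of _ ?B] conjI)
    then show False using conn unfolding connected_closed by (rule notE[rotated])
  qed
  moreover have tS: "upd x i t \<in> ?S" using t by (rule imageI)
  ultimately have "upd x i t \<notin> ?B" by (simp only: disjoint_iff) blast
  moreover have "upd x i t \<in> ?A \<union> ?B" using S tS by (rule subsetD)
  ultimately have "upd x i t \<in> ?A" by (elim UnE) (assumption, rule notE)
  then obtain M where "M \<in> {M \<in> T. \<forall>j. j \<noteq> i \<longrightarrow> same_side j K M}" "upd x i t \<in> M" by (rule UnionE)
  then show ?thesis using that[of M] by simp
qed

section \<open>Generic points and the tensor structure of the mesh\<close>

definition endpoints :: "real set" where
  "endpoints = (\<Union>K\<in>T. \<Union>i. {lo K $ i, hi K $ i})"

lemma finite_endpoints: "finite endpoints" by (simp add: endpoints_def)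

lemma generic_interior:
  assumes "K \<in> T" "x \<in> K" "\<And>j. x $ j \<notin> endpoints"
  shows "lo K $ j < x $ j \<and> x $ j < hi K $ j"
proof -
  have "lo K $ j \<in> endpoints" "hi K $ j \<in> endpoints" using assms(1) by (auto simp: endpoints_def)
  then have "x $ j \<noteq> lo K $ j" "x $ j \<noteq> hi K $ j" using assms(3)[of j] by auto
  moreover have "lo K $ j \<le> x $ j \<and> x $ j \<le> hi K $ j" using assms(1,2) mem_cell by blast
  ultimately show ?thesis by linarith
qed

lemma generic_real:
  assumes "s < (t::real)"
  obtains c where "s < c" "c < t" "c \<notin> endpoints"
proof -
  have "infinite ({s<..<t} - endpoints)" using assms finite_endpoints by (simp add: infinite_Ioo)
  then obtain c where "c \<in> {s<..<t} - endpoints" by (metis all_not_in_conv finite.emptyI)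
  then show ?thesis using that[of c] by simp
qed

text \<open>The coordinates in \<open>J\<close> are moved one at a time. Avoiding
  \<open>endpoints\<close> keeps every intermediate point interior to its cell, as
  \<open>move_coordinate\<close> requires, and each move preserves the sides in the coordinates not
  yet moved.\<close>

lemma generic_path:
  assumes K: "K \<in> T" and x: "x \<in> K" "\<And>j. x $ j \<notin> endpoints" and y: "y \<in> cbox a b" "\<And>j. y $ j \<notin> endpoints"
  shows "finite J \<Longrightarrow> \<exists>M\<in>T. (\<chi> j. if j \<in> J then y $ j else x $ j) \<in> M \<and> (\<forall>j. j \<notin> J \<longrightarrow> same_side j K M)"
proof (induction J rule: finite_induct)
  case empty
  then show ?case using K x(1) by auto
next
  case (insert m J)
  let ?z = "\<chi> j. if j \<in> J then y $ j else x $ j"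
  obtain M where M: "M \<in> T" "?z \<in> M" "\<And>j. j \<notin> J \<Longrightarrow> same_side j K M" using insert.IH by blast
  have gen: "?z $ j \<notin> endpoints" for j using x(2) y(2) by simp
  have "y $ m \<in> {a $ m..b $ m}" using y(1) by (auto simp: mem_box_cart)
  then obtain L where L: "L \<in> T" "upd ?z m (y $ m) \<in> L" "\<And>j. j \<noteq> m \<Longrightarrow> same_side j M L"
    using move_coordinate[OF M(1,2) generic_interior[OF M(1,2) gen]] by blast
  have "upd ?z m (y $ m) = (\<chi> j. if j \<in> insert m J then y $ j else x $ j)" by (auto simp: vec_eq_iff)
  moreover have "same_side j K L" if "j \<notin> insert m J" for j
    using M(3)[of j] L(3)[of j] that same_side_trans by blast
  ultimately show ?case using L(1,2) by auto
qed

text \<open>Pick interior points of \<open>K\<close> and \<open>L\<close> with the same generic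
  coordinate \<open>i\<close> and move all other coordinates from the first point to the second. The
  cell reached still has the side of \<open>K\<close> in direction \<open>i\<close>, and it contains
  an interior point of \<open>L\<close>, so it is \<open>L\<close>.\<close>

lemma overlap_same_side:
  assumes K: "K \<in> T" and L: "L \<in> T" and s: "lo K $ i < s" "s < hi K $ i" "lo L $ i < s" "s < hi L $ i"
  shows "same_side i K L"
proof -
  obtain c where c: "max (lo K $ i) (lo L $ i) < c" "c < min (hi K $ i) (hi L $ i)" "c \<notin> endpoints"
    using generic_real[of "max (lo K $ i) (lo L $ i)" "min (hi K $ i) (hi L $ i)"] s by auto
  have "\<exists>p. lo Q $ j < p \<and> p < hi Q $ j \<and> p \<notin> endpoints" if "Q \<in> T" for Q j
    using generic_real[OF cell(2)[OF that]] by metis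
  then obtain p where p: "\<And>Q j. Q \<in> T \<Longrightarrow> lo Q $ j < p Q j \<and> p Q j < hi Q $ j \<and> p Q j \<notin> endpoints" by metis
  define pt where "pt Q = (\<chi> j. if j = i then c else p Q j)" for Q
  have gen: "pt Q $ j \<notin> endpoints" if "Q \<in> T" for Q j using p[OF that] c(3) by (simp add: pt_def)
  have int: "pt Q \<in> interior Q" if "Q \<in> {K, L}" for Q
    using that p K L c by (auto simp: mem_interior_cell pt_def)
  have x: "pt K \<in> K" and "pt L \<in> L" using int interior_subset by blast+
  then have y: "pt L \<in> cbox a b" using cell_subset[OF L] by blast
  obtain M where M: "M \<in> T" "(\<chi> j. if j \<in> UNIV - {i} then pt L $ j else pt K $ j) \<in> M"
      "\<forall>j. j \<notin> UNIV - {i} \<longrightarrow> same_side j K M"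
    using generic_path[OF K x gen[OF K] y gen[OF L], of "UNIV - {i}"] by auto
  have "(\<chi> j. if j \<in> UNIV - {i} then pt L $ j else pt K $ j) = pt L"
    by (auto simp: vec_eq_iff pt_def)
  with M have "pt L \<in> M" by simp
  then have "pt L \<in> interior M"
    using generic_interior[OF M(1) _ gen[OF L]] by (simp add: mem_interior_cell[OF M(1)])
  then have "M = L" using disjoint_cells[OF M(1) L] int by blast
  then show ?thesis using M(3) by auto
qed

text \<open>A tensor grid has a cell for every combination of sides. One such cell lets shape
  regularity compare sides of \<open>K\<close> and \<open>L\<close> in different directions.\<close>

lemma cross_cell:
  assumes K: "K \<in> T" and L: "L \<in> T" and "i \<noteq> m"
  obtains M where "M \<in> T" "same_side i K M" "same_side m L M"
proof -
  obtain p where p: "lo K $ i < p" "p < hi K $ i" "p \<notin> endpoints" using generic_real[OF cell(2)[OF K]] by blast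
  obtain q where q: "lo L $ m < q" "q < hi L $ m" "q \<notin> endpoints" using generic_real[OF cell(2)[OF L]] by blast
  have "\<exists>c. a $ j < c \<and> c < b $ j \<and> c \<notin> endpoints" for j using generic_real[OF ab] by metis
  then obtain c where c: "\<And>j. a $ j < c j \<and> c j < b $ j \<and> c j \<notin> endpoints" by metis
  define z where "z = (\<chi> j. if j = i then p else if j = m then q else c j)"
  have bnd: "a $ j \<le> lo Q $ j \<and> hi Q $ j \<le> b $ j" if Q: "Q \<in> T" for Q j
  proof -
    have "lo Q \<in> Q" "hi Q \<in> Q" using cell(2)[OF Q] by (auto simp: mem_cell[OF Q] less_imp_le)
    then show ?thesis using cell_subset[OF Q] by (auto simp: mem_box_cart)
  qed
  have "z \<in> cbox a b"
    using bnd[OF K, of i] bnd[OF L, of m] p q c by (auto simp: z_def mem_box_cart less_imp_le)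
  then obtain M where M: "M \<in> T" "z \<in> M" using Union_T by blast
  have gen: "z $ j \<notin> endpoints" for j using p q c by (simp add: z_def)
  have "lo M $ j < z $ j \<and> z $ j < hi M $ j" for j by (rule generic_interior[OF M gen])
  from this[of i] this[of m] have "lo M $ i < p \<and> p < hi M $ i" "lo M $ m < q \<and> q < hi M $ m"
    using \<open>i \<noteq> m\<close> by (auto simp: z_def)
  then show ?thesis using that[OF M(1)] overlap_same_side[OF K M(1)] overlap_same_side[OF L M(1)] p q by blast
qed

lemma side_le_diameter:
  assumes K: "K \<in> T"
  shows "hi K $ i - lo K $ i \<le> diameter K"
proof -
  have "lo K \<in> K" "hi K \<in> K" using cell(2)[OF K] by (auto simp: mem_cell[OF K] less_imp_le)
  moreover have "bounded K" using cell(1)[OF K] bounded_cbox by metis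
  ultimately have "dist (hi K) (lo K) \<le> diameter K" by (intro diameter_bounded_bound) auto
  moreover have "hi K $ i - lo K $ i \<le> norm (hi K - lo K)"
    using component_le_norm_cart[of "hi K - lo K" i] by simp
  ultimately show ?thesis by (simp add: dist_norm)
qed

lemma side_ge_ball:
  assumes K: "K \<in> T" and ball: "cball x \<rho> \<subseteq> K" and "0 \<le> \<rho>"
  shows "2 * \<rho> \<le> hi K $ i - lo K $ i"
proof -
  have "x + \<rho> *\<^sub>R axis i 1 \<in> cball x \<rho>" "x - \<rho> *\<^sub>R axis i 1 \<in> cball x \<rho>"
    using \<open>0 \<le> \<rho>\<close> by (auto simp: dist_norm)
  then have "x + \<rho> *\<^sub>R axis i 1 \<in> K" "x - \<rho> *\<^sub>R axis i 1 \<in> K" using ball by auto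
  then have "(x + \<rho> *\<^sub>R axis i 1) $ i \<le> hi K $ i" "lo K $ i \<le> (x - \<rho> *\<^sub>R axis i 1) $ i"
    unfolding mem_cell[OF K] by blast+
  then show ?thesis by (simp add: axis_def)
qed

lemma T_nonempty: "T \<noteq> {}"
proof
  assume "T = {}"
  moreover have "a \<in> cbox a b" using ab by (auto simp: mem_box_cart less_imp_le)
  ultimately show False using Union_T by auto
qed

text \<open>A conforming mesh of boxes is a tensor product grid, so that shape regularity already
  implies quasi-uniformity.\<close>

lemma quasi_uniform:
  assumes card: "CARD('n) \<ge> 2" and \<sigma>: "\<sigma> > 0" "\<And>K. K \<in> T \<Longrightarrow> \<exists>x. cball x (\<sigma> * diameter K) \<subseteq> K" and K: "K \<in> T"
  shows "4 * \<sigma>\<^sup>2 * mesh_size T \<le> hi K $ i - lo K $ i"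
proof -
  have side: "2 * (\<sigma> * diameter Q) \<le> hi Q $ j - lo Q $ j" if Q: "Q \<in> T" for Q j
  proof -
    obtain x where "cball x (\<sigma> * diameter Q) \<subseteq> Q" using \<sigma>(2)[OF Q] by blast
    moreover have "bounded Q" using cell(1)[OF Q] bounded_cbox by metis
    ultimately show ?thesis using \<sigma>(1) diameter_ge_0[of Q] by (intro side_ge_ball[OF Q]) auto
  qed
  have "Max (diameter ` T) \<in> diameter ` T" using T_nonempty by (intro Max_in) auto
  then obtain L where "Max (diameter ` T) = diameter L" "L \<in> T" by (rule imageE)
  then have L: "L \<in> T" "diameter L = mesh_size T" by (simp_all add: mesh_size_def)
  obtain m where "i \<noteq> m"
  proof -
    have "\<exists>m. i \<noteq> m"
    proof (rule ccontr)
      assume "\<nexists>m. i \<noteq> m"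
      then have "UNIV = {i}" by auto
      then have "CARD('n) = card {i}" by (rule arg_cong)
      with card show False by simp
    qed
    then show ?thesis using that by blast
  qed
  then obtain M where M: "M \<in> T" "same_side i K M" "same_side m L M" using cross_cell[OF K L(1)] by blast
  \<comment> \<open>\<open>L\<close> is a largest cell and \<open>M\<close> shares its side in
    direction \<open>m\<close> and that of \<open>K\<close> in direction \<open>i\<close>. Shape
    regularity is used once in \<open>L\<close> and once in \<open>M\<close>, each time with the
    factor 2 * \<sigma>.\<close>
  have "4 * \<sigma>\<^sup>2 * mesh_size T = 2 * \<sigma> * (2 * (\<sigma> * diameter L))" by (simp add: L(2) power2_eq_square)
  also have "\<dots> \<le> 2 * \<sigma> * (hi L $ m - lo L $ m)" using side[OF L(1)] \<sigma>(1) by (intro mult_left_mono) auto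
  also have "\<dots> = 2 * \<sigma> * (hi M $ m - lo M $ m)" using M(3) by (simp add: same_side_def)
  also have "\<dots> \<le> 2 * \<sigma> * diameter M" using side_le_diameter[OF M(1)] \<sigma>(1) by (intro mult_left_mono) auto
  also have "\<dots> \<le> hi M $ i - lo M $ i" using side[OF M(1)] by (simp add: mult.assoc)
  also have "\<dots> = hi K $ i - lo K $ i" using M(2) by (simp add: same_side_def)
  finally show ?thesis .
qed

text \<open>For the intersection of two cells only \<open>face_of\<close> is at hand; membership in
  \<open>mesh_faces\<close> supplies the dimension n - 1. If \<open>c\<close> were strictly inside
  the side of \<open>K\<close>, a point of \<open>e\<close> would split a segment of
  \<open>K\<close> that leaves the hyperplane. A face of the slice that has the dimension of the
  hyperplane is the whole slice.\<close>

lemma face_eq: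
  assumes e: "e \<in> mesh_faces T" and K: "K \<in> T" and f: "e face_of K" and sub: "e \<subseteq> {x. x $ i = c}"
  shows "c \<in> {lo K $ i, hi K $ i}" and "e = K \<inter> {x. x $ i = c}"
proof -
  obtain K0 where K0: "K0 \<in> T" "e facet_of K0" using e by (auto simp: mesh_faces_def)
  have ne: "e \<noteq> {}" and dim0: "aff_dim e = aff_dim K0 - 1" using K0(2) by (auto simp: facet_of_def)
  have "interior K0 \<noteq> {}" using mesh K0(1) by (simp add: conforming_box_mesh_def)
  then have dim: "aff_dim e = int (DIM(real^'n)) - 1" using dim0 aff_dim_nonempty_interior by metis
  obtain z where z: "z \<in> e" using ne by blast
  then have zc: "z $ i = c" and zK: "z \<in> K" using sub face_of_imp_subset[OF f] by auto
  have "lo K $ i \<le> c" "c \<le> hi K $ i" using zK zc unfolding mem_cell[OF K] by auto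
  moreover have "\<not> (lo K $ i < c \<and> c < hi K $ i)"
  proof
    assume c: "lo K $ i < c \<and> c < hi K $ i"
    let ?p = "upd z i (lo K $ i)" and ?q = "upd z i (hi K $ i)"
    have pq: "?p \<in> K" "?q \<in> K"
      using zK cell(2)[OF K, of i] unfolding mem_cell[OF K] by (auto simp: less_imp_le)
    define t where "t = (c - lo K $ i) / (hi K $ i - lo K $ i)"
    have t: "0 < t" "t < 1" using c by (auto simp: t_def field_simps)
    have "t * (hi K $ i - lo K $ i) = c - lo K $ i" using c by (simp add: t_def)
    then have "z = (1 - t) *\<^sub>R ?p + t *\<^sub>R ?q" using zc by (auto simp: vec_eq_iff algebra_simps)
    moreover have "?p \<noteq> ?q" using c by (metis less_trans less_irrefl upd_nth)
    ultimately have "z \<in> open_segment ?p ?q" using t unfolding in_segment by blast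
    then have "?p \<in> e" using f z pq unfolding face_of_def by blast
    then show False using sub c by auto
  qed
  ultimately show "c \<in> {lo K $ i, hi K $ i}" by auto
  let ?E = "K \<inter> {x. x $ i = c}"
  have hyp: "{x::real^'n. x $ i = c} = {x. axis i 1 \<bullet> x = c}" by (simp add: inner_axis inner_commute)
  have conv: "convex ?E"
    unfolding hyp using cell(1)[OF K] convex_box(1) convex_hyperplane convex_Int by metis
  have "e face_of ?E" using f sub face_of_imp_subset[OF f] by (intro face_of_subset[OF f]) auto
  moreover have "aff_dim ?E \<le> aff_dim {x::real^'n. x $ i = c}" by (intro aff_dim_subset) simp
  moreover have "aff_dim {x::real^'n. x $ i = c} = int (DIM(real^'n)) - 1"
    unfolding hyp using aff_dim_hyperplane[of "axis i 1 :: real^'n" c] by (simp add: axis_eq_0_iff)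
  ultimately show "e = ?E" using face_of_aff_dim_lt[OF conv] dim by force
qed

lemma AE_cells:
  assumes "\<And>K. K \<in> T \<Longrightarrow> AE x in lebesgue_on (interior K). P x"
  shows "AE x in lebesgue_on (cbox a b). P x"
proof -
  have "AE x in lebesgue. \<forall>K\<in>T. x \<in> K \<longrightarrow> P x"
  proof (intro AE_finite_allI finite_T)
    fix K assume K: "K \<in> T"
    have "AE x in lebesgue_on (cbox (lo K) (hi K)). P x"
      using assms[OF K] unfolding AE_lebesgue_on_cbox_box cell(3)[OF K] .
    then have "AE x in lebesgue. x \<in> cbox (lo K) (hi K) \<longrightarrow> P x" by (subst (asm) AE_restrict_space_iff) auto
    then show "AE x in lebesgue. x \<in> K \<longrightarrow> P x" using cell(1)[OF K] by simp
  qed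
  then have "AE x in lebesgue. x \<in> cbox a b \<longrightarrow> P x" by eventually_elim (use Union_T in blast)
  then show ?thesis by (subst AE_restrict_space_iff) auto
qed

lemma integral_cells:
  fixes f :: "real^'n \<Rightarrow> real"
  assumes f: "integrable (lebesgue_on (cbox a b)) f"
  shows "(LINT x|lebesgue_on (cbox a b). f x) = (\<Sum>K\<in>T. LINT x|lebesgue_on K. f x)"
proof -
  have "(LINT x|lebesgue_on (cbox a b). f x) = integral (cbox a b) f"
    by (rule lebesgue_integral_eq_integral[OF f]) simp
  also have "\<dots> = (\<Sum>K\<in>T. integral K f)"
    using integrable_on_lebesgue_on[OF f] by (intro integral_combine_division_topdown division) simp
  also have "\<dots> = (\<Sum>K\<in>T. LINT x|lebesgue_on K. f x)"
  proof (rule sum.cong[OF refl])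
    fix K assume K: "K \<in> T"
    have KL: "K \<in> sets lebesgue" using cell(1)[OF K] lmeasurable_cbox fmeasurableD by metis
    have "integrable (lebesgue_on K) f"
      by (rule integrable_subset_lebesgue_on[OF f cell_subset[OF K] KL]) simp
    then show "integral K f = (LINT x|lebesgue_on K. f x)"
      using lebesgue_integral_eq_integral[OF _ KL] by metis
  qed
  finally show ?thesis .
qed

end

section \<open>Restriction to cells and moments of boxes\<close>

lemma sq_integrable_subset:
  fixes f :: "real^'n \<Rightarrow> real"
  assumes f: "sq_integrable (lebesgue_on S) f" and RS: "R \<subseteq> S" "R \<in> sets lebesgue" "S \<in> sets lebesgue"
  shows "sq_integrable (lebesgue_on R) f"
proof -
  have "f \<in> borel_measurable (lebesgue_on R)"
    using sq_integrable_measurable[OF f] RS(1) by (rule measurable_restrict_mono)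
  then show ?thesis
    using integrable_subset_lebesgue_on[OF sq_integrable_square[OF f] RS] by (simp add: sq_integrable_def)
qed

lemma integral_sq_subset:
  fixes f :: "real^'n \<Rightarrow> real"
  assumes f: "sq_integrable (lebesgue_on S) f" and RS: "R \<subseteq> S" "R \<in> sets lebesgue" "S \<in> sets lebesgue"
  shows "(LINT x|lebesgue_on R. (f x)\<^sup>2) \<le> (LINT x|lebesgue_on S. (f x)\<^sup>2)"
  by (rule integral_mono_lebesgue_on_AE[OF sq_integrable_square[OF f] _ _ RS]) (auto intro!: AE_I2)

lemma sq_tendsto_subset:
  fixes f :: "real^'n \<Rightarrow> real"
  assumes F: "sq_tendsto (lebesgue_on S) F f" and RS: "R \<subseteq> S" "R \<in> sets lebesgue" "S \<in> sets lebesgue"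
  shows "sq_tendsto (lebesgue_on R) F f"
proof (rule sq_tendstoI)
  have i: "sq_integrable (lebesgue_on S) (F k)" "sq_integrable (lebesgue_on S) f" for k
    using F by (auto simp: sq_tendsto_def)
  show "sq_integrable (lebesgue_on R) (F k)" "sq_integrable (lebesgue_on R) f" for k
    by (rule sq_integrable_subset[OF i(1) RS], rule sq_integrable_subset[OF i(2) RS])
  show "(LINT x|lebesgue_on R. (F k x - f x)\<^sup>2) \<le> (LINT x|lebesgue_on S. (F k x - f x)\<^sup>2)" for k
    by (rule integral_sq_subset[OF sq_integrable_diff[OF i] RS])
  show "(\<lambda>k. LINT x|lebesgue_on S. (F k x - f x)\<^sup>2) \<longlonglongrightarrow> 0" using F by (simp add: sq_tendsto_def)
qed

lemma has_weak_grad_cong: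
  assumes w: "has_weak_grad U v g" and U: "U \<in> sets lebesgue"
    and eq: "\<And>x. x \<in> U \<Longrightarrow> v x = v' x" "\<And>x. x \<in> U \<Longrightarrow> g x = g' x"
  shows "has_weak_grad U v' g'"
proof -
  have sp: "space (lebesgue_on U) = U" using U by (simp add: space_restrict_space)
  have "g' \<in> L2 U"
  proof -
    have "g' \<in> borel_measurable (lebesgue_on U)"
      using w eq(2) by (subst measurable_cong[of _ _ g]) (auto simp: sp has_weak_grad_def L2_def)
    moreover have "integrable (lebesgue_on U) (\<lambda>x. (norm (g' x))\<^sup>2)"
      using w eq(2) by (subst Bochner_Integration.integrable_cong[OF refl, of _ _ "\<lambda>x. (norm (g x))\<^sup>2"])
        (auto simp: sp has_weak_grad_def L2_def)
    ultimately show ?thesis by (simp add: L2_def)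
  qed
  moreover have "(LINT x|lebesgue_on U. v' x * partial_deriv i \<phi> x) = - (LINT x|lebesgue_on U. g' x $ i * \<phi> x)"
    if "test_function U \<phi>" for \<phi> i
  proof -
    have "(LINT x|lebesgue_on U. v' x * partial_deriv i \<phi> x) = (LINT x|lebesgue_on U. v x * partial_deriv i \<phi> x)"
      "(LINT x|lebesgue_on U. g' x $ i * \<phi> x) = (LINT x|lebesgue_on U. g x $ i * \<phi> x)"
      using eq by (auto intro!: Bochner_Integration.integral_cong simp: sp)
    then show ?thesis using w that by (simp add: has_weak_grad_def)
  qed
  ultimately show ?thesis by (simp add: has_weak_grad_def)
qed

text \<open>Mean and variance of a coordinate that is uniformly distributed on an interval, whence
  the 12.\<close>

lemma cbox_coordinate_moments:
  fixes l r :: "real^'n"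
  assumes lr: "\<And>i. l $ i < r $ i" and c: "c = (l $ i + r $ i) / 2" and s: "s = (r $ i - l $ i)\<^sup>2 / 12"
  shows "(LINT x|lebesgue_on (cbox l r). x $ i - c) = 0"
    and "(LINT x|lebesgue_on (cbox l r). (x $ i - c)\<^sup>2) = s * measure lebesgue (cbox l r)"
proof -
  have le: "l $ i \<le> r $ i" using lr less_imp_le by blast
  have cont: "\<exists>B. \<forall>t\<in>{l $ i..r $ i}. \<bar>h t\<bar> \<le> B" if "continuous_on UNIV h" for h :: "real \<Rightarrow> real"
  proof -
    have "compact (h ` {l $ i..r $ i})" by (intro compact_continuous_image continuous_on_subset[OF that]) auto
    then show ?thesis using compact_imp_bounded[of "h ` {l $ i..r $ i}"] by (auto simp: bounded_iff)
  qed
  have sep: "(LINT x|lebesgue_on (cbox l r). h (x $ i)) = 0"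
    if h: "continuous_on UNIV h" "(h has_integral 0) {l $ i..r $ i}" for h :: "real \<Rightarrow> real"
  proof -
    obtain B where B: "\<forall>t\<in>{l $ i..r $ i}. \<bar>h t\<bar> \<le> B" using cont[OF h(1)] by blast
    have "(LINT x|lebesgue_on (cbox l r). h (x $ i) * (\<lambda>_. 1) x) = 0"
      by (rule integral_separated_0[where C="max B 1"])
        (use B h in \<open>auto intro: borel_measurable_continuous_onI simp: le_max_iff_disj\<close>)
    then show ?thesis by simp
  qed
  have "((\<lambda>t. t - c) has_integral ((r $ i - c)\<^sup>2 / 2 - (l $ i - c)\<^sup>2 / 2)) {l $ i..r $ i}"
    by (rule fundamental_theorem_of_calculus[OF le])
      (auto simp flip: has_real_derivative_iff_has_vector_derivative intro!: derivative_eq_intros)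
  moreover have "(r $ i - c)\<^sup>2 / 2 - (l $ i - c)\<^sup>2 / 2 = 0"
    by (simp add: c power2_eq_square field_simps)
  ultimately have "((\<lambda>t. t - c) has_integral 0) {l $ i..r $ i}" by (simp only:)
  from sep[OF _ this] show "(LINT x|lebesgue_on (cbox l r). x $ i - c) = 0"
    by (simp add: continuous_intros)
  have "((\<lambda>t. (t - c)\<^sup>2 - s) has_integral (((r $ i - c) ^ 3 / 3 - s * r $ i) - ((l $ i - c) ^ 3 / 3 - s * l $ i))) {l $ i..r $ i}"
    by (rule fundamental_theorem_of_calculus[OF le])
      (auto simp flip: has_real_derivative_iff_has_vector_derivative intro!: derivative_eq_intros)
  moreover have "((r $ i - c) ^ 3 / 3 - s * r $ i) - ((l $ i - c) ^ 3 / 3 - s * l $ i) = 0"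
  proof -
    define d where "d = r $ i - l $ i"
    have e: "r $ i - c = d / 2" "l $ i - c = - (d / 2)" by (auto simp: c d_def field_simps)
    have "((r $ i - c) ^ 3 / 3 - s * r $ i) - ((l $ i - c) ^ 3 / 3 - s * l $ i) = (d / 2) ^ 3 / 3 - (- (d / 2)) ^ 3 / 3 - s * d"
      unfolding e by (simp add: d_def right_diff_distrib)
    also have "\<dots> = 0" by (simp add: s d_def[symmetric] power2_eq_square power3_eq_cube)
    finally show ?thesis .
  qed
  ultimately have "((\<lambda>t. (t - c)\<^sup>2 - s) has_integral 0) {l $ i..r $ i}" by (simp only:)
  from sep[OF _ this] have "(LINT x|lebesgue_on (cbox l r). (x $ i - c)\<^sup>2 - s) = 0"
    by (simp add: continuous_intros)
  moreover have "integrable (lebesgue_on (cbox l r)) (\<lambda>x. (x $ i - c)\<^sup>2)"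
    by (intro sq_integrable_square smooth_sq_integrable_box smooth_diff smooth_coord smooth_const)
  moreover have "integrable (lebesgue_on (cbox l r)) (\<lambda>x. s)"
    by (intro sq_integrable_integrable lmeasurable_box_finite smooth_sq_integrable_box smooth_const)
  moreover have "measure (lebesgue_on (cbox l r)) (space (lebesgue_on (cbox l r))) = measure lebesgue (cbox l r)"
    by (simp add: measure_restrict_space)
  ultimately show "(LINT x|lebesgue_on (cbox l r). (x $ i - c)\<^sup>2) = s * measure lebesgue (cbox l r)"
    by (simp add: mult.commute)
qed

definition quad_poly :: "real \<Rightarrow> ('n \<Rightarrow> real) \<Rightarrow> ('n \<Rightarrow> real) \<Rightarrow> ('n \<Rightarrow> real) \<Rightarrow> real^'n \<Rightarrow> real" where
  "quad_poly \<alpha> \<beta> \<gamma> c x = \<alpha> + (\<Sum>i\<in>UNIV. \<beta> i * (x $ i - c i)) + (\<Sum>i\<in>UNIV. \<gamma> i * (x $ i - c i)\<^sup>2)"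

lemma smooth_quad_poly: "smooth (quad_poly \<alpha> \<beta> \<gamma> c)"
  unfolding quad_poly_def[abs_def]
  by (intro smooth_add smooth_sum smooth_mult smooth_power smooth_diff smooth_const smooth_coord)

lemma partial_deriv_quad_poly:
  "partial_deriv i (quad_poly \<alpha> \<beta> \<gamma> c) x = \<beta> i + 2 * \<gamma> i * (x $ i - c i)"
proof -
  have coord: "((\<lambda>x. x $ j) has_derivative (\<lambda>h. h $ j)) (at x)" for j
    by (intro bounded_linear_imp_has_derivative bounded_linear_vec_nth)
  have "(quad_poly \<alpha> \<beta> \<gamma> c has_derivative
    (\<lambda>h. 0 + (\<Sum>j\<in>UNIV. \<beta> j * (h $ j)) + (\<Sum>j\<in>UNIV. \<gamma> j * (2 * (x $ j - c j) * h $ j)))) (at x)"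
    unfolding quad_poly_def[abs_def]
    by (auto intro!: derivative_eq_intros coord simp: fun_eq_iff algebra_simps)
  from partial_deriv_eq[OF this]
  have "partial_deriv i (quad_poly \<alpha> \<beta> \<gamma> c) x = (\<Sum>j\<in>UNIV. \<beta> j * axis i 1 $ j) + (\<Sum>j\<in>UNIV. \<gamma> j * (2 * (x $ j - c j) * axis i 1 $ j))"
    by simp
  also have "\<dots> = \<beta> i + 2 * \<gamma> i * (x $ i - c i)"
    by (simp add: axis_def if_distrib[of "\<lambda>y. _ * y"] sum.delta cong: if_cong)
  finally show ?thesis .
qed

lemma quad_poly_EQ1rot: "(\<lambda>x. \<kappa> * quad_poly \<alpha> \<beta> \<gamma> (\<lambda>i. (lo K $ i + hi K $ i) / 2) x) \<in> EQ1rot K"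
proof -
  let ?c = "\<lambda>i. (lo K $ i + hi K $ i) / 2" and ?d = "\<lambda>i. (hi K $ i - lo K $ i) / 2"
  have eq: "((\<lambda>x. \<kappa> * quad_poly \<alpha> \<beta> \<gamma> ?c x) \<circ> cell_map K) x =
    \<kappa> * \<alpha> + (\<Sum>i\<in>UNIV. (\<kappa> * \<beta> i * ?d i) * x $ i) + (\<Sum>i\<in>UNIV. (\<kappa> * \<gamma> i * (?d i)\<^sup>2) * (x $ i)\<^sup>2)" for x
    by (simp add: quad_poly_def cell_map_def distrib_left sum_distrib_left power_mult_distrib power_divide mult.assoc)
  show ?thesis unfolding EQ1rot_def EQ1rot_ref_def mem_Collect_eq by (intro exI allI) (rule eq)
qed

section \<open>Piecewise smooth functions on a mesh\<close>

context box_mesh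
begin

lemma cell_lebesgue: "K \<in> T \<Longrightarrow> K \<in> sets lebesgue"
  using cell(1)[of K] lmeasurable_cbox fmeasurableD by metis

lemma domain_lebesgue: "cbox a b \<in> sets lebesgue" by simp

lemma finite_cell_measure: "K \<in> T \<Longrightarrow> finite_measure (lebesgue_on K)"
  using cell(1)[of K] lmeasurable_box_finite(2) by metis

lemma measure_cell:
  assumes K: "K \<in> T"
  shows "measure lebesgue K = (\<Prod>i\<in>UNIV. hi K $ i - lo K $ i)"
proof -
  have "lo K \<in> cbox (lo K) (hi K)" using cell(2)[OF K] by (auto simp: mem_box_cart less_imp_le)
  then have ne: "cbox (lo K) (hi K) \<noteq> {}" by blast
  have "measure lebesgue K = measure lebesgue (cbox (lo K) (hi K))" by (rule arg_cong[OF cell(1)[OF K]])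
  also have "\<dots> = (\<Prod>i\<in>UNIV. hi K $ i - lo K $ i)" using content_cbox_cart[OF ne] by simp
  finally show ?thesis .
qed

lemma measure_cell_pos: "K \<in> T \<Longrightarrow> measure lebesgue K > 0"
  using cell(2)[of K] by (simp add: measure_cell prod_pos)

lemma smooth_sq_cell: "K \<in> T \<Longrightarrow> smooth f \<Longrightarrow> sq_integrable (lebesgue_on K) f"
  using cell(1)[of K] smooth_sq_integrable_box(2) by metis

text \<open>Only cell interiors contribute, so the sum has at most one nonzero term at each point
  and the faces, a null set, get the value 0.\<close>

definition piecewise :: "((real^'n) set \<Rightarrow> real^'n \<Rightarrow> real) \<Rightarrow> real^'n \<Rightarrow> real" where
  "piecewise F x = (\<Sum>K\<in>T. indicator (interior K) x * F K x)"

lemma piecewise_eq: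
  assumes "K \<in> T" "x \<in> interior K"
  shows "piecewise F x = F K x"
proof -
  have "piecewise F x = (\<Sum>L\<in>T. if L = K then F K x else 0)"
    unfolding piecewise_def using assms disjoint_cells by (intro sum.cong) (auto simp: indicator_def)
  then show ?thesis using assms by simp
qed

lemma piecewise_cell_AE:
  assumes "K \<in> T"
  shows "AE x in lebesgue_on K. piecewise F x = F K x"
proof -
  have "AE x in lebesgue_on (box (lo K) (hi K)). piecewise F x = F K x"
    using piecewise_eq[OF assms] by (intro AE_I2) (simp add: space_restrict_space cell(3)[OF assms])
  moreover have "lebesgue_on K = lebesgue_on (cbox (lo K) (hi K))" by (rule arg_cong[OF cell(1)[OF assms]])
  ultimately show ?thesis by (simp only: AE_lebesgue_on_cbox_box)
qed

lemma piecewise_sq_integrable: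
  assumes "\<And>K. K \<in> T \<Longrightarrow> smooth (F K)"
  shows "sq_integrable (lebesgue_on (cbox a b)) (piecewise F)"
  unfolding piecewise_def[abs_def]
proof (intro sq_integrable_sum sq_integrable_bounded_mult[where C=1])
  fix K assume "K \<in> T"
  show "sq_integrable (lebesgue_on (cbox a b)) (F K)" by (rule smooth_sq_integrable_box(2)[OF assms]) fact
  show "indicat_real (interior K) \<in> borel_measurable (lebesgue_on (cbox a b))"
    by (intro borel_measurable_lebesgue_on borel_measurable_indicator) simp
qed (auto simp: indicator_def)

lemma piecewise_power4_integrable:
  assumes "\<And>K. K \<in> T \<Longrightarrow> smooth (F K)"
  shows "integrable (lebesgue_on (cbox a b)) (\<lambda>x. piecewise F x ^ 4)"
proof -
  have s: "sq_integrable (lebesgue_on (cbox a b)) (piecewise (\<lambda>K x. (F K x)\<^sup>2))"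
    by (intro piecewise_sq_integrable smooth_power assms)
  have ae: "AE x in lebesgue_on (cbox a b). (piecewise (\<lambda>K x. (F K x)\<^sup>2) x)\<^sup>2 = piecewise F x ^ 4"
  proof (rule AE_cells)
    fix K assume K: "K \<in> T"
    show "AE x in lebesgue_on (interior K). (piecewise (\<lambda>K x. (F K x)\<^sup>2) x)\<^sup>2 = piecewise F x ^ 4"
      by (intro AE_I2) (simp add: space_restrict_space piecewise_eq[OF K] flip: power_mult)
  qed
  have m: "(\<lambda>x. piecewise F x ^ 4) \<in> borel_measurable (lebesgue_on (cbox a b))"
  proof -
    have "sq_integrable (lebesgue_on (cbox a b)) (piecewise F)" by (rule piecewise_sq_integrable) (rule assms)
    from sq_integrable_measurable[OF this] show ?thesis by simp
  qed
  show ?thesis by (rule integrable_cong_AE_imp[OF sq_integrable_square[OF s] m ae])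
qed

end

section \<open>The interpolant of the ground state\<close>

locale interpolation = ground_state_problem a b V \<beta> C\<^sub>V u g \<phi> + mesh: box_mesh a b T
  for a b :: "real^'n" and V \<beta> C\<^sub>V u g \<phi> T
begin

definition avg :: "(real^'n) set \<Rightarrow> (real^'n \<Rightarrow> real) \<Rightarrow> real" where
  "avg K f = (LINT x|lebesgue_on K. f x) / measure lebesgue K"

definition cen :: "(real^'n) set \<Rightarrow> 'n \<Rightarrow> real" where
  "cen K i = (lo K $ i + hi K $ i) / 2"

definition mom :: "(real^'n) set \<Rightarrow> 'n \<Rightarrow> real" where
  "mom K i = (hi K $ i - lo K $ i)\<^sup>2 / 12"

definition slope :: "(real^'n) set \<Rightarrow> 'n \<Rightarrow> real" where
  "slope K i = avg K (\<lambda>x. g x $ i)"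

text \<open>The derivative of the quadratic term is \<open>2 * curv K i * (x $ i - cen K i)\<close>;
  matching its first moment with that of the gradient component divides by twice the variance
  \<open>mom K i\<close>.\<close>

definition curv :: "(real^'n) set \<Rightarrow> 'n \<Rightarrow> real" where
  "curv K i = avg K (\<lambda>x. g x $ i * (x $ i - cen K i)) / (2 * mom K i)"

text \<open>The interpolant of \<open>u\<close> on a cell is fixed by the mean of \<open>u\<close> and by the moments of order
  zero and one of \<open>\<partial>\<^sub>i u\<close> in \<open>x $ i\<close>; by the divergence theorem, this is the same as preserving the
  means over the cell and over its faces.\<close>

definition interp :: "(real^'n) set \<Rightarrow> real^'n \<Rightarrow> real" where
  "interp K = quad_poly (avg K u - (\<Sum>i\<in>UNIV. curv K i * mom K i)) (slope K) (curv K) (cen K)"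

lemma smooth_interp: "smooth (interp K)"
  unfolding interp_def by (rule smooth_quad_poly)

lemma partial_interp: "partial_deriv i (interp K) x = slope K i + 2 * curv K i * (x $ i - cen K i)"
  unfolding interp_def by (rule partial_deriv_quad_poly)

lemma sq_cell: "K \<in> T \<Longrightarrow> sq_integrable M f \<Longrightarrow> sq_integrable (lebesgue_on K) f"
  using sq_integrable_subset mesh.cell_subset mesh.cell_lebesgue mesh.domain_lebesgue by blast

lemma conv_cell: "K \<in> T \<Longrightarrow> sq_tendsto M F f \<Longrightarrow> sq_tendsto (lebesgue_on K) F f"
  using sq_tendsto_subset mesh.cell_subset mesh.cell_lebesgue mesh.domain_lebesgue by blast

lemma sq_coord: "sq_integrable (lebesgue_on K) (\<lambda>x. x $ i - c)" if "K \<in> T"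
  by (intro mesh.smooth_sq_cell[OF that] smooth_diff smooth_coord smooth_const)

lemma sq_const: "sq_integrable (lebesgue_on K) (\<lambda>x. c)" if "K \<in> T"
  by (intro mesh.smooth_sq_cell[OF that] smooth_const)

lemma int_const: "K \<in> T \<Longrightarrow> (LINT x|lebesgue_on K. c) = c * measure lebesgue K"
  using mesh.cell_lebesgue by (simp add: measure_restrict_space)

lemma int_coord:
  assumes K: "K \<in> T"
  shows "(LINT x|lebesgue_on K. x $ i - cen K i) = 0"
    and "(LINT x|lebesgue_on K. (x $ i - cen K i)\<^sup>2) = mom K i * measure lebesgue K"
proof -
  have eq: "lebesgue_on K = lebesgue_on (cbox (lo K) (hi K))" "measure lebesgue K = measure lebesgue (cbox (lo K) (hi K))"
    by (rule arg_cong[OF mesh.cell(1)[OF K]])+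
  show "(LINT x|lebesgue_on K. x $ i - cen K i) = 0"
    unfolding eq by (rule cbox_coordinate_moments(1)[OF mesh.cell(2)[OF K] _ refl]) (simp add: cen_def)
  show "(LINT x|lebesgue_on K. (x $ i - cen K i)\<^sup>2) = mom K i * measure lebesgue K"
    unfolding eq by (rule cbox_coordinate_moments(2)[OF mesh.cell(2)[OF K]]) (simp_all add: cen_def mom_def)
qed

lemma mom_pos: "K \<in> T \<Longrightarrow> mom K i > 0"
  using mesh.cell(2)[of K i] by (simp add: mom_def)

text \<open>The quadratic part of \<open>interp K\<close> has the mean that its constant term
  subtracts, so the mean of \<open>u\<close> remains.\<close>

lemma interp_moment_0:
  assumes K: "K \<in> T"
  shows "(LINT x|lebesgue_on K. u x - interp K x) = 0"
proof -
  let ?M = "lebesgue_on K" and ?v = "measure lebesgue K"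
  have fin: "finite_measure ?M" by (rule mesh.finite_cell_measure[OF K])
  have iu: "integrable ?M u" by (rule sq_integrable_integrable[OF fin sq_cell[OF K u_sq]])
  have i1: "integrable ?M (\<lambda>x. x $ i - cen K i)" "integrable ?M (\<lambda>x. (x $ i - cen K i)\<^sup>2)" for i
    by (rule sq_integrable_integrable[OF fin sq_coord[OF K]], rule sq_integrable_square[OF sq_coord[OF K]])
  have ic: "integrable ?M (\<lambda>x. c)" for c :: real by (rule sq_integrable_integrable[OF fin sq_const[OF K]])
  have "(LINT x|?M. interp K x) = (avg K u - (\<Sum>i\<in>UNIV. curv K i * mom K i)) * ?v
     + (\<Sum>i\<in>UNIV. slope K i * 0) + (\<Sum>i\<in>UNIV. curv K i * (mom K i * ?v))"
    unfolding interp_def quad_poly_def using i1 ic int_coord[OF K] int_const[OF K, of 1]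
    by (simp add: Bochner_Integration.integral_sum)
  also have "\<dots> = avg K u * ?v" by (simp add: algebra_simps sum_distrib_left)
  also have "\<dots> = (LINT x|?M. u x)" using mesh.measure_cell_pos[OF K] by (simp add: avg_def)
  finally have "(LINT x|?M. interp K x) = (LINT x|?M. u x)" .
  moreover have "integrable ?M (interp K)"
    by (rule sq_integrable_integrable[OF fin mesh.smooth_sq_cell[OF K smooth_interp]])
  ultimately show ?thesis using iu by simp
qed

lemma interp_moment_1:
  assumes K: "K \<in> T"
  shows "(LINT x|lebesgue_on K. g x $ i - partial_deriv i (interp K) x) = 0"
    and "(LINT x|lebesgue_on K. (g x $ i - partial_deriv i (interp K) x) * (x $ i - cen K i)) = 0"
proof -
  let ?M = "lebesgue_on K" and ?v = "measure lebesgue K"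
  have fin: "finite_measure ?M" by (rule mesh.finite_cell_measure[OF K])
  have v: "?v > 0" by (rule mesh.measure_cell_pos[OF K])
  have ig: "integrable ?M (\<lambda>x. g x $ i)" by (rule sq_integrable_integrable[OF fin sq_cell[OF K g_sq]])
  have i1: "integrable ?M (\<lambda>x. x $ i - cen K i)" "integrable ?M (\<lambda>x. (x $ i - cen K i)\<^sup>2)" for i
    by (rule sq_integrable_integrable[OF fin sq_coord[OF K]], rule sq_integrable_square[OF sq_coord[OF K]])
  have ic: "integrable ?M (\<lambda>x. c)" for c :: real by (rule sq_integrable_integrable[OF fin sq_const[OF K]])
  have igx: "integrable ?M (\<lambda>x. g x $ i * (x $ i - cen K i))"
    by (rule sq_integrable_mult[OF sq_cell[OF K g_sq] sq_coord[OF K]])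
  have "(LINT x|?M. g x $ i - (slope K i + 2 * curv K i * (x $ i - cen K i))) =
    (LINT x|?M. g x $ i) - (slope K i * ?v + 2 * curv K i * 0)"
    using ig i1(1) ic int_coord(1)[OF K] int_const[OF K]
    by (subst Bochner_Integration.integral_diff; simp)
  also have "\<dots> = 0" using v by (simp add: slope_def avg_def)
  finally show "(LINT x|?M. g x $ i - partial_deriv i (interp K) x) = 0" by (simp only: partial_interp)
  have eq: "(g x $ i - (slope K i + 2 * curv K i * (x $ i - cen K i))) * (x $ i - cen K i) =
    g x $ i * (x $ i - cen K i) - (slope K i * (x $ i - cen K i) + 2 * curv K i * (x $ i - cen K i)\<^sup>2)" for x
    by (simp add: algebra_simps power2_eq_square)
  have "(LINT x|?M. g x $ i * (x $ i - cen K i) - (slope K i * (x $ i - cen K i) + 2 * curv K i * (x $ i - cen K i)\<^sup>2)) =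
    (LINT x|?M. g x $ i * (x $ i - cen K i)) - (slope K i * (LINT x|?M. x $ i - cen K i) + 2 * curv K i * (LINT x|?M. (x $ i - cen K i)\<^sup>2))"
    using igx i1
    by (subst Bochner_Integration.integral_diff; (simp del: Bochner_Integration.integral_diff)?)
  also have "\<dots> = (LINT x|?M. g x $ i * (x $ i - cen K i)) - 2 * curv K i * (mom K i * ?v)"
    unfolding int_coord[OF K] by simp
  also have "\<dots> = 0" using v mom_pos[OF K, of i] by (simp add: curv_def avg_def)
  finally show "(LINT x|?M. (g x $ i - partial_deriv i (interp K) x) * (x $ i - cen K i)) = 0"
    by (simp only: partial_interp eq)
qed

lemma grad_error_sq: "K \<in> T \<Longrightarrow> sq_integrable (lebesgue_on K) (\<lambda>x. g x $ i - partial_deriv i (interp K) x)"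
  by (rule sq_integrable_diff[OF sq_cell[OF _ g_sq] mesh.smooth_sq_cell[OF _ smooth_partial[OF smooth_interp]]])

text \<open>Affine weights in \<open>x $ i\<close> cover both uses: the derivative of the
  interpolant itself, and the factor of \<open>face_mean\<close> that vanishes on the opposite
  face.\<close>

lemma interp_orthogonal_affine:
  assumes K: "K \<in> T"
  shows "(LINT x|lebesgue_on K. (g x $ i - partial_deriv i (interp K) x) * (\<alpha> + \<gamma> * (x $ i - cen K i))) = 0"
proof -
  let ?M = "lebesgue_on K" and ?e = "\<lambda>x. g x $ i - partial_deriv i (interp K) x"
  have i: "integrable ?M ?e" "integrable ?M (\<lambda>x. ?e x * (x $ i - cen K i))"
    using sq_integrable_integrable[OF mesh.finite_cell_measure[OF K] grad_error_sq[OF K]]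
      sq_integrable_mult[OF grad_error_sq[OF K] sq_coord[OF K]] by auto
  have "(LINT x|?M. ?e x * (\<alpha> + \<gamma> * (x $ i - cen K i))) = (LINT x|?M. \<alpha> * ?e x + \<gamma> * (?e x * (x $ i - cen K i)))"
    by (intro Bochner_Integration.integral_cong refl) (simp add: algebra_simps)
  also have "\<dots> = \<alpha> * (LINT x|?M. ?e x) + \<gamma> * (LINT x|?M. ?e x * (x $ i - cen K i))"
    by (subst Bochner_Integration.integral_add) (use i in \<open>auto simp del: Bochner_Integration.integral_diff\<close>)
  finally show ?thesis by (simp only: interp_moment_1[OF K] mult_zero_right add_0)
qed

lemma interp_orthogonal:
  assumes K: "K \<in> T"
  shows "(LINT x|lebesgue_on K. (g x $ i - partial_deriv i (interp K) x) * partial_deriv i (interp K) x) = 0"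
  using interp_orthogonal_affine[OF K, of i "slope K i" "2 * curv K i"] by (simp only: partial_interp)

text \<open>The limit on the left stands in for the integral of the trace of \<open>u\<close>. It
  does not mention the cell, so interpolants on two neighbouring cells get the same face integral,
  and on boundary faces the limit is 0.\<close>

lemma face_limit:
  assumes e: "e \<in> mesh_faces T" and K: "K \<in> T" and f: "e face_of K" and sub: "e \<subseteq> {x. x $ i = c}"
  shows "(\<lambda>k. LINT x:e|plane_measure i c. \<phi> k x) \<longlonglongrightarrow> (LINT x:e|plane_measure i c. interp K x)"
proof -
  let ?M = "lebesgue_on K" and ?s = "hi K $ i - lo K $ i"
  define d where "d = lo K $ i + hi K $ i - c"
  have s: "?s > 0" using mesh.cell(2)[OF K] by simp
  have fin: "finite_measure ?M" by (rule mesh.finite_cell_measure[OF K])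
  have eM: "?M = lebesgue_on (cbox (lo K) (hi K))" by (rule arg_cong[OF mesh.cell(1)[OF K]])
  have eE: "e = cbox (lo K) (hi K) \<inter> {x. x $ i = c}"
    using mesh.face_eq(2)[OF e K f sub] mesh.cell(1)[OF K] by simp
  have face: "(LINT x|?M. q x + (x $ i - d) * partial_deriv i q x) = ?s * (LINT x:e|plane_measure i c. q x)"
    if q: "smooth q" for q
    unfolding eM eE by (rule face_mean[OF q _ mesh.face_eq(1)[OF e K f sub] d_def]) (use s in simp)
  have t1: "sq_tendsto ?M \<phi> u" by (rule conv_cell[OF K conv])
  have t2: "sq_tendsto ?M (\<lambda>k. partial_deriv i (\<phi> k)) (\<lambda>x. g x $ i)" by (rule conv_cell[OF K conv_grad])
  have "(\<lambda>k. (LINT x|?M. \<phi> k x) + (LINT x|?M. partial_deriv i (\<phi> k) x * (x $ i - d))) \<longlonglongrightarrow>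
    (LINT x|?M. u x) + (LINT x|?M. g x $ i * (x $ i - d))"
    by (intro tendsto_add sq_tendsto_integral[OF fin t1] sq_tendsto_inner_const[OF t2] sq_coord[OF K])
  moreover have "(LINT x|?M. \<phi> k x) + (LINT x|?M. partial_deriv i (\<phi> k) x * (x $ i - d)) = ?s * (LINT x:e|plane_measure i c. \<phi> k x)" for k
  proof -
    have "integrable ?M (\<phi> k)" by (rule sq_integrable_integrable[OF fin mesh.smooth_sq_cell[OF K smooth_\<phi>]])
    moreover have "integrable ?M (\<lambda>x. partial_deriv i (\<phi> k) x * (x $ i - d))"
      by (intro sq_integrable_mult mesh.smooth_sq_cell[OF K] smooth_partial smooth_\<phi> sq_coord[OF K])
    ultimately show ?thesis using face[OF smooth_\<phi>, of k] by (simp add: mult.commute)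
  qed
  moreover have "(LINT x|?M. u x) + (LINT x|?M. g x $ i * (x $ i - d)) = ?s * (LINT x:e|plane_measure i c. interp K x)"
  proof -
    have eq: "x $ i - d = (cen K i - d) + 1 * (x $ i - cen K i)" for x by simp
    have ip: "integrable ?M (interp K)" "integrable ?M u"
      by (rule sq_integrable_integrable[OF fin mesh.smooth_sq_cell[OF K smooth_interp]],
          rule sq_integrable_integrable[OF fin sq_cell[OF K u_sq]])
    have id: "integrable ?M (\<lambda>x. partial_deriv i (interp K) x * (x $ i - d))" "integrable ?M (\<lambda>x. g x $ i * (x $ i - d))"
      by (intro sq_integrable_mult mesh.smooth_sq_cell[OF K] smooth_partial smooth_interp sq_coord[OF K],
          intro sq_integrable_mult sq_cell[OF K g_sq] sq_coord[OF K])
    have "(LINT x|?M. (g x $ i - partial_deriv i (interp K) x) * (x $ i - d)) = 0"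
      using interp_orthogonal_affine[OF K, of i "cen K i - d" 1] by (simp only: eq[symmetric])
    then have "(LINT x|?M. g x $ i * (x $ i - d)) = (LINT x|?M. partial_deriv i (interp K) x * (x $ i - d))"
      using id by (simp add: left_diff_distrib)
    moreover have "(LINT x|?M. u x) = (LINT x|?M. interp K x)"
      using interp_moment_0[OF K] ip by simp
    ultimately show ?thesis using face[OF smooth_interp, of K] ip id by (simp add: mult.commute)
  qed
  ultimately have "(\<lambda>k. ?s * (LINT x:e|plane_measure i c. \<phi> k x)) \<longlonglongrightarrow> ?s * (LINT x:e|plane_measure i c. interp K x)"
    by simp
  from tendsto_mult[OF tendsto_const[of "inverse ?s"] this] s show ?thesis
    by (simp add: mult.assoc[symmetric])
qed

text \<open>Linearity is read off from the cell integrals in \<open>face_mean\<close>, which avoids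
  a discussion of integrability with respect to \<open>plane_measure\<close>.\<close>

lemma face_diff:
  assumes e: "e \<in> mesh_faces T" and K: "K \<in> T" and f: "e face_of K" and sub: "e \<subseteq> {x. x $ i = c}"
    and pq: "smooth p" "smooth q"
  shows "(LINT x:e|plane_measure i c. p x - q x) = (LINT x:e|plane_measure i c. p x) - (LINT x:e|plane_measure i c. q x)"
proof -
  let ?M = "lebesgue_on K" and ?s = "hi K $ i - lo K $ i"
  define d where "d = lo K $ i + hi K $ i - c"
  have s: "?s > 0" using mesh.cell(2)[OF K] by simp
  have eM: "?M = lebesgue_on (cbox (lo K) (hi K))" by (rule arg_cong[OF mesh.cell(1)[OF K]])
  have eE: "e = cbox (lo K) (hi K) \<inter> {x. x $ i = c}"
    using mesh.face_eq(2)[OF e K f sub] mesh.cell(1)[OF K] by simp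
  have face: "(LINT x|?M. q x + (x $ i - d) * partial_deriv i q x) = ?s * (LINT x:e|plane_measure i c. q x)"
    if q: "smooth q" for q
    unfolding eM eE by (rule face_mean[OF q _ mesh.face_eq(1)[OF e K f sub] d_def]) (use s in simp)
  have int: "integrable ?M (\<lambda>x. q x + (x $ i - d) * partial_deriv i q x)" if "smooth q" for q
    by (intro sq_integrable_integrable[OF mesh.finite_cell_measure[OF K]] mesh.smooth_sq_cell[OF K]
        smooth_add smooth_mult smooth_diff smooth_coord smooth_const smooth_partial that)
  have "?s * (LINT x:e|plane_measure i c. p x - q x) =
    (LINT x|?M. (p x - q x) + (x $ i - d) * partial_deriv i (\<lambda>x. p x - q x) x)"
    by (rule face[symmetric]) (intro smooth_diff pq)
  also have "\<dots> = (LINT x|?M. (p x + (x $ i - d) * partial_deriv i p x) - (q x + (x $ i - d) * partial_deriv i q x))"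
    by (intro Bochner_Integration.integral_cong refl) (simp add: partial_deriv_diff[OF pq] algebra_simps)
  also have "\<dots> = ?s * (LINT x:e|plane_measure i c. p x) - ?s * (LINT x:e|plane_measure i c. q x)"
    using int pq by (simp add: face)
  also have "\<dots> = ?s * ((LINT x:e|plane_measure i c. p x) - (LINT x:e|plane_measure i c. q x))"
    by (simp add: right_diff_distrib)
  finally show ?thesis using s by simp
qed

definition w :: "real^'n \<Rightarrow> real" where "w = mesh.piecewise interp"

definition gw :: "real^'n \<Rightarrow> real^'n" where
  "gw x = (\<chi> i. mesh.piecewise (\<lambda>K. partial_deriv i (interp K)) x)"

lemma w_sq: "sq_integrable M w"
  unfolding w_def by (intro mesh.piecewise_sq_integrable smooth_interp)

lemma w_power4: "integrable M (\<lambda>x. w x ^ 4)"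
  unfolding w_def by (intro mesh.piecewise_power4_integrable smooth_interp)

lemma gw_sq: "sq_integrable M (\<lambda>x. gw x $ i)"
  unfolding gw_def vec_lambda_beta
  by (subst mesh.piecewise_sq_integrable[of "\<lambda>K. partial_deriv i (interp K)", THEN eqTrueI]) (auto intro: smooth_partial smooth_interp)

text \<open>Stated for all multiples of \<open>w\<close>, because the competitor in the discrete
  problem is a normalised one. Boundary faces use that test functions vanish there, interior faces
  the uniqueness of the limit in \<open>face_limit\<close>.\<close>

lemma w_EQ1rot_space: "(\<lambda>x. \<kappa> * w x) \<in> EQ1rot_space (box a b) T"
proof -
  let ?p = "\<lambda>K x. \<kappa> * interp K x"
  have sp: "smooth (?p K)" for K by (intro smooth_mult smooth_const smooth_interp)
  have cm: "(LINT x:e|N. \<kappa> * f x) = \<kappa> * (LINT x:e|N. f x)" for e N and f :: "real^'n \<Rightarrow> real" by simp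
  have 1: "?p K \<in> EQ1rot K \<and> (AE x in lebesgue_on K. \<kappa> * w x = ?p K x)" if K: "K \<in> T" for K
  proof
    show "?p K \<in> EQ1rot K" unfolding interp_def cen_def[abs_def] by (rule quad_poly_EQ1rot)
    show "AE x in lebesgue_on K. \<kappa> * w x = ?p K x"
      using mesh.piecewise_cell_AE[OF K, of interp] by eventually_elim (simp add: w_def)
  qed
  have 2: "(LINT x:e|plane_measure i c. ?p K x) = 0"
    if e: "e \<in> mesh_faces T" and sub: "e \<subseteq> {x. x $ i = c}" and K: "K \<in> T" "e facet_of K" and fr: "e \<subseteq> frontier (box a b)" for e i c K
  proof -
    have f: "e face_of K" using K(2) by (simp add: facet_of_def)
    have "\<phi> k x = 0" if "x \<in> e" for k x
    proof (rule test_function_zero[OF test])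
      show "x \<notin> box a b" using that fr open_box[of a b] by (auto simp: frontier_def interior_open)
    qed
    then have "(LINT x:e|plane_measure i c. \<phi> k x) = (LINT x:e|plane_measure i c. 0)" for k
      unfolding set_lebesgue_integral_def by (intro Bochner_Integration.integral_cong refl) (auto simp: indicator_def)
    then have "(LINT x:e|plane_measure i c. interp K x) = 0"
      using face_limit[OF e K(1) f sub] by (simp add: LIMSEQ_const_iff)
    then show ?thesis by (simp add: cm)
  qed
  have 3: "(LINT x:e|plane_measure i c. ?p K1 x - ?p K2 x) = 0"
    if e: "e \<in> mesh_faces T" and sub: "e \<subseteq> {x. x $ i = c}" and K: "K1 \<in> T" "K2 \<in> T" "e = K1 \<inter> K2" for e i c K1 K2
  proof -
    have f: "e face_of K1" "e face_of K2" using K mesh.mesh by (auto simp: conforming_box_mesh_def)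
    have "(LINT x:e|plane_measure i c. interp K1 x) = (LINT x:e|plane_measure i c. interp K2 x)"
      using face_limit[OF e K(1) f(1) sub] face_limit[OF e K(2) f(2) sub] by (rule LIMSEQ_unique)
    then show ?thesis by (simp only: face_diff[OF e K(1) f(1) sub sp sp] cm diff_self)
  qed
  have "(\<lambda>x. \<kappa> * w x) \<in> L2 (box a b)"
    using sq_integrable_cmult[OF w_sq, of \<kappa>] by (simp add: L2_iff_sq_integrable sq_integrable_cbox_box)
  then show ?thesis
    unfolding EQ1rot_space_def mem_Collect_eq
  proof (intro conjI exI[of _ ?p] ballI allI impI)
    fix K assume "K \<in> T"
    from 1[OF this] show "?p K \<in> EQ1rot K" "AE x in lebesgue_on K. \<kappa> * w x = ?p K x" by blast+
  next
    fix e i c K assume "e \<in> mesh_faces T" "e \<subseteq> {x. x $ i = c}" "K \<in> T" "e facet_of K \<and> e \<subseteq> frontier (box a b)"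
    then show "(LINT x:e|plane_measure i c. ?p K x) = 0" by (elim conjE) (rule 2)
  next
    fix e i c K1 K2 assume "e \<in> mesh_faces T" "e \<subseteq> {x. x $ i = c}" "K1 \<in> T" "K2 \<in> T" "K1 \<noteq> K2 \<and> e = K1 \<inter> K2"
    then show "(LINT x:e|plane_measure i c. ?p K1 x - ?p K2 x) = 0" by (elim conjE) (rule 3)
  qed
qed

lemma w_weak_grad:
  assumes K: "K \<in> T"
  shows "has_weak_grad (interior K) (\<lambda>x. \<kappa> * w x) (\<lambda>x. \<kappa> *\<^sub>R gw x)"
proof (rule has_weak_grad_cong)
  have s: "smooth (\<lambda>x. \<kappa> * interp K x)" by (intro smooth_mult smooth_const smooth_interp)
  show "has_weak_grad (interior K) (\<lambda>x. \<kappa> * interp K x) (grad (\<lambda>x. \<kappa> * interp K x))"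
    unfolding mesh.cell(3)[OF K] by (rule has_weak_grad_smooth[OF s])
  show "interior K \<in> sets lebesgue" unfolding mesh.cell(3)[OF K] by simp
  show "\<kappa> * interp K x = \<kappa> * w x" if "x \<in> interior K" for x
    by (simp add: w_def mesh.piecewise_eq[OF K that])
  show "grad (\<lambda>x. \<kappa> * interp K x) x = \<kappa> *\<^sub>R gw x" if "x \<in> interior K" for x
    by (simp add: vec_eq_iff gw_def mesh.piecewise_eq[OF K that] partial_deriv_cmult[OF smooth_interp])
qed

lemma discrete_energy_w:
  "discrete_energy (box a b) T V \<beta> (\<lambda>x. \<kappa> * w x) = \<kappa>\<^sup>2 * quadratic_energy gw w + \<kappa> ^ 4 * quartic_energy w"
proof -
  let ?h = "piecewise_grad T (\<lambda>x. \<kappa> * w x)" and ?h' = "\<lambda>x. \<kappa> *\<^sub>R gw x"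
  have "\<forall>K\<in>T. has_weak_grad (interior K) (\<lambda>x. \<kappa> * w x) ?h"
    unfolding piecewise_grad_def by (rule someI[of _ ?h']) (simp add: w_weak_grad)
  then have "AE x in lebesgue_on (interior K). ?h x = ?h' x" if "K \<in> T" for K
    using has_weak_grad_unique[of "lo K" "hi K" "\<lambda>x. \<kappa> * w x" ?h ?h'] w_weak_grad[OF that, of \<kappa>] that
    by (simp only: mesh.cell(3)[OF that, symmetric])
  then have ae: "AE x in M. ?h x = ?h' x" by (rule mesh.AE_cells)
  have sq: "sq_integrable M (\<lambda>x. \<kappa> * w x)" "\<And>i. sq_integrable M (\<lambda>x. ?h' x $ i)"
    using sq_integrable_cmult[OF w_sq] sq_integrable_cmult[OF gw_sq] by auto
  have m': "?h' \<in> borel_measurable M" using sq(2) by (auto simp: borel_measurable_vec_iff sq_integrable_def)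
  \<comment> \<open>The chosen gradient is known to be measurable only on cell interiors.
    Measurability on the whole box follows from its almost everywhere equality with the explicit
    field, by completeness of Lebesgue measure.\<close>
  have m: "?h \<in> borel_measurable M"
    unfolding borel_measurable_vec_iff
  proof
    fix i
    have "(\<lambda>x. ?h' x $ i) \<in> borel_measurable M" using sq(2) by auto
    then have "(\<lambda>x. if x \<in> cbox a b then ?h' x $ i else 0) \<in> borel_measurable lebesgue"
      by (rule borel_measurable_if_I) simp
    moreover have "AE x in lebesgue. (if x \<in> cbox a b then ?h' x $ i else 0) = (if x \<in> cbox a b then ?h x $ i else 0)"
      using ae by (subst (asm) AE_restrict_space_iff) (auto elim!: eventually_mono)
    ultimately have "(\<lambda>x. if x \<in> cbox a b then ?h x $ i else 0) \<in> borel_measurable lebesgue"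
      by (rule borel_measurable_AE)
    then show "(\<lambda>x. ?h x $ i) \<in> borel_measurable M" by (rule borel_measurable_if_D)
  qed
  have "discrete_energy (box a b) T V \<beta> (\<lambda>x. \<kappa> * w x) = energy_with (box a b) V \<beta> ?h' (\<lambda>x. \<kappa> * w x)"
    unfolding discrete_energy_def by (rule energy_with_cong[OF ae m m']) (use sq in auto)
  also have "\<dots> = quadratic_energy ?h' (\<lambda>x. \<kappa> * w x) + quartic_energy (\<lambda>x. \<kappa> * w x)"
    by (rule energy_eq[OF sq]) (use w_power4 in \<open>simp add: power_mult_distrib\<close>)
  also have "quadratic_energy ?h' (\<lambda>x. \<kappa> * w x) = \<kappa>\<^sup>2 * quadratic_energy gw w"
  proof -
    have "(LINT x|M. (norm (?h' x))\<^sup>2) = (LINT x|M. \<kappa>\<^sup>2 * (norm (gw x))\<^sup>2)"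
      "(LINT x|M. V x * (\<kappa> * w x)\<^sup>2) = (LINT x|M. \<kappa>\<^sup>2 * (V x * (w x)\<^sup>2))"
      by (simp_all only: norm_scaleR power_mult_distrib power2_abs mult.left_commute)
    then show ?thesis unfolding quadratic_energy_def integral_mult_right_zero by (simp add: distrib_left)
  qed
  also have "quartic_energy (\<lambda>x. \<kappa> * w x) = \<kappa> ^ 4 * quartic_energy w"
    by (simp add: quartic_energy_def power_mult_distrib)
  finally show ?thesis .
qed

lemma discrete_ground_state_le:
  assumes uh: "discrete_ground_state (box a b) T V \<beta> uh" and N: "(LINT x|M. (w x)\<^sup>2) = N" "N > 0"
  shows "discrete_energy (box a b) T V \<beta> uh \<le> quadratic_energy gw w / N + quartic_energy w / N\<^sup>2"
proof -
  define \<kappa> where "\<kappa> = 1 / sqrt N"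
  have \<kappa>: "\<kappa>\<^sup>2 = 1 / N" using N by (simp add: \<kappa>_def power_divide)
  then have \<kappa>4: "\<kappa> ^ 4 = 1 / N\<^sup>2" using power_mult[of \<kappa> 2 2] by (simp add: power_divide)
  have "L2_norm (box a b) (\<lambda>x. \<kappa> * w x) = 1"
    using N \<kappa> by (simp add: L2_norm_def power_mult_distrib flip: integral_cbox_box)
  then have "discrete_energy (box a b) T V \<beta> uh \<le> discrete_energy (box a b) T V \<beta> (\<lambda>x. \<kappa> * w x)"
    using uh w_EQ1rot_space[of \<kappa>] unfolding discrete_ground_state_def is_arg_min_def by (meson not_less)
  then show ?thesis by (simp add: discrete_energy_w \<kappa> \<kappa>4)
qed

end

section \<open>The interpolation error\<close>

definition trunc :: "real \<Rightarrow> real \<Rightarrow> real" where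
  "trunc B s = max (- B) (min B s)"

lemma trunc_bounded: "0 \<le> B \<Longrightarrow> \<bar>trunc B s\<bar> \<le> B" by (auto simp: trunc_def)

lemma trunc_measurable [measurable]: "trunc B \<in> borel_measurable borel"
  unfolding trunc_def[abs_def] by measurable

lemma trunc_continuous: "continuous_on UNIV f \<Longrightarrow> continuous_on UNIV (\<lambda>x. trunc B (f x))"
  unfolding trunc_def by (intro continuous_intros)

lemma sq_integrable_trunc_approx:
  assumes G: "sq_integrable M G" and \<epsilon>: "\<epsilon> > 0"
  shows "\<exists>B\<ge>0. (LINT x|M. (G x - trunc B (G x))\<^sup>2) < \<epsilon>"
proof -
  have [measurable]: "G \<in> borel_measurable M" using G by auto
  have "(\<lambda>k. LINT x|M. (G x - trunc (real k) (G x))\<^sup>2) \<longlonglongrightarrow> (LINT x|M. 0)"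
  proof (rule integral_dominated_convergence[where w="\<lambda>x. (G x)\<^sup>2"])
    show "AE x in M. (\<lambda>k. (G x - trunc (real k) (G x))\<^sup>2) \<longlonglongrightarrow> 0"
    proof (rule AE_I2)
      fix x
      obtain m where m: "\<bar>G x\<bar> \<le> real m" using real_arch_simple by blast
      have "(G x - trunc (real k) (G x))\<^sup>2 = 0" if "m \<le> k" for k
      proof -
        have "real m \<le> real k" using that by simp
        then show ?thesis using m by (auto simp: trunc_def)
      qed
      then have "eventually (\<lambda>k. (G x - trunc (real k) (G x))\<^sup>2 = 0) sequentially"
        unfolding eventually_sequentially by blast
      then show "(\<lambda>k. (G x - trunc (real k) (G x))\<^sup>2) \<longlonglongrightarrow> 0" by (rule tendsto_eventually)
    qed
    show "AE x in M. norm ((G x - trunc (real k) (G x))\<^sup>2) \<le> (G x)\<^sup>2" for k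
      by (rule AE_I2) (auto simp: trunc_def abs_le_square_iff[symmetric] max_def min_def)
    show "integrable M (\<lambda>x. (G x)\<^sup>2)" using G by auto
  qed measurable
  then have "eventually (\<lambda>k. (LINT x|M. (G x - trunc (real k) (G x))\<^sup>2) < \<epsilon>) sequentially"
    using \<epsilon> by (intro order_tendstoD(2)[of _ 0]) auto
  then obtain k where "(LINT x|M. (G x - trunc (real k) (G x))\<^sup>2) < \<epsilon>"
    by (auto simp: eventually_sequentially)
  then show ?thesis by (intro exI[of _ "real k"]) simp
qed

text \<open>The continuous functions supplied by \<open>measurable_on\<close> converge only off a
  negligible set. Truncating \<open>G\<close> and the approximants at the same height makes the
  convergence dominated; each of the two steps may cost half of \<epsilon>. Uniform continuity on
  the compact box then bounds the oscillation at scale \<delta>.\<close>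

lemma sq_integrable_continuous_approx:
  fixes G :: "real^'n \<Rightarrow> real" and a b :: "real^'n"
  defines "M \<equiv> lebesgue_on (cbox a b)"
  assumes G: "sq_integrable M G" and \<epsilon>: "\<epsilon> > 0"
  shows "\<exists>\<gamma> \<delta>. \<delta> > 0 \<and> continuous_on UNIV \<gamma> \<and> sq_integrable M \<gamma> \<and> sqrt (LINT x|M. (G x - \<gamma> x)\<^sup>2) \<le> \<epsilon> \<and>
    (\<forall>x\<in>cbox a b. \<forall>y\<in>cbox a b. dist x y \<le> \<delta> \<longrightarrow> \<bar>\<gamma> x - \<gamma> y\<bar> \<le> \<epsilon>)"
proof -
  have fin: "finite_measure M" unfolding M_def by (rule lmeasurable_box_finite)
  interpret finite_measure M by (rule fin)
  have Gm [measurable]: "G \<in> borel_measurable M" using G by auto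
  have cm: "f \<in> borel_measurable M" if "continuous_on UNIV f" for f :: "real^'n \<Rightarrow> real"
    unfolding M_def by (rule borel_measurable_lebesgue_on[OF borel_measurable_continuous_onI[OF that]])
  obtain B where B: "0 \<le> B" "(LINT x|M. (G x - trunc B (G x))\<^sup>2) < (\<epsilon> / 2)\<^sup>2"
    using sq_integrable_trunc_approx[OF G, of "(\<epsilon> / 2)\<^sup>2"] \<epsilon> by auto
  have "G measurable_on (cbox a b)"
    using Gm unfolding M_def by (subst measurable_on_iff_borel_measurable) auto
  then obtain N \<gamma> where N: "negligible N" and cont: "\<And>n. continuous_on UNIV (\<gamma> n)"
    and lim: "\<And>x. x \<notin> N \<Longrightarrow> (\<lambda>n. \<gamma> n x) \<longlonglongrightarrow> (if x \<in> cbox a b then G x else 0)"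
    unfolding measurable_on_def by blast
  have cl: "continuous_on UNIV (\<lambda>x. trunc B (\<gamma> n x))" for n by (rule trunc_continuous[OF cont])
  have aeN: "AE x in M. x \<notin> N"
  proof -
    have "AE x in lebesgue. x \<notin> N" using N by (intro AE_not_in) (simp add: negligible_iff_null_sets)
    then show ?thesis unfolding M_def by (subst AE_restrict_space_iff) auto
  qed
  have "(\<lambda>n. LINT x|M. (trunc B (G x) - trunc B (\<gamma> n x))\<^sup>2) \<longlonglongrightarrow> (LINT x|M. 0)"
  proof (rule integral_dominated_convergence[where w="\<lambda>_. (2 * B)\<^sup>2"])
    show "(\<lambda>x. (trunc B (G x) - trunc B (\<gamma> n x))\<^sup>2) \<in> borel_measurable M" for n
      using cm[OF cl[of n]] by measurable
    have sp: "AE x in M. x \<in> cbox a b" unfolding M_def by (rule AE_I2) (simp add: space_restrict_space)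
    show "AE x in M. (\<lambda>n. (trunc B (G x) - trunc B (\<gamma> n x))\<^sup>2) \<longlonglongrightarrow> 0"
      using aeN sp
    proof eventually_elim
      case (elim x)
      then have "(\<lambda>n. \<gamma> n x) \<longlonglongrightarrow> G x" using lim[of x] by simp
      then have "(\<lambda>n. (trunc B (G x) - trunc B (\<gamma> n x))\<^sup>2) \<longlonglongrightarrow> (trunc B (G x) - trunc B (G x))\<^sup>2"
        unfolding trunc_def by (intro tendsto_intros)
      then show ?case by simp
    qed
    show "AE x in M. norm ((trunc B (G x) - trunc B (\<gamma> n x))\<^sup>2) \<le> (2 * B)\<^sup>2" for n
    proof (rule AE_I2)
      fix x
      have "\<bar>trunc B (G x) - trunc B (\<gamma> n x)\<bar> \<le> 2 * B"
        using trunc_bounded[OF B(1), of "G x"] trunc_bounded[OF B(1), of "\<gamma> n x"] by linarith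
      then show "norm ((trunc B (G x) - trunc B (\<gamma> n x))\<^sup>2) \<le> (2 * B)\<^sup>2"
        using power_mono[OF _ abs_ge_zero, of _ "2 * B" 2] by simp
    qed
  qed auto
  then have "eventually (\<lambda>n. (LINT x|M. (trunc B (G x) - trunc B (\<gamma> n x))\<^sup>2) < (\<epsilon> / 2)\<^sup>2) sequentially"
    using \<epsilon> by (intro order_tendstoD(2)[of _ 0]) auto
  then obtain n where n: "(LINT x|M. (trunc B (G x) - trunc B (\<gamma> n x))\<^sup>2) < (\<epsilon> / 2)\<^sup>2"
    by (auto simp: eventually_sequentially)
  define c where "c x = trunc B (\<gamma> n x)" for x
  have cc: "continuous_on UNIV c" unfolding c_def[abs_def] by (rule cl)
  have cs: "sq_integrable M c"
    by (rule sq_integrable_bounded[OF fin cm[OF cc], of B]) (simp add: c_def trunc_bounded B(1))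
  have Gs: "sq_integrable M (\<lambda>x. trunc B (G x))"
    by (rule sq_integrable_bounded[OF fin _, of _ B]) (simp_all add: trunc_bounded B(1))
  have "sqrt (LINT x|M. (G x - c x)\<^sup>2) = sqrt (LINT x|M. ((G x - trunc B (G x)) + (trunc B (G x) - c x))\<^sup>2)"
    by simp
  also have "\<dots> \<le> sqrt (LINT x|M. (G x - trunc B (G x))\<^sup>2) + sqrt (LINT x|M. (trunc B (G x) - c x)\<^sup>2)"
    by (intro minkowski_integral sq_integrable_diff G Gs cs)
  also have "\<dots> \<le> \<epsilon> / 2 + \<epsilon> / 2"
    using B(2) n \<epsilon> by (intro add_mono real_le_lsqrt) (auto simp: c_def less_imp_le)
  finally have le: "sqrt (LINT x|M. (G x - c x)\<^sup>2) \<le> \<epsilon>" by simp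
  have "uniformly_continuous_on (cbox a b) c"
    by (rule compact_uniformly_continuous[OF continuous_on_subset[OF cc] compact_cbox]) simp
  then obtain d where d: "d > 0" "\<And>x y. x \<in> cbox a b \<Longrightarrow> y \<in> cbox a b \<Longrightarrow> dist y x < d \<Longrightarrow> dist (c y) (c x) < \<epsilon>"
    using \<epsilon> unfolding uniformly_continuous_on_def by blast
  have "\<bar>c x - c y\<bar> \<le> \<epsilon>" if "x \<in> cbox a b" "y \<in> cbox a b" "dist x y \<le> d / 2" for x y
    using d(2)[of y x] that d(1) by (simp add: dist_real_def less_imp_le)
  then show ?thesis using d(1) cc cs le by (intro exI[of _ c] exI[of _ "d / 2"]) auto
qed

context interpolation
begin

definition err :: "real^'n \<Rightarrow> real" where "err x = u x - w x"
definition gerr :: "real^'n \<Rightarrow> real^'n" where "gerr x = g x - gw x"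
definition \<eta>2 :: real where "\<eta>2 = (LINT x|M. (norm (gerr x))\<^sup>2)"

lemma err_sq: "sq_integrable M err" and gerr_sq: "sq_integrable M (\<lambda>x. gerr x $ i)"
  unfolding err_def[abs_def] gerr_def[abs_def] using u_sq w_sq g_sq gw_sq by (auto intro: sq_integrable_diff)

lemma \<eta>2_nonneg: "0 \<le> \<eta>2" by (simp add: \<eta>2_def)

lemma AE_cellD:
  assumes K: "K \<in> T"
  shows "AE x in lebesgue_on K. err x = u x - interp K x"
    and "AE x in lebesgue_on K. \<forall>i. gerr x $ i = g x $ i - partial_deriv i (interp K) x"
proof -
  show "AE x in lebesgue_on K. err x = u x - interp K x"
    using mesh.piecewise_cell_AE[OF K, of interp] by eventually_elim (simp add: err_def w_def)
  have "AE x in lebesgue_on K. \<forall>i\<in>UNIV. mesh.piecewise (\<lambda>K. partial_deriv i (interp K)) x = partial_deriv i (interp K) x"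
    by (intro AE_finite_allI mesh.piecewise_cell_AE[OF K]) simp
  then show "AE x in lebesgue_on K. \<forall>i. gerr x $ i = g x $ i - partial_deriv i (interp K) x"
    by eventually_elim (simp add: gerr_def gw_def)
qed

lemma err_measurable_cell: "K \<in> T \<Longrightarrow> err \<in> borel_measurable (lebesgue_on K)"
  and gerr_measurable_cell: "K \<in> T \<Longrightarrow> (\<lambda>x. gerr x $ i) \<in> borel_measurable (lebesgue_on K)"
  and u_measurable_cell: "K \<in> T \<Longrightarrow> u \<in> borel_measurable (lebesgue_on K)"
  and g_measurable_cell: "K \<in> T \<Longrightarrow> (\<lambda>x. g x $ i) \<in> borel_measurable (lebesgue_on K)"
  by (auto intro: sq_integrable_measurable[OF sq_cell[OF _ err_sq]] sq_integrable_measurable[OF sq_cell[OF _ gerr_sq]]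
    sq_integrable_measurable[OF sq_cell[OF _ u_sq]] sq_integrable_measurable[OF sq_cell[OF _ g_sq]])

lemma interp_measurable_cell: "interp L \<in> borel_measurable (lebesgue_on K)"
  and partial_interp_measurable_cell: "partial_deriv i (interp L) \<in> borel_measurable (lebesgue_on K)"
  by (intro borel_measurable_lebesgue_on smooth_borel smooth_interp smooth_partial)+

lemma err_mean_cell:
  assumes K: "K \<in> T"
  shows "(LINT x|lebesgue_on K. err x) = 0"
proof -
  have "(LINT x|lebesgue_on K. err x) = (LINT x|lebesgue_on K. u x - interp K x)"
    by (rule integral_cong_AE[OF err_measurable_cell[OF K] borel_measurable_diff[OF u_measurable_cell[OF K] interp_measurable_cell]
      AE_cellD(1)[OF K]])
  then show ?thesis by (simp only: interp_moment_0[OF K])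
qed

definition \<eta>2_cell :: "(real^'n) set \<Rightarrow> real" where
  "\<eta>2_cell K = (LINT x|lebesgue_on K. (norm (gerr x))\<^sup>2)"

lemma \<eta>2_cells: "\<eta>2 = (\<Sum>K\<in>T. \<eta>2_cell K)"
  unfolding \<eta>2_def \<eta>2_cell_def by (rule mesh.integral_cells) (rule integral_norm_sq_sum(2)[OF gerr_sq])

lemma \<eta>2_cell_nonneg: "0 \<le> \<eta>2_cell K" by (simp add: \<eta>2_cell_def)

text \<open>The error has mean zero on the cell, so \<open>sobolev_poincare\<close> applies with
  mean 0. It is approximated there by \<open>\<phi> k\<close> minus the fixed polynomial
  \<open>interp K\<close>.\<close>

lemma err_cell_bounds:
  assumes K: "K \<in> T"
  shows "(LINT x|lebesgue_on K. (err x)\<^sup>2) \<le> 46 * (diameter K)\<^sup>2 * \<eta>2_cell K"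
    and "(LINT x|lebesgue_on K. (err x) ^ 4) \<le> 2048 * (diameter K) ^ 4 / measure lebesgue K * (\<eta>2_cell K)\<^sup>2"
proof -
  let ?M = "lebesgue_on K"
  let ?g = "\<lambda>x. \<chi> i. g x $ i - partial_deriv i (interp K) x"
  have eM: "?M = lebesgue_on (cbox (lo K) (hi K))" and eK: "measure lebesgue K = measure lebesgue (cbox (lo K) (hi K))"
    and eD: "diameter K = diameter (cbox (lo K) (hi K))"
    by (rule arg_cong[OF mesh.cell(1)[OF K]])+
  have sm: "smooth (\<lambda>x. \<phi> k x - interp K x)" for k by (intro smooth_diff smooth_\<phi> smooth_interp)
  have t1: "sq_tendsto ?M (\<lambda>k x. \<phi> k x - interp K x) (\<lambda>x. u x - interp K x)"
    by (intro sq_tendsto_diff conv_cell[OF K conv] sq_tendsto_const mesh.smooth_sq_cell[OF K smooth_interp])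
  have t2: "sq_tendsto ?M (\<lambda>k. partial_deriv i (\<lambda>x. \<phi> k x - interp K x)) (\<lambda>x. ?g x $ i)" for i
  proof -
    have "partial_deriv i (\<lambda>x. \<phi> k x - interp K x) = (\<lambda>x. partial_deriv i (\<phi> k) x - partial_deriv i (interp K) x)" for k
      by (rule ext) (rule partial_deriv_diff[OF smooth_\<phi> smooth_interp])
    moreover have "sq_tendsto ?M (\<lambda>k x. partial_deriv i (\<phi> k) x - partial_deriv i (interp K) x) (\<lambda>x. ?g x $ i)"
      unfolding vec_lambda_beta
      by (intro sq_tendsto_diff conv_cell[OF K conv_grad] sq_tendsto_const mesh.smooth_sq_cell[OF K] smooth_partial smooth_interp)
    ultimately show ?thesis by simp
  qed
  have m: "0 = (LINT x|?M. u x - interp K x) / measure lebesgue K" using interp_moment_0[OF K] by simp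
  have v: "measure lebesgue K > 0" by (rule mesh.measure_cell_pos[OF K])
  note sp = sobolev_poincare[OF dim, of "lo K" "hi K" "\<lambda>k x. \<phi> k x - interp K x" "\<lambda>x. u x - interp K x" ?g 0,
      folded eM eK eD, OF v sm t1 t2 m]
  have G: "(LINT x|?M. (norm (?g x))\<^sup>2) = \<eta>2_cell K"
    unfolding \<eta>2_cell_def
  proof (rule integral_cong_AE)
    show "AE x in ?M. (norm (?g x))\<^sup>2 = (norm (gerr x))\<^sup>2"
      using AE_cellD(2)[OF K] by eventually_elim (simp add: norm_vec_sq)
    show "(\<lambda>x. (norm (?g x))\<^sup>2) \<in> borel_measurable ?M" "(\<lambda>x. (norm (gerr x))\<^sup>2) \<in> borel_measurable ?M"
      unfolding norm_vec_sq vec_lambda_beta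
      by (intro borel_measurable_sum borel_measurable_power borel_measurable_diff
          g_measurable_cell[OF K] gerr_measurable_cell[OF K] partial_interp_measurable_cell)+
  qed
  have "(LINT x|?M. (u x - interp K x - 0)\<^sup>2) = (LINT x|?M. (err x)\<^sup>2)"
  proof (rule integral_cong_AE)
    show "AE x in ?M. (u x - interp K x - 0)\<^sup>2 = (err x)\<^sup>2" using AE_cellD(1)[OF K] by eventually_elim simp
  qed (use err_measurable_cell[OF K] u_measurable_cell[OF K] interp_measurable_cell in auto)
  with sp(3) show "(LINT x|?M. (err x)\<^sup>2) \<le> 46 * (diameter K)\<^sup>2 * \<eta>2_cell K" by (simp only: G)
  have "(LINT x|?M. (u x - interp K x - 0) ^ 4) = (LINT x|?M. (err x) ^ 4)"
  proof (rule integral_cong_AE)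
    show "AE x in ?M. (u x - interp K x - 0) ^ 4 = (err x) ^ 4" using AE_cellD(1)[OF K] by eventually_elim simp
  qed (use err_measurable_cell[OF K] u_measurable_cell[OF K] interp_measurable_cell in auto)
  with sp(2) show "(LINT x|?M. (err x) ^ 4) \<le> 2048 * (diameter K) ^ 4 / measure lebesgue K * (\<eta>2_cell K)\<^sup>2"
    by (simp only: G)
qed

lemma diameter_le_mesh_size: "K \<in> T \<Longrightarrow> diameter K \<le> mesh_size T"
  unfolding mesh_size_def by (intro Max_ge) auto

lemma diameter_cell_nonneg: "K \<in> T \<Longrightarrow> 0 \<le> diameter K"
  using mesh.cell(1)[of K] by (metis bounded_cbox diameter_ge_0)

lemma err_L2: "(LINT x|M. (err x)\<^sup>2) \<le> 46 * (mesh_size T)\<^sup>2 * \<eta>2"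
proof -
  have "(LINT x|M. (err x)\<^sup>2) = (\<Sum>K\<in>T. LINT x|lebesgue_on K. (err x)\<^sup>2)"
    by (rule mesh.integral_cells[OF sq_integrable_square[OF err_sq]])
  also have "\<dots> \<le> (\<Sum>K\<in>T. 46 * (mesh_size T)\<^sup>2 * \<eta>2_cell K)"
  proof (rule sum_mono)
    fix K assume K: "K \<in> T"
    have "(diameter K)\<^sup>2 \<le> (mesh_size T)\<^sup>2"
      by (intro power_mono diameter_le_mesh_size diameter_cell_nonneg K)
    then have "46 * (diameter K)\<^sup>2 * \<eta>2_cell K \<le> 46 * (mesh_size T)\<^sup>2 * \<eta>2_cell K"
      by (intro mult_right_mono \<eta>2_cell_nonneg) simp
    with err_cell_bounds(1)[OF K] show "(LINT x|lebesgue_on K. (err x)\<^sup>2) \<le> 46 * (mesh_size T)\<^sup>2 * \<eta>2_cell K" by linarith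
  qed
  also have "\<dots> = 46 * (mesh_size T)\<^sup>2 * \<eta>2" by (simp add: \<eta>2_cells sum_distrib_left)
  finally show ?thesis .
qed

lemma err_power4_integrable: "integrable M (\<lambda>x. err x ^ 4)"
proof (rule Bochner_Integration.integrable_bound)
  show "integrable M (\<lambda>x. 8 * (u x ^ 4 + w x ^ 4))" using u_power4 w_power4 by simp
  have "(s - t) ^ 4 \<le> 8 * (s ^ 4 + t ^ 4)" for s t :: real
  proof -
    have two: "(p + q)\<^sup>2 \<le> 2 * (p\<^sup>2 + q\<^sup>2)" for p q :: real
      using sum_squares_bound[of p q] by (simp add: power2_sum)
    have "(s - t)\<^sup>2 \<le> 2 * (s\<^sup>2 + t\<^sup>2)" using two[of s "- t"] by simp
    then have "((s - t)\<^sup>2)\<^sup>2 \<le> (2 * (s\<^sup>2 + t\<^sup>2))\<^sup>2" by (rule power_mono) simp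
    also have "\<dots> = 4 * (s\<^sup>2 + t\<^sup>2)\<^sup>2" unfolding power_mult_distrib by simp
    also have "\<dots> \<le> 4 * (2 * ((s\<^sup>2)\<^sup>2 + (t\<^sup>2)\<^sup>2))" by (intro mult_left_mono two) auto
    finally show ?thesis by (simp flip: power_mult)
  qed
  then show "AE x in M. norm (err x ^ 4) \<le> norm (8 * (u x ^ 4 + w x ^ 4))"
    by (auto intro!: AE_I2 simp: err_def)
qed (use err_sq in auto)

text \<open>The cell bound is quadratic in \<open>\<eta>2_cell\<close>: one factor is estimated by
  the total \<open>\<eta>2\<close>, the other is summed over the cells.\<close>

lemma err_L4:
  assumes c: "\<And>K. K \<in> T \<Longrightarrow> (diameter K) ^ 4 \<le> c * measure lebesgue K" and c0: "0 \<le> c"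
  shows "(LINT x|M. err x ^ 4) \<le> 2048 * c * \<eta>2\<^sup>2"
proof -
  have "(LINT x|M. err x ^ 4) = (\<Sum>K\<in>T. LINT x|lebesgue_on K. err x ^ 4)"
    by (rule mesh.integral_cells[OF err_power4_integrable])
  also have "\<dots> \<le> (\<Sum>K\<in>T. 2048 * c * (\<eta>2 * \<eta>2_cell K))"
  proof (rule sum_mono)
    fix K assume K: "K \<in> T"
    have "(diameter K) ^ 4 / measure lebesgue K \<le> c"
      using c[OF K] mesh.measure_cell_pos[OF K] by (simp add: divide_le_eq)
    then have "2048 * ((diameter K) ^ 4 / measure lebesgue K) * (\<eta>2_cell K)\<^sup>2 \<le> 2048 * c * (\<eta>2_cell K)\<^sup>2"
      by (intro mult_right_mono) auto
    also have "\<dots> \<le> 2048 * c * (\<eta>2 * \<eta>2_cell K)"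
    proof -
      have "\<eta>2_cell K \<le> \<eta>2" unfolding \<eta>2_cells by (rule member_le_sum[OF K]) (auto simp: \<eta>2_cell_nonneg)
      then have "(\<eta>2_cell K)\<^sup>2 \<le> \<eta>2 * \<eta>2_cell K"
        unfolding power2_eq_square by (intro mult_right_mono \<eta>2_cell_nonneg)
      then show ?thesis using c0 by (intro mult_left_mono) auto
    qed
    finally show "(LINT x|lebesgue_on K. err x ^ 4) \<le> 2048 * c * (\<eta>2 * \<eta>2_cell K)"
      using err_cell_bounds(2)[OF K] by simp
  qed
  also have "\<dots> = 2048 * c * \<eta>2\<^sup>2" by (simp add: \<eta>2_cells power2_eq_square sum_distrib_left sum_distrib_right)
  finally show ?thesis .
qed

lemma grad_pythagoras: "(LINT x|M. (norm (gw x))\<^sup>2) = (LINT x|M. (norm (g x))\<^sup>2) - \<eta>2"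
proof -
  have orth: "(LINT x|M. gerr x $ i * gw x $ i) = 0" for i
  proof -
    have "(LINT x|M. gerr x $ i * gw x $ i) = (\<Sum>K\<in>T. LINT x|lebesgue_on K. gerr x $ i * gw x $ i)"
      by (rule mesh.integral_cells[OF sq_integrable_mult[OF gerr_sq gw_sq]])
    also have "\<dots> = (\<Sum>K\<in>T. 0)"
    proof (rule sum.cong[OF refl])
      fix K assume K: "K \<in> T"
      have "(LINT x|lebesgue_on K. gerr x $ i * gw x $ i) =
        (LINT x|lebesgue_on K. (g x $ i - partial_deriv i (interp K) x) * partial_deriv i (interp K) x)"
      proof (rule integral_cong_AE)
        show "AE x in lebesgue_on K. gerr x $ i * gw x $ i = (g x $ i - partial_deriv i (interp K) x) * partial_deriv i (interp K) x"
          using AE_cellD(2)[OF K] by eventually_elim (metis diff_diff_eq2 add_diff_cancel_left' diff_add_cancel gerr_def vector_minus_component)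
        show "(\<lambda>x. gerr x $ i * gw x $ i) \<in> borel_measurable (lebesgue_on K)"
          by (intro borel_measurable_times gerr_measurable_cell[OF K] sq_integrable_measurable[OF sq_cell[OF K gw_sq]])
        show "(\<lambda>x. (g x $ i - partial_deriv i (interp K) x) * partial_deriv i (interp K) x) \<in> borel_measurable (lebesgue_on K)"
          using g_measurable_cell[OF K] partial_interp_measurable_cell by auto
      qed
      then show "(LINT x|lebesgue_on K. gerr x $ i * gw x $ i) = 0" by (simp add: interp_orthogonal[OF K])
    qed
    finally show ?thesis by simp
  qed
  have comp: "(LINT x|M. (g x $ i)\<^sup>2) = (LINT x|M. (gw x $ i)\<^sup>2) + (LINT x|M. (gerr x $ i)\<^sup>2)" for i
  proof -
    have "(LINT x|M. (g x $ i)\<^sup>2) = (LINT x|M. (gw x $ i)\<^sup>2 + (gerr x $ i)\<^sup>2 + 2 * (gerr x $ i * gw x $ i))"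
      by (intro Bochner_Integration.integral_cong refl) (simp add: gerr_def power2_eq_square algebra_simps)
    also have "\<dots> = (LINT x|M. (gw x $ i)\<^sup>2) + (LINT x|M. (gerr x $ i)\<^sup>2)"
      using sq_integrable_square[OF gw_sq] sq_integrable_square[OF gerr_sq] sq_integrable_mult[OF gerr_sq gw_sq]
      by (simp add: orth)
    finally show ?thesis .
  qed
  show ?thesis
    unfolding \<eta>2_def integral_norm_sq_sum(1)[OF gw_sq] integral_norm_sq_sum(1)[OF g_sq] integral_norm_sq_sum(1)[OF gerr_sq]
    by (simp add: comp sum.distrib)
qed

text \<open>Replace \<open>G\<close> by \<open>\<gamma>\<close> and then by the piecewise constant
  function with the values of \<open>\<gamma>\<close> at the lower corners. The latter integrates to
  zero against \<open>err\<close>, which has mean zero on every cell, and the two replacement errors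
  are at most \<epsilon> in L^2 and pointwise almost everywhere. The remaining factor is the L^2
  norm of \<open>err\<close>.\<close>

lemma integral_mult_err:
  assumes G: "sq_integrable M G" and \<gamma>: "sq_integrable M \<gamma>" "sqrt (LINT x|M. (G x - \<gamma> x)\<^sup>2) \<le> \<epsilon>"
    and osc: "\<And>x y. x \<in> cbox a b \<Longrightarrow> y \<in> cbox a b \<Longrightarrow> dist x y \<le> mesh_size T \<Longrightarrow> \<bar>\<gamma> x - \<gamma> y\<bar> \<le> \<epsilon>"
    and \<epsilon>: "0 \<le> \<epsilon>"
  shows "\<bar>LINT x|M. G x * err x\<bar> \<le> \<epsilon> * (1 + sqrt (measure lebesgue (cbox a b))) * (7 * mesh_size T * sqrt \<eta>2)"
proof -
  define c where "c = mesh.piecewise (\<lambda>K _. \<gamma> (lo K))"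
  have cs: "sq_integrable M c" unfolding c_def by (intro mesh.piecewise_sq_integrable smooth_const)
  have c0: "(LINT x|M. c x * err x) = 0"
  proof -
    have "(LINT x|M. c x * err x) = (\<Sum>K\<in>T. LINT x|lebesgue_on K. c x * err x)"
      by (rule mesh.integral_cells[OF sq_integrable_mult[OF cs err_sq]])
    also have "\<dots> = (\<Sum>K\<in>T. 0)"
    proof (rule sum.cong[OF refl])
      fix K assume K: "K \<in> T"
      have "(LINT x|lebesgue_on K. c x * err x) = (LINT x|lebesgue_on K. \<gamma> (lo K) * err x)"
      proof (rule integral_cong_AE)
        show "AE x in lebesgue_on K. c x * err x = \<gamma> (lo K) * err x"
          using mesh.piecewise_cell_AE[OF K, of "\<lambda>K _. \<gamma> (lo K)"] by eventually_elim (simp add: c_def)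
      qed (use err_measurable_cell[OF K] sq_cell[OF K cs] in auto)
      then show "(LINT x|lebesgue_on K. c x * err x) = 0" by (simp add: err_mean_cell[OF K])
    qed
    finally show ?thesis by simp
  qed
  have ae: "AE x in M. \<bar>\<gamma> x - c x\<bar> \<le> \<epsilon>"
  proof (rule mesh.AE_cells)
    fix K assume K: "K \<in> T"
    have b: "bounded K" using mesh.cell(1)[OF K] bounded_cbox by metis
    have l: "lo K \<in> K" using mesh.cell(2)[OF K] by (auto simp: mesh.mem_cell[OF K] less_imp_le)
    have "\<bar>\<gamma> x - c x\<bar> \<le> \<epsilon>" if x: "x \<in> interior K" for x
    proof -
      have xK: "x \<in> K" using x interior_subset by blast
      have "dist x (lo K) \<le> diameter K" by (rule diameter_bounded_bound[OF b xK l])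
      then have "dist x (lo K) \<le> mesh_size T" using diameter_le_mesh_size[OF K] by linarith
      then show ?thesis
        using osc[of x "lo K"] mesh.cell_subset[OF K] xK l by (auto simp: c_def mesh.piecewise_eq[OF K x])
    qed
    then show "AE x in lebesgue_on (interior K). \<bar>\<gamma> x - c x\<bar> \<le> \<epsilon>"
      by (intro AE_I2) (simp add: space_restrict_space mesh.cell(3)[OF K])
  qed
  have s1: "sq_integrable M (\<lambda>x. G x - \<gamma> x)" "sq_integrable M (\<lambda>x. \<gamma> x - c x)"
    by (intro sq_integrable_diff G \<gamma>(1) cs)+
  have "(LINT x|M. G x * err x) = (LINT x|M. (G x - \<gamma> x) * err x + (\<gamma> x - c x) * err x + c x * err x)"
    by (intro Bochner_Integration.integral_cong refl) (simp add: algebra_simps)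
  also have "\<dots> = (LINT x|M. (G x - \<gamma> x) * err x) + (LINT x|M. (\<gamma> x - c x) * err x)"
    using sq_integrable_mult[OF s1(1) err_sq] sq_integrable_mult[OF s1(2) err_sq] sq_integrable_mult[OF cs err_sq]
    by (simp add: c0 del: Bochner_Integration.integral_diff)
  finally have split: "(LINT x|M. G x * err x) = (LINT x|M. (G x - \<gamma> x) * err x) + (LINT x|M. (\<gamma> x - c x) * err x)" .
  let ?E = "sqrt (LINT x|M. (err x)\<^sup>2)"
  have h0: "0 \<le> mesh_size T"
    using mesh.T_nonempty diameter_le_mesh_size diameter_cell_nonneg by (metis all_not_in_conv order_trans)
  have E: "?E \<le> 7 * mesh_size T * sqrt \<eta>2"
  proof (rule real_le_lsqrt)
    \<comment> \<open>7^2 = 49 exceeds 46; this is where the factor 7 comes from.\<close>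
    have "46 * (mesh_size T)\<^sup>2 * \<eta>2 \<le> 49 * (mesh_size T)\<^sup>2 * \<eta>2"
      using zero_le_power2[of "mesh_size T"] by (intro mult_right_mono \<eta>2_nonneg) linarith
    from order_trans[OF err_L2 this]
    show "(LINT x|M. (err x)\<^sup>2) \<le> (7 * mesh_size T * sqrt \<eta>2)\<^sup>2"
      using \<eta>2_nonneg by (simp add: power_mult_distrib)
  qed (use h0 \<eta>2_nonneg in auto)
  have b1: "\<bar>LINT x|M. (G x - \<gamma> x) * err x\<bar> \<le> \<epsilon> * ?E"
    using cauchy_schwarz_integral_abs[OF s1(1) err_sq] mult_right_mono[OF \<gamma>(2), of ?E] by simp
  have "sqrt (LINT x|M. (\<gamma> x - c x)\<^sup>2) \<le> \<epsilon> * sqrt (measure lebesgue (cbox a b))"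
  proof (rule real_le_lsqrt)
    interpret finite_measure M by (rule finite_M)
    have vM: "measure M (space M) = measure lebesgue (cbox a b)" by (simp add: measure_restrict_space)
    have "(LINT x|M. (\<gamma> x - c x)\<^sup>2) \<le> (LINT x|M. \<epsilon>\<^sup>2)"
    proof (rule integral_mono_AE)
      show "AE x in M. (\<gamma> x - c x)\<^sup>2 \<le> \<epsilon>\<^sup>2"
        using ae by eventually_elim (use \<epsilon> in \<open>simp add: abs_le_square_iff[symmetric]\<close>)
    qed (use sq_integrable_square[OF s1(2)] in auto)
    also have "\<dots> = \<epsilon>\<^sup>2 * measure lebesgue (cbox a b)" using vM by simp
    finally show "(LINT x|M. (\<gamma> x - c x)\<^sup>2) \<le> (\<epsilon> * sqrt (measure lebesgue (cbox a b)))\<^sup>2"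
      by (simp add: power_mult_distrib)
  qed (use \<epsilon> in auto)
  then have b2: "\<bar>LINT x|M. (\<gamma> x - c x) * err x\<bar> \<le> \<epsilon> * sqrt (measure lebesgue (cbox a b)) * ?E"
    using cauchy_schwarz_integral_abs[OF s1(2) err_sq] mult_right_mono[of _ _ ?E] by (smt (verit) real_sqrt_ge_zero Bochner_Integration.integral_nonneg zero_le_power2)
  have "\<bar>LINT x|M. G x * err x\<bar> \<le> \<epsilon> * (1 + sqrt (measure lebesgue (cbox a b))) * ?E"
    unfolding split using b1 b2 by (simp add: algebra_simps)
  also have "\<dots> \<le> \<epsilon> * (1 + sqrt (measure lebesgue (cbox a b))) * (7 * mesh_size T * sqrt \<eta>2)"
    using \<epsilon> by (intro mult_left_mono E) auto
  finally show ?thesis .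
qed

end

section \<open>Saturation of the interpolation error\<close>

lemma AE_0_of_box_integrals_on:
  fixes f :: "real^'n \<Rightarrow> real"
  assumes f: "integrable (lebesgue_on (cbox a b)) f"
    and boxes: "\<And>c d. (LINT x|lebesgue_on (cbox a b). f x * indicator (box c d) x) = 0"
  shows "AE x in lebesgue_on (cbox a b). f x = 0"
proof -
  let ?U = "cbox a b"
  let ?f = "\<lambda>x. indicator ?U x *\<^sub>R f x"
  have f': "integrable lebesgue ?f"
    using f by (subst (asm) integrable_restrict_space) auto
  then obtain F where F: "F \<in> borel_measurable lborel" and eq: "AE x in lborel. ?f x = F x"
    using completion_ex_borel_measurable_real borel_measurable_integrable by blast
  then have ae: "AE x in lebesgue. ?f x = F x" by (intro AE_completion)
  have Fl: "F \<in> borel_measurable lebesgue" using F by (intro measurable_completion)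
  have "integrable lebesgue F" by (rule integrable_cong_AE_imp[OF f' Fl ae])
  then have Fi: "integrable lborel F" using F by (simp add: integrable_completion)
  have all: "(LINT x:box c d|lborel. F x) = 0" for c d
  proof -
    have "(LINT x:box c d|lborel. F x) = (LINT x|lebesgue. indicator (box c d) x *\<^sub>R F x)"
      unfolding set_lebesgue_integral_def using F by (intro integral_completion[symmetric]) auto
    also have "\<dots> = (LINT x|lebesgue. indicator ?U x *\<^sub>R (f x * indicator (box c d) x))"
    proof (rule integral_cong_AE)
      show "AE x in lebesgue. indicator (box c d) x *\<^sub>R F x = indicator ?U x *\<^sub>R (f x * indicator (box c d) x)"
        using ae by eventually_elim (auto simp: indicator_def)
      show "(\<lambda>x. indicator (box c d) x *\<^sub>R F x) \<in> borel_measurable lebesgue"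
        using Fl by (intro borel_measurable_scaleR borel_measurable_indicator) auto
      have "(\<lambda>x. ?f x * indicator (box c d) x) \<in> borel_measurable lebesgue"
        using f' by (intro borel_measurable_times borel_measurable_indicator) auto
      then show "(\<lambda>x. indicator ?U x *\<^sub>R (f x * indicator (box c d) x)) \<in> borel_measurable lebesgue"
        by (simp add: mult.assoc)
    qed
    also have "\<dots> = (LINT x|lebesgue_on ?U. f x * indicator (box c d) x)"
      by (subst integral_restrict_space) auto
    finally show ?thesis using boxes by simp
  qed
  have "AE x in lborel. F x = 0"
  proof (rule AE_0_of_box_integrals[OF Fi all])
    \<comment> \<open>An open box around the closed domain: as \<open>F\<close> vanishes almost
      everywhere off the domain, the total integral becomes a box integral.\<close>
    let ?B = "box (a - 1) (b + 1)"
    have sub: "?U \<subseteq> ?B"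
    proof
      fix x assume "x \<in> ?U"
      then have "(a - 1) $ i < x $ i \<and> x $ i < (b + 1) $ i" for i
        by (simp add: mem_box_cart less_le_trans le_less_trans add_strict_increasing2 spec[of _ i]) (smt (verit) mem_box_cart(2) \<open>x \<in> ?U\<close>)
      then show "x \<in> ?B" by (simp add: mem_box_cart)
    qed
    have "(LINT x|lborel. F x) = (LINT x|lborel. indicator ?B x *\<^sub>R F x)"
    proof (rule integral_cong_AE)
      show "AE x in lborel. F x = indicator ?B x *\<^sub>R F x"
        using eq
      proof eventually_elim
        case (elim x)
        then show ?case using sub by (cases "x \<in> ?U") (auto simp: indicator_def)
      qed
    qed (use F in auto)
    then show "(LINT x|lborel. F x) = 0" using all by (simp add: set_lebesgue_integral_def)
  qed
  then have "AE x in lebesgue. F x = 0" by (rule AE_completion)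
  with ae have "AE x in lebesgue. x \<in> ?U \<longrightarrow> f x = 0" by eventually_elim auto
  then show ?thesis by (subst AE_restrict_space_iff) auto
qed

section \<open>Ramps and their bubble projections\<close>

definition ramp :: "real \<Rightarrow> real \<Rightarrow> real \<Rightarrow> real" where
  "ramp c d t = max c (min d t)"

lemma ramp_bounded: "c \<le> d \<Longrightarrow> \<bar>ramp c d t\<bar> \<le> \<bar>c\<bar> + \<bar>d\<bar>"
  by (auto simp: ramp_def max_def min_def)

lemma ramp_continuous: "continuous_on S (ramp c d)"
  unfolding ramp_def[abs_def] by (intro continuous_intros)

text \<open>Differentiating a ramp gives the indicator of an interval. Integrating by parts in one
  coordinate against a ramp therefore produces one factor of the indicator of a box.\<close>

lemma ramp_deriv:
  assumes "c < d" "t \<notin> {c, d}"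
  shows "(ramp c d has_real_derivative indicator {c<..<d} t) (at t)"
proof -
  consider "t < c" | "c < t" "t < d" | "d < t" using assms by fastforce
  then show ?thesis
  proof cases
    case 1
    have "((\<lambda>_. c) has_real_derivative 0) (at t)" by simp
    then have "(ramp c d has_real_derivative 0) (at t)"
      by (rule has_field_derivative_transform_within_open[where S="{..<c}"]) (use 1 assms in \<open>auto simp: ramp_def\<close>)
    then show ?thesis using 1 by simp
  next
    case 2
    have "((\<lambda>t. t) has_real_derivative 1) (at t)" by simp
    then have "(ramp c d has_real_derivative 1) (at t)"
      by (rule has_field_derivative_transform_within_open[where S="{c<..<d}"]) (use 2 in \<open>auto simp: ramp_def\<close>)
    then show ?thesis using 2 by simp
  next
    case 3
    have "((\<lambda>_. d) has_real_derivative 0) (at t)" by simp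
    then have "(ramp c d has_real_derivative 0) (at t)"
      by (rule has_field_derivative_transform_within_open[where S="{d<..}"]) (use 3 assms in \<open>auto simp: ramp_def\<close>)
    then show ?thesis using 3 by simp
  qed
qed

text \<open>The cubic polynomial that vanishes at the ends of \<open>[l, r]\<close> and has the same moments of order
  zero and one as \<open>f\<close>.\<close>

definition bub_A :: "(real \<Rightarrow> real) \<Rightarrow> real \<Rightarrow> real \<Rightarrow> real" where
  "bub_A f l r = 3 / (4 * ((r - l) / 2) ^ 3) * integral {l..r} f"

definition bub_B :: "(real \<Rightarrow> real) \<Rightarrow> real \<Rightarrow> real \<Rightarrow> real" where
  "bub_B f l r = 15 / (4 * ((r - l) / 2) ^ 5) * integral {l..r} (\<lambda>t. f t * (t - (l + r) / 2))"

definition bub :: "(real \<Rightarrow> real) \<Rightarrow> real \<Rightarrow> real \<Rightarrow> real \<Rightarrow> real" where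
  "bub f l r t = (((r - l) / 2)\<^sup>2 - (t - (l + r) / 2)\<^sup>2) * (bub_A f l r + bub_B f l r * (t - (l + r) / 2))"

definition bub' :: "(real \<Rightarrow> real) \<Rightarrow> real \<Rightarrow> real \<Rightarrow> real \<Rightarrow> real" where
  "bub' f l r t = (- 2 * (t - (l + r) / 2)) * (bub_A f l r + bub_B f l r * (t - (l + r) / 2)) +
     (((r - l) / 2)\<^sup>2 - (t - (l + r) / 2)\<^sup>2) * bub_B f l r"

lemma bub_deriv: "(bub f l r has_real_derivative bub' f l r t) (at t within S)"
proof -
  have "((\<lambda>t. (q - (t - m)\<^sup>2) * (A + B * (t - m))) has_real_derivative
    (- 2 * (t - m)) * (A + B * (t - m)) + (q - (t - m)\<^sup>2) * B) (at t within S)" for q m A B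
    by (auto intro!: derivative_eq_intros simp: algebra_simps power2_eq_square)
  then show ?thesis unfolding bub_def[abs_def] bub'_def by blast
qed

lemma bub_continuous: "continuous_on S (bub f l r)"
  unfolding bub_def[abs_def] by (intro continuous_intros)

lemma bub'_continuous: "continuous_on S (bub' f l r)"
  unfolding bub'_def[abs_def] by (intro continuous_intros)

lemma bub_ends [simp]: "bub f l r l = 0" "bub f l r r = 0"
  by (auto simp: bub_def field_simps power2_eq_square)

lemma bub'_integral: "l \<le> r \<Longrightarrow> (bub' f l r has_integral 0) {l..r}"
  using fundamental_theorem_of_calculus[of l r "bub f l r" "bub' f l r"] bub_deriv
  by (auto simp: has_real_derivative_iff_has_vector_derivative)

lemma power_primitive:
  "((\<lambda>t. (t - m) ^ Suc k / real (Suc k)) has_real_derivative (t - m) ^ k) (at t within S)"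
proof -
  have "((\<lambda>t. t - m) has_real_derivative 1) (at t within S)" by (auto intro!: derivative_eq_intros)
  from DERIV_cdivide[OF DERIV_power[OF this, of "Suc k"], of "real (Suc k)"] show ?thesis
    by (simp del: of_nat_Suc)
qed

text \<open>The affine factor is general because, on a cell, a gradient component of the interpolant
  is an affine function of its own coordinate.\<close>

lemma bub_moments:
  assumes lr: "l < r" and f: "continuous_on {l..r} f"
  shows "((\<lambda>t. (\<alpha> + \<gamma> * (t - (l + r) / 2)) * (f t - bub f l r t)) has_integral 0) {l..r}"
proof -
  define m where "m = (l + r) / 2"
  define s where "s = (r - l) / 2"
  define A where "A = bub_A f l r"
  define B where "B = bub_B f l r"
  have s: "s > 0" and ends: "r - m = s" "l - m = - s" using lr by (auto simp: s_def m_def field_simps)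
  have bub: "bub f l r t = (s\<^sup>2 - (t - m)\<^sup>2) * (A + B * (t - m))" for t
    by (simp add: bub_def s_def m_def A_def B_def)
  define Q where "Q k t = (t - m) ^ Suc k / real (Suc k)" for k t
  define P where "P k t = A * (s\<^sup>2 * Q k t - Q (k + 2) t) + B * (s\<^sup>2 * Q (k + 1) t - Q (k + 3) t)" for k t
  have P: "((\<lambda>t. bub f l r t * (t - m) ^ k) has_integral P k r - P k l) {l..r}" for k
  proof (rule fundamental_theorem_of_calculus)
    fix t
    have "(P k has_real_derivative A * (s\<^sup>2 * (t - m) ^ k - (t - m) ^ (k + 2)) + B * (s\<^sup>2 * (t - m) ^ (k + 1) - (t - m) ^ (k + 3))) (at t within {l..r})"
      unfolding P_def[abs_def] Q_def by (intro DERIV_add DERIV_cmult DERIV_diff power_primitive)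
    moreover have "A * (s\<^sup>2 * (t - m) ^ k - (t - m) ^ (k + 2)) + B * (s\<^sup>2 * (t - m) ^ (k + 1) - (t - m) ^ (k + 3)) = bub f l r t * (t - m) ^ k"
      unfolding bub by (simp add: power_add power2_eq_square power3_eq_cube algebra_simps)
    ultimately show "(P k has_vector_derivative bub f l r t * (t - m) ^ k) (at t within {l..r})"
      by (simp only: has_real_derivative_iff_has_vector_derivative)
  qed (use lr in simp)
  have "P 0 r - P 0 l = integral {l..r} f"
  proof -
    \<comment> \<open>Over the interval of half length s and midpoint m, the integral of s^2 - (t -
      m)^2 is 4 s^3 / 3, and with the weight (t - m)^2 it is 4 s^5 / 15; odd weights give 0. The
      reciprocals are the constants in \<open>bub_A\<close> and \<open>bub_B\<close>.\<close>
    have "P 0 r - P 0 l = A * (4 * s ^ 3 / 3)"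
      unfolding P_def Q_def ends by (simp add: eval_nat_numeral algebra_simps)
    also have "\<dots> = integral {l..r} f" using s by (simp add: A_def bub_A_def s_def[symmetric])
    finally show ?thesis .
  qed
  with P[of 0] have I0: "(bub f l r has_integral integral {l..r} f) {l..r}" by simp
  have "P 1 r - P 1 l = integral {l..r} (\<lambda>t. f t * (t - m))"
  proof -
    have "P 1 r - P 1 l = B * (4 * s ^ 5 / 15)"
      unfolding P_def Q_def ends by (simp add: eval_nat_numeral algebra_simps)
    also have "\<dots> = integral {l..r} (\<lambda>t. f t * (t - m))" using s by (simp add: B_def bub_B_def s_def[symmetric] m_def)
    finally show ?thesis .
  qed
  with P[of 1] have I1: "((\<lambda>t. bub f l r t * (t - m)) has_integral integral {l..r} (\<lambda>t. f t * (t - m))) {l..r}" by simp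
  have f0: "(f has_integral integral {l..r} f) {l..r}"
    by (intro integrable_integral integrable_continuous_interval f)
  have f1: "((\<lambda>t. f t * (t - m)) has_integral integral {l..r} (\<lambda>t. f t * (t - m))) {l..r}"
    by (intro integrable_integral integrable_continuous_interval continuous_intros f)
  have "((\<lambda>t. \<alpha> * (f t - bub f l r t) + \<gamma> * (f t * (t - m) - bub f l r t * (t - m))) has_integral
    \<alpha> * (integral {l..r} f - integral {l..r} f) + \<gamma> * (integral {l..r} (\<lambda>t. f t * (t - m)) - integral {l..r} (\<lambda>t. f t * (t - m)))) {l..r}"
    by (intro has_integral_add has_integral_mult_right has_integral_diff f0 f1 I0 I1)
  moreover have "(\<alpha> + \<gamma> * (t - m)) * (f t - bub f l r t) =
    \<alpha> * (f t - bub f l r t) + \<gamma> * (f t * (t - m) - bub f l r t * (t - m))" for t by (simp add: algebra_simps)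
  ultimately show ?thesis unfolding m_def[symmetric] by simp
qed

text \<open>Here 9 = 3/2 + 15/2, from the bounds for the two coefficients. The derivative bound
  blows up like the inverse length of the interval; it is the source of 1/h in the saturation
  estimate.\<close>

lemma bub_bounds:
  assumes lr: "l < r" and f: "continuous_on {l..r} f" "\<And>t. t \<in> {l..r} \<Longrightarrow> \<bar>f t\<bar> \<le> C" and t: "t \<in> {l..r}"
  shows "\<bar>bub f l r t\<bar> \<le> 9 * C" and "\<bar>bub' f l r t\<bar> \<le> 52 * C / (r - l)"
proof -
  define m where "m = (l + r) / 2"
  define s where "s = (r - l) / 2"
  define A where "A = bub_A f l r"
  define B where "B = bub_B f l r"
  have s: "s > 0" and rl: "r - l = 2 * s" using lr by (simp_all add: s_def)
  have C: "0 \<le> C" using f(2)[OF t] by linarith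
  have tm: "\<bar>x - m\<bar> \<le> s" if "x \<in> {l..r}" for x using that by (auto simp: s_def m_def abs_le_iff field_simps)
  have "\<bar>integral {l..r} f\<bar> \<le> C * (r - l)"
    using integral_bound[of l r f C] lr f by simp
  then have i0: "\<bar>integral {l..r} f\<bar> \<le> C * (2 * s)" by (simp only: rl)
  have "\<bar>A\<bar> \<le> 3 / (4 * s ^ 3) * (C * (2 * s))"
    unfolding A_def bub_A_def s_def[symmetric] abs_mult using s by (intro mult_mono i0) auto
  also have "\<dots> = 3 / 2 * C / s\<^sup>2" using s by (simp add: field_simps power2_eq_square power3_eq_cube)
  finally have A: "\<bar>A\<bar> * s\<^sup>2 \<le> 3 / 2 * C" using s by (simp add: field_simps)
  have "\<bar>integral {l..r} (\<lambda>t. f t * (t - m))\<bar> \<le> C * s * (r - l)"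
  proof -
    have "norm (integral {l..r} (\<lambda>t. f t * (t - m))) \<le> C * s * (r - l)"
    proof (rule integral_bound)
      show "norm (f t * (t - m)) \<le> C * s" if "t \<in> {l..r}" for t
        unfolding real_norm_def abs_mult using f(2)[OF that] tm[OF that] C by (intro mult_mono) auto
    qed (use lr in \<open>auto intro!: continuous_intros f\<close>)
    then show ?thesis by simp
  qed
  then have i1: "\<bar>integral {l..r} (\<lambda>t. f t * (t - m))\<bar> \<le> C * s * (2 * s)" by (simp only: rl)
  have "\<bar>B\<bar> \<le> 15 / (4 * s ^ 5) * (C * s * (2 * s))"
    unfolding B_def bub_B_def s_def[symmetric] m_def[symmetric] abs_mult using s by (intro mult_mono i1) auto
  also have "\<dots> = 15 / 2 * C / s ^ 3" using s by (simp add: field_simps eval_nat_numeral)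
  finally have B: "\<bar>B\<bar> * s ^ 3 \<le> 15 / 2 * C" using s by (simp add: field_simps)
  define x where "x = t - m"
  have x: "\<bar>x\<bar> \<le> s" using tm[OF t] by (simp add: x_def)
  have x2: "x\<^sup>2 \<le> s\<^sup>2" using x s by (simp add: abs_le_square_iff[symmetric])
  have q: "\<bar>s\<^sup>2 - x\<^sup>2\<bar> \<le> s\<^sup>2" using x2 by (simp add: abs_le_iff)
  have AB: "\<bar>A + B * x\<bar> * s\<^sup>2 \<le> 9 * C"
  proof -
    have "\<bar>A + B * x\<bar> \<le> \<bar>A\<bar> + \<bar>B\<bar> * s"
      using abs_triangle_ineq[of A "B * x"] mult_left_mono[OF x, of "\<bar>B\<bar>"] by (simp add: abs_mult)
    then have "\<bar>A + B * x\<bar> * s\<^sup>2 \<le> (\<bar>A\<bar> + \<bar>B\<bar> * s) * s\<^sup>2" by (rule mult_right_mono) simp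
    also have "\<dots> = \<bar>A\<bar> * s\<^sup>2 + \<bar>B\<bar> * s ^ 3" by (simp add: algebra_simps power2_eq_square power3_eq_cube)
    finally show ?thesis using A B by linarith
  qed
  have "\<bar>bub f l r t\<bar> = \<bar>s\<^sup>2 - x\<^sup>2\<bar> * \<bar>A + B * x\<bar>"
    by (simp add: bub_def s_def m_def A_def B_def x_def abs_mult)
  also have "\<dots> \<le> s\<^sup>2 * \<bar>A + B * x\<bar>" by (rule mult_right_mono[OF q]) simp
  finally show "\<bar>bub f l r t\<bar> \<le> 9 * C" using AB by (simp add: mult.commute)
  have "\<bar>bub' f l r t\<bar> = \<bar>(- 2 * x) * (A + B * x) + (s\<^sup>2 - x\<^sup>2) * B\<bar>"
    by (simp add: bub'_def s_def m_def A_def B_def x_def)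
  also have "\<dots> \<le> 2 * \<bar>x\<bar> * \<bar>A + B * x\<bar> + \<bar>s\<^sup>2 - x\<^sup>2\<bar> * \<bar>B\<bar>"
    using abs_triangle_ineq[of "(- 2 * x) * (A + B * x)" "(s\<^sup>2 - x\<^sup>2) * B"] by (simp add: abs_mult)
  also have "\<dots> \<le> 2 * s * \<bar>A + B * x\<bar> + s\<^sup>2 * \<bar>B\<bar>"
    using x q by (intro add_mono mult_right_mono) auto
  finally have "\<bar>bub' f l r t\<bar> * s \<le> (2 * s * \<bar>A + B * x\<bar> + s\<^sup>2 * \<bar>B\<bar>) * s"
    using s by (intro mult_right_mono) auto
  also have "\<dots> = 2 * (\<bar>A + B * x\<bar> * s\<^sup>2) + \<bar>B\<bar> * s ^ 3" by (simp add: algebra_simps power2_eq_square power3_eq_cube)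
  \<comment> \<open>2 * 9 + 15/2 is below 26. Passing from the half length to the full length
    doubles this to 52.\<close>
  also have "\<dots> \<le> 26 * C" using AB B C by linarith
  finally have "\<bar>bub' f l r t\<bar> * (r - l) \<le> 52 * C" by (simp add: s_def)
  then show "\<bar>bub' f l r t\<bar> \<le> 52 * C / (r - l)" using lr by (simp add: pos_le_divide_eq)
qed

section \<open>Functions of one coordinate on the grid\<close>

context box_mesh
begin

text \<open>By \<open>overlap_same_side\<close>, the sides of all cells in direction
  \<open>i\<close> form a subdivision of \<open>{a $ i..b $ i}\<close>. A function given interval by
  interval is then a function of \<open>x $ i\<close> on the whole domain.\<close>

definition grid :: "'n \<Rightarrow> (real \<times> real) set" where
  "grid i = (\<lambda>K. (lo K $ i, hi K $ i)) ` T"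

lemma finite_grid: "finite (grid i)" by (simp add: grid_def)

lemma grid_less: "(l, r) \<in> grid i \<Longrightarrow> l < r"
  using cell(2) by (auto simp: grid_def)

lemma grid_overlap:
  assumes "(l, r) \<in> grid i" "(l', r') \<in> grid i" "t \<in> {l<..<r}" "t \<in> {l'..r'}"
  shows "(l, r) = (l', r')"
proof -
  obtain K L where K: "K \<in> T" "l = lo K $ i" "r = hi K $ i" and L: "L \<in> T" "l' = lo L $ i" "r' = hi L $ i"
    using assms(1,2) by (auto simp: grid_def)
  have "l' < r'" by (rule grid_less[OF assms(2)])
  then have "max l l' < min r r'" using assms(3,4) by auto
  then obtain s where "max l l' < s" "s < min r r'" using dense by blast
  then have "same_side i K L" by (intro overlap_same_side[OF K(1) L(1), of _ s]) (auto simp: K L)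
  then show ?thesis by (simp add: same_side_def K L)
qed

lemma grid_cover:
  assumes "t \<in> {a $ i..b $ i}"
  obtains l r where "(l, r) \<in> grid i" "t \<in> {l..r}"
proof -
  have "upd a i t \<in> cbox a b" using assms ab by (auto simp: mem_box_cart less_imp_le)
  then obtain K where K: "K \<in> T" "upd a i t \<in> K" using Union_T by blast
  then have "lo K $ i \<le> t \<and> t \<le> hi K $ i" unfolding mem_cell[OF K(1)] by (metis upd_nth)
  then show ?thesis using that[of "lo K $ i" "hi K $ i"] K(1) by (auto simp: grid_def)
qed

text \<open>The value at grid points is 0. For \<open>bub f\<close> this is the right value, which
  makes the glued function continuous; for \<open>bub' f\<close> the grid points are finitely many
  exceptions that an integral does not see.\<close>

definition grid_fun :: "'n \<Rightarrow> (real \<Rightarrow> real \<Rightarrow> real \<Rightarrow> real) \<Rightarrow> real \<Rightarrow> real" where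
  "grid_fun i h t = (\<Sum>(l, r)\<in>grid i. indicator {l<..<r} t * h l r t)"

lemma grid_fun_eq:
  assumes I: "(l, r) \<in> grid i" and t: "t \<in> {l<..<r}"
  shows "grid_fun i h t = h l r t"
proof -
  have "grid_fun i h t = (\<Sum>J\<in>grid i. if J = (l, r) then h l r t else 0)"
    unfolding grid_fun_def
  proof (rule sum.cong[OF refl])
    fix J assume J: "J \<in> grid i"
    obtain l' r' where J': "J = (l', r')" by (cases J)
    show "(case J of (l, r) \<Rightarrow> indicator {l<..<r} t * h l r t) = (if J = (l, r) then h l r t else 0)"
    proof (cases "J = (l, r)")
      case False
      have "t \<notin> {l'<..<r'}"
      proof
        assume "t \<in> {l'<..<r'}"
        then have "t \<in> {l'..r'}" by simp
        from grid_overlap[OF I J[unfolded J'] t this] False show False by (simp add: J')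
      qed
      then have "(case J of (l, r) \<Rightarrow> indicator {l<..<r} t * h l r t) = 0" unfolding J' by simp
      then show ?thesis using False by (simp only: if_False)
    qed (use t in simp)
  qed
  then show ?thesis using I by (simp add: finite_grid)
qed

lemma grid_fun_end:
  assumes I: "(l, r) \<in> grid i" and t: "t = l \<or> t = r"
  shows "grid_fun i h t = 0"
  unfolding grid_fun_def
proof (rule sum.neutral, rule ballI)
  fix J assume J: "J \<in> grid i"
  obtain l' r' where J': "J = (l', r')" by (cases J)
  have "l < r" by (rule grid_less[OF I])
  have "t \<notin> {l'<..<r'}"
  proof
    assume t': "t \<in> {l'<..<r'}"
    have "t \<in> {l..r}" using t \<open>l < r\<close> by auto
    from grid_overlap[OF J[unfolded J'] I t' this] t' t show False by auto
  qed
  then show "(case J of (l, r) \<Rightarrow> indicator {l<..<r} t * h l r t) = 0" by (simp add: J')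
qed

lemma grid_fun_bounded:
  assumes "\<And>l r t. (l, r) \<in> grid i \<Longrightarrow> t \<in> {l<..<r} \<Longrightarrow> \<bar>h l r t\<bar> \<le> C" "0 \<le> C"
  shows "\<bar>grid_fun i h t\<bar> \<le> C"
proof (cases "\<exists>l r. (l, r) \<in> grid i \<and> t \<in> {l<..<r}")
  case True
  then obtain l r where I: "(l, r) \<in> grid i" "t \<in> {l<..<r}" by blast
  show ?thesis using assms(1)[OF I] by (simp only: grid_fun_eq[OF I])
next
  case False
  have "grid_fun i h t = 0" unfolding grid_fun_def
  proof (rule sum.neutral, rule ballI)
    fix J assume "J \<in> grid i"
    then have "t \<notin> {fst J<..<snd J}" using False by (metis prod.collapse)
    then show "(case J of (l, r) \<Rightarrow> indicator {l<..<r} t * h l r t) = 0" by (simp add: case_prod_beta)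
  qed
  then show ?thesis using assms(2) by simp
qed

lemma grid_fun_borel:
  assumes "\<And>l r. h l r \<in> borel_measurable borel"
  shows "grid_fun i h \<in> borel_measurable borel"
  unfolding grid_fun_def[abs_def] using assms
  by (auto intro!: borel_measurable_sum borel_measurable_times simp: case_prod_beta)

lemma grid_bub_eq:
  assumes I: "(l, r) \<in> grid i" and t: "t \<in> {l..r}"
  shows "grid_fun i (bub f) t = bub f l r t"
proof (cases "t \<in> {l<..<r}")
  case False
  then have "t = l \<or> t = r" using t by auto
  then show ?thesis using grid_fun_end[OF I] by auto
qed (rule grid_fun_eq[OF I])

lemma grid_bub_continuous: "continuous_on {a $ i..b $ i} (grid_fun i (bub f))"
proof -
  have "continuous_on (\<Union>J\<in>grid i. {fst J..snd J}) (grid_fun i (bub f))"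
  proof (rule continuous_on_closed_Union[OF finite_grid])
    fix J assume J: "J \<in> grid i"
    show "continuous_on {fst J..snd J} (grid_fun i (bub f))"
      using continuous_on_cong[THEN iffD1, OF refl _ bub_continuous[of "{fst J..snd J}" f "fst J" "snd J"]]
        grid_bub_eq[of "fst J" "snd J" i _ f] J by simp
  qed auto
  moreover have "{a $ i..b $ i} \<subseteq> (\<Union>J\<in>grid i. {fst J..snd J})"
  proof
    fix t assume "t \<in> {a $ i..b $ i}"
    then obtain l r where "(l, r) \<in> grid i" "t \<in> {l..r}" by (rule grid_cover)
    then show "t \<in> (\<Union>J\<in>grid i. {fst J..snd J})" by (intro UN_I[of "(l, r)"]) auto
  qed
  ultimately show ?thesis by (rule continuous_on_subset)
qed

lemma grid_bub_deriv:
  assumes t: "t \<in> {a $ i<..<b $ i} - (fst ` grid i \<union> snd ` grid i)"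
  shows "(grid_fun i (bub f) has_real_derivative grid_fun i (bub' f) t) (at t)"
proof -
  have "t \<in> {a $ i..b $ i}" using t by auto
  then obtain l r where I: "(l, r) \<in> grid i" "t \<in> {l..r}" by (rule grid_cover)
  then have "t \<noteq> l" "t \<noteq> r" using t by force+
  with I(2) have tI: "t \<in> {l<..<r}" by auto
  have "(grid_fun i (bub f) has_real_derivative bub' f l r t) (at t)"
    by (rule has_field_derivative_transform_within_open[OF bub_deriv, of "{l<..<r}"])
      (use tI grid_fun_eq[OF I(1)] in auto)
  then show ?thesis by (simp add: grid_fun_eq[OF I(1) tI])
qed

end

lemma borel_measurable_coord: "(\<lambda>x::real^'n. x $ i) \<in> borel_measurable borel"
  by (intro borel_measurable_continuous_onI continuous_on_component continuous_on_id)

section \<open>Testing the gradient of the ground state with bounded functions\<close>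

context ground_state_problem
begin

lemma bounded_sq:
  assumes "f \<in> borel_measurable borel" "\<And>x. x \<in> cbox a b \<Longrightarrow> \<bar>f x\<bar> \<le> C"
  shows "sq_integrable M f"
  by (rule sq_integrable_bounded[OF finite_M borel_measurable_lebesgue_on[OF assms(1)], of C])
    (use assms(2) in \<open>auto intro!: AE_I2 simp: space_restrict_space\<close>)

lemma integral_mult_bounded:
  assumes f: "sq_integrable M f" and h: "h \<in> borel_measurable borel" "\<And>x. x \<in> cbox a b \<Longrightarrow> \<bar>h x\<bar> \<le> C" and "0 \<le> C"
  shows "\<bar>LINT x|M. f x * h x\<bar> \<le> sqrt (LINT x|M. (f x)\<^sup>2) * (C * sqrt (measure lebesgue (cbox a b)))"
proof -
  interpret finite_measure M by (rule finite_M)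
  have vM: "measure M (space M) = measure lebesgue (cbox a b)" by (simp add: measure_restrict_space)
  have hs: "sq_integrable M h" by (rule bounded_sq[OF h])
  have "(LINT x|M. (h x)\<^sup>2) \<le> (LINT x|M. C\<^sup>2)"
  proof (rule integral_mono_AE)
    show "AE x in M. (h x)\<^sup>2 \<le> C\<^sup>2"
      using h(2) \<open>0 \<le> C\<close> by (intro AE_I2) (simp add: space_restrict_space abs_le_square_iff[symmetric])
  qed (use hs in auto)
  also have "\<dots> = C\<^sup>2 * measure lebesgue (cbox a b)" using vM by simp
  finally have "sqrt (LINT x|M. (h x)\<^sup>2) \<le> C * sqrt (measure lebesgue (cbox a b))"
    using \<open>0 \<le> C\<close> by (intro real_le_lsqrt) (auto simp: power_mult_distrib)
  then have "sqrt (LINT x|M. (f x)\<^sup>2) * sqrt (LINT x|M. (h x)\<^sup>2) \<le> sqrt (LINT x|M. (f x)\<^sup>2) * (C * sqrt (measure lebesgue (cbox a b)))"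
    by (rule mult_left_mono) simp
  with cauchy_schwarz_integral_abs[OF f hs] show ?thesis by linarith
qed

text \<open>The weight need not vanish at the boundary of the domain: the approximating test
  functions do, so no boundary term survives. This is how the zero boundary values of
  \<open>u\<close> enter the lower bound.\<close>

lemma u_by_parts:
  fixes F F' :: "real \<Rightarrow> real" and q :: "real^'n \<Rightarrow> real"
  assumes F: "continuous_on {a $ i..b $ i} F" "F \<in> borel_measurable borel" "F' \<in> borel_measurable borel"
      "finite P" "\<And>t. t \<in> {a $ i<..<b $ i} - P \<Longrightarrow> (F has_real_derivative F' t) (at t)"
    and bF: "\<And>t. t \<in> {a $ i..b $ i} \<Longrightarrow> \<bar>F t\<bar> \<le> C" "\<And>t. t \<in> {a $ i..b $ i} \<Longrightarrow> \<bar>F' t\<bar> \<le> C"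
    and q: "q \<in> borel_measurable borel" "\<And>x. x \<in> cbox a b \<Longrightarrow> \<bar>q x\<bar> \<le> C" "\<And>x t. q (upd x i t) = q x"
  shows "(LINT x|M. g x $ i * (F (x $ i) * q x)) = - (LINT x|M. u x * (F' (x $ i) * q x))"
proof (rule LIMSEQ_unique)
  note [measurable] = F(2,3) q(1) borel_measurable_coord
  have b: "\<bar>F (x $ i) * q x\<bar> \<le> C * C" "\<bar>F' (x $ i) * q x\<bar> \<le> C * C" if x: "x \<in> cbox a b" for x
  proof -
    have xi: "x $ i \<in> {a $ i..b $ i}" using x by (auto simp: mem_box_cart)
    show "\<bar>F (x $ i) * q x\<bar> \<le> C * C" "\<bar>F' (x $ i) * q x\<bar> \<le> C * C"
      unfolding abs_mult using bF[OF xi] q(2)[OF x] by (auto intro!: mult_mono)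
  qed
  have s: "sq_integrable M (\<lambda>x. F (x $ i) * q x)" "sq_integrable M (\<lambda>x. F' (x $ i) * q x)"
    by (rule bounded_sq[OF _ b(1)], measurable, rule bounded_sq[OF _ b(2)], measurable)
  show "(\<lambda>k. LINT x|M. partial_deriv i (\<phi> k) x * (F (x $ i) * q x)) \<longlonglongrightarrow> (LINT x|M. g x $ i * (F (x $ i) * q x))"
    by (rule sq_tendsto_inner_const[OF conv_grad s(1)])
  have "(LINT x|M. partial_deriv i (\<phi> k) x * (F (x $ i) * q x)) = - (LINT x|M. \<phi> k x * (F' (x $ i) * q x))" for k
  proof (rule integral_partial_by_parts[OF smooth_\<phi> _ _ F bF q])
    show "a $ i \<le> b $ i" using ab[of i] by simp
    show "\<phi> k x = 0" if "x $ i \<in> {a $ i, b $ i}" for x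
      by (rule test_function_zero[OF test]) (use that in \<open>auto simp: mem_box_cart intro!: exI[of _ i]\<close>)
  qed
  then show "(\<lambda>k. LINT x|M. partial_deriv i (\<phi> k) x * (F (x $ i) * q x)) \<longlonglongrightarrow> - (LINT x|M. u x * (F' (x $ i) * q x))"
    using tendsto_minus[OF sq_tendsto_inner_const[OF conv s(2)]] by simp
qed

end

context interpolation
begin

lemma gerr_comp_le: "(LINT x|M. (gerr x $ i)\<^sup>2) \<le> \<eta>2"
proof -
  have "(LINT x|M. (gerr x $ i)\<^sup>2) \<le> (\<Sum>i\<in>UNIV. LINT x|M. (gerr x $ i)\<^sup>2)"
    by (rule member_le_sum) auto
  then show ?thesis by (simp add: \<eta>2_def integral_norm_sq_sum(1)[OF gerr_sq])
qed

lemma gw_integral_0: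
  assumes hb: "sq_integrable M X" and X: "X \<in> borel_measurable borel"
    and cells: "\<And>K. K \<in> T \<Longrightarrow> (LINT x|lebesgue_on (cbox (lo K) (hi K)). partial_deriv i (interp K) x * X x) = 0"
  shows "(LINT x|M. gw x $ i * X x) = 0"
proof -
  have "(LINT x|M. gw x $ i * X x) = (\<Sum>K\<in>T. LINT x|lebesgue_on K. gw x $ i * X x)"
    by (rule mesh.integral_cells[OF sq_integrable_mult[OF gw_sq hb]])
  also have "\<dots> = (\<Sum>K\<in>T. 0)"
  proof (rule sum.cong[OF refl])
    fix K assume K: "K \<in> T"
    have eM: "lebesgue_on K = lebesgue_on (cbox (lo K) (hi K))" by (rule arg_cong[OF mesh.cell(1)[OF K]])
    have "(LINT x|lebesgue_on K. gw x $ i * X x) = (LINT x|lebesgue_on K. partial_deriv i (interp K) x * X x)"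
    proof (rule integral_cong_AE)
      show "AE x in lebesgue_on K. gw x $ i * X x = partial_deriv i (interp K) x * X x"
        using mesh.piecewise_cell_AE[OF K, of "\<lambda>K. partial_deriv i (interp K)"]
        by eventually_elim (simp add: gw_def)
      show "(\<lambda>x. gw x $ i * X x) \<in> borel_measurable (lebesgue_on K)"
        by (intro borel_measurable_times sq_integrable_measurable[OF sq_cell[OF K gw_sq]] borel_measurable_lebesgue_on X)
      show "(\<lambda>x. partial_deriv i (interp K) x * X x) \<in> borel_measurable (lebesgue_on K)"
        by (intro borel_measurable_times partial_interp_measurable_cell borel_measurable_lebesgue_on X)
    qed
    also have "\<dots> = 0" unfolding eM by (rule cells[OF K])
    finally show "(LINT x|lebesgue_on K. gw x $ i * X x) = 0" .
  qed
  finally show ?thesis by simp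
qed

text \<open>Mixed second derivatives of the interpolant vanish on every cell, whereas the left-hand
  side is the mixed second derivative of \<open>u\<close> tested with a product of ramps. Replacing one ramp by its bubble
  projection, which vanishes on the faces of the cells, removes the jumps of the interpolant.\<close>

lemma saturation:
  assumes ij: "i \<noteq> j" and cd: "\<And>m. c $ m < d $ m" and s: "0 < s"
    and sides: "\<And>K. K \<in> T \<Longrightarrow> s \<le> hi K $ i - lo K $ i"
    and C: "1 \<le> C" "\<bar>c $ i\<bar> + \<bar>d $ i\<bar> \<le> C" "\<bar>c $ j\<bar> + \<bar>d $ j\<bar> \<le> C"
  shows "\<bar>LINT x|M. u x * indicator (box c d) x\<bar> \<le>
    sqrt \<eta>2 * (sqrt (measure lebesgue (cbox a b)) * (10 * C + 52 * C\<^sup>2 / s))"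
proof -
  let ?f = "ramp (c $ i) (d $ i)" and ?fj = "ramp (c $ j) (d $ j)"
  let ?I = "\<lambda>m t. indicator {c $ m<..<d $ m} t :: real"
  define r where "r x = (\<Prod>m\<in>UNIV - {i, j}. ?I m (x $ m))" for x :: "real^'n"
  define F where "F = mesh.grid_fun i (bub ?f)"
  define F' where "F' = mesh.grid_fun i (bub' ?f)"
  define D where "D = 10 * C + 52 * C\<^sup>2 / s"
  have C0: "0 \<le> C" using C by simp
  have CC: "C \<le> C\<^sup>2" using mult_left_mono[OF C(1) C0] by (simp add: power2_eq_square)
  have "0 \<le> 52 * C\<^sup>2 / s" using s by simp
  then have D1: "1 \<le> D" "C \<le> D" "9 * C \<le> D" using C(1) by (auto simp: D_def)
  have fb: "\<bar>?f t\<bar> \<le> C" "\<bar>?fj t\<bar> \<le> C" for t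
    using ramp_bounded[of "c $ i" "d $ i" t] ramp_bounded[of "c $ j" "d $ j" t] cd[of i] cd[of j] C by linarith+
  have gl: "l < rr" and gs: "s \<le> rr - l" if "(l, rr) \<in> mesh.grid i" for l rr
    using that mesh.grid_less[OF that] sides by (auto simp: mesh.grid_def)
  have Fb: "\<bar>F t\<bar> \<le> 9 * C" for t
    unfolding F_def
    by (rule mesh.grid_fun_bounded) (use bub_bounds(1)[OF gl ramp_continuous fb(1)] C0 in auto)
  have F'b: "\<bar>F' t\<bar> \<le> 52 * C / s" for t
    unfolding F'_def
  proof (rule mesh.grid_fun_bounded)
    fix l rr t assume I: "(l, rr) \<in> mesh.grid i" "t \<in> {l<..<rr}"
    have "\<bar>bub' ?f l rr t\<bar> \<le> 52 * C / (rr - l)"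
      by (rule bub_bounds(2)[OF gl[OF I(1)] ramp_continuous fb(1)]) (use I(2) in auto)
    also have "\<dots> \<le> 52 * C / s" using gs[OF I(1)] s C0 by (intro divide_left_mono) auto
    finally show "\<bar>bub' ?f l rr t\<bar> \<le> 52 * C / s" .
  qed (use s C0 in simp)
  have F'D: "52 * C / s \<le> D"
  proof -
    have "52 * C / s \<le> 52 * C\<^sup>2 / s" using CC s by (intro divide_right_mono) auto
    then show ?thesis using C0 by (simp add: D_def)
  qed
  have [measurable]: "F \<in> borel_measurable borel" "F' \<in> borel_measurable borel"
    unfolding F_def F'_def
    by (intro mesh.grid_fun_borel borel_measurable_continuous_onI[OF bub_continuous]
        borel_measurable_continuous_onI[OF bub'_continuous])+
  have [measurable]: "?f \<in> borel_measurable borel" "?fj \<in> borel_measurable borel"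
    by (auto intro!: borel_measurable_continuous_onI ramp_continuous)
  have Im: "?I m \<in> borel_measurable borel" for m by simp
  note [measurable] = borel_measurable_coord
  have rm [measurable]: "r \<in> borel_measurable borel"
    unfolding r_def[abs_def] by (intro borel_measurable_prod measurable_compose[OF borel_measurable_coord Im])
  have r0: "0 \<le> r x" and r1: "r x \<le> 1" for x
    unfolding r_def by (auto intro!: prod_nonneg prod_le_1 simp: indicator_def)
  have rb: "\<bar>r x\<bar> \<le> 1" for x using r0[of x] r1[of x] by simp
  have ru: "r (upd x m t) = r x" if "m \<in> {i, j}" for x m t
    unfolding r_def using that by (intro prod.cong) auto
  have Ib: "\<bar>?I m t\<bar> \<le> 1" for m t by (simp add: indicator_def)
  have m1: "\<bar>p * q\<bar> \<le> A * B" if "\<bar>p\<bar> \<le> A" "\<bar>q\<bar> \<le> B" for p q A B :: real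
    unfolding abs_mult using that by (intro mult_mono) auto
  \<comment> \<open>Integrating the ramp in direction \<open>i\<close> by parts produces the last
    missing factor of the indicator of the box.\<close>
  have I1: "(LINT x|M. g x $ i * (?f (x $ i) * (?I j (x $ j) * r x))) = - (LINT x|M. u x * (?I i (x $ i) * (?I j (x $ j) * r x)))"
  proof (rule u_by_parts[where C=D and P="{c $ i, d $ i}"])
    show "(?f has_real_derivative ?I i t) (at t)" if "t \<in> {a $ i<..<b $ i} - {c $ i, d $ i}" for t
      by (rule ramp_deriv[OF cd]) (use that in auto)
    show "\<bar>?f t\<bar> \<le> D" "\<bar>?I i t\<bar> \<le> D" for t using fb(1)[of t] Ib[of i t] D1 by linarith+
    show "\<bar>?I j (x $ j) * r x\<bar> \<le> D" for x using m1[OF Ib rb, of j "x $ j" x] D1 by linarith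
    show "?I j (upd x i t $ j) * r (upd x i t) = ?I j (x $ j) * r x" for x t using ij ru[of i x t] by simp
  qed (auto intro: ramp_continuous)
  have I2: "(LINT x|M. g x $ i * (F (x $ i) * (?I j (x $ j) * r x))) = - (LINT x|M. u x * (F' (x $ i) * (?I j (x $ j) * r x)))"
  proof (rule u_by_parts[where C=D and P="fst ` mesh.grid i \<union> snd ` mesh.grid i"])
    show "continuous_on {a $ i..b $ i} F" unfolding F_def by (rule mesh.grid_bub_continuous)
    show "finite (fst ` mesh.grid i \<union> snd ` mesh.grid i)" by (simp add: mesh.finite_grid)
    show "(F has_real_derivative F' t) (at t)" if "t \<in> {a $ i<..<b $ i} - (fst ` mesh.grid i \<union> snd ` mesh.grid i)" for t
      unfolding F_def F'_def by (rule mesh.grid_bub_deriv[OF that])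
    show "\<bar>F t\<bar> \<le> D" "\<bar>F' t\<bar> \<le> D" for t using Fb[of t] F'b[of t] F'D D1 by linarith+
    show "\<bar>?I j (x $ j) * r x\<bar> \<le> D" for x using m1[OF Ib rb, of j "x $ j" x] D1 by linarith
    show "?I j (upd x i t $ j) * r (upd x i t) = ?I j (x $ j) * r x" for x t using ij ru[of i x t] by simp
  qed auto
  \<comment> \<open>The right-hand side agrees with that of I2. The bubble part of the
    \<open>i\<close>-th gradient component is thereby traded for an expression in the
    \<open>j\<close>-th one.\<close>
  have I3: "(LINT x|M. g x $ j * (?fj (x $ j) * (F' (x $ i) * r x))) = - (LINT x|M. u x * (?I j (x $ j) * (F' (x $ i) * r x)))"
  proof (rule u_by_parts[where C=D and P="{c $ j, d $ j}"])
    show "(?fj has_real_derivative ?I j t) (at t)" if "t \<in> {a $ j<..<b $ j} - {c $ j, d $ j}" for t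
      by (rule ramp_deriv[OF cd]) (use that in auto)
    show "\<bar>?fj t\<bar> \<le> D" "\<bar>?I j t\<bar> \<le> D" for t using fb(2)[of t] Ib[of j t] D1 by linarith+
    show "\<bar>F' (x $ i) * r x\<bar> \<le> D" for x using m1[OF F'b rb, of "x $ i" x] F'D by linarith
    show "F' (upd x j t $ i) * r (upd x j t) = F' (x $ i) * r x" for x t using ij ru[of j x t] by simp
  qed (auto intro: ramp_continuous)
  \<comment> \<open>\<open>X\<close> and \<open>Y\<close> are the components of the field tested
    against the gradient error. On the gradient of \<open>u\<close> it gives minus the integral over
    the box; on each component of \<open>gw\<close> it gives 0.\<close>
  define X where "X x = (?f (x $ i) - F (x $ i)) * (?I j (x $ j) * r x)" for x
  define Y where "Y x = ?fj (x $ j) * (F' (x $ i) * r x)" for x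
  have Xm [measurable]: "X \<in> borel_measurable borel" and Ym [measurable]: "Y \<in> borel_measurable borel"
    unfolding X_def[abs_def] Y_def[abs_def] by measurable
  have Xb: "\<bar>X x\<bar> \<le> 10 * C" for x
  proof -
    have "\<bar>?f (x $ i) - F (x $ i)\<bar> \<le> 10 * C" using fb(1)[of "x $ i"] Fb[of "x $ i"] by linarith
    from m1[OF this m1[OF Ib rb], of j "x $ j" x] show ?thesis by (simp add: X_def)
  qed
  have Yb: "\<bar>Y x\<bar> \<le> 52 * C\<^sup>2 / s" for x
    using m1[OF fb(2) m1[OF F'b rb], of "x $ j" "x $ i" x] by (simp add: Y_def power2_eq_square mult.left_commute)
  have Xs: "sq_integrable M X" by (rule bounded_sq[OF Xm Xb])
  have Ys: "sq_integrable M Y" by (rule bounded_sq[OF Ym Yb])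
  \<comment> \<open>On a cell the \<open>i\<close>-th component of \<open>gw\<close> is affine in
    \<open>x $ i\<close>, and the ramp minus its bubble projection has vanishing moments of order
    zero and one on every grid interval.\<close>
  have gX: "(LINT x|M. gw x $ i * X x) = 0"
  proof (rule gw_integral_0[OF Xs Xm])
    fix K assume K: "K \<in> T"
    have I: "(lo K $ i, hi K $ i) \<in> mesh.grid i" using K by (auto simp: mesh.grid_def)
    let ?h = "\<lambda>t. (slope K i + 2 * curv K i * (t - cen K i)) * (?f t - F t)"
    have "((\<lambda>t. (slope K i + 2 * curv K i * (t - (lo K $ i + hi K $ i) / 2)) * (?f t - bub ?f (lo K $ i) (hi K $ i) t)) has_integral 0) {lo K $ i..hi K $ i}"
      by (rule bub_moments[OF gl[OF I] ramp_continuous])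
    then have h0: "(?h has_integral 0) {lo K $ i..hi K $ i}"
      by (rule has_integral_eq[rotated]) (simp add: F_def mesh.grid_bub_eq[OF I] cen_def)
    define A where "A = \<bar>slope K i\<bar> + 2 * \<bar>curv K i\<bar> * (hi K $ i - lo K $ i)"
    have hb: "\<bar>?h t\<bar> \<le> A * (10 * C)" if "t \<in> {lo K $ i..hi K $ i}" for t
    proof (rule m1)
      have "\<bar>t - cen K i\<bar> \<le> hi K $ i - lo K $ i" using that by (auto simp: cen_def abs_le_iff field_simps)
      then have "\<bar>2 * curv K i * (t - cen K i)\<bar> \<le> 2 * \<bar>curv K i\<bar> * (hi K $ i - lo K $ i)"
        by (intro m1) auto
      then show "\<bar>slope K i + 2 * curv K i * (t - cen K i)\<bar> \<le> A" unfolding A_def by linarith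
      show "\<bar>?f t - F t\<bar> \<le> 10 * C" using fb(1)[of t] Fb[of t] by linarith
    qed
    have "(LINT x|lebesgue_on (cbox (lo K) (hi K)). ?h (x $ i) * (?I j (x $ j) * r x)) = 0"
    proof (rule integral_separated_0[where C="max (A * (10 * C)) 1"])
      show "?h \<in> borel_measurable borel" by measurable
      show "\<bar>?h t\<bar> \<le> max (A * (10 * C)) 1" if "t \<in> {lo K $ i..hi K $ i}" for t using hb[OF that] by simp
      show "\<bar>?I j (x $ j) * r x\<bar> \<le> max (A * (10 * C)) 1" for x using m1[OF Ib rb, of j "x $ j" x] by simp
      show "?I j (upd x i t $ j) * r (upd x i t) = ?I j (x $ j) * r x" for x t using ij ru[of i x t] by simp
    qed (use h0 in auto)
    then show "(LINT x|lebesgue_on (cbox (lo K) (hi K)). partial_deriv i (interp K) x * X x) = 0"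
      by (simp only: partial_interp X_def mult.assoc)
  qed
  \<comment> \<open>On a cell the \<open>j\<close>-th component of \<open>gw\<close> does not depend
    on \<open>x $ i\<close>, while \<open>F'\<close> integrates to 0 over every grid interval
    because the bubble vanishes at both ends.\<close>
  have gY: "(LINT x|M. gw x $ j * Y x) = 0"
  proof (rule gw_integral_0[OF Ys Ym])
    fix K assume K: "K \<in> T"
    have I: "(lo K $ i, hi K $ i) \<in> mesh.grid i" using K by (auto simp: mesh.grid_def)
    have h0: "(F' has_integral 0) {lo K $ i..hi K $ i}"
    proof (rule has_integral_spike_finite)
      show "(bub' ?f (lo K $ i) (hi K $ i) has_integral 0) {lo K $ i..hi K $ i}"
        by (rule bub'_integral) (use gl[OF I] in simp)
      show "F' t = bub' ?f (lo K $ i) (hi K $ i) t" if "t \<in> {lo K $ i..hi K $ i} - {lo K $ i, hi K $ i}" for t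
        unfolding F'_def by (rule mesh.grid_fun_eq[OF I]) (use that in auto)
    qed simp
    let ?q = "\<lambda>x. (slope K j + 2 * curv K j * (x $ j - cen K j)) * (?fj (x $ j) * r x)"
    define A where "A = \<bar>slope K j\<bar> + 2 * \<bar>curv K j\<bar> * (hi K $ j - lo K $ j)"
    have qb: "\<bar>?q x\<bar> \<le> A * (C * 1)" if x: "x \<in> cbox (lo K) (hi K)" for x
    proof (rule m1[OF _ m1[OF fb(2) rb]])
      have "lo K $ j \<le> x $ j" "x $ j \<le> hi K $ j" using x by (auto simp: mem_box_cart)
      then have "\<bar>x $ j - cen K j\<bar> \<le> hi K $ j - lo K $ j" by (auto simp: cen_def abs_le_iff field_simps)
      then have "\<bar>2 * curv K j * (x $ j - cen K j)\<bar> \<le> 2 * \<bar>curv K j\<bar> * (hi K $ j - lo K $ j)"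
        by (intro m1) auto
      then show "\<bar>slope K j + 2 * curv K j * (x $ j - cen K j)\<bar> \<le> A" unfolding A_def by linarith
    qed
    have "(LINT x|lebesgue_on (cbox (lo K) (hi K)). F' (x $ i) * ?q x) = 0"
    proof (rule integral_separated_0[where C="max (52 * C / s) (A * (C * 1))", OF _ _ h0])
      show "\<bar>F' t\<bar> \<le> max (52 * C / s) (A * (C * 1))" for t using F'b[of t] by simp
      show "\<bar>?q x\<bar> \<le> max (52 * C / s) (A * (C * 1))" if "x \<in> cbox (lo K) (hi K)" for x using qb[OF that] by simp
      show "?q (upd x i t) = ?q x" for x t using ij ru[of i x t] by simp
      show "?q \<in> borel_measurable borel" by measurable
    qed measurable
    moreover have "partial_deriv j (interp K) x * Y x = F' (x $ i) * ?q x" for x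
      by (simp only: partial_interp Y_def mult_ac)
    ultimately show "(LINT x|lebesgue_on (cbox (lo K) (hi K)). partial_deriv j (interp K) x * Y x) = 0"
      by (simp only:)
  qed
  have ind: "indicator (box c d) x = ?I i (x $ i) * (?I j (x $ j) * r x)" for x
  proof -
    have "(indicator (box c d) x :: real) = (\<Prod>m\<in>UNIV. ?I m (x $ m))"
    proof (cases "x \<in> box c d")
      case True
      then have "?I m (x $ m) = 1" for m by (simp add: mem_box_cart)
      then show ?thesis using True by simp
    next
      case False
      then obtain m where "?I m (x $ m) = 0" by (auto simp: mem_box_cart indicator_def)
      then have "(\<Prod>m\<in>UNIV. ?I m (x $ m)) = 0" by (intro prod_zero) auto
      then show ?thesis using False by simp
    qed
    also have "\<dots> = ?I i (x $ i) * (\<Prod>m\<in>UNIV - {i}. ?I m (x $ m))" by (rule prod.remove) auto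
    also have "(\<Prod>m\<in>UNIV - {i}. ?I m (x $ m)) = ?I j (x $ j) * (\<Prod>m\<in>UNIV - {i} - {j}. ?I m (x $ m))"
      using ij by (intro prod.remove) auto
    also have "UNIV - {i} - {j} = UNIV - {i, j}" by auto
    finally show ?thesis by (simp add: r_def)
  qed
  have s12: "sq_integrable M (\<lambda>x. ?f (x $ i) * (?I j (x $ j) * r x))" "sq_integrable M (\<lambda>x. F (x $ i) * (?I j (x $ j) * r x))"
  proof -
    show "sq_integrable M (\<lambda>x. ?f (x $ i) * (?I j (x $ j) * r x))"
      by (rule bounded_sq[OF _ m1[OF fb(1) m1[OF Ib rb]]]) measurable
    show "sq_integrable M (\<lambda>x. F (x $ i) * (?I j (x $ j) * r x))"
      by (rule bounded_sq[OF _ m1[OF Fb m1[OF Ib rb]]]) measurable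
  qed
  have "(LINT x|M. g x $ i * X x) = (LINT x|M. g x $ i * (?f (x $ i) * (?I j (x $ j) * r x)) - g x $ i * (F (x $ i) * (?I j (x $ j) * r x)))"
    by (simp only: X_def left_diff_distrib right_diff_distrib)
  also have "\<dots> = (LINT x|M. g x $ i * (?f (x $ i) * (?I j (x $ j) * r x))) - (LINT x|M. g x $ i * (F (x $ i) * (?I j (x $ j) * r x)))"
    by (intro Bochner_Integration.integral_diff sq_integrable_mult g_sq s12)
  also have "\<dots> = - (LINT x|M. u x * indicator (box c d) x) - (LINT x|M. g x $ j * Y x)"
    unfolding I1 I2 by (simp only: ind Y_def I3) (simp only: mult_ac minus_minus diff_minus_eq_add uminus_add_conv_diff add.commute)
  finally have eq1: "(LINT x|M. g x $ i * X x) + (LINT x|M. g x $ j * Y x) = - (LINT x|M. u x * indicator (box c d) x)" by linarith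
  have eX: "(LINT x|M. gerr x $ i * X x) = (LINT x|M. g x $ i * X x)"
    using sq_integrable_mult[OF g_sq Xs, of i] sq_integrable_mult[OF gw_sq Xs, of i] gX
    by (simp add: gerr_def left_diff_distrib)
  have eY: "(LINT x|M. gerr x $ j * Y x) = (LINT x|M. g x $ j * Y x)"
    using sq_integrable_mult[OF g_sq Ys, of j] sq_integrable_mult[OF gw_sq Ys, of j] gY
    by (simp add: gerr_def left_diff_distrib)
  let ?v = "sqrt (measure lebesgue (cbox a b))"
  have b1: "\<bar>LINT x|M. gerr x $ i * X x\<bar> \<le> sqrt \<eta>2 * (10 * C * ?v)"
  proof -
    have "\<bar>LINT x|M. gerr x $ i * X x\<bar> \<le> sqrt (LINT x|M. (gerr x $ i)\<^sup>2) * (10 * C * ?v)"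
      by (rule integral_mult_bounded[OF gerr_sq Xm Xb]) (use C0 in simp)
    also have "\<dots> \<le> sqrt \<eta>2 * (10 * C * ?v)"
      using C0 by (intro mult_right_mono real_sqrt_le_mono gerr_comp_le) simp
    finally show ?thesis .
  qed
  have b2: "\<bar>LINT x|M. gerr x $ j * Y x\<bar> \<le> sqrt \<eta>2 * (52 * C\<^sup>2 / s * ?v)"
  proof -
    have "\<bar>LINT x|M. gerr x $ j * Y x\<bar> \<le> sqrt (LINT x|M. (gerr x $ j)\<^sup>2) * (52 * C\<^sup>2 / s * ?v)"
      by (rule integral_mult_bounded[OF gerr_sq Ym Yb]) (use s in simp)
    also have "\<dots> \<le> sqrt \<eta>2 * (52 * C\<^sup>2 / s * ?v)"
      using s by (intro mult_right_mono real_sqrt_le_mono gerr_comp_le) simp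
    finally show ?thesis .
  qed
  have "\<bar>LINT x|M. u x * indicator (box c d) x\<bar> \<le> sqrt \<eta>2 * (10 * C * ?v) + sqrt \<eta>2 * (52 * C\<^sup>2 / s * ?v)"
    using b1 b2 eX eY eq1 by linarith
  also have "\<dots> = sqrt \<eta>2 * (?v * (10 * C + 52 * C\<^sup>2 / s))" by (simp only: distrib_left mult_ac)
  finally show ?thesis .
qed

end

section \<open>Comparison of the energies\<close>

text \<open>The convex function 1/(1 - x)^2 lies below its chord on [0, 1/2]; the chord joins 1 to 4
  and has slope 6.\<close>

lemma normalisation_factor:
  fixes q r N x :: real
  assumes "0 \<le> q" "0 \<le> r" "0 \<le> x" "x \<le> 1/2" "1 - x \<le> N"
  shows "q / N + r / N\<^sup>2 \<le> (1 + 6 * x) * (q + r)"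
proof -
  have N: "0 < 1 - x" "0 < N" using assms by auto
  have "(1 - x)\<^sup>2 * (1 + 6 * x) = 1 + x * ((1 - 2 * x) * (4 - 3 * x))"
    by (simp add: power2_eq_square algebra_simps)
  moreover have "0 \<le> x * ((1 - 2 * x) * (4 - 3 * x))" using assms by (intro mult_nonneg_nonneg) auto
  ultimately have "1 \<le> (1 - x)\<^sup>2 * (1 + 6 * x)" by linarith
  then have f2: "1 / (1 - x)\<^sup>2 \<le> 1 + 6 * x" using N by (simp add: divide_le_eq mult.commute)
  have N1: "1 / N \<le> 1 / (1 - x)" using N assms by (intro divide_left_mono) auto
  have x1: "1 / (1 - x) \<le> 1 / (1 - x)\<^sup>2"
    using N assms by (intro divide_left_mono) (auto simp: power2_eq_square mult_le_one intro!: mult_left_le)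
  have N2: "1 / N\<^sup>2 \<le> 1 / (1 - x)\<^sup>2"
    using N assms by (intro divide_left_mono power_mono) auto
  have "q * (1 / N) + r * (1 / N\<^sup>2) \<le> q * (1 + 6 * x) + r * (1 + 6 * x)"
    using N1 N2 x1 f2 assms(1,2) by (intro add_mono mult_left_mono) linarith+
  then show ?thesis by (simp add: algebra_simps)
qed

context interpolation
begin

lemma \<eta>2_le_energy: "\<eta>2 \<le> 2 * energy (box a b) V \<beta> u"
proof -
  have "\<eta>2 \<le> (LINT x|M. (norm (g x))\<^sup>2)"
  proof -
    have "0 \<le> (LINT x|M. (norm (gw x))\<^sup>2)" by simp
    then show ?thesis unfolding grad_pythagoras by linarith
  qed
  also have "\<dots> \<le> 2 * quadratic_energy g u"
  proof -
    have "0 \<le> (LINT x|M. V x * (u x)\<^sup>2)"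
      using V_nonneg by (intro integral_nonneg_AE) (auto elim!: eventually_mono)
    then show ?thesis by (simp add: quadratic_energy_def)
  qed
  also have "\<dots> \<le> 2 * energy (box a b) V \<beta> u"
    unfolding energy_u quartic_energy_def using beta by simp
  finally show ?thesis .
qed

lemma u_cube_sq: "sq_integrable M (\<lambda>x. u x ^ 3)"
  using u_power6 u_sq by (auto simp: sq_integrable_def simp flip: power_mult)

lemma u_square_sq: "sq_integrable M (\<lambda>x. (u x)\<^sup>2)"
  using u_power4 u_sq by (auto simp: sq_integrable_def simp flip: power_mult)

lemma err_square_sq: "sq_integrable M (\<lambda>x. (err x)\<^sup>2)"
  using err_power4_integrable err_sq by (auto simp: sq_integrable_def simp flip: power_mult)

text \<open>Every change of the energy other than the drop of the Dirichlet term is at most a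
  multiple of \<epsilon> \<open>\<eta>2\<close>. The condition on \<epsilon> makes their sum,
  including the cost of normalisation, at most the gain \<open>\<eta>2 / 2\<close>.\<close>

lemma discrete_energy_le:
  assumes uh: "discrete_ground_state (box a b) T V \<beta> uh"
    and 1: "\<bar>LINT x|M. u x * err x\<bar> \<le> \<epsilon> * \<eta>2"
    and 2: "\<bar>LINT x|M. (V x * u x) * err x\<bar> \<le> \<epsilon> * \<eta>2"
    and 3: "\<bar>LINT x|M. u x ^ 3 * err x\<bar> \<le> \<epsilon> * \<eta>2"
    and 4: "(LINT x|M. V x * (err x)\<^sup>2) \<le> \<epsilon> * \<eta>2"
    and 5: "(LINT x|M. (u x)\<^sup>2 * (err x)\<^sup>2) \<le> \<epsilon> * \<eta>2"
    and 6: "(LINT x|M. err x ^ 4) \<le> \<epsilon> * \<eta>2"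
    and \<epsilon>: "0 < \<epsilon>" "\<epsilon> * (12 * energy (box a b) V \<beta> u + 3/2 + 15 * \<beta> / 4) \<le> 1/2"
  shows "discrete_energy (box a b) T V \<beta> uh \<le> energy (box a b) V \<beta> u"
proof -
  define E where "E = energy (box a b) V \<beta> u"
  define y where "y = \<epsilon> * \<eta>2"
  define N where "N = (LINT x|M. (w x)\<^sup>2)"
  have y0: "0 \<le> y" using \<epsilon>(1) \<eta>2_nonneg by (simp add: y_def)
  have E0: "0 \<le> E" using \<eta>2_le_energy \<eta>2_nonneg by (simp add: E_def)
  have weq: "w x = u x - err x" for x by (simp add: err_def)
  have "N = (LINT x|M. (u x)\<^sup>2 - 2 * (u x * err x) + (err x)\<^sup>2)"
    unfolding N_def weq by (intro Bochner_Integration.integral_cong refl) (simp add: power2_eq_square algebra_simps)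
  also have "\<dots> = 1 - 2 * (LINT x|M. u x * err x) + (LINT x|M. (err x)\<^sup>2)"
    using sq_integrable_square[OF u_sq] sq_integrable_square[OF err_sq] sq_integrable_mult[OF u_sq err_sq] u_norm by simp
  also have "\<dots> \<ge> 1 - 2 * y"
  proof -
    have "0 \<le> (LINT x|M. (err x)\<^sup>2)" by simp
    then show ?thesis using 1 unfolding y_def by linarith
  qed
  finally have N: "1 - 2 * y \<le> N" .
  have V2: "(LINT x|M. V x * (w x)\<^sup>2) \<le> (LINT x|M. V x * (u x)\<^sup>2) + 3 * y"
  proof -
    have "(LINT x|M. V x * (w x)\<^sup>2) = (LINT x|M. V x * (u x)\<^sup>2 - 2 * ((V x * u x) * err x) + V x * (err x)\<^sup>2)"
      unfolding weq by (intro Bochner_Integration.integral_cong refl) (simp add: power2_eq_square algebra_simps)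
    also have "\<dots> = (LINT x|M. V x * (u x)\<^sup>2) - 2 * (LINT x|M. (V x * u x) * err x) + (LINT x|M. V x * (err x)\<^sup>2)"
      using V_sq_integrable[OF u_sq] V_sq_integrable[OF err_sq] V_mult_integrable[OF u_sq err_sq]
      by (simp add: mult.assoc)
    finally show ?thesis using 2 4 by (simp add: y_def)
  qed
  have "(LINT x|M. (w x) ^ 4) \<le> (LINT x|M. u x ^ 4 - 4 * (u x ^ 3 * err x) + 8 * ((u x)\<^sup>2 * (err x)\<^sup>2) + 3 * err x ^ 4)"
  proof (rule integral_mono)
    show "integrable M (\<lambda>x. w x ^ 4)" by (rule w_power4)
    show "integrable M (\<lambda>x. u x ^ 4 - 4 * (u x ^ 3 * err x) + 8 * ((u x)\<^sup>2 * (err x)\<^sup>2) + 3 * err x ^ 4)"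
      using u_power4 err_power4_integrable sq_integrable_mult[OF u_cube_sq err_sq] sq_integrable_mult[OF u_square_sq err_square_sq]
      by simp
    fix x
    \<comment> \<open>Completing a square absorbs the term with the third power of the error, so its
      integral is never estimated; the coefficients 6 and 1 of the binomial expansion become 8 and
      3.\<close>
    have "0 \<le> 2 * ((err x)\<^sup>2 * (u x + err x)\<^sup>2)" by simp
    also have "\<dots> = (u x ^ 4 - 4 * (u x ^ 3 * err x) + 8 * ((u x)\<^sup>2 * (err x)\<^sup>2) + 3 * err x ^ 4) - (u x - err x) ^ 4"
      by (simp add: eval_nat_numeral algebra_simps)
    finally show "w x ^ 4 \<le> u x ^ 4 - 4 * (u x ^ 3 * err x) + 8 * ((u x)\<^sup>2 * (err x)\<^sup>2) + 3 * err x ^ 4"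
      by (simp add: weq)
  qed
  also have "\<dots> = (LINT x|M. u x ^ 4) - 4 * (LINT x|M. u x ^ 3 * err x) + 8 * (LINT x|M. (u x)\<^sup>2 * (err x)\<^sup>2) + 3 * (LINT x|M. err x ^ 4)"
    using u_power4 err_power4_integrable sq_integrable_mult[OF u_cube_sq err_sq] sq_integrable_mult[OF u_square_sq err_square_sq]
    by simp
  \<comment> \<open>15 = 4 + 8 + 3.\<close>
  also have "\<dots> \<le> (LINT x|M. u x ^ 4) + 15 * y" using 3 5 6 by (simp add: y_def abs_le_iff)
  finally have w4: "(LINT x|M. (w x) ^ 4) \<le> (LINT x|M. u x ^ 4) + 15 * y" .
  have "quartic_energy w \<le> \<beta> / 4 * ((LINT x|M. u x ^ 4) + 15 * y)"
    unfolding quartic_energy_def using beta w4 by (intro mult_left_mono) auto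
  then have R: "quartic_energy w \<le> quartic_energy u + 15 * \<beta> / 4 * y"
    by (simp add: quartic_energy_def algebra_simps)
  have Q: "quadratic_energy gw w \<le> quadratic_energy g u - \<eta>2 / 2 + 3/2 * y"
    using V2 by (simp add: quadratic_energy_def grad_pythagoras field_simps)
  define \<kappa> where "\<kappa> = 3/2 + 15 * \<beta> / 4"
  have sum: "quadratic_energy gw w + quartic_energy w \<le> E - \<eta>2 / 2 + \<kappa> * y"
    using Q R by (simp add: E_def energy_u \<kappa>_def algebra_simps)
  have \<kappa>0: "0 \<le> \<kappa>" using beta by (simp add: \<kappa>_def)
  have \<epsilon>2: "12 * \<epsilon> * E + \<epsilon> * \<kappa> \<le> 1/2" using \<epsilon>(2) by (simp add: E_def \<kappa>_def algebra_simps)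
  have \<epsilon>E: "0 \<le> \<epsilon> * E" "0 \<le> \<epsilon> * \<kappa>" using \<epsilon>(1) E0 \<kappa>0 by simp_all
  have "y \<le> \<epsilon> * (2 * E)" unfolding y_def using \<epsilon>(1) \<eta>2_le_energy by (intro mult_left_mono) (auto simp: E_def)
  then have x: "2 * y \<le> 1/2" using \<epsilon>2 \<epsilon>E by simp
  have N0: "0 < N" using N x by linarith
  have R0: "0 \<le> quartic_energy w" using beta by (simp add: quartic_energy_def)
  have "discrete_energy (box a b) T V \<beta> uh \<le> quadratic_energy gw w / N + quartic_energy w / N\<^sup>2"
    by (rule discrete_ground_state_le[OF uh]) (use N0 in \<open>simp_all add: N_def\<close>)
  also have "\<dots> \<le> (1 + 6 * (2 * y)) * (quadratic_energy gw w + quartic_energy w)"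
    by (rule normalisation_factor[OF quadratic_energy_nonneg R0 _ x N]) (use y0 in simp)
  also have "\<dots> \<le> (1 + 6 * (2 * y)) * (E - \<eta>2 / 2 + \<kappa> * y)"
    using y0 by (intro mult_left_mono sum) auto
  \<comment> \<open>The factor 12 is 6 from \<open>normalisation_factor\<close> times 2 from the
    lower bound 1 - 2 y for the squared norm of \<open>w\<close>. The smallness of \<epsilon> makes
    both brackets nonpositive.\<close>
  also have "\<dots> = E + \<eta>2 * (12 * \<epsilon> * E + \<epsilon> * \<kappa> - 1/2) + 12 * y * (\<eta>2 * (\<epsilon> * \<kappa> - 1/2))"
    by (simp add: y_def algebra_simps)
  also have "\<dots> \<le> E"
  proof -
    have "\<eta>2 * (12 * \<epsilon> * E + \<epsilon> * \<kappa> - 1/2) \<le> 0"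
      using \<eta>2_nonneg \<epsilon>2 by (intro mult_nonneg_nonpos) auto
    moreover have "12 * y * (\<eta>2 * (\<epsilon> * \<kappa> - 1/2)) \<le> 0"
      using \<eta>2_nonneg \<epsilon>2 \<epsilon>E y0 by (intro mult_nonneg_nonpos) auto
    ultimately show ?thesis by linarith
  qed
  finally show ?thesis by (simp add: E_def)
qed

end

lemma (in ground_state_problem) nonzero_box:
  obtains c d where "(LINT x|M. u x * indicator (box c d) x) \<noteq> 0" "\<And>m. c $ m < d $ m"
proof -
  have "\<exists>c d. (LINT x|M. u x * indicator (box c d) x) \<noteq> 0"
  proof (rule ccontr)
    assume "\<nexists>c d. (LINT x|M. u x * indicator (box c d) x) \<noteq> 0"
    then have "AE x in M. u x = 0"
      by (intro AE_0_of_box_integrals_on sq_integrable_integrable[OF finite_M u_sq]) auto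
    then have "AE x in M. (u x)\<^sup>2 = 0" by eventually_elim simp
    then have "(LINT x|M. (u x)\<^sup>2) = 0" by (rule integral_eq_zero_AE)
    with u_norm show False by simp
  qed
  then obtain c d where cd: "(LINT x|M. u x * indicator (box c d) x) \<noteq> 0" by blast
  have "c $ m < d $ m" for m
  proof (rule ccontr)
    assume "\<not> c $ m < d $ m"
    then have "x \<notin> box c d" for x by (metis mem_box_cart(1) less_trans)
    then have "(LINT x|M. u x * indicator (box c d) x) = 0" by simp
    with cd show False by simp
  qed
  with cd that show ?thesis by blast
qed

lemma (in interpolation) mesh_size_pos: "0 < mesh_size T"
proof -
  obtain K where K: "K \<in> T" using mesh.T_nonempty by blast
  have "0 < diameter K" using mesh.side_le_diameter[OF K, of undefined] mesh.cell(2)[OF K, of undefined] by linarith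
  then show ?thesis using diameter_le_mesh_size[OF K] by linarith
qed

text \<open>The volume of a cell is at least (q h)^n, and h^4 \<le> h h^n for n \<le> 3 and h \<le>
  1. The spare factor h is what makes the fourth power of the error negligible against
  \<open>\<eta>2\<close>.\<close>

lemma (in interpolation) diameter_power4_le:
  assumes q: "0 < q" and sides: "\<And>K i. K \<in> T \<Longrightarrow> q * mesh_size T \<le> hi K $ i - lo K $ i"
    and h: "mesh_size T \<le> 1" and K: "K \<in> T"
  shows "(diameter K) ^ 4 \<le> mesh_size T / q ^ CARD('n) * measure lebesgue K"
proof -
  let ?h = "mesh_size T" and ?n = "CARD('n)"
  have h0: "0 < ?h" by (rule mesh_size_pos)
  have "(q * ?h) ^ ?n = (\<Prod>i\<in>(UNIV::'n set). q * ?h)" by simp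
  also have "\<dots> \<le> measure lebesgue K"
    unfolding mesh.measure_cell[OF K] using q h0 sides[OF K] by (intro prod_mono) auto
  finally have v: "q ^ ?n * ?h ^ ?n \<le> measure lebesgue K" by (simp add: power_mult_distrib)
  have "(diameter K) ^ 4 \<le> ?h ^ 4" by (intro power_mono diameter_le_mesh_size diameter_cell_nonneg K)
  also have "\<dots> = ?h * ?h ^ 3" by (simp add: eval_nat_numeral)
  also have "\<dots> \<le> ?h * ?h ^ ?n" using h0 h dim by (intro mult_left_mono power_decreasing) auto
  also have "\<dots> = ?h / q ^ ?n * (q ^ ?n * ?h ^ ?n)" using q by simp
  also have "\<dots> \<le> ?h / q ^ ?n * measure lebesgue K" using q h0 by (intro mult_left_mono v) auto
  finally show ?thesis .
qed

theorem theorem5p4: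
  fixes a b :: "real^'n" and s :: real and D :: "(real^'n) set"
    and V :: "real^'n \<Rightarrow> real" and \<beta> :: real
    and H :: "real set" and T :: "real \<Rightarrow> (real^'n) set set"
    and u :: "real^'n \<Rightarrow> real"
  assumes dim: "CARD('n) = 2 \<or> CARD('n) = 3"
    and cube: "s > 0" "\<And>i. b $ i - a $ i = s" "D = box a b"
    and V_Linfty: "V \<in> Linfty D"
    and V_nonneg: "AE x in lebesgue_on D. 0 \<le> V x"
    and beta_pos: "\<beta> > 0"
    and H_pos: "H \<subseteq> {0<..}"
    and H_accumulates: "0 islimpt H"
    and meshes: "\<And>h. h \<in> H \<Longrightarrow> conforming_box_mesh D (T h)"
    and sizes: "\<And>h. h \<in> H \<Longrightarrow> mesh_size (T h) = h"
    and regular: "shape_regular H T"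
    and V_H1: "V \<in> H1 D"
    and u: "ground_state D V \<beta> u"
  shows "\<exists>h0>0. \<forall>h\<in>H. h < h0 \<longrightarrow>
    (\<forall>uh. discrete_ground_state D (T h) V \<beta> uh \<longrightarrow>
      discrete_energy D (T h) V \<beta> uh \<le> energy D V \<beta> u)"
proof -
  have n: "CARD('n) \<le> 3" "2 \<le> CARD('n)" using dim by auto
  have ab: "a $ i < b $ i" for i using cube(1) cube(2)[of i] by simp
  have V_meas: "V \<in> borel_measurable (lebesgue_on (cbox a b))"
    using V_Linfty by (simp add: Linfty_def borel_measurable_cbox_box cube(3))
  obtain C\<^sub>V where V_bound: "AE x in lebesgue_on (cbox a b). \<bar>V x\<bar> \<le> C\<^sub>V"
    using V_Linfty by (auto simp: Linfty_def AE_lebesgue_on_cbox_box cube(3))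
  have V_pos: "AE x in lebesgue_on (cbox a b). 0 \<le> V x"
    using V_nonneg unfolding cube(3) AE_lebesgue_on_cbox_box .
  have ground: "ground_state (box a b) V \<beta> u" using u by (simp add: cube(3))
  then have "u \<in> H10 (box a b)" by (simp add: ground_state_def is_arg_min_def)
  then obtain g \<phi> where gu: "has_weak_grad (box a b) u g" "\<And>k. test_function (box a b) (\<phi> k)"
    "sq_tendsto (lebesgue_on (box a b)) \<phi> u"
    "\<And>i. sq_tendsto (lebesgue_on (box a b)) (\<lambda>k. partial_deriv i (\<phi> k)) (\<lambda>x. g x $ i)"
    by (rule H10_sequence) blast
  interpret P: ground_state_problem a b V \<beta> C\<^sub>V u g \<phi>
    by unfold_locales (use n ab V_meas V_pos V_bound beta_pos ground gu in \<open>simp_all add: sq_tendsto_cbox_box\<close>)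
  let ?M = "lebesgue_on (cbox a b)"
  obtain \<sigma> where \<sigma>: "\<sigma> > 0" "\<And>h K. h \<in> H \<Longrightarrow> K \<in> T h \<Longrightarrow> \<exists>x. cball x (\<sigma> * diameter K) \<subseteq> K"
    using regular unfolding shape_regular_def by blast
  obtain c d where cd: "(LINT x|?M. u x * indicator (box c d) x) \<noteq> 0" "\<And>m. c $ m < d $ m"
    using P.nonzero_box by blast
  obtain i j :: 'n where ij: "i \<noteq> j"
  proof -
    have "\<not> card (UNIV :: 'n set) \<le> 1" using n by simp
    then show ?thesis using that by (auto simp: card_le_Suc0_iff_eq)
  qed
  define q where "q = 4 * \<sigma>\<^sup>2"
  have q: "q > 0" using \<sigma>(1) by (simp add: q_def)
  define C where "C = 1 + (\<bar>c $ i\<bar> + \<bar>d $ i\<bar>) + (\<bar>c $ j\<bar> + \<bar>d $ j\<bar>)"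
  have C: "1 \<le> C" "\<bar>c $ i\<bar> + \<bar>d $ i\<bar> \<le> C" "\<bar>c $ j\<bar> + \<bar>d $ j\<bar> \<le> C" by (auto simp: C_def)
  define v where "v = sqrt (measure lebesgue (cbox a b))"
  define Q where "Q = \<bar>LINT x|?M. u x * indicator (box c d) x\<bar>"
  have Q: "Q > 0" using cd(1) by (simp add: Q_def)
  have v0: "0 \<le> v" by (simp add: v_def)
  \<comment> \<open>The constant in the saturation estimate: it will satisfy h \<le> c1
    sqrt(\<open>\<eta>2\<close>) for h \<le> 1.\<close>
  define c\<^sub>1 where "c\<^sub>1 = v * (10 * C + 52 * C\<^sup>2 / q) / Q"
  have c1: "0 \<le> c\<^sub>1" unfolding c\<^sub>1_def using v0 q Q C(1) by (intro divide_nonneg_nonneg mult_nonneg_nonneg add_nonneg_nonneg) auto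
  define E where "E = energy (box a b) V \<beta> u"
  have E0: "0 \<le> E"
    unfolding E_def P.energy_u P.quartic_energy_def using beta_pos by (intro add_nonneg_nonneg P.quadratic_energy_nonneg) auto
  define \<kappa> where "\<kappa> = 12 * E + 3/2 + 15 * \<beta> / 4"
  have \<kappa>: "\<kappa> > 0" using E0 beta_pos by (simp add: \<kappa>_def)
  define \<epsilon> where "\<epsilon> = 1 / (2 * \<kappa>)"
  have \<epsilon>: "0 < \<epsilon>" "\<epsilon> * \<kappa> \<le> 1/2" using \<kappa> by (simp_all add: \<epsilon>_def)
  \<comment> \<open>Chosen so that the bound of \<open>integral_mult_err\<close>, with h replaced
    through saturation, stays below \<epsilon> \<open>\<eta>2\<close>. Using c1 + 1 keeps the
    denominator positive when c1 = 0.\<close>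
  define \<epsilon>\<^sub>1 where "\<epsilon>\<^sub>1 = \<epsilon> / ((1 + v) * 7 * (c\<^sub>1 + 1))"
  have \<epsilon>1: "0 < \<epsilon>\<^sub>1" using \<epsilon>(1) v0 c1 by (simp add: \<epsilon>\<^sub>1_def)
  have approx: "\<exists>\<gamma> \<delta>. \<delta> > 0 \<and> sq_integrable ?M \<gamma> \<and> sqrt (LINT x|?M. (G x - \<gamma> x)\<^sup>2) \<le> \<epsilon>\<^sub>1 \<and>
    (\<forall>x\<in>cbox a b. \<forall>y\<in>cbox a b. dist x y \<le> \<delta> \<longrightarrow> \<bar>\<gamma> x - \<gamma> y\<bar> \<le> \<epsilon>\<^sub>1)" if "sq_integrable ?M G" for G
    using sq_integrable_continuous_approx[OF that \<epsilon>1] by blast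
  have G2: "sq_integrable ?M (\<lambda>x. V x * u x)" by (rule sq_integrable_bounded_mult[OF P.u_sq V_meas V_bound])
  have G3: "sq_integrable ?M (\<lambda>x. u x ^ 3)"
    using P.u_power6 P.u_sq by (auto simp: sq_integrable_def simp flip: power_mult)
  obtain \<gamma>1 \<delta>1 where g1: "\<delta>1 > 0" "sq_integrable ?M \<gamma>1" "sqrt (LINT x|?M. (u x - \<gamma>1 x)\<^sup>2) \<le> \<epsilon>\<^sub>1"
    "\<And>x y. x \<in> cbox a b \<Longrightarrow> y \<in> cbox a b \<Longrightarrow> dist x y \<le> \<delta>1 \<Longrightarrow> \<bar>\<gamma>1 x - \<gamma>1 y\<bar> \<le> \<epsilon>\<^sub>1"
    using approx[OF P.u_sq] by blast
  obtain \<gamma>2 \<delta>2 where g2: "\<delta>2 > 0" "sq_integrable ?M \<gamma>2" "sqrt (LINT x|?M. (V x * u x - \<gamma>2 x)\<^sup>2) \<le> \<epsilon>\<^sub>1"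
    "\<And>x y. x \<in> cbox a b \<Longrightarrow> y \<in> cbox a b \<Longrightarrow> dist x y \<le> \<delta>2 \<Longrightarrow> \<bar>\<gamma>2 x - \<gamma>2 y\<bar> \<le> \<epsilon>\<^sub>1"
    using approx[OF G2] by blast
  obtain \<gamma>3 \<delta>3 where g3: "\<delta>3 > 0" "sq_integrable ?M \<gamma>3" "sqrt (LINT x|?M. (u x ^ 3 - \<gamma>3 x)\<^sup>2) \<le> \<epsilon>\<^sub>1"
    "\<And>x y. x \<in> cbox a b \<Longrightarrow> y \<in> cbox a b \<Longrightarrow> dist x y \<le> \<delta>3 \<Longrightarrow> \<bar>\<gamma>3 x - \<gamma>3 y\<bar> \<le> \<epsilon>\<^sub>1"
    using approx[OF G3] by blast
  define U where "U = (LINT x|?M. u x ^ 4)"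
  have U0: "0 \<le> U" by (simp add: U_def)
  define qn where "qn = q ^ CARD('n)"
  have qn: "qn > 0" using q by (simp add: qn_def)
  \<comment> \<open>All thresholds for h: 1 for comparing powers of h, the three scales at which the
    continuous approximants of \<open>u\<close>, \<open>V u\<close> and the cube of \<open>u\<close>
    oscillate little, and one bound each for the potential term, the mixed quartic term and the pure
    quartic term in the error. The summands 1 keep the denominators positive.\<close>
  define hs where "hs = {1, \<delta>1, \<delta>2, \<delta>3, \<epsilon> / (46 * \<bar>C\<^sub>V\<bar> + 1), \<epsilon>\<^sup>2 * qn / (2048 * U + 1), \<epsilon> * qn / (4096 * E + 1)}"
  define h0 where "h0 = Min hs"
  have "h0 > 0"
    unfolding h0_def hs_def using g1(1) g2(1) g3(1) \<epsilon>(1) qn U0 E0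
    by (subst Min_gr_iff) (auto intro!: divide_pos_pos mult_pos_pos add_nonneg_pos)
  moreover have "discrete_energy D (T h) V \<beta> uh \<le> energy D V \<beta> u"
    if h: "h \<in> H" "h < h0" and uh: "discrete_ground_state D (T h) V \<beta> uh" for h uh
  proof -
    interpret I: interpolation a b V \<beta> C\<^sub>V u g \<phi> "T h"
      by unfold_locales (use ab meshes[OF h(1)] cube(3) in auto)
    have hm: "mesh_size (T h) = h" by (rule sizes[OF h(1)])
    have hpos: "0 < h" using I.mesh_size_pos by (simp add: hm)
    have "h0 \<le> t" if "t \<in> hs" for t unfolding h0_def using that by (intro Min_le) (auto simp: hs_def)
    then have lt: "h < t" if "t \<in> hs" for t using that h(2) by force
    have h1: "h \<le> 1" and hd: "h \<le> \<delta>1" "h \<le> \<delta>2" "h \<le> \<delta>3"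
      and hV: "h \<le> \<epsilon> / (46 * \<bar>C\<^sub>V\<bar> + 1)" and hU: "h \<le> \<epsilon>\<^sup>2 * qn / (2048 * U + 1)" and hE: "h \<le> \<epsilon> * qn / (4096 * E + 1)"
      using lt by (auto simp: hs_def less_imp_le)
    have sides: "q * h \<le> hi K $ m - lo K $ m" if "K \<in> T h" for K m
      using I.mesh.quasi_uniform[OF n(2) \<sigma>(1) \<sigma>(2)[OF h(1)] that, of m] by (simp add: hm q_def)
    have \<eta>0: "0 \<le> I.\<eta>2" by (rule I.\<eta>2_nonneg)
    have sat: "h \<le> c\<^sub>1 * sqrt I.\<eta>2"
    proof -
      have "Q \<le> sqrt I.\<eta>2 * (v * (10 * C + 52 * C\<^sup>2 / (q * h)))"
        unfolding Q_def v_def using q hpos by (intro I.saturation[OF ij cd(2) _ sides C]) auto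
      \<comment> \<open>As h \<le> 1, the part of the bound without a factor 1/h may be given
        one.\<close>
      also have "\<dots> \<le> sqrt I.\<eta>2 * (v * ((10 * C + 52 * C\<^sup>2 / q) / h))"
      proof (intro mult_left_mono)
        have "10 * C \<le> 10 * C / h" using hpos h1 C(1) by (simp add: le_divide_eq mult_left_le)
        then show "10 * C + 52 * C\<^sup>2 / (q * h) \<le> (10 * C + 52 * C\<^sup>2 / q) / h" by (simp add: add_divide_distrib)
      qed (use v0 \<eta>0 in auto)
      finally have "Q * h \<le> sqrt I.\<eta>2 * (v * (10 * C + 52 * C\<^sup>2 / q))" using hpos by (simp add: field_simps)
      then show ?thesis using Q by (simp add: c\<^sub>1_def field_simps)
    qed
    \<comment> \<open>Saturation trades the remaining h for another square root of
      \<open>\<eta>2\<close>, so that the estimate becomes quadratic in the gradient error.\<close>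
    have small: "\<epsilon>\<^sub>1 * (1 + v) * (7 * h * sqrt I.\<eta>2) \<le> \<epsilon> * I.\<eta>2"
    proof -
      have "h * sqrt I.\<eta>2 \<le> c\<^sub>1 * sqrt I.\<eta>2 * sqrt I.\<eta>2" using sat \<eta>0 by (intro mult_right_mono) auto
      also have "\<dots> = c\<^sub>1 * I.\<eta>2" using \<eta>0 by (simp add: mult.assoc)
      also have "\<dots> \<le> (c\<^sub>1 + 1) * I.\<eta>2" using \<eta>0 by (intro mult_right_mono) auto
      finally have "\<epsilon>\<^sub>1 * (1 + v) * 7 * (h * sqrt I.\<eta>2) \<le> \<epsilon>\<^sub>1 * (1 + v) * 7 * ((c\<^sub>1 + 1) * I.\<eta>2)"
        using \<epsilon>1 v0 by (intro mult_left_mono) auto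
      also have "\<dots> = (\<epsilon>\<^sub>1 * ((1 + v) * 7 * (c\<^sub>1 + 1))) * I.\<eta>2" by (simp only: mult_ac)
      also have "\<epsilon>\<^sub>1 * ((1 + v) * 7 * (c\<^sub>1 + 1)) = \<epsilon>"
        unfolding \<epsilon>\<^sub>1_def by (rule nonzero_eq_divide_eq[THEN iffD1, OF _ refl]) (use v0 c1 in simp)
      finally show ?thesis by (simp only: mult.assoc)
    qed
    have b1: "\<bar>LINT x|?M. u x * I.err x\<bar> \<le> \<epsilon> * I.\<eta>2"
      using I.integral_mult_err[OF P.u_sq g1(2,3) g1(4)] hd(1) \<epsilon>1 small by (simp add: hm v_def)
    have b2: "\<bar>LINT x|?M. (V x * u x) * I.err x\<bar> \<le> \<epsilon> * I.\<eta>2"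
      using I.integral_mult_err[OF G2 g2(2,3) g2(4)] hd(2) \<epsilon>1 small by (simp add: hm v_def)
    have b3: "\<bar>LINT x|?M. u x ^ 3 * I.err x\<bar> \<le> \<epsilon> * I.\<eta>2"
      using I.integral_mult_err[OF G3 g3(2,3) g3(4)] hd(3) \<epsilon>1 small by (simp add: hm v_def)
    have b4: "(LINT x|?M. V x * (I.err x)\<^sup>2) \<le> \<epsilon> * I.\<eta>2"
    proof -
      have "(LINT x|?M. V x * (I.err x)\<^sup>2) \<le> (LINT x|?M. \<bar>C\<^sub>V\<bar> * (I.err x)\<^sup>2)"
      proof (rule integral_mono_AE)
        show "AE x in ?M. V x * (I.err x)\<^sup>2 \<le> \<bar>C\<^sub>V\<bar> * (I.err x)\<^sup>2"
          using V_bound by eventually_elim (auto intro!: mult_right_mono)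
      qed (use P.V_sq_integrable[OF I.err_sq] sq_integrable_square[OF I.err_sq] in auto)
      also have "\<dots> = \<bar>C\<^sub>V\<bar> * (LINT x|?M. (I.err x)\<^sup>2)" by simp
      also have "\<dots> \<le> \<bar>C\<^sub>V\<bar> * (46 * h\<^sup>2 * I.\<eta>2)"
        using I.err_L2 unfolding hm by (intro mult_left_mono) auto
      also have "\<dots> = 46 * \<bar>C\<^sub>V\<bar> * h * (h * I.\<eta>2)" by (simp add: power2_eq_square)
      also have "\<dots> \<le> 46 * \<bar>C\<^sub>V\<bar> * h * (1 * I.\<eta>2)"
        using h1 hpos \<eta>0 by (intro mult_left_mono mult_right_mono) auto
      also have "\<dots> \<le> \<epsilon> * I.\<eta>2"
      proof -
        have "(46 * \<bar>C\<^sub>V\<bar> + 1) * h \<le> \<epsilon>" using hV by (simp add: le_divide_eq mult.commute)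
        then have "46 * \<bar>C\<^sub>V\<bar> * h \<le> \<epsilon>" using hpos by (simp add: distrib_right)
        then show ?thesis using \<eta>0 by (simp add: mult_right_mono)
      qed
      finally show ?thesis .
    qed
    have L4: "(LINT x|?M. I.err x ^ 4) \<le> 2048 * (h / qn) * I.\<eta>2\<^sup>2"
    proof (rule I.err_L4)
      show "(diameter K) ^ 4 \<le> h / qn * measure lebesgue K" if "K \<in> T h" for K
        using I.diameter_power4_le[OF q _ _ that] sides h1 by (simp add: hm qn_def)
    qed (use hpos qn in simp)
    have b6: "(LINT x|?M. I.err x ^ 4) \<le> \<epsilon> * I.\<eta>2"
    proof -
      have "2048 * (h / qn) * I.\<eta>2\<^sup>2 = 2048 * (h / qn) * I.\<eta>2 * I.\<eta>2" by (simp add: power2_eq_square)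
      \<comment> \<open>One factor \<open>\<eta>2\<close> is replaced by twice the ground state
        energy, which turns 2048 into the 4096 of the threshold.\<close>
      also have "\<dots> \<le> 2048 * (h / qn) * (2 * E) * I.\<eta>2"
        using I.\<eta>2_le_energy \<eta>0 hpos qn by (intro mult_right_mono mult_left_mono) (auto simp: E_def)
      also have "\<dots> \<le> \<epsilon> * I.\<eta>2"
      proof (rule mult_right_mono[OF _ \<eta>0])
        have "(4096 * E + 1) * h \<le> \<epsilon> * qn" using hE E0 by (simp add: pos_le_divide_eq mult.commute add_nonneg_pos)
        then have "4096 * E * h \<le> \<epsilon> * qn" using hpos by (simp add: distrib_right)
        then show "2048 * (h / qn) * (2 * E) \<le> \<epsilon>" using qn by (simp add: divide_le_eq mult_ac)
      qed
      finally show ?thesis using L4 by linarith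
    qed
    have b5: "(LINT x|?M. (u x)\<^sup>2 * (I.err x)\<^sup>2) \<le> \<epsilon> * I.\<eta>2"
    proof -
      \<comment> \<open>The Cauchy-Schwarz inequality reduces the mixed term to the fourth power of
        the error. As the result is a square root, the threshold for h involves the square of
        \<epsilon>.\<close>
      have "(LINT x|?M. (u x)\<^sup>2 * (I.err x)\<^sup>2)\<^sup>2 \<le> U * (LINT x|?M. I.err x ^ 4)"
        using cauchy_schwarz_integral[OF I.u_square_sq I.err_square_sq] by (simp add: U_def flip: power_mult)
      also have "\<dots> \<le> U * (2048 * (h / qn) * I.\<eta>2\<^sup>2)" by (rule mult_left_mono[OF L4 U0])
      also have "\<dots> = (2048 * U * h / qn) * I.\<eta>2\<^sup>2" by simp
      also have "\<dots> \<le> \<epsilon>\<^sup>2 * I.\<eta>2\<^sup>2"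
      proof (rule mult_right_mono)
        have "(2048 * U + 1) * h \<le> \<epsilon>\<^sup>2 * qn" using hU U0 by (simp add: pos_le_divide_eq mult.commute add_nonneg_pos)
        then have "2048 * U * h \<le> \<epsilon>\<^sup>2 * qn" using hpos by (simp add: distrib_right)
        then show "2048 * U * h / qn \<le> \<epsilon>\<^sup>2" using qn by (simp add: divide_le_eq)
      qed simp
      finally have "(LINT x|?M. (u x)\<^sup>2 * (I.err x)\<^sup>2)\<^sup>2 \<le> (\<epsilon> * I.\<eta>2)\<^sup>2" by (simp add: power_mult_distrib)
      then show ?thesis by (rule power2_le_imp_le) (use \<epsilon>(1) \<eta>0 in simp)
    qed
    have "discrete_energy (box a b) (T h) V \<beta> uh \<le> energy (box a b) V \<beta> u"
      by (rule I.discrete_energy_le[OF _ b1 b2 b3 b4 b5 b6 \<epsilon>(1)])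
        (use uh \<epsilon>(2) cube(3) in \<open>auto simp: \<kappa>_def E_def\<close>)
    then show ?thesis by (simp add: cube(3))
  qed
  ultimately show ?thesis by blast
qed

end
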